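(* Let $p$ be an odd prime and $\mathbb{F}=\mathbb{F}_p$. The category $\mathcal{U}$ of unstable modules over the mod-$p$ Steenrod algebra is equivalent to the category of graded right comodules (with respect to a completed tensor product) over the $\mathbb{Z}/2$-graded bialgebra $\tilde{\mathcal{A}}^*$.
   Context: An unstable module is a graded left module $M$ over the mod-$p$ Steenrod algebra $\mathcal{A}$ (with generators $\beta$ and $P^i$) such that $\beta^eP^ix=0$ whenever $x\in M$ is homogeneous, $e\in\{0,1\}$ and $e+2i>|x|$. Morphisms in $\mathcal{U}$ are $\mathcal{A}$-linear maps of degree $0$. All algebras are $\mathbb{Z}/2$-graded and graded commutative with the Koszul sign convention; tensor products are graded tensor products. $\tilde{\mathcal{A}}^*$ is the $\mathbb{Z}/2$-graded bialgebra with underlying algebra $\Lambda(\tau_i\mid i\ge 0)\otimes\mathbb{F}[u,\xi_j\mid j\ge 0]/(\xi_0-u^2)$, with $u,\xi_j$ even and $\tau_i$ odd, coproduct $$\Delta u=u\otimes u,\qquad \Delta\xi_j=\sum_{s=0}^{j}\xi_{j-s}^{p^s}\otimes\xi_s,\qquad \Delta\tau_i=\sum_{s=0}^{i}\xi_{i-s}^{p^s}\otimes\tau_s+\tau_i\otimes u,$$ and counit $u,\xi_0\mapsto 1$, $\xi_j\mapsto 0$ ($j\geq 1$), $\tau_i\mapsto 0$. The bialgebra quotient $\tilde{\mathcal{A}}^*\to\mathbb{F}[u]$ ($u$ grouplike; $\xi_j\mapsto0$ for $j\ge1$, $\tau_i\mapsto 0$) makes $\tilde{\mathcal{A}}^*$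 a left and a right $\mathbb{F}[u]$-comodule and hence bigraded; write $\tilde{\mathcal{A}}^*_{m,n}$ for the component of left degree $m$ and right degree $n$. For each $m$ the component of left degree $m$ is finite dimensional. A graded right $\tilde{\mathcal{A}}^*$-comodule is a non-negatively graded $\mathbb{F}$-vector space $M=\bigoplus_{n\ge0}M^n$ (regarded as $\mathbb{Z}/2$-graded by reducing the degree mod 2) with a coassociative counital structure map $\psi\colon M\to M\hat\otimes\tilde{\mathcal{A}}^*$ into the degreewise completed tensor product, whose composite with $\tilde{\mathcal{A}}^*\to\mathbb{F}[u]$ is the coaction $x\mapsto x\otimes u^n$ ($x\in M^n$) defining the grading; equivalently $\psi(M^n)\subset\prod_m M^m\otimes\tilde{\mathcal{A}}^*_{m,n}$. Morphisms are degree-preserving linear maps commuting with the structure maps. *)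

theory Defs
  imports
    "Berlekamp_Zassenhaus.Finite_Field"
    "HOL-Algebra.Module"
    "HOL-Algebra.QuotRing"
    "HOL-Library.FSet"
    "HOL-Library.FuncSet"
    "HOL-Library.Poly_Mapping"
begin

section \<open>Categories and equivalences\<close>

text \<open>A morphism does not record its source and target, so composition takes the three objects
  as arguments: \<open>cmp C X Y Z g f\<close> is \<open>g \<circ> f\<close> for \<open>f : X \<rightarrow> Y\<close> and \<open>g : Y \<rightarrow> Z\<close>.\<close>

record ('o, 'm) cat =
  ob :: "'o set"
  mor :: "'o \<Rightarrow> 'o \<Rightarrow> 'm set"
  ident :: "'o \<Rightarrow> 'm"
  cmp :: "'o \<Rightarrow> 'o \<Rightarrow> 'o \<Rightarrow> 'm \<Rightarrow> 'm \<Rightarrow> 'm"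

definition is_category :: "('o, 'm) cat \<Rightarrow> bool" where
  "is_category C \<longleftrightarrow>
    (\<forall>X\<in>ob C. ident C X \<in> mor C X X) \<and>
    (\<forall>X\<in>ob C. \<forall>Y\<in>ob C. \<forall>Z\<in>ob C. \<forall>f\<in>mor C X Y. \<forall>g\<in>mor C Y Z. cmp C X Y Z g f \<in> mor C X Z) \<and>
    (\<forall>X\<in>ob C. \<forall>Y\<in>ob C. \<forall>f\<in>mor C X Y.
      cmp C X X Y f (ident C X) = f \<and> cmp C X Y Y (ident C Y) f = f) \<and>
    (\<forall>W\<in>ob C. \<forall>X\<in>ob C. \<forall>Y\<in>ob C. \<forall>Z\<in>ob C. \<forall>f\<in>mor C W X. \<forall>g\<in>mor C X Y. \<forall>h\<in>mor C Y Z.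
      cmp C W X Z (cmp C X Y Z h g) f = cmp C W Y Z h (cmp C W X Y g f))"

definition is_functor ::
  "('o, 'm) cat \<Rightarrow> ('q, 'n) cat \<Rightarrow> ('o \<Rightarrow> 'q) \<Rightarrow> ('o \<Rightarrow> 'o \<Rightarrow> 'm \<Rightarrow> 'n) \<Rightarrow> bool" where
  "is_functor C D Fo Fm \<longleftrightarrow>
    (\<forall>X\<in>ob C. Fo X \<in> ob D) \<and>
    (\<forall>X\<in>ob C. \<forall>Y\<in>ob C. \<forall>f\<in>mor C X Y. Fm X Y f \<in> mor D (Fo X) (Fo Y)) \<and>
    (\<forall>X\<in>ob C. Fm X X (ident C X) = ident D (Fo X)) \<and>
    (\<forall>X\<in>ob C. \<forall>Y\<in>ob C. \<forall>Z\<in>ob C. \<forall>f\<in>mor C X Y. \<forall>g\<in>mor C Y Z.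
      Fm X Z (cmp C X Y Z g f) = cmp D (Fo X) (Fo Y) (Fo Z) (Fm Y Z g) (Fm X Y f))"

definition is_iso :: "('o, 'm) cat \<Rightarrow> 'o \<Rightarrow> 'o \<Rightarrow> 'm \<Rightarrow> bool" where
  "is_iso C X Y f \<longleftrightarrow> f \<in> mor C X Y \<and>
    (\<exists>g\<in>mor C Y X. cmp C X Y X g f = ident C X \<and> cmp C Y X Y f g = ident C Y)"

definition is_natural_iso ::
  "('o, 'm) cat \<Rightarrow> ('q, 'n) cat \<Rightarrow> ('o \<Rightarrow> 'q) \<Rightarrow> ('o \<Rightarrow> 'o \<Rightarrow> 'm \<Rightarrow> 'n) \<Rightarrow>
    ('o \<Rightarrow> 'q) \<Rightarrow> ('o \<Rightarrow> 'o \<Rightarrow> 'm \<Rightarrow> 'n) \<Rightarrow> ('o \<Rightarrow> 'n) \<Rightarrow> bool" where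
  "is_natural_iso C D Fo Fm Go Gm \<eta> \<longleftrightarrow>
    (\<forall>X\<in>ob C. is_iso D (Fo X) (Go X) (\<eta> X)) \<and>
    (\<forall>X\<in>ob C. \<forall>Y\<in>ob C. \<forall>f\<in>mor C X Y.
      cmp D (Fo X) (Fo Y) (Go Y) (\<eta> Y) (Fm X Y f) = cmp D (Fo X) (Go X) (Go Y) (Gm X Y f) (\<eta> X))"

definition equivalent_categories :: "('o, 'm) cat \<Rightarrow> ('q, 'n) cat \<Rightarrow> bool" where
  "equivalent_categories C D \<longleftrightarrow> is_category C \<and> is_category D \<and>
    (\<exists>Fo Fm Go Gm \<eta> \<epsilon>.
      is_functor C D Fo Fm \<and> is_functor D C Go Gm \<and>
      is_natural_iso C C (\<lambda>X. X) (\<lambda>X Y f. f) (\<lambda>X. Go (Fo X)) (\<lambda>X Y f. Gm (Fo X) (Fo Y) (Fm X Y f)) \<eta> \<and>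
      is_natural_iso D D (\<lambda>X. Fo (Go X)) (\<lambda>X Y f. Fm (Go X) (Go Y) (Gm X Y f)) (\<lambda>X. X) (\<lambda>X Y f. f) \<epsilon>)"


section \<open>Graded vector spaces\<close>

text \<open>The ground field \<open>\<F>\<^sub>p\<close> is \<open>'p mod_ring\<close> with \<open>p = CARD('p)\<close>, which is prime by the sort
  \<open>'p :: prime_card\<close>.  A graded vector space is the family of its homogeneous components, all with
  carriers inside a fixed but arbitrary type \<open>'a\<close>.\<close>

definition ring_of_type :: "'k::ring_1 ring" where
  "ring_of_type = \<lparr>carrier = UNIV, monoid.mult = (*), one = 1, zero = 0, add = (+)\<rparr>"

definition graded_space :: "('i \<Rightarrow> ('p::prime_card mod_ring, 'a) module) \<Rightarrow> bool" where
  "graded_space M \<longleftrightarrow> (\<forall>n. module ring_of_type (M n))"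

text \<open>Morphisms are extensional functions, so that equality of morphisms is equality on carriers.\<close>

definition graded_maps ::
  "('i \<Rightarrow> ('p::prime_card mod_ring, 'a) module) \<Rightarrow> ('i \<Rightarrow> ('p mod_ring, 'a) module) \<Rightarrow>
    ('i \<Rightarrow> 'a \<Rightarrow> 'a) set" where
  "graded_maps M N = {f. \<forall>n. f n \<in> carrier (M n) \<rightarrow>\<^sub>E carrier (N n) \<and>
    (\<forall>x\<in>carrier (M n). \<forall>y\<in>carrier (M n). f n (x \<oplus>\<^bsub>M n\<^esub> y) = f n x \<oplus>\<^bsub>N n\<^esub> f n y) \<and>
    (\<forall>c. \<forall>x\<in>carrier (M n). f n (c \<odot>\<^bsub>M n\<^esub> x) = c \<odot>\<^bsub>N n\<^esub> f n x)}"

definition graded_id :: "('i \<Rightarrow> ('k, 'a) module) \<Rightarrow> 'i \<Rightarrow> 'a \<Rightarrow> 'a" where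
  "graded_id M = (\<lambda>n. \<lambda>x\<in>carrier (M n). x)"

definition graded_comp ::
  "('i \<Rightarrow> ('k, 'a) module) \<Rightarrow> ('i \<Rightarrow> 'a \<Rightarrow> 'a) \<Rightarrow> ('i \<Rightarrow> 'a \<Rightarrow> 'a) \<Rightarrow> 'i \<Rightarrow> 'a \<Rightarrow> 'a" where
  "graded_comp M g f = (\<lambda>n. compose (carrier (M n)) (g n) (f n))"


section \<open>The Steenrod algebra and unstable modules\<close>

text \<open>Words form the free monoid, so finitely supported functions on words with the convolution
  product are the free associative algebra.\<close>

datatype 'g word = Word "'g list"

instantiation word :: (type) monoid_add
begin

definition zero_word :: "'g word" where "zero_word = Word []"

fun plus_word :: "'g word \<Rightarrow> 'g word \<Rightarrow> 'g word" where
  "plus_word (Word v) (Word w) = Word (v @ w)"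

instance
proof
  fix a b c :: "'g word"
  show "a + b + c = a + (b + c)" by (cases a; cases b; cases c) simp
  show "0 + a = a" by (cases a) (simp add: zero_word_def)
  show "a + 0 = a" by (cases a) (simp add: zero_word_def)
qed

end

datatype st_gen = Beta | Pow nat

type_synonym 'p st_free = "st_gen word \<Rightarrow>\<^sub>0 'p mod_ring"

definition sq_beta :: "'p::prime_card st_free" where
  "sq_beta = Poly_Mapping.single (Word [Beta]) 1"

definition sq_pow :: "nat \<Rightarrow> 'p::prime_card st_free" where
  "sq_pow i = Poly_Mapping.single (Word [Pow i]) 1"

text \<open>The Adem relations for odd \<open>p\<close>, together with \<open>\<beta>\<^sup>2 = 0\<close> and \<open>P\<^sup>0 = 1\<close>.  All
  truncated subtractions below have nonnegative value: \<open>j \<le> a/p \<le> b\<close>, with \<open>j < b\<close> wherever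
  \<open>(p - 1) * (b - j) - 1\<close> occurs.\<close>

definition adem_relators :: "'p::prime_card st_free set" where
  "adem_relators = (let p = CARD('p) in
    {sq_beta * sq_beta, sq_pow 0 - 1} \<union>
    {sq_pow a * sq_pow b
      - (\<Sum>j\<le>a div p. (- 1) ^ (a + j) * of_nat (((p - 1) * (b - j) - 1) choose (a - p * j))
            * (sq_pow (a + b - j) * sq_pow j)) | a b. 0 < a \<and> a < p * b} \<union>
    {sq_pow a * sq_beta * sq_pow b
      - (\<Sum>j\<le>a div p. (- 1) ^ (a + j) * of_nat (((p - 1) * (b - j)) choose (a - p * j))
            * (sq_beta * sq_pow (a + b - j) * sq_pow j))
      - (\<Sum>j\<le>(a - 1) div p. (- 1) ^ (a + j - 1) * of_nat (((p - 1) * (b - j) - 1) choose (a - p * j - 1))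
            * (sq_pow (a + b - j) * sq_beta * sq_pow j)) | a b. 0 < a \<and> a \<le> p * b})"

definition adem_ideal :: "'p::prime_card st_free set" where
  "adem_ideal = Idl\<^bsub>ring_of_type\<^esub> adem_relators"

definition steenrod :: "'p::prime_card st_free set ring" where
  "steenrod = ring_of_type Quot adem_ideal"

definition st_class :: "'p::prime_card st_free \<Rightarrow> 'p st_free set" where
  "st_class f = adem_ideal +>\<^bsub>ring_of_type\<^esub> f"

fun gen_degree :: "nat \<Rightarrow> st_gen \<Rightarrow> nat" where
  "gen_degree p Beta = 1"
| "gen_degree p (Pow i) = 2 * i * (p - 1)"

fun word_degree :: "nat \<Rightarrow> st_gen word \<Rightarrow> nat" where
  "word_degree p (Word w) = sum_list (map (gen_degree p) w)"

definition steenrod_component :: "nat \<Rightarrow> 'p::prime_card st_free set set" where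
  "steenrod_component k =
    st_class ` {f :: 'p st_free. \<forall>w\<in>Poly_Mapping.keys f. word_degree CARD('p) w = k}"

text \<open>\<open>act M k n a x\<close> is \<open>a x\<close> for \<open>a\<close> of degree \<open>k\<close> and \<open>x\<close> of degree \<open>n\<close>.  Modules are
  \<open>\<int>\<close>-graded; instability (with \<open>e = i = 0\<close>) makes the components of negative degree vanish.\<close>

record ('p, 'a) st_module =
  stcomp :: "int \<Rightarrow> ('p mod_ring, 'a) module"
  act :: "nat \<Rightarrow> int \<Rightarrow> 'p st_free set \<Rightarrow> 'a \<Rightarrow> 'a"

text \<open>The last clause says that the scalars of the algebra act by the given scalar multiplication
  (and \<open>1\<close> acts as the identity); with associativity it makes the action \<open>\<F>\<^sub>p\<close>-bilinear.\<close>

definition is_st_module :: "('p::prime_card, 'a) st_module \<Rightarrow> bool" where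
  "is_st_module M \<longleftrightarrow>
    graded_space (stcomp M) \<and>
    (\<forall>k n. \<forall>a\<in>steenrod_component k. \<forall>x\<in>carrier (stcomp M n).
      act M k n a x \<in> carrier (stcomp M (n + int k))) \<and>
    (\<forall>k n. \<forall>a\<in>steenrod_component k. \<forall>x\<in>carrier (stcomp M n). \<forall>y\<in>carrier (stcomp M n).
      act M k n a (x \<oplus>\<^bsub>stcomp M n\<^esub> y) = act M k n a x \<oplus>\<^bsub>stcomp M (n + int k)\<^esub> act M k n a y) \<and>
    (\<forall>k n. \<forall>a\<in>steenrod_component k. \<forall>b\<in>steenrod_component k. \<forall>x\<in>carrier (stcomp M n).
      act M k n (a \<oplus>\<^bsub>steenrod\<^esub> b) x = act M k n a x \<oplus>\<^bsub>stcomp M (n + int k)\<^esub> act M k n b x) \<and>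
    (\<forall>k l n. \<forall>a\<in>steenrod_component k. \<forall>b\<in>steenrod_component l. \<forall>x\<in>carrier (stcomp M n).
      act M (k + l) n (a \<otimes>\<^bsub>steenrod\<^esub> b) x = act M k (n + int l) a (act M l n b x)) \<and>
    (\<forall>n c. \<forall>x\<in>carrier (stcomp M n).
      act M 0 n (st_class (Poly_Mapping.single 0 c)) x = c \<odot>\<^bsub>stcomp M n\<^esub> x)"

definition is_unstable :: "('p::prime_card, 'a) st_module \<Rightarrow> bool" where
  "is_unstable M \<longleftrightarrow>
    (\<forall>e i n. e \<in> {0, 1} \<and> int e + 2 * int i > n \<longrightarrow>
      (let d = e + 2 * i * (CARD('p) - 1) in
        \<forall>x\<in>carrier (stcomp M n). act M d n (st_class (sq_beta ^ e * sq_pow i)) x = \<zero>\<^bsub>stcomp M (n + int d)\<^esub>))"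

definition st_module_maps ::
  "('p::prime_card, 'a) st_module \<Rightarrow> ('p, 'a) st_module \<Rightarrow> (int \<Rightarrow> 'a \<Rightarrow> 'a) set" where
  "st_module_maps M N = {f \<in> graded_maps (stcomp M) (stcomp N).
    \<forall>k n. \<forall>a\<in>steenrod_component k. \<forall>x\<in>carrier (stcomp M n).
      f (n + int k) (act M k n a x) = act N k n a (f n x)}"

definition unstable_modules :: "(('p::prime_card, 'a) st_module, int \<Rightarrow> 'a \<Rightarrow> 'a) cat" where
  "unstable_modules =
    \<lparr>ob = {M. is_st_module M \<and> is_unstable M},
     mor = st_module_maps,
     ident = (\<lambda>M. graded_id (stcomp M)),
     cmp = (\<lambda>M N L g f. graded_comp (stcomp M) g f)\<rparr>"


section \<open>The bialgebra\<close>

subsection \<open>Linear algebra in coordinates\<close>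

text \<open>\<open>'b \<Rightarrow>\<^sub>0 'k\<close> is the vector space with basis \<open>'b\<close>, and \<open>'b \<times> 'c \<Rightarrow>\<^sub>0 'k\<close> is
  \<open>('b \<Rightarrow>\<^sub>0 'k) \<otimes> ('c \<Rightarrow>\<^sub>0 'k)\<close>.\<close>

definition scale :: "'k::field \<Rightarrow> ('b \<Rightarrow>\<^sub>0 'k) \<Rightarrow> ('b \<Rightarrow>\<^sub>0 'k)" where
  "scale c a = Poly_Mapping.map ((*) c) a"

definition lin_ext :: "('b \<Rightarrow> ('c \<Rightarrow>\<^sub>0 'k)) \<Rightarrow> ('b \<Rightarrow>\<^sub>0 'k) \<Rightarrow> ('c \<Rightarrow>\<^sub>0 'k::field)" where
  "lin_ext \<phi> a = (\<Sum>b\<in>Poly_Mapping.keys a. scale (Poly_Mapping.lookup a b) (\<phi> b))"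

definition tens :: "('b \<Rightarrow>\<^sub>0 'k) \<Rightarrow> ('c \<Rightarrow>\<^sub>0 'k) \<Rightarrow> ('b \<times> 'c \<Rightarrow>\<^sub>0 'k::field)" where
  "tens a b = (\<Sum>x\<in>Poly_Mapping.keys a. \<Sum>y\<in>Poly_Mapping.keys b.
    Poly_Mapping.single (x, y) (Poly_Mapping.lookup a x * Poly_Mapping.lookup b y))"

subsection \<open>The algebra\<close>

text \<open>Eliminating \<open>\<xi>\<^sub>0 = u\<^sup>2\<close>, the algebra is \<open>\<Lambda>(\<tau>\<^sub>i | i \<ge> 0) \<otimes> \<F>\<^sub>p[u, \<xi>\<^sub>j | j \<ge> 1]\<close>.  The pair
  \<open>(S, e)\<close> stands for the basis monomial \<open>\<tau>\<^bsub>i\<^sub>1\<^esub> \<dots> \<tau>\<^bsub>i\<^sub>r\<^esub> u\<^bsup>e 0\<^esup> \<Prod>\<^bsub>j\<ge>1\<^esub> \<xi>\<^sub>j\<^bsup>e j\<^esup>\<close> where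
  \<open>i\<^sub>1 < \<dots> < i\<^sub>r\<close> are the elements of \<open>S\<close>.\<close>

type_synonym mono = "nat fset \<times> (nat \<Rightarrow>\<^sub>0 nat)"

type_synonym 'p dst = "mono \<Rightarrow>\<^sub>0 'p mod_ring"

text \<open>The sign counts the transpositions that sort the \<open>\<tau>\<close>s of a product.\<close>

fun mono_mult :: "mono \<Rightarrow> mono \<Rightarrow> 'p::prime_card dst" where
  "mono_mult (S, e) (T, f) =
    (if S |\<inter>| T = {||}
     then Poly_Mapping.single (S |\<union>| T, e + f) ((- 1) ^ card {(i, j). i |\<in>| S \<and> j |\<in>| T \<and> j < i})
     else 0)"

definition dst_mult :: "'p::prime_card dst \<Rightarrow> 'p dst \<Rightarrow> 'p dst" where
  "dst_mult a b = lin_ext (\<lambda>(x, y). mono_mult x y) (tens a b)"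

definition dst_one :: "'p::prime_card dst" where
  "dst_one = Poly_Mapping.single ({||}, 0) 1"

definition dst_power :: "'p::prime_card dst \<Rightarrow> nat \<Rightarrow> 'p dst" where
  "dst_power a k = (dst_mult a ^^ k) dst_one"

definition gen_u :: "'p::prime_card dst" where
  "gen_u = Poly_Mapping.single ({||}, Poly_Mapping.single 0 1) 1"

definition gen_xi :: "nat \<Rightarrow> 'p::prime_card dst" where
  "gen_xi j = (if j = 0 then dst_power gen_u 2
    else Poly_Mapping.single ({||}, Poly_Mapping.single j 1) 1)"

definition gen_tau :: "nat \<Rightarrow> 'p::prime_card dst" where
  "gen_tau i = Poly_Mapping.single ({|i|}, 0) 1"

definition mono_parity :: "mono \<Rightarrow> nat" where
  "mono_parity b = fcard (fst b)"

text \<open>The product of the graded tensor square,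
  \<open>(a \<otimes> b)(c \<otimes> d) = (-1)\<^bsup>|b||c|\<^esup> ac \<otimes> bd\<close>.\<close>

definition dst2_mult ::
  "(mono \<times> mono \<Rightarrow>\<^sub>0 'p::prime_card mod_ring) \<Rightarrow> (mono \<times> mono \<Rightarrow>\<^sub>0 'p mod_ring) \<Rightarrow>
    (mono \<times> mono \<Rightarrow>\<^sub>0 'p mod_ring)" where
  "dst2_mult s t =
    lin_ext (\<lambda>((a, b), (c, d)).
      scale ((- 1) ^ (mono_parity b * mono_parity c)) (tens (mono_mult a c) (mono_mult b d)))
    (tens s t)"

subsection \<open>Coproduct and counit\<close>

definition delta_u :: "mono \<times> mono \<Rightarrow>\<^sub>0 'p::prime_card mod_ring" where
  "delta_u = tens gen_u gen_u"

definition delta_xi :: "nat \<Rightarrow> (mono \<times> mono \<Rightarrow>\<^sub>0 'p::prime_card mod_ring)" where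
  "delta_xi j = (\<Sum>s\<le>j. tens (dst_power (gen_xi (j - s)) (CARD('p) ^ s)) (gen_xi s))"

definition delta_tau :: "nat \<Rightarrow> (mono \<times> mono \<Rightarrow>\<^sub>0 'p::prime_card mod_ring)" where
  "delta_tau i = (\<Sum>s\<le>i. tens (dst_power (gen_xi (i - s)) (CARD('p) ^ s)) (gen_tau s))
    + tens (gen_tau i) gen_u"

text \<open>The coproduct is an algebra map: its value on a basis monomial is the product of the values
  on the generators, in the order in which they occur in the monomial.\<close>

fun delta_mono :: "mono \<Rightarrow> (mono \<times> mono \<Rightarrow>\<^sub>0 'p::prime_card mod_ring)" where
  "delta_mono (S, e) =
    foldr dst2_mult
      (map delta_tau (sorted_list_of_fset S) @
       concat (map (\<lambda>j. replicate (Poly_Mapping.lookup e j) (if j = 0 then delta_u else delta_xi j))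
         (sorted_list_of_set (Poly_Mapping.keys e))))
      (tens dst_one dst_one)"

definition delta :: "'p::prime_card dst \<Rightarrow> (mono \<times> mono \<Rightarrow>\<^sub>0 'p mod_ring)" where
  "delta = lin_ext delta_mono"

fun counit_mono :: "mono \<Rightarrow> 'p::prime_card mod_ring" where
  "counit_mono (S, e) = (if S = {||} \<and> Poly_Mapping.keys e \<subseteq> {0} then 1 else 0)"

subsection \<open>The bigrading\<close>

text \<open>\<open>\<F>\<^sub>p[u]\<close> is \<open>nat \<Rightarrow>\<^sub>0 'p mod_ring\<close> with basis the powers of \<open>u\<close>; \<open>quot_mono\<close> is the
  quotient map onto it, on basis monomials.\<close>

fun quot_mono :: "mono \<Rightarrow> (nat \<Rightarrow>\<^sub>0 'p::prime_card mod_ring)" where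
  "quot_mono (S, e) =
    (if S = {||} \<and> Poly_Mapping.keys e \<subseteq> {0}
     then Poly_Mapping.single (Poly_Mapping.lookup e 0) 1 else 0)"

definition left_coact :: "'p::prime_card dst \<Rightarrow> (nat \<times> mono \<Rightarrow>\<^sub>0 'p mod_ring)" where
  "left_coact a = lin_ext (\<lambda>(x, y). tens (quot_mono x) (Poly_Mapping.single y 1)) (delta a)"

definition right_coact :: "'p::prime_card dst \<Rightarrow> (mono \<times> nat \<Rightarrow>\<^sub>0 'p mod_ring)" where
  "right_coact a = lin_ext (\<lambda>(x, y). tens (Poly_Mapping.single x 1) (quot_mono y)) (delta a)"

definition dst_component :: "nat \<Rightarrow> nat \<Rightarrow> 'p::prime_card dst set" where
  "dst_component m n = {a. left_coact a = tens (Poly_Mapping.single m 1) a \<and>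
    right_coact a = tens a (Poly_Mapping.single n 1)}"


section \<open>Graded right comodules\<close>

text \<open>For a vector space \<open>V\<close>, elements of \<open>V \<otimes> ('b \<Rightarrow>\<^sub>0 'k)\<close> are finitely supported functions
  \<open>'b \<Rightarrow> V\<close> (the coefficients of the basis vectors); \<open>V \<otimes> W\<close>, for a subspace \<open>W\<close>, consists of the
  finite sums of tensors \<open>x \<otimes> a\<close> with \<open>a \<in> W\<close>.\<close>

inductive_set tensor_space :: "('k::field, 'a) module \<Rightarrow> ('b \<Rightarrow>\<^sub>0 'k) set \<Rightarrow> ('b \<Rightarrow> 'a) set"
  for V :: "('k, 'a) module" and W :: "('b \<Rightarrow>\<^sub>0 'k) set" where
  zero: "(\<lambda>b. \<zero>\<^bsub>V\<^esub>) \<in> tensor_space V W"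
| add: "x \<in> carrier V \<Longrightarrow> a \<in> W \<Longrightarrow> y \<in> tensor_space V W \<Longrightarrow>
    (\<lambda>b. (Poly_Mapping.lookup a b \<odot>\<^bsub>V\<^esub> x) \<oplus>\<^bsub>V\<^esub> y b) \<in> tensor_space V W"

text \<open>\<open>contract V f\<close> is \<open>id \<otimes> f : V \<otimes> ('b \<Rightarrow>\<^sub>0 'k) \<rightarrow> V\<close>, for the linear form with values \<open>f b\<close> on
  the basis.\<close>

definition contract :: "('k::field, 'a) module \<Rightarrow> ('b \<Rightarrow> 'k) \<Rightarrow> ('b \<Rightarrow> 'a) \<Rightarrow> 'a" where
  "contract V f y = finsum V (\<lambda>b. f b \<odot>\<^bsub>V\<^esub> y b) {b. y b \<noteq> \<zero>\<^bsub>V\<^esub>}"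

text \<open>For \<open>x \<in> M\<^sup>n\<close>, \<open>coact M n x m\<close> is the component of \<open>\<psi>(x)\<close> in \<open>M\<^sup>m \<otimes> A\<^bsub>m,n\<^esub>\<close>.\<close>

record ('p, 'a) comodule =
  cocomp :: "nat \<Rightarrow> ('p mod_ring, 'a) module"
  coact :: "nat \<Rightarrow> 'a \<Rightarrow> nat \<Rightarrow> mono \<Rightarrow> 'a"

text \<open>After linearity, the clauses are: \<open>\<psi>(x) \<in> \<Prod>\<^sub>m M\<^sup>m \<otimes> A\<^bsub>m,n\<^esub>\<close>; the composite of \<open>\<psi>\<close> with
  the quotient map to \<open>\<F>\<^sub>p[u]\<close> is \<open>x \<mapsto> x \<otimes> u\<^sup>n\<close>; counitality; and coassociativity
  \<open>(\<psi> \<otimes> id) \<psi>(x) = (id \<otimes> \<Delta>) \<psi>(x)\<close>, compared at the coefficient of \<open>b \<otimes> c\<close> in degree \<open>l\<close>.  The sum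
  over the middle degree \<open>m\<close> has finite support, since the coefficient of \<open>c\<close> in \<open>\<psi>(x)\<close> is nonzero
  at most for the \<open>m\<close> that is the left degree of \<open>c\<close>.\<close>

definition is_comodule :: "('p::prime_card, 'a) comodule \<Rightarrow> bool" where
  "is_comodule M \<longleftrightarrow>
    graded_space (cocomp M) \<and>
    (\<forall>n m b. \<forall>x\<in>carrier (cocomp M n). \<forall>y\<in>carrier (cocomp M n).
      coact M n (x \<oplus>\<^bsub>cocomp M n\<^esub> y) m b = coact M n x m b \<oplus>\<^bsub>cocomp M m\<^esub> coact M n y m b) \<and>
    (\<forall>n m b c. \<forall>x\<in>carrier (cocomp M n).
      coact M n (c \<odot>\<^bsub>cocomp M n\<^esub> x) m b = c \<odot>\<^bsub>cocomp M m\<^esub> coact M n x m b) \<and>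
    (\<forall>n. \<forall>x\<in>carrier (cocomp M n). \<forall>m.
      coact M n x m \<in> tensor_space (cocomp M m) (dst_component m n)) \<and>
    (\<forall>n. \<forall>x\<in>carrier (cocomp M n). \<forall>m k.
      contract (cocomp M m) (\<lambda>b. Poly_Mapping.lookup (quot_mono b) k) (coact M n x m) =
        (if m = n \<and> k = n then x else \<zero>\<^bsub>cocomp M m\<^esub>)) \<and>
    (\<forall>n. \<forall>x\<in>carrier (cocomp M n). \<forall>m.
      contract (cocomp M m) counit_mono (coact M n x m) =
        (if m = n then x else \<zero>\<^bsub>cocomp M m\<^esub>)) \<and>
    (\<forall>n. \<forall>x\<in>carrier (cocomp M n). \<forall>l b c.
      finsum (cocomp M l) (\<lambda>m. coact M m (coact M n x m c) l b)
        {m. coact M m (coact M n x m c) l b \<noteq> \<zero>\<^bsub>cocomp M l\<^esub>} =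
      contract (cocomp M l) (\<lambda>d. Poly_Mapping.lookup (delta_mono d) (b, c)) (coact M n x l))"

definition comodule_maps ::
  "('p::prime_card, 'a) comodule \<Rightarrow> ('p, 'a) comodule \<Rightarrow> (nat \<Rightarrow> 'a \<Rightarrow> 'a) set" where
  "comodule_maps M N = {f \<in> graded_maps (cocomp M) (cocomp N).
    \<forall>n m b. \<forall>x\<in>carrier (cocomp M n). coact N n (f n x) m b = f m (coact M n x m b)}"

definition graded_comodules :: "(('p::prime_card, 'a) comodule, nat \<Rightarrow> 'a \<Rightarrow> 'a) cat" where
  "graded_comodules =
    \<lparr>ob = {M. is_comodule M},
     mor = comodule_maps,
     ident = (\<lambda>M. graded_id (cocomp M)),
     cmp = (\<lambda>M N L g f. graded_comp (cocomp M) g f)\<rparr>"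

end

theory Submission
  imports Defs "HOL-Computational_Algebra.Formal_Power_Series"
begin

text \<open>Let \<open>A\<close> be the bialgebra.  Linear functionals on \<open>A\<close> form an algebra under convolution, and
  \<open>P\<^sup>i \<mapsto>\<close> the sum over \<open>k\<close> of the functionals dual to \<open>u\<^sup>k \<xi>\<^sub>1\<^sup>i\<close>, \<open>\<beta> \<mapsto>\<close> the sum over \<open>k\<close> of the
  functionals dual to \<open>\<tau>\<^sub>0 u\<^sup>k\<close> respects the Adem relations, so that a Steenrod operation \<open>a\<close> acts on a
  comodule by \<open>a x = (id \<otimes> a) \<psi>(x)\<close>; this action is unstable because \<open>\<xi>\<^sub>1\<^sup>i\<close> and \<open>\<tau>\<^sub>0 \<xi>\<^sub>1\<^sup>i\<close> have right
  degrees \<open>2i\<close> and \<open>2i + 1\<close>.  Conversely, the pairing identifies the part of left degree \<open>m\<close> and right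
  degree \<open>n\<close> of \<open>A\<close> with the dual of the degree \<open>m\<close> part of the free unstable module on a class of
  degree \<open>n\<close>.  This is proved by induction on \<open>n\<close>: multiplication by \<open>u\<close> from right degree \<open>n - 1\<close> to
  \<open>n\<close> corresponds to desuspension, whose kernel consists of the operations of top degree (\<open>P\<^sup>s\<close> for
  \<open>n + k = 2s\<close>, \<open>\<beta> P\<^sup>s\<close> for \<open>n + k = 2s + 1\<close>) applied to elements of degree \<open>k\<close>, and these pair with the
  monomials that do not contain \<open>u\<close>.  Hence an unstable module has a unique coaction, given on
  \<open>M\<^sup>n\<close> by \<open>x \<mapsto> \<Sum>\<^sub>b a\<^sub>b x \<otimes> b\<close> with \<open>a\<^sub>b\<close> dual to the monomials \<open>b\<close>.\<close>

section \<open>Superalgebras with a signed monomial basis\<close>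

text \<open>The product of the basis vectors \<open>x\<close> and \<open>y\<close> is \<open>bsg x y\<close> (a sign, or \<open>0\<close>) times \<open>bpl x y\<close>, and
  \<open>bpar\<close> is the parity that enters the Koszul signs of tensor products.\<close>

class sbasis =
  fixes bone :: 'a
    and bpl :: "'a \<Rightarrow> 'a \<Rightarrow> 'a"
    and bsg :: "'a \<Rightarrow> 'a \<Rightarrow> int"
    and bpar :: "'a \<Rightarrow> nat"
  assumes bpl_assoc: "bpl (bpl x y) z = bpl x (bpl y z)"
    and bpl_commute: "bpl x y = bpl y x"
    and bpl_one_left [simp]: "bpl bone x = x"
    and bsg_cocycle: "bsg x y * bsg (bpl x y) z = bsg y z * bsg x (bpl y z)"
    and bsg_one_left [simp]: "bsg bone x = 1"
    and bsg_commute: "bsg x y = (- 1) ^ (bpar x * bpar y) * bsg y x"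
    and bpar_bpl: "bsg x y \<noteq> 0 \<Longrightarrow> even (bpar (bpl x y)) \<longleftrightarrow> even (bpar x + bpar y)"
    and bpar_one [simp]: "bpar bone = 0"
begin

lemma bpl_one_right [simp]: "bpl x bone = x"
  using bpl_commute[of x bone] by simp

lemma bsg_one_right [simp]: "bsg x bone = 1"
  using bsg_commute[of x bone] by simp

end

definition inversions :: "'i::linorder set \<Rightarrow> 'i set \<Rightarrow> nat" where
  "inversions S T = card {(i, j). i \<in> S \<and> j \<in> T \<and> j < i}"

lemma finite_inversions: "finite S \<Longrightarrow> finite T \<Longrightarrow> finite {(i, j). i \<in> S \<and> j \<in> T \<and> j < (i::'i::linorder)}"
  by (rule finite_subset[of _ "S \<times> T"]) auto

lemma inversions_Un_left:
  assumes "finite S" "finite T" "finite U" "S \<inter> T = {}"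
  shows "inversions (S \<union> T) U = inversions S U + inversions T U"
proof -
  have "{(i, j). i \<in> S \<union> T \<and> j \<in> U \<and> j < i} =
      {(i, j). i \<in> S \<and> j \<in> U \<and> j < i} \<union> {(i, j). i \<in> T \<and> j \<in> U \<and> j < i}"
    by auto
  then show ?thesis
    unfolding inversions_def using assms
    by (auto intro!: card_Un_disjoint simp: finite_inversions)
qed

lemma inversions_Un_right:
  assumes "finite S" "finite T" "finite U" "T \<inter> U = {}"
  shows "inversions S (T \<union> U) = inversions S T + inversions S U"
proof -
  have "{(i, j). i \<in> S \<and> j \<in> T \<union> U \<and> j < i} =
      {(i, j). i \<in> S \<and> j \<in> T \<and> j < i} \<union> {(i, j). i \<in> S \<and> j \<in> U \<and> j < i}"
    by auto
  then show ?thesis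
    unfolding inversions_def using assms
    by (auto intro!: card_Un_disjoint simp: finite_inversions)
qed

text \<open>Each pair in \<open>S \<times> T\<close> is inverted in exactly one of the two orders.
  This yields the sign of graded commutativity for exterior monomials.\<close>

lemma inversions_swap:
  fixes S T :: "'i::linorder set"
  assumes "finite S" "finite T" "S \<inter> T = {}"
  shows "inversions S T + inversions T S = card S * card T"
proof -
  have "card {(i, j). i \<in> T \<and> j \<in> S \<and> j < i} = card (prod.swap ` {(i, j). i \<in> T \<and> j \<in> S \<and> j < i})"
    by (rule card_image[symmetric]) (auto intro: inj_onI)
  also have "prod.swap ` {(i, j). i \<in> T \<and> j \<in> S \<and> j < i} = {(i, j). i \<in> S \<and> j \<in> T \<and> i < j}"
    by (auto simp: image_iff)
  finally have "inversions S T + inversions T S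
      = card {(i, j). i \<in> S \<and> j \<in> T \<and> j < i} + card {(i, j). i \<in> S \<and> j \<in> T \<and> i < j}"
    by (simp add: inversions_def)
  also have "\<dots> = card ({(i, j). i \<in> S \<and> j \<in> T \<and> j < i} \<union> {(i, j). i \<in> S \<and> j \<in> T \<and> i < j})"
    using assms
    by (intro card_Un_disjoint[symmetric]) (auto intro: finite_subset[of _ "S \<times> T"])
  also have "{(i, j). i \<in> S \<and> j \<in> T \<and> j < i} \<union> {(i, j). i \<in> S \<and> j \<in> T \<and> i < j} = S \<times> T"
  proof (intro equalityI subsetI)
    fix z assume "z \<in> S \<times> T"
    then obtain i j where "z = (i, j)" "i \<in> S" "j \<in> T" by auto
    moreover from this assms(3) have "i < j \<or> j < i" by (metis disjoint_iff linorder_neqE)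
    ultimately show "z \<in> {(i, j). i \<in> S \<and> j \<in> T \<and> j < i} \<union> {(i, j). i \<in> S \<and> j \<in> T \<and> i < j}"
      by auto
  qed auto
  finally show ?thesis by (simp add: card_cartesian_product)
qed

lemma minus_one_power_cong: "even a = even b \<Longrightarrow> (- 1 :: int) ^ a = (- 1) ^ b"
  by (cases "even a") auto

text \<open>Exterior monomials: a finite set stands for the product of its elements in increasing
  order, and the sign sorts a concatenation of two such products.\<close>

instantiation fset :: (linorder) sbasis
begin

definition bone_fset :: "'a fset" where "bone_fset = {||}"
definition bpl_fset :: "'a fset \<Rightarrow> 'a fset \<Rightarrow> 'a fset" where "bpl_fset S T = S |\<union>| T"
definition bsg_fset :: "'a fset \<Rightarrow> 'a fset \<Rightarrow> int" where
  "bsg_fset S T = (if S |\<inter>| T = {||} then (- 1) ^ inversions (fset S) (fset T) else 0)"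
definition bpar_fset :: "'a fset \<Rightarrow> nat" where "bpar_fset S = fcard S"

instance
proof
  fix S T U :: "'a fset"
  have disj: "A |\<inter>| B = {||} \<longleftrightarrow> fset A \<inter> fset B = {}" for A B :: "'a fset"
    by (metis bot_fset.rep_eq fset_inject inf_fset.rep_eq)
  show "bpl (bpl S T) U = bpl S (bpl T U)" "bpl S T = bpl T S" "bpl bone S = S"
    by (auto simp: bpl_fset_def bone_fset_def)
  show "bsg bone S = 1" by (simp add: bsg_fset_def bone_fset_def inversions_def)
  show "bpar (bone :: 'a fset) = 0" by (simp add: bpar_fset_def bone_fset_def)
  show "bsg S T * bsg (bpl S T) U = bsg T U * bsg S (bpl T U)"
    by (auto simp: bsg_fset_def bpl_fset_def disj inversions_Un_left inversions_Un_right
        power_add Int_Un_distrib Int_Un_distrib2)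
  show "bsg S T = (- 1) ^ (bpar S * bpar T) * bsg T S"
  proof (cases "fset S \<inter> fset T = {}")
    case True
    have "(- 1 :: int) ^ inversions (fset S) (fset T)
        = (- 1) ^ (card (fset S) * card (fset T) + inversions (fset T) (fset S))"
      by (rule minus_one_power_cong) (simp flip: inversions_swap[OF _ _ True], blast)
    then show ?thesis using True
      by (simp add: bsg_fset_def bpar_fset_def disj Int_commute fcard.rep_eq power_add)
  qed (simp add: bsg_fset_def disj Int_commute)
  show "even (bpar (bpl S T)) = even (bpar S + bpar T)" if "bsg S T \<noteq> 0"
    using that by (auto simp: bsg_fset_def bpar_fset_def bpl_fset_def fcard.rep_eq disj
        card_Un_disjoint split: if_splits)
qed

end

text \<open>Polynomial monomials: exponent vectors, all of even parity, so that no signs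
  occur.\<close>

instantiation poly_mapping :: (type, comm_monoid_add) sbasis
begin

definition bone_poly_mapping :: "'a \<Rightarrow>\<^sub>0 'b" where "bone_poly_mapping = 0"
definition bpl_poly_mapping :: "('a \<Rightarrow>\<^sub>0 'b) \<Rightarrow> ('a \<Rightarrow>\<^sub>0 'b) \<Rightarrow> 'a \<Rightarrow>\<^sub>0 'b" where
  "bpl_poly_mapping e f = e + f"
definition bsg_poly_mapping :: "('a \<Rightarrow>\<^sub>0 'b) \<Rightarrow> ('a \<Rightarrow>\<^sub>0 'b) \<Rightarrow> int" where
  "bsg_poly_mapping e f = 1"
definition bpar_poly_mapping :: "('a \<Rightarrow>\<^sub>0 'b) \<Rightarrow> nat" where "bpar_poly_mapping e = 0"

instance
  by standard (auto simp: bone_poly_mapping_def bpl_poly_mapping_def bsg_poly_mapping_def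
      bpar_poly_mapping_def add_ac)

end

text \<open>The basis of the graded tensor product; the extra sign moves the second factor of
  \<open>x\<close> past the first factor of \<open>y\<close>.\<close>

instantiation prod :: (sbasis, sbasis) sbasis
begin

definition bone_prod :: "'a \<times> 'b" where "bone_prod = (bone, bone)"
definition bpl_prod :: "'a \<times> 'b \<Rightarrow> 'a \<times> 'b \<Rightarrow> 'a \<times> 'b" where
  "bpl_prod x y = (bpl (fst x) (fst y), bpl (snd x) (snd y))"
definition bsg_prod :: "'a \<times> 'b \<Rightarrow> 'a \<times> 'b \<Rightarrow> int" where
  "bsg_prod x y = (- 1) ^ (bpar (snd x) * bpar (fst y)) * (bsg (fst x) (fst y) * bsg (snd x) (snd y))"
definition bpar_prod :: "'a \<times> 'b \<Rightarrow> nat" where "bpar_prod x = bpar (fst x) + bpar (snd x)"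

instance
proof
  fix x y z :: "'a \<times> 'b"
  show "bpl (bpl x y) z = bpl x (bpl y z)" "bpl bone x = x"
    by (simp_all add: bpl_prod_def bone_prod_def bpl_assoc)
  show "bpl x y = bpl y x"
    by (simp add: bpl_prod_def bpl_commute)
  show "bsg bone x = 1" "bpar (bone :: 'a \<times> 'b) = 0"
    by (simp_all add: bsg_prod_def bone_prod_def bpar_prod_def)
  obtain a b c d e f where [simp]: "x = (a, b)" "y = (c, d)" "z = (e, f)"
    by (cases x; cases y; cases z) auto
  \<comment> \<open>The parity of a product is known only where the sign is nonzero, so it is
    rewritten under multiplication by the sign.\<close>
  have s1: "bsg b d * bsg (bpl b d) f * (- 1) ^ (bpar (bpl b d) * bpar e) =
      bsg b d * bsg (bpl b d) f * (- 1) ^ ((bpar b + bpar d) * bpar e)"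
  proof (cases "bsg b d = 0")
    case False
    have "(- 1 :: int) ^ (bpar (bpl b d) * bpar e) = (- 1) ^ ((bpar b + bpar d) * bpar e)"
      by (rule minus_one_power_cong) (use bpar_bpl[OF False] in auto)
    then show ?thesis by simp
  qed simp
  have s2: "bsg c e * bsg a (bpl c e) * (- 1) ^ (bpar b * bpar (bpl c e)) =
      bsg c e * bsg a (bpl c e) * (- 1) ^ (bpar b * (bpar c + bpar e))"
  proof (cases "bsg c e = 0")
    case False
    have "(- 1 :: int) ^ (bpar b * bpar (bpl c e)) = (- 1) ^ (bpar b * (bpar c + bpar e))"
      by (rule minus_one_power_cong) (use bpar_bpl[OF False] in auto)
    then show ?thesis by simp
  qed simp
  have "bsg x y * bsg (bpl x y) z = (- 1) ^ (bpar b * bpar c) * (bsg a c * bsg (bpl a c) e)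
      * (bsg b d * bsg (bpl b d) f * (- 1) ^ (bpar (bpl b d) * bpar e))"
    by (simp add: bsg_prod_def bpl_prod_def)
  also have "\<dots> = (- 1) ^ (bpar b * bpar c + (bpar b + bpar d) * bpar e)
      * (bsg a c * bsg (bpl a c) e) * (bsg b d * bsg (bpl b d) f)"
    unfolding s1 by (simp add: power_add)
  also have "\<dots> = (- 1) ^ (bpar d * bpar e) * (bsg d f * bsg b (bpl d f)) *
      (bsg c e * bsg a (bpl c e) * (- 1) ^ (bpar b * (bpar c + bpar e)))"
    unfolding bsg_cocycle by (simp add: power_add algebra_simps)
  also have "\<dots> = bsg y z * bsg x (bpl y z)"
    unfolding s2[symmetric] by (simp add: bsg_prod_def bpl_prod_def)
  finally show "bsg x y * bsg (bpl x y) z = bsg y z * bsg x (bpl y z)" .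
  have "bsg x y = (- 1) ^ (bpar b * bpar c + bpar a * bpar c + bpar b * bpar d) * (bsg c a * bsg d b)"
    by (simp add: bsg_prod_def bsg_commute[of a c] bsg_commute[of b d] power_add)
  also have "(- 1 :: int) ^ (bpar b * bpar c + bpar a * bpar c + bpar b * bpar d)
      = (- 1) ^ (bpar x * bpar y + bpar d * bpar a)"
    by (rule minus_one_power_cong) (simp add: bpar_prod_def algebra_simps, blast)
  finally show "bsg x y = (- 1) ^ (bpar x * bpar y) * bsg y x"
    by (simp add: bsg_prod_def power_add)
  show "even (bpar (bpl x y)) = even (bpar x + bpar y)" if "bsg x y \<noteq> 0"
    using that bpar_bpl[of a c] bpar_bpl[of b d]
    by (auto simp: bsg_prod_def bpar_prod_def bpl_prod_def)
qed

end

subsection \<open>Linear extension and tensors in coordinates\<close>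

lemma lookup_scale [simp]: "Poly_Mapping.lookup (scale c a) b = c * Poly_Mapping.lookup a b"
  by (simp add: scale_def Poly_Mapping.map.rep_eq when_def)

lemma keys_scale_subset: "Poly_Mapping.keys (scale c a) \<subseteq> Poly_Mapping.keys a"
  by (auto simp: in_keys_iff)

lemma scale_zero [simp]: "scale c 0 = 0" "scale 0 a = 0"
  by (rule poly_mapping_eqI; simp)+

lemma scale_single [simp]: "scale c (Poly_Mapping.single b d) = Poly_Mapping.single b (c * d)"
  by (rule poly_mapping_eqI) (simp add: lookup_single when_def)

lemma lin_ext_superset:
  assumes "finite A" "Poly_Mapping.keys a \<subseteq> A"
  shows "lin_ext f a = (\<Sum>b\<in>A. scale (Poly_Mapping.lookup a b) (f b))"
  unfolding lin_ext_def
  by (rule sum.mono_neutral_left) (use assms in \<open>auto simp: in_keys_iff\<close>)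

lemma lin_ext_add: "lin_ext f (a + b) = lin_ext f a + lin_ext f b"
proof -
  let ?A = "Poly_Mapping.keys a \<union> Poly_Mapping.keys b"
  have k: "Poly_Mapping.keys (a + b) \<subseteq> ?A" by (rule keys_add)
  show ?thesis
    by (rule poly_mapping_eqI)
      (simp add: lin_ext_superset[OF _ k] lin_ext_superset[of ?A a] lin_ext_superset[of ?A b]
        lookup_sum lookup_add sum.distrib algebra_simps)
qed

lemma lin_ext_scale: "lin_ext f (scale c a) = scale c (lin_ext f a)"
  by (rule poly_mapping_eqI)
    (simp add: lin_ext_superset[OF finite_keys keys_scale_subset] lin_ext_def[of f a] lookup_sum
      sum_distrib_left mult.assoc)

lemma lin_ext_single [simp]: "lin_ext f (Poly_Mapping.single b c) = scale c (f b)"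
  by (subst lin_ext_superset[of "{b}"]) auto

lemma poly_mapping_sum_singles:
  "a = (\<Sum>b\<in>Poly_Mapping.keys a. Poly_Mapping.single b (Poly_Mapping.lookup a b))"
proof (rule poly_mapping_eqI)
  fix k
  show "Poly_Mapping.lookup a k =
      Poly_Mapping.lookup (\<Sum>b\<in>Poly_Mapping.keys a. Poly_Mapping.single b (Poly_Mapping.lookup a b)) k"
    by (cases "k \<in> Poly_Mapping.keys a")
      (auto simp: lookup_sum lookup_single when_def in_keys_iff sum.delta)
qed

lemma poly_mapping_single_induct [case_names single add]:
  assumes "\<And>b c. P (Poly_Mapping.single b c)" "\<And>a b. P a \<Longrightarrow> P b \<Longrightarrow> P (a + b)"
  shows "P (a :: 'b \<Rightarrow>\<^sub>0 'c::comm_monoid_add)"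
proof -
  have z: "P 0" using assms(1)[of undefined 0] by simp
  have "P (\<Sum>b\<in>A. Poly_Mapping.single b (Poly_Mapping.lookup a b))" if "finite A" for A
    using that by (induction A rule: finite_induct) (auto intro: assms z)
  then show ?thesis by (subst poly_mapping_sum_singles) auto
qed

lemma lookup_tens [simp]:
  "Poly_Mapping.lookup (tens a b) (x, y) = Poly_Mapping.lookup a x * Poly_Mapping.lookup b y"
proof -
  have "Poly_Mapping.lookup (tens a b) (x, y) = (\<Sum>x'\<in>Poly_Mapping.keys a.
      if x' = x then (\<Sum>y'\<in>Poly_Mapping.keys b. if y' = y then Poly_Mapping.lookup a x * Poly_Mapping.lookup b y else 0) else 0)"
    unfolding tens_def lookup_sum
    by (intro sum.cong refl) (auto simp: lookup_single when_def intro!: sum.cong)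
  then show ?thesis by (auto simp: sum.delta in_keys_iff)
qed

lemma tens_single [simp]: "tens (Poly_Mapping.single x c) (Poly_Mapping.single y d) = Poly_Mapping.single (x, y) (c * d)"
  by (rule poly_mapping_eqI) (auto simp: lookup_single when_def split_paired_all)

lemma tens_add_left: "tens (a + b) c = tens a c + tens b c"
  by (rule poly_mapping_eqI) (auto simp: lookup_add algebra_simps split_paired_all)

lemma tens_add_right: "tens a (b + c) = tens a b + tens a c"
  by (rule poly_mapping_eqI) (auto simp: lookup_add algebra_simps split_paired_all)

lemma tens_scale_left: "tens (scale c a) b = scale c (tens a b)"
  by (rule poly_mapping_eqI) (auto simp: split_paired_all)

lemma tens_scale_right: "tens a (scale c b) = scale c (tens a b)"
  by (rule poly_mapping_eqI) (auto simp: split_paired_all)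

lemma tens_zero [simp]: "tens 0 b = 0" "tens a 0 = 0"
  by (rule poly_mapping_eqI; auto simp: split_paired_all)+

definition basis_mult :: "'b::sbasis \<Rightarrow> 'b \<Rightarrow> ('b \<Rightarrow>\<^sub>0 'k::field)" where
  "basis_mult x y = Poly_Mapping.single (bpl x y) (of_int (bsg x y))"

definition twisted_mult :: "('b::sbasis \<Rightarrow>\<^sub>0 'k::field) \<Rightarrow> ('b \<Rightarrow>\<^sub>0 'k) \<Rightarrow> ('b \<Rightarrow>\<^sub>0 'k)" where
  "twisted_mult a b = lin_ext (\<lambda>(x, y). basis_mult x y) (tens a b)"

lemma twisted_mult_single:
  "twisted_mult (Poly_Mapping.single x c) (Poly_Mapping.single y d)
    = Poly_Mapping.single (bpl x y) (c * d * of_int (bsg x y))"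
  by (simp add: twisted_mult_def basis_mult_def)

lemma twisted_mult_add:
  "twisted_mult (a + b) c = twisted_mult a c + twisted_mult b c"
  "twisted_mult a (b + c) = twisted_mult a b + twisted_mult a c"
  by (simp_all add: twisted_mult_def tens_add_left tens_add_right lin_ext_add)

lemma twisted_mult_assoc: "twisted_mult (twisted_mult a b) c = twisted_mult a (twisted_mult b c)"
proof (induction a rule: poly_mapping_single_induct)
  case (single x r)
  show ?case
  proof (induction b rule: poly_mapping_single_induct)
    case (single y s)
    show ?case
    proof (induction c rule: poly_mapping_single_induct)
      case (single z t)
      have "(of_int (bsg x y) * of_int (bsg (bpl x y) z) :: 'b) = of_int (bsg y z) * of_int (bsg x (bpl y z))"
        unfolding of_int_mult[symmetric] by (simp add: bsg_cocycle)
      then show ?case by (simp add: twisted_mult_single bpl_assoc mult_ac)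
    qed (simp add: twisted_mult_add)
  qed (simp add: twisted_mult_add)
qed (simp add: twisted_mult_add)

text \<open>A copy of the finitely supported functions: their own \<open>*\<close> is the unsigned
  convolution, whereas the copy becomes a \<open>ring_1\<close> with the signed product.\<close>

typedef (overloaded) ('b, 'k) salg = "UNIV :: ('b \<Rightarrow>\<^sub>0 'k::field) set" ..

setup_lifting type_definition_salg

instantiation salg :: (sbasis, field) ring_1
begin

lift_definition zero_salg :: "('a, 'b) salg" is 0 .
lift_definition one_salg :: "('a, 'b) salg" is "Poly_Mapping.single bone 1" .
lift_definition plus_salg :: "('a, 'b) salg \<Rightarrow> ('a, 'b) salg \<Rightarrow> ('a, 'b) salg" is "(+)" .
lift_definition minus_salg :: "('a, 'b) salg \<Rightarrow> ('a, 'b) salg \<Rightarrow> ('a, 'b) salg" is "(-)" .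
lift_definition uminus_salg :: "('a, 'b) salg \<Rightarrow> ('a, 'b) salg" is "uminus" .
lift_definition times_salg :: "('a, 'b) salg \<Rightarrow> ('a, 'b) salg \<Rightarrow> ('a, 'b) salg" is twisted_mult .

instance
proof
  fix a b c :: "('a, 'b) salg"
  show "1 * a = a"
  proof transfer
    fix a :: "'a \<Rightarrow>\<^sub>0 'b"
    show "twisted_mult (Poly_Mapping.single bone 1) a = a"
      by (induction a rule: poly_mapping_single_induct) (auto simp: twisted_mult_single twisted_mult_add)
  qed
  show "a * 1 = a"
  proof transfer
    fix a :: "'a \<Rightarrow>\<^sub>0 'b"
    show "twisted_mult a (Poly_Mapping.single bone 1) = a"
      by (induction a rule: poly_mapping_single_induct) (auto simp: twisted_mult_single twisted_mult_add)
  qed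
  show "(0 :: ('a, 'b) salg) \<noteq> 1"
    by transfer (metis lookup_single_eq lookup_zero zero_neq_one)
qed (transfer; simp add: twisted_mult_assoc twisted_mult_add add_ac)+

end

subsection \<open>Linear maps and algebra homomorphisms\<close>

lift_definition mon :: "'b \<Rightarrow> 'k \<Rightarrow> ('b, 'k::field) salg" is Poly_Mapping.single .
lift_definition coef :: "('b, 'k::field) salg \<Rightarrow> 'b \<Rightarrow> 'k" is Poly_Mapping.lookup .
lift_definition supp :: "('b, 'k::field) salg \<Rightarrow> 'b set" is Poly_Mapping.keys .
lift_definition sc :: "'k \<Rightarrow> ('b, 'k::field) salg \<Rightarrow> ('b, 'k) salg" is scale .
lift_definition slin :: "('b \<Rightarrow> ('c, 'k) salg) \<Rightarrow> ('b, 'k::field) salg \<Rightarrow> ('c, 'k) salg" is lin_ext .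
lift_definition ten :: "('b, 'k::field) salg \<Rightarrow> ('c, 'k) salg \<Rightarrow> ('b \<times> 'c, 'k) salg" is tens .
text \<open>The functional may have infinite support, as the functionals of the Steenrod operations
  have.\<close>

lift_definition evl :: "('b \<Rightarrow> 'k) \<Rightarrow> ('b, 'k::field) salg \<Rightarrow> 'k" is
  "\<lambda>\<phi> a. \<Sum>b\<in>Poly_Mapping.keys a. Poly_Mapping.lookup a b * \<phi> b" .

abbreviation bs :: "'b \<Rightarrow> ('b, 'k::field) salg" where "bs x \<equiv> mon x 1"

lemma salg_induct [case_names mon add]:
  fixes a :: "('b::sbasis, 'k::field) salg"
  assumes "\<And>x c. P (mon x c)" "\<And>a b. P a \<Longrightarrow> P b \<Longrightarrow> P (a + b)"
  shows "P a"
proof -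
  have "P (Abs_salg r)" for r
  proof (induction r rule: poly_mapping_single_induct)
    case (single x c)
    then show ?case using assms(1)[of x c] by (simp add: mon.abs_eq)
  next
    case (add r r')
    then show ?case using assms(2) by (metis plus_salg.abs_eq)
  qed
  then show ?thesis by (metis Rep_salg_inverse)
qed

lemma finite_supp [simp]: "finite (supp a)" by transfer simp

lemma salg_eqI: "(\<And>x. coef a x = coef b x) \<Longrightarrow> a = b"
  by transfer (rule poly_mapping_eqI)

lemma supp_iff: "x \<in> supp a \<longleftrightarrow> coef a x \<noteq> 0"
  by transfer (simp add: in_keys_iff)

lemma mon_mult: "mon x c * mon y d = mon (bpl x y) (c * d * of_int (bsg x y))"
  by transfer (simp add: twisted_mult_single)

lemma one_salg_eq: "1 = bs bone"
  by transfer simp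

lemma coef_simps [simp]:
  "coef (a + b) x = coef a x + coef b x" "coef (a - b) x = coef a x - coef b x"
  "coef (- a) x = - coef a x" "coef 0 x = 0" "coef (sc c a) x = c * coef a x"
  for a b :: "('b::sbasis, 'k::field) salg"
  by (transfer; simp add: lookup_add lookup_minus)+

lemma coef_mon: "coef (mon x c) y = (if x = y then c else 0)"
  by transfer (simp add: lookup_single when_def)

lemma coef_sum [simp]: "coef (sum f A) x = (\<Sum>i\<in>A. coef (f i) x)"
  for f :: "'i \<Rightarrow> ('b::sbasis, 'k::field) salg"
  by (induction A rule: infinite_finite_induct) auto

lemma coef_ten [simp]: "coef (ten a b) (x, y) = coef a x * coef b y"
  by transfer simp

lemma mon_zero [simp]: "mon x 0 = (0 :: ('b::sbasis, 'k::field) salg)"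
  by (rule salg_eqI) (simp add: coef_mon)

lemma sc_mon [simp]: "sc c (mon x d) = mon x (c * d)"
  by transfer simp

lemma sc_simps [simp]:
  "sc c (a + b) = sc c a + sc c b" "sc c 0 = 0" "sc 0 a = 0" "sc 1 a = a" "sc c (sc d a) = sc (c * d) a"
  "sc c (- a) = - sc c a"
  for a b :: "('b::sbasis, 'k::field) salg"
  by (rule salg_eqI; simp add: algebra_simps)+

lemma sc_mult_left [simp]: "sc c a * b = sc c (a * b)"
  for a b :: "('b::sbasis, 'k::field) salg"
proof (induction a rule: salg_induct)
  case (mon x d)
  show ?case
    by (induction b rule: salg_induct) (simp_all add: mon_mult distrib_left mult_ac)
qed (simp add: distrib_right)

lemma sc_mult_right [simp]: "a * sc c b = sc c (a * b)"
  for a b :: "('b::sbasis, 'k::field) salg"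
proof (induction a rule: salg_induct)
  case (mon x d)
  show ?case
    by (induction b rule: salg_induct) (simp_all add: mon_mult distrib_left mult_ac)
qed (simp add: distrib_right)

lemma sc_minus_one: "sc (- 1) a = - a" for a :: "('b::sbasis, 'k::field) salg"
  by (rule salg_eqI) simp

lemma sc_add_left: "sc (c + d) a = sc c a + sc d a" for a :: "('b::sbasis, 'k::field) salg"
  by (rule salg_eqI) (simp add: algebra_simps)

lemma of_nat_mult_sc: "of_nat n * a = sc (of_nat n) a" for a :: "('b::sbasis, 'k::field) salg"
  by (induction n) (auto simp: distrib_right sc_add_left)

lemma of_int_mult_sc: "of_int n * a = sc (of_int n) a" for a :: "('b::sbasis, 'k::field) salg"
proof (cases n)
  case (nonneg m)
  then show ?thesis by (simp add: of_nat_mult_sc)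
next
  case (neg m)
  have "of_int (- int (Suc m)) * a = - (of_nat (Suc m) * a)" by (simp only: of_int_minus of_int_of_nat_eq mult_minus_left)
  also have "\<dots> = sc (- of_nat (Suc m)) a" unfolding of_nat_mult_sc by (rule salg_eqI) (simp only: coef_simps mult_minus_left)
  finally show ?thesis unfolding neg by (simp only: of_int_minus of_int_of_nat_eq)
qed

definition slinear :: "(('b::sbasis, 'k::field) salg \<Rightarrow> ('c::sbasis, 'k) salg) \<Rightarrow> bool" where
  "slinear f \<longleftrightarrow> (\<forall>a b. f (a + b) = f a + f b) \<and> (\<forall>c a. f (sc c a) = sc c (f a))"

lemma slinearD:
  assumes "slinear f"
  shows "f (a + b) = f a + f b" "f (sc c a) = sc c (f a)" "f 0 = 0" "f (mon x c) = sc c (f (bs x))"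
    "f (sum g A) = (\<Sum>i\<in>A. f (g i))"
proof -
  show l: "f (a + b) = f a + f b" "f (sc c a) = sc c (f a)" for a b c
    using assms by (auto simp: slinear_def)
  show z: "f 0 = 0" using l(2)[of 0 0] by simp
  show "f (mon x c) = sc c (f (bs x))" using l(2)[of c "bs x"] by simp
  show "f (sum g A) = (\<Sum>i\<in>A. f (g i))"
    by (induction A rule: infinite_finite_induct) (auto simp: l z)
qed

lemma slinear_eqI:
  assumes "slinear f" "slinear g" "\<And>x. f (bs x) = g (bs x)"
  shows "f a = g a"
proof (induction a rule: salg_induct)
  case (mon x c)
  then show ?case using assms by (simp add: slinearD(4)[of f x c] slinearD(4)[of g x c])
qed (use assms in \<open>simp add: slinearD(1)[of f] slinearD(1)[of g]\<close>)

lemma slinear_slin [simp]: "slinear (slin f)"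
  unfolding slinear_def by transfer (simp add: lin_ext_add lin_ext_scale)

lemma slin_mon [simp]: "slin f (mon x c) = sc c (f x)"
  by transfer simp

lemma slinear_comp: "slinear f \<Longrightarrow> slinear g \<Longrightarrow> slinear (\<lambda>a. f (g a))"
  by (simp add: slinear_def)

lemma slinear_id [simp]: "slinear (\<lambda>a. a)"
  by (simp add: slinear_def)

lemma ten_simps:
  "ten (a + b) c = ten a c + ten b c" "ten c' (b' + d') = ten c' b' + ten c' d'"
  "ten (sc r a) c = sc r (ten a c)" "ten a (sc r c) = sc r (ten a c)"
  "ten 0 c = 0" "ten a 0 = 0"
  for a b c' :: "('b::sbasis, 'k::field) salg" and c b' d' :: "('c::sbasis, 'k::field) salg"
  by (transfer; simp add: tens_add_left tens_add_right tens_scale_left tens_scale_right)+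

lemma ten_mon [simp]: "ten (mon x c) (mon y d) = mon (x, y) (c * d)"
  by transfer simp

lemma ten_sum_left: "ten (sum f A) b = (\<Sum>i\<in>A. ten (f i) b)"
  for f :: "'i \<Rightarrow> ('b::sbasis, 'k::field) salg" and b :: "('c::sbasis, 'k) salg"
  by (induction A rule: infinite_finite_induct) (auto simp: ten_simps)

lemma ten_sum_right: "ten b (sum f A) = (\<Sum>i\<in>A. ten b (f i))"
  for f :: "'i \<Rightarrow> ('b::sbasis, 'k::field) salg" and b :: "('c::sbasis, 'k) salg"
  by (induction A rule: infinite_finite_induct) (auto simp: ten_simps)

lemma evl_superset:
  assumes "finite A" "supp a \<subseteq> A"
  shows "evl \<phi> a = (\<Sum>b\<in>A. coef a b * \<phi> b)"
  using assms
  by transfer (rule sum.mono_neutral_left, auto simp: in_keys_iff)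

lemma evl_add: "evl \<phi> (a + b) = evl \<phi> a + evl \<phi> b"
  for a b :: "('b::sbasis, 'k::field) salg"
proof -
  have "supp (a + b) \<subseteq> supp a \<union> supp b" by (auto simp: supp_iff)
  then show ?thesis
    by (simp add: evl_superset[of "supp a \<union> supp b"] distrib_right sum.distrib)
qed

lemma evl_sc: "evl \<phi> (sc c a) = c * evl \<phi> a"
  for a :: "('b::sbasis, 'k::field) salg"
proof -
  have "supp (sc c a) \<subseteq> supp a" by (auto simp: supp_iff)
  then show ?thesis
    by (simp add: evl_superset[of "supp a"] sum_distrib_left mult_ac)
qed

lemma evl_mon [simp]: "evl \<phi> (mon x c) = c * \<phi> x"
  by (subst evl_superset[of "{x}"]) (auto simp: supp_iff coef_mon split: if_splits)

lemma evl_zero [simp]: "evl \<phi> (0 :: ('b::sbasis, 'k::field) salg) = 0"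
  using evl_sc[of \<phi> 0 0] by simp

lemma evl_ten: "evl (\<lambda>(x, y). \<phi> x * \<psi> y) (ten a b) = evl \<phi> a * evl \<psi> b"
  for a :: "('b::sbasis, 'k::field) salg" and b :: "('c::sbasis, 'k::field) salg"
proof (induction a rule: salg_induct)
  case (mon x c)
  show ?case
    by (induction b rule: salg_induct) (auto simp: ten_simps evl_add algebra_simps)
qed (auto simp: ten_simps evl_add algebra_simps)

lemma evl_cong: "(\<And>x. x \<in> supp a \<Longrightarrow> \<phi> x = \<psi> x) \<Longrightarrow> evl \<phi> a = evl \<psi> a"
  by (simp add: evl_superset[OF finite_supp order_refl])

lemma evl_coef: "coef a x = evl (\<lambda>y. if y = x then 1 else 0) a"
  by (auto simp: evl_superset[OF finite_supp order_refl] supp_iff if_distrib[of "\<lambda>t. _ * t"] sum.delta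
      cong: if_cong)

definition alghom :: "(('b::sbasis, 'k::field) salg \<Rightarrow> ('c::sbasis, 'k) salg) \<Rightarrow> bool" where
  "alghom f \<longleftrightarrow> slinear f \<and> (\<forall>a b. f (a * b) = f a * f b) \<and> f 1 = 1"

lemma alghomD:
  assumes "alghom f"
  shows "slinear f" "f (a * b) = f a * f b" "f 1 = 1" "f (a ^ n) = f a ^ n"
    "f (prod_list as) = prod_list (map f as)"
proof -
  show l: "slinear f" "f (a * b) = f a * f b" "f 1 = 1" for a b
    using assms by (auto simp: alghom_def)
  show "f (a ^ n) = f a ^ n" by (induction n) (auto simp: l)
  show "f (prod_list as) = prod_list (map f as)" by (induction as) (auto simp: l)
qed

lemma alghomI:
  assumes lin: "slinear f" and mult: "\<And>x y. f (bs x) * f (bs y) = sc (of_int (bsg x y)) (f (bs (bpl x y)))"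
    and one: "f (bs bone) = 1"
  shows "alghom f"
  unfolding alghom_def
proof (intro conjI allI)
  note l = slinearD[OF lin]
  fix a b
  show "f (a * b) = f a * f b"
  proof (induction a rule: salg_induct)
    case (mon x c)
    show ?case
    proof (induction b rule: salg_induct)
      case (mon y d)
      have "f (mon x c * mon y d) = sc (c * d) (sc (of_int (bsg x y)) (f (bs (bpl x y))))"
        by (simp add: mon_mult l(4)[of _ "c * d * _"])
      also have "\<dots> = f (mon x c) * f (mon y d)"
        by (simp add: mult[symmetric] l(4)[of _ c] l(4)[of _ d] mult.commute[of c d])
      finally show ?case .
    qed (simp add: l(1) distrib_left)
  qed (simp add: l(1) distrib_right)
  show "slinear f" by fact
  show "f 1 = 1" using one by (simp add: one_salg_eq)
qed

lemma alghom_comp: "alghom f \<Longrightarrow> alghom g \<Longrightarrow> alghom (\<lambda>a. f (g a))"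
  by (simp add: alghom_def slinear_comp)

lemma alghom_id [simp]: "alghom (\<lambda>a. a)"
  by (simp add: alghom_def)

subsection \<open>Supports and parity\<close>

lemma supp_mon: "supp (mon x c) \<subseteq> {x}"
  by (auto simp: supp_iff coef_mon split: if_splits)

lemma supp_induct [consumes 1, case_names zero mon add]:
  fixes a :: "('b::sbasis, 'k::field) salg"
  assumes a: "supp a \<subseteq> X" and 0: "P 0"
    and m: "\<And>x c. x \<in> X \<Longrightarrow> P (mon x c)" and add: "\<And>a b. P a \<Longrightarrow> P b \<Longrightarrow> P (a + b)"
  shows "P a"
proof -
  have "P (\<Sum>x\<in>A. mon x (coef a x))" if "finite A" "A \<subseteq> X" for A
    using that by (induction A rule: finite_induct) (auto intro: 0 m add)
  moreover have "(\<Sum>x\<in>supp a. mon x (coef a x)) = a"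
    by (rule salg_eqI) (auto simp: coef_mon supp_iff sum.delta)
  ultimately show ?thesis using a finite_supp by metis
qed

lemma supp_add: "supp (a + b) \<subseteq> supp a \<union> supp b" for a b :: "('b::sbasis, 'k::field) salg"
  by (auto simp: supp_iff)

lemma supp_addI: "supp a \<subseteq> X \<Longrightarrow> supp b \<subseteq> X \<Longrightarrow> supp (a + b) \<subseteq> X"
  for a b :: "('b::sbasis, 'k::field) salg"
  using supp_add[of a b] by blast

lemma supp_zero [simp]: "supp (0 :: ('b::sbasis, 'k::field) salg) = {}"
  by (auto simp: supp_iff)

lemma supp_sumI: "(\<And>i. i \<in> A \<Longrightarrow> supp (f i) \<subseteq> X) \<Longrightarrow> supp (sum f A) \<subseteq> X"
  for f :: "'i \<Rightarrow> ('b::sbasis, 'k::field) salg"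
  by (induction A rule: infinite_finite_induct) (simp_all add: supp_addI)

lemma supp_multI:
  assumes a: "supp a \<subseteq> X" and b: "supp b \<subseteq> Y"
    and m: "\<And>x y. x \<in> X \<Longrightarrow> y \<in> Y \<Longrightarrow> bsg x y \<noteq> 0 \<Longrightarrow> bpl x y \<in> Z"
  shows "supp (a * b) \<subseteq> Z"
  using a
proof (induction a rule: supp_induct)
  case (mon x c)
  show ?case using b
  proof (induction b rule: supp_induct)
    case (mon y d)
    show ?case
    proof (cases "bsg x y = 0")
      case False
      then show ?thesis using m[OF \<open>x \<in> X\<close> \<open>y \<in> Y\<close>] supp_mon by (fastforce simp: mon_mult)
    qed (simp add: mon_mult)
  qed (simp_all add: distrib_left supp_addI)
qed (simp_all add: distrib_right supp_addI)

definition parity :: "nat \<Rightarrow> ('b::sbasis, 'k::field) salg \<Rightarrow> bool" where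
  "parity n a \<longleftrightarrow> supp a \<subseteq> {x. even (bpar x) = even n}"

lemma parity_mon: "parity (bpar x) (mon x c)"
  using supp_mon[of x c] by (auto simp: parity_def)

lemma parity_zero [simp]: "parity n 0" by (simp add: parity_def)

lemma parity_add: "parity n a \<Longrightarrow> parity n b \<Longrightarrow> parity n (a + b)"
  by (simp add: parity_def supp_addI)

lemma parity_sum: "(\<And>i. i \<in> A \<Longrightarrow> parity n (f i)) \<Longrightarrow> parity n (sum f A)"
  by (simp add: parity_def supp_sumI)

lemma parity_mult: "parity m a \<Longrightarrow> parity n b \<Longrightarrow> parity (m + n) (a * b)"
  unfolding parity_def by (erule (1) supp_multI) (auto simp: bpar_bpl)

lemma parity_one [simp]: "parity 0 1"
  using parity_mon[of bone 1] by (simp add: one_salg_eq)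

lemma parity_cong: "even m = even n \<Longrightarrow> parity m a = parity n a"
  by (simp add: parity_def)

lemma parity_power: "parity 0 a \<Longrightarrow> parity 0 (a ^ n)"
  by (induction n) (use parity_mult[of 0 _ 0] in auto)

lemma parity_ten:
  assumes "parity m a" "parity n b"
  shows "parity (m + n) (ten a b)"
  using assms(1)[unfolded parity_def]
proof (induction a rule: supp_induct)
  case (mon x c)
  show ?case using assms(2)[unfolded parity_def]
  proof (induction b rule: supp_induct)
    case (mon y d)
    have "parity (bpar (x, y)) (mon (x, y) (c * d))" by (rule parity_mon)
    then show ?case using mon \<open>x \<in> _\<close>
      by (subst parity_cong[of _ "bpar (x, y)"]) (auto simp: bpar_prod_def)
  qed (auto simp: ten_simps parity_add)
qed (auto simp: ten_simps parity_add)

lemma super_commute: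
  assumes "parity m a" "parity n b"
  shows "a * b = sc ((- 1) ^ (m * n)) (b * a)"
  using assms(1)[unfolded parity_def]
proof (induction a rule: supp_induct)
  case (mon x c)
  show ?case using assms(2)[unfolded parity_def]
  proof (induction b rule: supp_induct)
    case (mon y d)
    have "(- 1 :: int) ^ (bpar x * bpar y) = (- 1) ^ (m * n)"
      by (rule minus_one_power_cong) (use mon \<open>x \<in> _\<close> in auto)
    then have "(of_int (bsg x y) :: 'b) = (- 1) ^ (m * n) * of_int (bsg y x)"
      by (subst bsg_commute) simp
    then show ?case by (simp add: mon_mult bpl_commute[of x y] mult_ac)
  qed (auto simp: distrib_left distrib_right)
qed (auto simp: distrib_left distrib_right)

lemma even_central: "parity 0 a \<Longrightarrow> a * b = b * a"
proof (induction b rule: salg_induct)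
  case (mon x c)
  then show ?case using super_commute[OF _ parity_mon, of 0 a x c] by simp
qed (simp add: distrib_left distrib_right)

text \<open>Graded commutativity gives \<open>a * a = - (a * a)\<close>. This is how the coproduct
  comes to respect \<open>\<tau>\<^sub>i\<^sup>2 = 0\<close>.\<close>

lemma odd_square:
  assumes "parity 1 a" "(2 :: 'k) \<noteq> 0"
  shows "a * a = (0 :: ('b::sbasis, 'k::field) salg)"
proof (rule salg_eqI)
  fix x
  have "a * a = - (a * a)" using super_commute[OF assms(1) assms(1)] by (simp add: sc_minus_one)
  then have "coef (a * a) x = - coef (a * a) x" by (metis coef_simps(3))
  then have "2 * coef (a * a) x = 0" by (metis add.right_inverse mult_2)
  then show "coef (a * a) x = coef 0 x" using assms(2) by simp
qed

lemma ten_mult: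
  fixes a c :: "('b::sbasis, 'k::field) salg" and b d :: "('c::sbasis, 'k) salg"
  assumes "parity m b" "parity n c"
  shows "ten a b * ten c d = sc ((- 1) ^ (m * n)) (ten (a * c) (b * d))"
  using assms(1)[unfolded parity_def]
proof (induction b rule: supp_induct)
  case (mon y s)
  show ?case using assms(2)[unfolded parity_def]
  proof (induction c rule: supp_induct)
    case (mon z t)
    have "(- 1 :: int) ^ (bpar y * bpar z) = (- 1) ^ (m * n)"
      by (rule minus_one_power_cong) (use mon \<open>y \<in> _\<close> in auto)
    then have "of_int ((- 1) ^ (bpar y * bpar z)) = (- 1 :: 'k) ^ (m * n)" by simp
    then have e: "(- 1 :: 'k) ^ (bpar y * bpar z) = (- 1) ^ (m * n)" by simp
    show ?case
    proof (induction a rule: salg_induct)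
      case (mon x r)
      show ?case
        by (induction d rule: salg_induct)
          (simp_all add: ten_simps distrib_left mon_mult bsg_prod_def bpl_prod_def e e[unfolded mult.commute[of "bpar y"]] mult_ac)
    qed (simp add: ten_simps distrib_right)
  qed (simp_all add: ten_simps distrib_left distrib_right)
qed (simp_all add: ten_simps distrib_left distrib_right)

lemma ten_one: "ten 1 1 = 1"
  by (simp add: one_salg_eq bone_prod_def)

lemma ten_mult_even: "parity 0 b \<or> parity 0 c \<Longrightarrow> ten a b * ten c d = ten (a * c) (b * d)"
proof (elim disjE)
  assume b: "parity 0 b"
  show ?thesis
  proof (induction c rule: salg_induct)
    case (mon x r)
    then show ?case using ten_mult[OF b parity_mon] by simp
  qed (simp add: ten_simps distrib_left distrib_right)
next
  assume c: "parity 0 c"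
  show ?thesis
  proof (induction b rule: salg_induct)
    case (mon x r)
    then show ?case using ten_mult[OF parity_mon c] by simp
  qed (simp add: ten_simps distrib_left distrib_right)
qed

lemma ten_power: "parity 0 a \<or> parity 0 b \<Longrightarrow> ten a b ^ n = ten (a ^ n) (b ^ n)"
  by (induction n) (auto simp: ten_one ten_mult_even parity_power)

definition parpres :: "(('b::sbasis, 'k::field) salg \<Rightarrow> ('c::sbasis, 'k) salg) \<Rightarrow> bool" where
  "parpres f \<longleftrightarrow> (\<forall>x. parity (bpar x) (f (bs x)))"

definition tmap :: "(('b::sbasis, 'k::field) salg \<Rightarrow> ('c::sbasis, 'k) salg) \<Rightarrow>
    (('d::sbasis, 'k) salg \<Rightarrow> ('e::sbasis, 'k) salg) \<Rightarrow> ('b \<times> 'd, 'k) salg \<Rightarrow> ('c \<times> 'e, 'k) salg" where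
  "tmap f g = slin (\<lambda>(x, y). ten (f (bs x)) (g (bs y)))"

lemma tmap_ten:
  assumes "slinear f" "slinear g"
  shows "tmap f g (ten a b) = ten (f a) (g b)"
proof (induction a rule: salg_induct)
  case (mon x c)
  show ?case
  proof (induction b rule: salg_induct)
    case (mon y d)
    show ?case
      by (simp add: tmap_def slinearD(4)[OF assms(1), of x c] slinearD(4)[OF assms(2), of y d]
          ten_simps mult.commute)
  qed (simp add: ten_simps slinearD(1)[OF assms(2)] tmap_def slinearD(1)[OF slinear_slin])
qed (simp add: ten_simps slinearD(1)[OF assms(1)] tmap_def slinearD(1)[OF slinear_slin])

text \<open>The Koszul signs of the tensor product are computed from parities, so both factors must
  preserve parity.\<close>

lemma alghom_tmap:
  assumes f: "alghom f" and g: "alghom g" and pf: "parpres f" and pg: "parpres g"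
  shows "alghom (tmap f g)"
proof (rule alghomI)
  show "slinear (tmap f g)" by (simp add: tmap_def)
  show "tmap f g (bs bone) = 1"
    by (simp add: tmap_def bone_prod_def one_salg_eq[symmetric] alghomD[OF f] alghomD[OF g] ten_one)
  fix x y :: "'a \<times> 'd"
  obtain a b c d where [simp]: "x = (a, b)" "y = (c, d)" by (cases x; cases y) auto
  have m: "f (bs a) * f (bs c) = sc (of_int (bsg a c)) (f (bs (bpl a c)))"
    "g (bs b) * g (bs d) = sc (of_int (bsg b d)) (g (bs (bpl b d)))"
    using alghomD(2)[OF f, of "bs a" "bs c"] alghomD(2)[OF g, of "bs b" "bs d"]
    by (simp_all add: mon_mult slinearD(4)[OF alghomD(1)[OF f], of _ "of_int _"]
        slinearD(4)[OF alghomD(1)[OF g], of _ "of_int _"])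
  have "tmap f g (bs x) * tmap f g (bs y)
      = sc ((- 1) ^ (bpar b * bpar c)) (ten (f (bs a) * f (bs c)) (g (bs b) * g (bs d)))"
    by (simp add: tmap_def ten_mult[OF pg[unfolded parpres_def, rule_format] pf[unfolded parpres_def, rule_format]])
  also have "\<dots> = sc (of_int (bsg x y)) (tmap f g (bs (bpl x y)))"
    by (simp add: m tmap_def bpl_prod_def bsg_prod_def ten_simps mult_ac)
  finally show "tmap f g (bs x) * tmap f g (bs y) = sc (of_int (bsg x y)) (tmap f g (bs (bpl x y)))" .
qed

definition asc :: "(('b::sbasis \<times> 'c::sbasis) \<times> 'd::sbasis, 'k::field) salg \<Rightarrow> ('b \<times> 'c \<times> 'd, 'k) salg" where
  "asc = slin (\<lambda>((x, y), z). bs (x, y, z))"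

lemma alghom_asc:
  "alghom (asc :: (('b::sbasis \<times> 'c::sbasis) \<times> 'd::sbasis, 'k::field) salg \<Rightarrow> _)"
proof (rule alghomI)
  show "slinear (asc :: (('b \<times> 'c) \<times> 'd, 'k) salg \<Rightarrow> _)" by (simp add: asc_def)
  show "asc (bs bone) = (1 :: ('b \<times> 'c \<times> 'd, 'k) salg)"
    by (simp add: asc_def bone_prod_def one_salg_eq)
  show "asc (bs x) * asc (bs y) = sc (of_int (bsg x y)) (asc (bs (bpl x y)))" for x y :: "('b \<times> 'c) \<times> 'd"
    by (cases x; cases y)
      (simp add: asc_def mon_mult split_beta bpl_prod_def bsg_prod_def bpar_prod_def power_add algebra_simps)
qed

lemma asc_ten: "asc (ten (ten a b) c) = ten a (ten b c)"
proof (induction a rule: salg_induct)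
  case (mon x r)
  show ?case
  proof (induction b rule: salg_induct)
    case (mon y s)
    show ?case
      by (induction c rule: salg_induct) (simp_all add: ten_simps asc_def slinearD(1)[OF slinear_slin] mult.assoc)
  qed (simp add: ten_simps asc_def slinearD(1)[OF slinear_slin])
qed (simp add: ten_simps asc_def slinearD(1)[OF slinear_slin])

subsection \<open>Frobenius\<close>

lemma commute_power: "x * y = y * x \<Longrightarrow> x * y ^ n = y ^ n * (x :: 'a::monoid_mult)"
  by (induction n) (auto simp: mult.assoc[symmetric], simp add: mult.assoc)

text \<open>Superalgebras are not commutative, so the binomial theorem, and Frobenius after it, are
  proved for two commuting elements; even elements commute.\<close>

lemma commuting_binomial:
  fixes x y :: "'a::ring_1"
  assumes "x * y = y * x"
  shows "(x + y) ^ n = (\<Sum>k\<le>n. of_nat (n choose k) * (x ^ k * y ^ (n - k)))"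
proof (induction n)
  case (Suc n)
  have xk: "x * (of_nat c * (x ^ k * y ^ l)) = of_nat c * (x ^ Suc k * y ^ l)" for c k l
    using mult_of_nat_commute[of c x] by (simp flip: mult.assoc)
  have "y * x ^ k = x ^ k * y" for k using commute_power[OF assms[symmetric]] .
  then have yk: "y * (of_nat c * (x ^ k * y ^ l)) = of_nat c * (x ^ k * y ^ Suc l)" for c k l
  proof -
    have "y * (of_nat c * (x ^ k * y ^ l)) = of_nat c * ((y * x ^ k) * y ^ l)"
      using mult_of_nat_commute[of c y] by (simp flip: mult.assoc)
    then show ?thesis by (simp only: \<open>y * x ^ k = x ^ k * y\<close> mult.assoc power_Suc)
  qed
  have "(x + y) ^ Suc n = (\<Sum>k\<le>n. of_nat (n choose k) * (x ^ Suc k * y ^ (n - k)))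
      + (\<Sum>k\<le>n. of_nat (n choose k) * (x ^ k * y ^ Suc (n - k)))"
    by (simp add: Suc.IH distrib_right sum_distrib_left xk[unfolded power_Suc] yk[unfolded power_Suc]
        sum.distrib)
  also have "(\<Sum>k\<le>n. of_nat (n choose k) * (x ^ k * y ^ Suc (n - k)))
      = y ^ Suc n + (\<Sum>k\<le>n. of_nat (n choose Suc k) * (x ^ Suc k * y ^ (n - k)))"
  proof -
    have "(\<Sum>k\<le>n. of_nat (n choose k) * (x ^ k * y ^ Suc (n - k)))
        = (\<Sum>k\<le>Suc n. of_nat (n choose k) * (x ^ k * y ^ (Suc n - k)))"
      by (simp add: Suc_diff_le binomial_eq_0 cong: sum.cong_simp)
    also have "\<dots> = y ^ Suc n + (\<Sum>k\<le>n. of_nat (n choose Suc k) * (x ^ Suc k * y ^ (n - k)))"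
      by (subst sum.atMost_Suc_shift) simp
    finally show ?thesis .
  qed
  also have "(\<Sum>k\<le>n. of_nat (n choose k) * (x ^ Suc k * y ^ (n - k))) + (y ^ Suc n +
        (\<Sum>k\<le>n. of_nat (n choose Suc k) * (x ^ Suc k * y ^ (n - k))))
      = y ^ Suc n + (\<Sum>k\<le>n. of_nat (Suc n choose Suc k) * (x ^ Suc k * y ^ (n - k)))"
    by (simp add: sum.distrib[symmetric] distrib_right)
  also have "\<dots> = (\<Sum>k\<le>Suc n. of_nat (Suc n choose k) * (x ^ k * y ^ (Suc n - k)))"
    by (subst sum.atMost_Suc_shift) simp
  finally show ?case .
qed simp

lemma commuting_frobenius:
  fixes x y :: "'a::ring_1"
  assumes "x * y = y * x" "prime p" "(of_nat p :: 'a) = 0"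
  shows "(x + y) ^ p = x ^ p + y ^ p"
proof -
  have p: "p > 0" using assms(2) prime_gt_0_nat by blast
  have z: "(of_nat (p choose k) :: 'a) = 0" if "0 < k" "k < p" for k
  proof -
    have "p dvd p choose k" using that assms(2) by (intro dvd_choose_prime) auto
    then show ?thesis using assms(3) by (auto simp: dvd_def)
  qed
  have "(x + y) ^ p = (\<Sum>k\<in>{0, p}. of_nat (p choose k) * (x ^ k * y ^ (p - k)))"
    unfolding commuting_binomial[OF assms(1)]
    by (rule sum.mono_neutral_right) (auto, metis z bot_nat_0.not_eq_extremum le_neq_implies_less mult_zero_left)
  then show ?thesis using p by (simp add: add.commute)
qed

lemma commuting_frobenius_power:
  fixes x y :: "'a::ring_1"
  assumes "x * y = y * x" "prime p" "(of_nat p :: 'a) = 0"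
  shows "(x + y) ^ (p ^ s) = x ^ (p ^ s) + y ^ (p ^ s)"
proof (induction s)
  case (Suc s)
  have c: "x ^ (p ^ s) * y ^ (p ^ s) = y ^ (p ^ s) * x ^ (p ^ s)"
    by (rule commute_power) (metis commute_power assms(1))
  have "(x + y) ^ p ^ Suc s = ((x + y) ^ p ^ s) ^ p"
    by (simp add: power_mult[symmetric] mult.commute)
  then show ?case
    by (simp add: Suc commuting_frobenius[OF c assms(2,3)] power_mult[symmetric] mult.commute)
qed simp

subsection \<open>Homomorphisms determined by the values on the generators\<close>

definition oprod :: "(nat \<Rightarrow> 'r::ring_1) \<Rightarrow> nat set \<Rightarrow> 'r" where
  "oprod f S = prod_list (map f (sorted_list_of_set S))"

definition eprod :: "(nat \<Rightarrow> 'r::ring_1) \<Rightarrow> (nat \<Rightarrow>\<^sub>0 nat) \<Rightarrow> 'r" where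
  "eprod v e = prod_list (map (\<lambda>j. v j ^ Poly_Mapping.lookup e j) (sorted_list_of_set (Poly_Mapping.keys e)))"

lemma oprod_empty [simp]: "oprod f {} = 1"
  by (simp add: oprod_def)

lemma oprod_insert_min:
  assumes "finite T" "\<forall>t\<in>T. m < t"
  shows "oprod f (insert m T) = f m * oprod f T"
proof -
  have "sorted_list_of_set (set (m # sorted_list_of_set T)) = m # sorted_list_of_set T"
    by (rule sorted_list_of_set.idem_if_sorted_distinct) (use assms in \<open>auto intro: less_imp_le\<close>)
  then show ?thesis using assms(1) by (simp add: oprod_def)
qed

text \<open>Moving \<open>f i\<close> into its place passes exactly the factors of smaller index,
  each at the cost of a sign.\<close>

lemma oprod_mult_gen:
  assumes "\<And>i j. i \<noteq> j \<Longrightarrow> f i * f j = - (f j * f i)" "\<And>i. f i * f i = 0" "finite T"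
  shows "f i * oprod f T = (if i \<in> T then 0 else (- 1) ^ card {j \<in> T. j < i} * oprod f (insert i T))"
  using \<open>finite T\<close>
proof (induction T rule: finite_linorder_min_induct)
  case empty
  show ?case using oprod_insert_min[of "{}" i f] by simp
next
  case (insert m T)
  have m: "m \<notin> T" using insert by auto
  consider "i < m" | "i = m" | "m < i" by linarith
  then show ?case
  proof cases
    case 1
    have e: "{j \<in> insert m T. j < i} = {}" and i: "i \<notin> insert m T" and l: "\<forall>t\<in>insert m T. i < t"
      using 1 insert(2) by (auto dest: less_trans)
    show ?thesis
      using oprod_insert_min[OF _ l, of f] insert(1) i by (simp only: e) simp
  next
    case 2
    then show ?thesis
      using assms(2)[of m] by (simp add: oprod_insert_min[OF insert(1,2)] flip: mult.assoc)
  next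
    case 3
    have "f i * oprod f (insert m T) = - (f m * (f i * oprod f T))"
      using assms(1)[of i m] 3 by (simp add: oprod_insert_min[OF insert(1,2)] flip: mult.assoc)
    also have "\<dots> = (if i \<in> T then 0 else - (f m * ((- 1) ^ card {j \<in> T. j < i} * oprod f (insert i T))))"
      unfolding insert.IH by simp
    also have "\<dots> = (if i \<in> T then 0 else (- 1) ^ card {j \<in> insert m T. j < i} * oprod f (insert i (insert m T)))"
    proof -
      have "{j \<in> insert m T. j < i} = insert m {j \<in> T. j < i}" using 3 by auto
      then have c: "card {j \<in> insert m T. j < i} = Suc (card {j \<in> T. j < i})" using m insert(1) by simp
      have o: "oprod f (insert i (insert m T)) = f m * oprod f (insert i T)"
        using insert 3 by (subst insert_commute) (auto intro: oprod_insert_min)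
      have "f m * ((- 1) ^ k * z) = (- 1) ^ k * (f m * z)" for k z
        by (cases "even k") auto
      then show ?thesis unfolding c o by simp
    qed
    finally show ?thesis using 3 by auto
  qed
qed

text \<open>The sign is that of \<open>bsg\<close> on finite sets, so anticommuting elements of
  square zero define an algebra map on the exterior part.\<close>

lemma oprod_mult:
  assumes "\<And>i j. i \<noteq> j \<Longrightarrow> f i * f j = - (f j * f i)" "\<And>i. f i * f i = 0"
    and "finite S" "finite T"
  shows "oprod f S * oprod f T =
    (if S \<inter> T = {} then (- 1) ^ inversions S T * oprod f (S \<union> T) else 0)"
  using \<open>finite S\<close>
proof (induction S rule: finite_linorder_min_induct)
  case empty
  show ?case by (simp add: inversions_def)
next
  case (insert m S)
  have m: "m \<notin> S" using insert by auto
  have "oprod f (insert m S) * oprod f T = f m * (oprod f S * oprod f T)"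
    by (simp add: oprod_insert_min[OF insert(1,2)] mult.assoc)
  also have "\<dots> = (if S \<inter> T = {} then (- 1) ^ inversions S T * (f m * oprod f (S \<union> T)) else 0)"
  proof -
    have "f m * ((- 1) ^ k * z) = (- 1) ^ k * (f m * z)" for k z
      by (cases "even k") auto
    then show ?thesis unfolding insert.IH by simp
  qed
  also have "\<dots> = (if insert m S \<inter> T = {} then (- 1) ^ inversions (insert m S) T * oprod f (insert m S \<union> T) else 0)"
  proof (cases "S \<inter> T = {} \<and> m \<notin> T")
    case True
    have i: "inversions (insert m S) T = inversions {m} T + inversions S T"
      using inversions_Un_left[of "{m}" S T] insert(1) assms(4) m by simp
    have "{(i, j). i \<in> {m} \<and> j \<in> T \<and> j < i} = Pair m ` {j \<in> T. j < m}" by auto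
    then have "inversions {m} T = card {j \<in> T. j < m}"
      by (simp add: inversions_def card_image inj_on_def)
    moreover have "{j \<in> S \<union> T. j < m} = {j \<in> T. j < m}" using insert by auto
    ultimately show ?thesis using True insert(1) assms(4) m
      by (subst oprod_mult_gen[OF assms(1,2)]) (auto simp: i power_add mult.assoc[symmetric] simp flip: power_add, simp add: add.commute)
  next
    case False
    have "f m * oprod f (S \<union> T) = 0" if "m \<in> T"
      using that insert(1) assms(4) by (subst oprod_mult_gen) (auto intro: assms(1,2))
    then show ?thesis using False by auto
  qed
  finally show ?case .
qed

text \<open>Exponent vectors with different keys are compared over a common index range; the
  additional factors have exponent 0.\<close>

lemma eprod_upt:
  assumes "Poly_Mapping.keys e \<subseteq> {..<N}"
  shows "eprod v e = prod_list (map (\<lambda>j. v j ^ Poly_Mapping.lookup e j) [0..<N])"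
proof -
  have "sorted_list_of_set (set (filter (\<lambda>j. j \<in> Poly_Mapping.keys e) [0..<N]))
      = filter (\<lambda>j. j \<in> Poly_Mapping.keys e) [0..<N]"
    by (rule sorted_list_of_set.idem_if_sorted_distinct) (auto simp: sorted_wrt_filter)
  moreover have "set (filter (\<lambda>j. j \<in> Poly_Mapping.keys e) [0..<N]) = Poly_Mapping.keys e"
    using assms by auto
  ultimately have l: "sorted_list_of_set (Poly_Mapping.keys e) = filter (\<lambda>j. j \<in> Poly_Mapping.keys e) [0..<N]"
    by simp
  have "prod_list (map g (filter P xs)) = prod_list (map g xs)" if "\<And>x. \<not> P x \<Longrightarrow> g x = 1"
    for g :: "nat \<Rightarrow> 'a" and P xs
    using that by (induction xs) auto
  from this[of "\<lambda>j. j \<in> Poly_Mapping.keys e" "\<lambda>j. v j ^ Poly_Mapping.lookup e j" "[0..<N]"]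
  show ?thesis unfolding eprod_def l by (auto simp: in_keys_iff)
qed

lemma keys_bounded: "\<exists>N. Poly_Mapping.keys (e :: nat \<Rightarrow>\<^sub>0 'z::zero) \<subseteq> {..<N}"
proof (cases "Poly_Mapping.keys e = {}")
  case False
  have "Poly_Mapping.keys e \<subseteq> {..<Suc (Max (Poly_Mapping.keys e))}"
    by (auto simp: less_Suc_eq_le)
  then show ?thesis ..
qed auto

lemma commute_prod_list:
  "(\<And>y. y \<in> set ys \<Longrightarrow> x * y = y * x) \<Longrightarrow> x * prod_list ys = prod_list ys * (x :: 'a::monoid_mult)"
  by (induction ys) (auto simp: mult.assoc[symmetric], simp add: mult.assoc)

lemma prod_list_mult_commute:
  assumes "\<And>i j. f i * g j = g j * (f i :: 'a::monoid_mult)"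
  shows "prod_list (map (\<lambda>i. f i * g i) xs) = prod_list (map f xs) * prod_list (map g xs)"
proof (induction xs)
  case (Cons x xs)
  have "g x * prod_list (map f xs) = prod_list (map f xs) * g x"
    by (rule commute_prod_list) (auto simp: assms)
  then show ?case by (simp add: Cons mult.assoc) (simp flip: mult.assoc)
qed simp

lemma commute_powers: "x * y = y * x \<Longrightarrow> x ^ m * y ^ n = y ^ n * (x :: 'a::monoid_mult) ^ m"
  by (metis commute_power)

lemma eprod_add:
  assumes "\<And>i j. v i * v j = v j * v i"
  shows "eprod v (e + f) = eprod v e * eprod v f"
proof -
  obtain N where N: "Poly_Mapping.keys e \<union> Poly_Mapping.keys f \<subseteq> {..<N}"
  proof -
    obtain N1 N2 where "Poly_Mapping.keys e \<subseteq> {..<N1}" "Poly_Mapping.keys f \<subseteq> {..<N2}"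
      using keys_bounded by metis
    then have "Poly_Mapping.keys e \<union> Poly_Mapping.keys f \<subseteq> {..<max N1 N2}" by force
    then show thesis by (rule that)
  qed
  have "Poly_Mapping.keys (e + f) \<subseteq> {..<N}" using N keys_add[of e f] by blast
  then show ?thesis using N
    by (simp add: eprod_upt[of _ N] lookup_add power_add prod_list_mult_commute commute_powers assms)
qed

lemma eprod_zero [simp]: "eprod v 0 = 1"
  by (simp add: eprod_def)

lemma eprod_single [simp]: "eprod v (Poly_Mapping.single j n) = v j ^ n"
  by (cases "n = 0") (simp_all add: eprod_def)

lemma parity_prod_list: "(\<And>x. x \<in> set xs \<Longrightarrow> parity 0 x) \<Longrightarrow> parity 0 (prod_list xs)"
  by (induction xs) (use parity_mult[of 0 _ 0] in auto)

lemma parity_eprod: "(\<And>j. parity 0 (v j)) \<Longrightarrow> parity 0 (eprod v e)"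
  unfolding eprod_def by (rule parity_prod_list) (auto intro: parity_power)

lemma parity_oprod:
  assumes "\<And>i. parity 1 (f i)" "finite S"
  shows "parity (card S) (oprod f S)"
  using assms(2)
proof (induction S rule: finite_linorder_min_induct)
  case (insert m S)
  then show ?case using parity_mult[OF assms(1) insert.IH, of m]
    by (subst oprod_insert_min) (auto simp: card_insert_if)
qed simp

definition ghom :: "(nat \<Rightarrow> ('c::sbasis, 'k::field) salg) \<Rightarrow> (nat \<Rightarrow> ('c, 'k) salg) \<Rightarrow>
    (mono, 'k) salg \<Rightarrow> ('c, 'k) salg" where
  "ghom f v = slin (\<lambda>(S, e). oprod f (fset S) * eprod v e)"

lemma ghom_bs: "ghom f v (bs (S, e)) = oprod f (fset S) * eprod v e"
  by (simp add: ghom_def)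

lemma bpl_mono: "bpl (S, e) (T, f) = (S |\<union>| T, e + f)"
  for e f :: "'b \<Rightarrow>\<^sub>0 'c::comm_monoid_add"
  by (simp add: bpl_prod_def bpl_fset_def bpl_poly_mapping_def)

lemma bsg_mono: "bsg (S, e) (T, f) =
    (if fset S \<inter> fset T = {} then (- 1) ^ inversions (fset S) (fset T) else 0)"
  for e f :: "'b \<Rightarrow>\<^sub>0 'c::comm_monoid_add"
proof -
  have "S |\<inter>| T = {||} \<longleftrightarrow> fset S \<inter> fset T = {}"
    by (metis bot_fset.rep_eq fset_inject inf_fset.rep_eq)
  then show ?thesis
    by (simp add: bsg_prod_def bsg_fset_def bsg_poly_mapping_def bpar_poly_mapping_def)
qed

lemma bpar_mono: "bpar (S, e) = card (fset S)"
  for e :: "'b \<Rightarrow>\<^sub>0 'c::comm_monoid_add"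
  by (simp add: bpar_prod_def bpar_fset_def bpar_poly_mapping_def fcard.rep_eq)

lemma bone_mono: "bone = ({||}, 0 :: 'b \<Rightarrow>\<^sub>0 'c::comm_monoid_add)"
  by (simp add: bone_prod_def bone_fset_def bone_poly_mapping_def)

text \<open>The universal property of the free graded commutative algebra: odd images anticommute
  and have square zero, even images are central.\<close>

lemma alghom_ghom:
  assumes f: "\<And>i. parity 1 (f i)" and v: "\<And>j. parity 0 (v j)" and two: "(2 :: 'k) \<noteq> 0"
  shows "alghom (ghom f v :: (mono, 'k::field) salg \<Rightarrow> ('c::sbasis, 'k) salg)"
proof (rule alghomI)
  show "slinear (ghom f v)" by (simp add: ghom_def)
  show "ghom f v (bs bone) = 1" by (simp add: bone_mono ghom_bs)
  fix x y :: mono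
  obtain S e T g where [simp]: "x = (S, e)" "y = (T, g)" by (cases x; cases y)
  have anti: "f i * f j = - (f j * f i)" for i j
    using super_commute[OF f f, of i j] by (simp add: sc_minus_one)
  have sq: "f i * f i = 0" for i by (rule odd_square[OF f two])
  have "ghom f v (bs x) * ghom f v (bs y) = oprod f (fset S) * oprod f (fset T) * (eprod v e * eprod v g)"
    using even_central[OF parity_eprod[of v e, OF v]] by (simp add: ghom_bs) (metis mult.assoc)
  also have "eprod v e * eprod v g = eprod v (e + g)"
    by (rule eprod_add[symmetric]) (rule even_central[OF v])
  also have "oprod f (fset S) * oprod f (fset T) = of_int (bsg x y) * oprod f (fset S \<union> fset T)"
    by (simp add: oprod_mult[OF anti sq] bsg_mono)
  finally show "ghom f v (bs x) * ghom f v (bs y) = sc (of_int (bsg x y)) (ghom f v (bs (bpl x y)))"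
    by (simp add: bpl_mono ghom_bs of_int_mult_sc)
qed

lemma parpres_ghom:
  assumes f: "\<And>i. parity 1 (f i)" and v: "\<And>j. parity 0 (v j)"
  shows "parpres (ghom f v)"
  unfolding parpres_def
  using parity_mult[OF parity_oprod[of f, OF f] parity_eprod[of v, OF v]]
  by (auto simp: ghom_bs bpar_mono)

definition taug :: "nat \<Rightarrow> (mono, 'k::field) salg" where "taug i = bs ({|i|}, 0)"
text \<open>\<open>pgen 0\<close> is \<open>u\<close>, and \<open>pgen j\<close> is
  \<open>\<xi>\<^sub>j\<close> for positive \<open>j\<close>.\<close>

definition pgen :: "nat \<Rightarrow> (mono, 'k::field) salg" where "pgen j = bs ({||}, Poly_Mapping.single j 1)"

lemma parity_gens [simp]: "parity (Suc 0) (taug i)" "parity 0 (pgen j)"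
  using parity_mon[of "({|i|}, 0) :: mono" 1] parity_mon[of "({||}, Poly_Mapping.single j 1) :: mono" 1]
  by (simp_all add: taug_def pgen_def bpar_mono)

lemma pgen_power: "pgen j ^ n = bs ({||}, Poly_Mapping.single j n)"
  by (induction n) (simp_all add: pgen_def one_salg_eq bone_mono mon_mult bpl_mono bsg_mono
      inversions_def flip: single_add)

lemma oprod_taug: "finite S \<Longrightarrow> oprod taug S = bs (Abs_fset S, 0)"
proof (induction S rule: finite_linorder_min_induct)
  case empty
  show ?case by (simp add: one_salg_eq bone_mono bot_fset_def)
next
  case (insert m S)
  have "{(i, j). i \<in> {m} \<and> j \<in> S \<and> j < i} = {}" using insert by auto
  then have i: "inversions {m} S = 0" unfolding inversions_def by (simp only: card.empty)
  have [simp]: "fset (Abs_fset S) = S" using insert by (simp add: Abs_fset_inverse)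
  have "finsert m (Abs_fset S) = Abs_fset (insert m S)"
    by (metis Abs_fset_inverse finite.insertI finsert.rep_eq fset_inverse insert.hyps(1) mem_Collect_eq)
  moreover have "m \<notin> S" using insert(2) by blast
  ultimately show ?case using i
    unfolding oprod_insert_min[OF insert(1,2)] insert.IH by (simp add: taug_def mon_mult bpl_mono bsg_mono)
qed

lemma eprod_pgen: "eprod pgen e = bs ({||}, e)"
proof (induction e rule: poly_mapping_single_induct)
  case (single j n)
  show ?case by (simp add: pgen_power)
next
  case (add e f)
  have "eprod pgen (e + f) = eprod pgen e * (eprod pgen f :: (mono, 'a) salg)"
    by (rule eprod_add) (rule even_central, simp)
  then show ?case by (simp add: add mon_mult bpl_mono bsg_mono inversions_def)
qed

lemma bs_mono_eq: "bs (S, e) = oprod taug (fset S) * eprod pgen e"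
  by (simp add: oprod_taug eprod_pgen fset_inverse mon_mult bpl_mono bsg_mono inversions_def)

lemma alghom_oprod: "alghom h \<Longrightarrow> h (oprod f S) = oprod (\<lambda>i. h (f i)) S"
  by (simp add: oprod_def alghomD o_def)

lemma alghom_eprod: "alghom h \<Longrightarrow> h (eprod v e) = eprod (\<lambda>i. h (v i)) e"
  by (simp add: eprod_def alghomD o_def)

lemma alghom_bs:
  "alghom h \<Longrightarrow> h (bs (S, e)) = oprod (\<lambda>i. h (taug i)) (fset S) * eprod (\<lambda>j. h (pgen j)) e"
  unfolding bs_mono_eq by (simp add: alghomD(2) alghom_oprod alghom_eprod)

lemma alghom_eqI:
  fixes f g :: "(mono, 'k::field) salg \<Rightarrow> ('c::sbasis, 'k) salg"
  assumes "alghom f" "alghom g" "\<And>i. f (taug i) = g (taug i)" "\<And>j. f (pgen j) = g (pgen j)"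
  shows "f a = g a"
proof (rule slinear_eqI[of f g])
  fix x :: mono
  show "f (bs x) = g (bs x)"
    by (cases x) (simp add: alghom_bs[OF assms(1)] alghom_bs[OF assms(2)] assms(3,4))
qed (use assms alghomD in auto)

lemma ghom_gens [simp]:
  "ghom f v (taug i) = f i" "ghom f v (pgen j) = v j"
  using oprod_insert_min[of "{}" i f] by (simp_all add: taug_def pgen_def ghom_bs)

section \<open>The coproduct is a coassociative algebra homomorphism\<close>

lemma mono_mult_eq: "mono_mult x y = basis_mult x y"
proof -
  obtain S e T f where [simp]: "x = (S, e)" "y = (T, f)" by (cases x; cases y)
  have "S |\<inter>| T = {||} \<longleftrightarrow> fset S \<inter> fset T = {}"
    by (metis bot_fset.rep_eq fset_inject inf_fset.rep_eq)
  then show ?thesis by (simp add: basis_mult_def bpl_mono bsg_mono inversions_def)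
qed

lemma dst_mult_eq: "dst_mult = twisted_mult"
  by (intro ext) (simp add: dst_mult_def twisted_mult_def mono_mult_eq)

lemma dst2_mult_eq: "dst2_mult = twisted_mult"
proof -
  have "scale ((- 1) ^ (mono_parity b * mono_parity c)) (tens (mono_mult a c) (mono_mult b d))
      = (basis_mult (a, b) (c, d) :: _ \<Rightarrow>\<^sub>0 'a mod_ring)" for a b c d
    by (simp add: mono_mult_eq basis_mult_def bpl_prod_def[of "(a, b)"] bsg_prod_def[of "(a, b)"]
        mono_parity_def bpar_prod_def[of b] bpar_prod_def[of c] bpar_fset_def bpar_poly_mapping_def)
  then have "(\<lambda>((a, b), (c, d)). scale ((- 1) ^ (mono_parity b * mono_parity c))
        (tens (mono_mult a c) (mono_mult b d)))
      = (\<lambda>(x, y). basis_mult x y :: _ \<Rightarrow>\<^sub>0 'a mod_ring)"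
    by (auto simp: fun_eq_iff)
  then show ?thesis by (intro ext) (simp add: dst2_mult_def twisted_mult_def)
qed

lemma Abs_dst_mult: "Abs_salg (dst_mult a b) = Abs_salg a * Abs_salg b"
  by (simp add: dst_mult_eq times_salg.abs_eq)

lemma Abs_dst2_mult: "Abs_salg (dst2_mult a b) = Abs_salg a * Abs_salg b"
  by (simp add: dst2_mult_eq times_salg.abs_eq)

lemma Abs_dst_one: "Abs_salg dst_one = 1"
  by (simp add: dst_one_def one_salg.abs_eq bone_mono)

lemma Abs_dst_power: "Abs_salg (dst_power a n) = Abs_salg a ^ n"
  by (induction n) (simp_all add: dst_power_def Abs_dst_one Abs_dst_mult)

lemma Abs_tens: "Abs_salg (tens a b) = ten (Abs_salg a) (Abs_salg b)"
  by (simp add: ten.abs_eq)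

lemma Abs_add: "Abs_salg (a + b) = Abs_salg a + (Abs_salg b :: ('b::sbasis, 'k::field) salg)"
  by (simp add: plus_salg.abs_eq)

lemma Abs_sum: "Abs_salg (sum f A) = (\<Sum>i\<in>A. Abs_salg (f i) :: ('b::sbasis, 'k::field) salg)"
  by (induction A rule: infinite_finite_induct) (auto simp: Abs_add zero_salg.abs_eq)

definition xig :: "nat \<Rightarrow> (mono, 'k::field) salg" where
  "xig j = (if j = 0 then pgen 0 ^ 2 else pgen j)"

lemma Abs_gens: "Abs_salg gen_u = pgen 0" "Abs_salg (gen_xi j) = xig j" "Abs_salg (gen_tau i) = taug i"
proof -
  show u: "Abs_salg gen_u = pgen 0" by (simp add: gen_u_def pgen_def mon.abs_eq)
  show "Abs_salg (gen_tau i) = taug i" by (simp add: gen_tau_def taug_def mon.abs_eq)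
  show "Abs_salg (gen_xi j) = xig j"
    by (simp add: gen_xi_def xig_def Abs_dst_power u) (simp add: pgen_def mon.abs_eq)
qed

lemma parity_xig [simp]: "parity 0 (xig j)"
  by (auto simp: xig_def intro: parity_power)

definition Dtau :: "nat \<Rightarrow> (mono \<times> mono, 'p::prime_card mod_ring) salg" where
  "Dtau i = (\<Sum>s\<le>i. ten (xig (i - s) ^ (CARD('p) ^ s)) (taug s)) + ten (taug i) (pgen 0)"

definition Dxi :: "nat \<Rightarrow> (mono \<times> mono, 'p::prime_card mod_ring) salg" where
  "Dxi j = (\<Sum>s\<le>j. ten (xig (j - s) ^ (CARD('p) ^ s)) (xig s))"

definition Dpol :: "nat \<Rightarrow> (mono \<times> mono, 'p::prime_card mod_ring) salg" where
  "Dpol j = (if j = 0 then ten (pgen 0) (pgen 0) else Dxi j)"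

definition cop :: "(mono, 'p::prime_card mod_ring) salg \<Rightarrow> (mono \<times> mono, 'p mod_ring) salg" where
  "cop = ghom Dtau Dpol"

lemma Abs_delta_gens:
  "Abs_salg (delta_tau i) = Dtau i" "Abs_salg (if j = 0 then delta_u else delta_xi j) = Dpol j"
  by (simp_all add: delta_tau_def delta_xi_def delta_u_def Dtau_def Dpol_def Dxi_def
      Abs_add Abs_sum Abs_tens Abs_gens Abs_dst_power)

text \<open>The fold in the definition of the coproduct is the ordered product in
  \<open>ghom\<close>, so the coproduct can be studied through its values on the generators.\<close>

lemma Abs_delta_mono: "Abs_salg (delta_mono d) = cop (bs d)"
proof -
  obtain S e where d: "d = (S, e)" by (cases d)
  have fold: "Abs_salg (foldr dst2_mult xs z) = prod_list (map Abs_salg xs) * Abs_salg z"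
    for xs and z :: "mono \<times> mono \<Rightarrow>\<^sub>0 'a mod_ring"
    by (induction xs) (simp_all add: Abs_dst2_mult mult.assoc)
  have one: "Abs_salg (tens dst_one dst_one) = (1 :: (mono \<times> mono, 'a mod_ring) salg)"
    by (simp add: Abs_tens Abs_dst_one ten_one)
  have rep: "prod_list (map Abs_salg (concat (map (\<lambda>j. replicate (g j) (h j)) xs)))
      = prod_list (map (\<lambda>j. Abs_salg (h j) ^ g j) xs)"
    for g and h :: "nat \<Rightarrow> (mono \<times> mono \<Rightarrow>\<^sub>0 'a mod_ring)" and xs
    by (induction xs) (simp_all add: prod_list_replicate)
  show ?thesis
    unfolding d delta_mono.simps fold one
    by (simp add: cop_def ghom_bs oprod_def eprod_def rep Abs_delta_gens o_def sorted_list_of_fset.rep_eq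
        del: concat_map_singleton)
qed

lemma coef_cop: "coef (cop (bs d)) x = Poly_Mapping.lookup (delta_mono d) x"
  unfolding Abs_delta_mono[symmetric] by (simp add: coef.abs_eq)

lemma of_nat_card_salg: "(of_nat CARD('p) :: ('b::sbasis, 'p::prime_card mod_ring) salg) = 0"
proof -
  have "of_nat CARD('p) * 1 = sc (of_nat CARD('p)) (1 :: ('b, 'p mod_ring) salg)"
    by (rule of_nat_mult_sc)
  then show ?thesis by simp
qed

lemma parity_Dtau: "parity 1 (Dtau i)"
proof -
  have "parity (0 + Suc 0) (ten (xig (i - s) ^ (CARD('a) ^ s)) (taug s :: (mono, 'a mod_ring) salg))" for s
    by (intro parity_ten parity_power) auto
  moreover have "parity (Suc 0 + 0) (ten (taug i) (pgen 0 :: (mono, 'a mod_ring) salg))"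
    by (intro parity_ten) auto
  ultimately show ?thesis unfolding Dtau_def by (intro parity_add parity_sum) auto
qed

lemma parity_Dxi: "parity 0 (Dxi j)"
proof -
  have "parity (0 + 0) (ten (xig (j - s) ^ (CARD('a) ^ s)) (xig s :: (mono, 'a mod_ring) salg))" for s
    by (intro parity_ten parity_power) auto
  then show ?thesis unfolding Dxi_def by (intro parity_sum) auto
qed

lemma parity_Dpol: "parity 0 (Dpol j)"
  using parity_ten[of 0 "pgen 0" 0 "pgen 0"] by (auto simp: Dpol_def parity_Dxi)

locale odd_prime =
  fixes prime_type :: "'p::prime_card itself"
  assumes odd_card: "odd CARD('p)"
begin

lemma card_ge_3: "CARD('p) \<ge> 3"
proof -
  have "CARD('p) \<ge> 2" using prime_card[where 'a = 'p] prime_ge_2_nat by blast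
  moreover have "CARD('p) \<noteq> 2" using odd_card by auto
  ultimately show ?thesis by simp
qed

lemma two_neq_zero: "(2 :: 'p mod_ring) \<noteq> 0"
proof
  assume "(2 :: 'p mod_ring) = 0"
  then have "(of_nat 2 :: 'p mod_ring) = 0" by simp
  then have "CARD('p) dvd 2" by (rule of_nat_0_mod_ring_dvd)
  then show False using card_ge_3 by (auto dest!: dvd_imp_le)
qed

lemma alghom_cop: "alghom (cop :: (mono, 'p mod_ring) salg \<Rightarrow> _)"
  unfolding cop_def by (rule alghom_ghom[OF parity_Dtau parity_Dpol two_neq_zero])

lemma parpres_cop: "parpres (cop :: (mono, 'p mod_ring) salg \<Rightarrow> _)"
  unfolding cop_def by (rule parpres_ghom[OF parity_Dtau parity_Dpol])

lemma cop_taug: "cop (taug i :: (mono, 'p mod_ring) salg) = Dtau i"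
  by (simp add: cop_def)

lemma cop_xig: "cop (xig j :: (mono, 'p mod_ring) salg) = Dxi j"
proof (cases "j = 0")
  case True
  have "cop (pgen 0 ^ 2 :: (mono, 'p mod_ring) salg) = ten (pgen 0) (pgen 0) ^ 2"
    unfolding alghomD(4)[OF alghom_cop] by (simp add: cop_def Dpol_def)
  also have "\<dots> = ten (pgen 0 ^ 2) (pgen 0 ^ 2)" by (rule ten_power) simp
  finally show ?thesis using True by (simp add: xig_def Dxi_def)
qed (simp add: cop_def xig_def Dpol_def)

lemma frobenius_sum:
  fixes f :: "'i \<Rightarrow> ('b::sbasis, 'p mod_ring) salg"
  assumes "finite A" "\<And>i. parity 0 (f i)"
  shows "sum f A ^ (CARD('p) ^ s) = (\<Sum>i\<in>A. f i ^ (CARD('p) ^ s))"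
  using assms(1)
proof (induction A rule: finite_induct)
  case empty
  have "CARD('p) ^ s > 0" by (simp add: prime_gt_0_nat prime_card)
  then show ?case by (simp add: power_0_left)
next
  case (insert i A)
  have "f i * sum f A = sum f A * f i" by (rule even_central) (rule assms)
  then show ?case using insert
    by (simp add: commuting_frobenius_power[OF _ prime_card of_nat_card_salg])
qed

text \<open>The summands are even, hence commute, and in characteristic p the power can be taken
  term by term.\<close>

lemma Dxi_frobenius:
  "(Dxi j :: (mono \<times> mono, 'p mod_ring) salg) ^ (CARD('p) ^ s)
    = (\<Sum>t\<le>j. ten (xig (j - t) ^ (CARD('p) ^ (t + s))) (xig t ^ (CARD('p) ^ s)))"
proof -
  have e: "parity 0 (ten (xig (j - t) ^ (CARD('p) ^ t)) (xig t :: (mono, 'p mod_ring) salg))" for t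
    using parity_ten[of 0 "xig (j - t) ^ (CARD('p) ^ t)" 0 "xig t :: (mono, 'p mod_ring) salg"]
    by (simp add: parity_power)
  show ?thesis
    by (simp add: Dxi_def frobenius_sum[OF _ e] ten_power parity_power power_mult[symmetric]
        power_add del: power_mult)
qed

lemma triangle_sum_reindex:
  fixes f :: "nat \<Rightarrow> nat \<Rightarrow> 'a::comm_monoid_add"
  shows "(\<Sum>s\<le>j. \<Sum>t\<le>j - s. f s t) = (\<Sum>r\<le>j. \<Sum>s\<le>r. f s (r - s))"
proof -
  have "(\<Sum>s\<le>j. \<Sum>t\<le>j - s. f s t) = (\<Sum>(s, t)\<in>(SIGMA s:{..j}. {..j - s}). f s t)"
    by (rule sum.Sigma) auto
  also have "\<dots> = (\<Sum>(r, s)\<in>(SIGMA r:{..j}. {..r}). f s (r - s))"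
    by (rule sum.reindex_bij_witness[of _ "\<lambda>(r, s). (s, r - s)" "\<lambda>(s, t). (s + t, s)"])
      (simp_all add: split_beta, auto)
  also have "\<dots> = (\<Sum>r\<le>j. \<Sum>s\<le>r. f s (r - s))"
    by (rule sum.Sigma[symmetric]) auto
  finally show ?thesis .
qed

definition cop_left :: "(mono \<times> mono, 'p mod_ring) salg \<Rightarrow> (mono \<times> mono \<times> mono, 'p mod_ring) salg" where
  "cop_left a = asc (tmap cop (\<lambda>a. a) a)"

definition cop_right :: "(mono \<times> mono, 'p mod_ring) salg \<Rightarrow> (mono \<times> mono \<times> mono, 'p mod_ring) salg" where
  "cop_right a = tmap (\<lambda>a. a) cop a"

lemma cop_left_ten: "cop_left (ten a b) = asc (ten (cop a) b)"
  by (simp add: cop_left_def tmap_ten alghomD(1)[OF alghom_cop])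

lemma cop_right_ten: "cop_right (ten a b) = ten a (cop b)"
  by (simp add: cop_right_def tmap_ten alghomD(1)[OF alghom_cop])

lemma parpres_id: "parpres (\<lambda>a. a)"
  by (simp add: parpres_def parity_mon)

lemma alghom_cop_left: "alghom cop_left"
  unfolding cop_left_def
  by (rule alghom_comp[OF alghom_asc alghom_tmap[OF alghom_cop alghom_id parpres_cop parpres_id]])

lemma alghom_cop_right: "alghom cop_right"
  unfolding cop_right_def
  by (rule alghom_tmap[OF alghom_id alghom_cop parpres_id parpres_cop])

lemma slinear_asc: "slinear asc" by (simp add: asc_def)

lemmas cop_left_sum = slinearD(5)[OF alghomD(1)[OF alghom_cop_left]]
lemmas cop_right_sum = slinearD(5)[OF alghomD(1)[OF alghom_cop_right]]
lemmas cop_left_add = slinearD(1)[OF alghomD(1)[OF alghom_cop_left]]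
lemmas cop_right_add = slinearD(1)[OF alghomD(1)[OF alghom_cop_right]]

lemma cop_left_term:
  "cop_left (ten (xig j ^ (CARD('p) ^ s)) z)
    = (\<Sum>t\<le>j. ten (xig (j - t) ^ (CARD('p) ^ (t + s))) (ten (xig t ^ (CARD('p) ^ s)) z))"
  by (simp add: cop_left_ten alghomD(4)[OF alghom_cop] cop_xig Dxi_frobenius ten_sum_left
      slinearD(5)[OF slinear_asc] asc_ten)

text \<open>Shared by the cases \<open>z = xig\<close> and \<open>z = taug\<close> of
  coassociativity. Collecting the terms with the same \<open>r = s + t\<close> turns the left
  bracketing into the right one.\<close>

lemma cop_left_sum_terms:
  "(\<Sum>s\<le>j. cop_left (ten (xig (j - s) ^ (CARD('p) ^ s)) (z s)))
    = (\<Sum>r\<le>j. ten (xig (j - r) ^ (CARD('p) ^ r)) (\<Sum>s\<le>r. ten (xig (r - s) ^ (CARD('p) ^ s)) (z s)))"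
proof -
  have "(\<Sum>s\<le>j. cop_left (ten (xig (j - s) ^ (CARD('p) ^ s)) (z s)))
    = (\<Sum>s\<le>j. \<Sum>t\<le>j - s. ten (xig (j - s - t) ^ (CARD('p) ^ (t + s))) (ten (xig t ^ (CARD('p) ^ s)) (z s)))"
    by (simp add: cop_left_term)
  also have "\<dots> = (\<Sum>r\<le>j. \<Sum>s\<le>r. ten (xig (j - r) ^ (CARD('p) ^ r)) (ten (xig (r - s) ^ (CARD('p) ^ s)) (z s)))"
    unfolding triangle_sum_reindex by (intro sum.cong refl) simp
  finally show ?thesis by (simp add: ten_sum_right)
qed

text \<open>Both iterated coproducts are algebra homomorphisms, so it suffices to compare them on
  the generators.\<close>

theorem coassociative: "cop_left (cop a) = cop_right (cop (a :: (mono, 'p mod_ring) salg))"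
proof (rule alghom_eqI[of "\<lambda>a. cop_left (cop a)" "\<lambda>a. cop_right (cop a)"])
  show "alghom (\<lambda>a. cop_left (cop a))" by (rule alghom_comp[OF alghom_cop_left alghom_cop])
  show "alghom (\<lambda>a. cop_right (cop a))" by (rule alghom_comp[OF alghom_cop_right alghom_cop])
  show "cop_left (cop (taug i)) = cop_right (cop (taug i))" for i
  proof -
    have "cop_left (cop (taug i)) = (\<Sum>s\<le>i. cop_left (ten (xig (i - s) ^ (CARD('p) ^ s)) (taug s)))
        + asc (ten (Dtau i) (pgen 0))"
      unfolding cop_taug by (subst Dtau_def) (simp add: cop_left_add cop_left_sum cop_left_ten cop_taug)
    also have "asc (ten (Dtau i) (pgen 0 :: (mono, 'p mod_ring) salg)) =
        (\<Sum>s\<le>i. ten (xig (i - s) ^ (CARD('p) ^ s)) (ten (taug s) (pgen 0))) + ten (taug i) (ten (pgen 0) (pgen 0))"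
      by (simp add: Dtau_def ten_simps ten_sum_left slinearD(1,5)[OF slinear_asc] asc_ten)
    \<comment> \<open>The summands with \<open>\<tau>\<^sub>s \<otimes> u\<close> that come from the
      last term complete the inner sums to the coproducts of the
      \<open>\<tau>\<^sub>r\<close>.\<close>
    also have "(\<Sum>s\<le>i. cop_left (ten (xig (i - s) ^ (CARD('p) ^ s)) (taug s))) +
        ((\<Sum>s\<le>i. ten (xig (i - s) ^ (CARD('p) ^ s)) (ten (taug s) (pgen 0))) + ten (taug i) (ten (pgen 0) (pgen 0)))
      = (\<Sum>r\<le>i. ten (xig (i - r) ^ (CARD('p) ^ r)) (Dtau r)) + ten (taug i) (ten (pgen 0) (pgen 0))"
      unfolding cop_left_sum_terms by (simp add: Dtau_def ten_simps sum.distrib add.assoc)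
    also have "\<dots> = cop_right (cop (taug i))"
      unfolding cop_taug Dtau_def[of i]
      by (simp add: cop_right_add cop_right_sum cop_right_ten cop_taug) (simp add: cop_def Dpol_def)
    finally show ?thesis .
  qed
  show "cop_left (cop (pgen j)) = cop_right (cop (pgen j))" for j
  proof (cases "j = 0")
    case True
    have "cop (pgen 0 :: (mono, 'p mod_ring) salg) = ten (pgen 0) (pgen 0)"
      by (simp add: cop_def Dpol_def)
    then show ?thesis using True by (simp add: cop_left_ten cop_right_ten asc_ten)
  next
    case False
    then have j: "pgen j = (xig j :: (mono, 'p mod_ring) salg)" by (simp add: xig_def)
    have "cop_left (cop (xig j)) = (\<Sum>r\<le>j. ten (xig (j - r) ^ (CARD('p) ^ r)) (Dxi r))"
      unfolding cop_xig Dxi_def[of j] cop_left_sum cop_left_sum_terms by (simp add: Dxi_def)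
    also have "\<dots> = cop_right (cop (xig j))"
      unfolding cop_xig Dxi_def[of j] cop_right_sum by (simp add: cop_right_ten cop_xig)
    finally show ?thesis using j by simp
  qed
qed

end

section \<open>The bigrading\<close>

definition additive_degree :: "('b::sbasis \<Rightarrow> int) \<Rightarrow> bool" where
  "additive_degree dg \<longleftrightarrow> dg bone = 0 \<and> (\<forall>x y. bsg x y \<noteq> 0 \<longrightarrow> dg (bpl x y) = dg x + dg y)"

definition homog :: "('b::sbasis \<Rightarrow> int) \<Rightarrow> int \<Rightarrow> ('b, 'k::field) salg \<Rightarrow> bool" where
  "homog dg n a \<longleftrightarrow> supp a \<subseteq> {x. dg x = n}"

lemma homog_mult:
  assumes "additive_degree dg" "homog dg m a" "homog dg n b"
  shows "homog dg (m + n) (a * b)"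
  using assms unfolding homog_def additive_degree_def by (elim supp_multI) auto

lemma homog_mon: "dg x = n \<Longrightarrow> homog dg n (mon x c)"
  unfolding homog_def using supp_mon[of x c] by auto

lemma homog_one: "additive_degree dg \<Longrightarrow> homog dg 0 1"
  by (simp add: one_salg_eq homog_mon additive_degree_def)

lemma homog_power: "additive_degree dg \<Longrightarrow> homog dg n a \<Longrightarrow> homog dg (n * int k) (a ^ k)"
proof (induction k)
  case (Suc k)
  show ?case using homog_mult[OF Suc.prems Suc.IH[OF Suc.prems]] by (simp add: algebra_simps)
qed (simp add: homog_one)

lemma homog_add: "homog dg n a \<Longrightarrow> homog dg n b \<Longrightarrow> homog dg n (a + b)"
  unfolding homog_def by (rule supp_addI)

lemma homog_sum: "(\<And>i. i \<in> A \<Longrightarrow> homog dg n (f i)) \<Longrightarrow> homog dg n (sum f A)"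
  unfolding homog_def by (rule supp_sumI)

lemma supp_ten: "supp (ten a b) \<subseteq> supp a \<times> supp b"
  by (auto simp: supp_iff)

text \<open>The weights of the generators are arbitrary, so that the left degree, the right degree,
  the zero weight and the number of factors \<open>\<tau>\<^sub>0\<close> are all instances.\<close>

definition wt :: "(nat \<Rightarrow> int) \<Rightarrow> (nat \<Rightarrow> int) \<Rightarrow> mono \<Rightarrow> int" where
  "wt \<alpha> \<beta> x = (\<Sum>i\<in>fset (fst x). \<alpha> i)
    + (\<Sum>j\<in>Poly_Mapping.keys (snd x). \<beta> j * int (Poly_Mapping.lookup (snd x) j))"

lemma wt_superset:
  assumes "finite A" "Poly_Mapping.keys e \<subseteq> A"
  shows "wt \<alpha> \<beta> (S, e) = (\<Sum>i\<in>fset S. \<alpha> i) + (\<Sum>j\<in>A. \<beta> j * int (Poly_Mapping.lookup e j))"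
  unfolding wt_def fst_conv snd_conv
  by (intro arg_cong2[where f = "(+)"] refl sum.mono_neutral_left) (use assms in \<open>auto simp: in_keys_iff\<close>)

lemma additive_wt: "additive_degree (wt \<alpha> \<beta>)"
  unfolding additive_degree_def
proof (intro conjI allI impI)
  show "wt \<alpha> \<beta> bone = 0" by (simp add: wt_def bone_mono)
  fix x y :: mono
  obtain S e T f where [simp]: "x = (S, e)" "y = (T, f)" by (cases x; cases y)
  assume "bsg x y \<noteq> 0"
  then have d: "fset S \<inter> fset T = {}" by (auto simp: bsg_mono split: if_splits)
  let ?A = "Poly_Mapping.keys e \<union> Poly_Mapping.keys f"
  have k: "Poly_Mapping.keys (e + f) \<subseteq> ?A" by (rule keys_add)
  show "wt \<alpha> \<beta> (bpl x y) = wt \<alpha> \<beta> x + wt \<alpha> \<beta> y"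
    by (simp add: bpl_mono wt_superset[OF _ k] wt_superset[of ?A e] wt_superset[of ?A f]
        sum.union_disjoint[OF _ _ d] lookup_add sum.distrib algebra_simps)
qed

lemma homog_oprod:
  assumes "additive_degree dg" "\<And>i. homog dg (\<alpha> i) (f i)" "finite S"
  shows "homog dg (\<Sum>i\<in>S. \<alpha> i) (oprod f S)"
  using assms(3)
proof (induction S rule: finite_linorder_min_induct)
  case (insert m S)
  then show ?case using homog_mult[OF assms(1) assms(2)[of m] insert.IH]
    by (subst oprod_insert_min) (auto simp: sum.insert_if)
qed (simp add: homog_one assms)

lemma homog_prod_list:
  assumes "additive_degree dg" "\<And>j. j \<in> set xs \<Longrightarrow> homog dg (\<beta> j) (f j)"
  shows "homog dg (sum_list (map \<beta> xs)) (prod_list (map f xs))"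
  using assms(2) by (induction xs) (auto simp: homog_one homog_mult assms(1))

lemma homog_ghom:
  assumes "additive_degree dg" "\<And>i. homog dg (\<alpha> i) (f i)" "\<And>j. homog dg (\<beta> j) (v j)"
  shows "homog dg (wt \<alpha> \<beta> x) (ghom f v (bs x))"
proof -
  obtain S e where [simp]: "x = (S, e)" by (cases x)
  have "homog dg (sum_list (map (\<lambda>j. \<beta> j * int (Poly_Mapping.lookup e j))
      (sorted_list_of_set (Poly_Mapping.keys e)))) (eprod v e)"
    unfolding eprod_def by (rule homog_prod_list) (auto intro: assms homog_power)
  then have "homog dg (\<Sum>j\<in>Poly_Mapping.keys e. \<beta> j * int (Poly_Mapping.lookup e j)) (eprod v e)"
    by (simp add: sum_list_distinct_conv_sum_set)
  then show ?thesis
    using homog_mult[OF assms(1) homog_oprod[of dg \<alpha> f "fset S", OF assms(1,2)]]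
    by (simp add: ghom_bs wt_def)
qed

text \<open>The left and right degrees of a monomial: \<open>\<tau>\<^sub>i\<close> has bidegree \<open>(2p\<^sup>i, 1)\<close>, \<open>\<xi>\<^sub>j\<close> has
  bidegree \<open>(2p\<^sup>j, 2)\<close> and \<open>u\<close>, which is the variable with index \<open>0\<close>, has bidegree \<open>(1, 1)\<close>.\<close>

definition ldeg :: "nat \<Rightarrow> mono \<Rightarrow> int" where
  "ldeg p = wt (\<lambda>i. 2 * int p ^ i) (\<lambda>j. if j = 0 then 1 else 2 * int p ^ j)"

definition rdeg :: "mono \<Rightarrow> int" where
  "rdeg = wt (\<lambda>i. 1) (\<lambda>j. if j = 0 then 1 else 2)"

lemma homog_gens:
  "homog (wt \<alpha> \<beta>) (\<alpha> i) (taug i)" "homog (wt \<alpha> \<beta>) (\<beta> j) (pgen j)"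
  unfolding taug_def pgen_def
  by (rule homog_mon, simp add: wt_def; fail)+

lemma homog_xig: "homog (ldeg p) (2 * int p ^ j) (xig j)" "homog rdeg 2 (xig j)"
  using homog_power[OF additive_wt homog_gens(2), of "\<lambda>i. 2 * int p ^ i" "\<lambda>j. if j = 0 then 1 else 2 * int p ^ j" 0 2]
    homog_power[OF additive_wt homog_gens(2), of "\<lambda>i. 1" "\<lambda>j. if j = 0 then 1 else 2" 0 2]
    homog_gens(2)[of "\<lambda>i. 2 * int p ^ i" "\<lambda>j. if j = 0 then 1 else 2 * int p ^ j" j]
    homog_gens(2)[of "\<lambda>i. 1" "\<lambda>j. if j = 0 then 1 else 2" j]
  by (auto simp: xig_def ldeg_def rdeg_def)

lemma homog_xig_power:
  "homog (ldeg p) (2 * int p ^ (j + s)) (xig j ^ (p ^ s))" "homog rdeg (2 * int p ^ s) (xig j ^ (p ^ s))"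
  using homog_power[OF additive_wt, of _ _ "2 * int p ^ j" "xig j" "p ^ s"] homog_xig(1)[of p j]
    homog_power[OF additive_wt, of _ _ 2 "xig j" "p ^ s"] homog_xig(2)[of j]
  by (auto simp: ldeg_def rdeg_def power_add mult.assoc)

lemma homog_taug: "homog (ldeg p) (2 * int p ^ i) (taug i)" "homog rdeg 1 (taug i)"
  using homog_gens(1)[of "\<lambda>i. 2 * int p ^ i" _ i] homog_gens(1)[of "\<lambda>i. 1" _ i]
  by (auto simp: ldeg_def rdeg_def)

lemma homog_u: "homog (ldeg p) 1 (pgen 0)" "homog rdeg 1 (pgen 0)"
  using homog_gens(2)[of _ "\<lambda>j. if j = 0 then 1 else 2 * int p ^ j" 0]
    homog_gens(2)[of _ "\<lambda>j. if j = 0 then 1 else 2" 0]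
  by (auto simp: ldeg_def rdeg_def)

lemma homog_ten:
  "homog dg n a \<Longrightarrow> homog (\<lambda>x. dg (fst x)) n (ten a b)"
  "homog dg n b \<Longrightarrow> homog (\<lambda>x. dg (snd x)) n (ten a b)"
  "homog dg m a \<Longrightarrow> homog dg' m b \<Longrightarrow> homog (\<lambda>x. dg (fst x) - dg' (snd x)) 0 (ten a b)"
  unfolding homog_def using supp_ten[of a b] by fastforce+

lemma additive_prod:
  assumes "additive_degree dg" "additive_degree dg'"
  shows "additive_degree (\<lambda>x. dg (fst x))" "additive_degree (\<lambda>x. dg' (snd x))"
    "additive_degree (\<lambda>x. dg (fst x) - dg' (snd x))"
  using assms by (auto simp: additive_degree_def bone_prod_def bpl_prod_def bsg_prod_def)

lemma additive_deg: "additive_degree (ldeg p)" "additive_degree rdeg"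
  by (simp_all add: ldeg_def rdeg_def additive_wt)

lemma wt_zero: "wt (\<lambda>i. 0) (\<lambda>j. 0) x = 0" by (simp add: wt_def)

text \<open>Three degrees on the tensor square are additive, so each can be checked on the
  generators: the left degree of the first factor, the right degree of the second, and the
  difference of the two inner degrees, which is 0 on the coproduct of every generator.\<close>

lemma supp_cop:
  "supp (cop (bs d) :: (_, 'p::prime_card mod_ring) salg)
    \<subseteq> {(b, c). ldeg CARD('p) b = ldeg CARD('p) d \<and> rdeg c = rdeg d \<and> rdeg b = ldeg CARD('p) c}"
proof -
  let ?p = "CARD('p)"
  note add = additive_prod[OF additive_deg(1) additive_deg(2)] additive_prod[OF additive_deg(2) additive_deg(1)]
  have e: "2 * int ?p ^ i = 2 * int ?p ^ (i - s + s)" if "s \<le> i" for i s using that by simp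
  have "homog (\<lambda>x. ldeg ?p (fst x)) (wt (\<lambda>i. 2 * int ?p ^ i) (\<lambda>j. if j = 0 then 1 else 2 * int ?p ^ j) d)
      (cop (bs d) :: (_, 'p mod_ring) salg)"
    unfolding cop_def
  proof (rule homog_ghom)
    show "homog (\<lambda>x. ldeg ?p (fst x)) (2 * int ?p ^ i) (Dtau i :: (_, 'p mod_ring) salg)" for i
      unfolding Dtau_def
      by (intro homog_add homog_sum homog_ten(1) homog_taug) (subst e, auto intro: homog_xig_power)
    show "homog (\<lambda>x. ldeg ?p (fst x)) (if j = 0 then 1 else 2 * int ?p ^ j) (Dpol j :: (_, 'p mod_ring) salg)" for j
    proof (cases "j = 0")
      case False
      then show ?thesis unfolding Dpol_def Dxi_def
        by (simp, intro homog_sum homog_ten(1)) (subst e, auto intro: homog_xig_power)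
    qed (auto simp: Dpol_def intro: homog_ten homog_u)
  qed (rule add)
  moreover have "homog (\<lambda>x. rdeg (snd x)) (wt (\<lambda>i. 1) (\<lambda>j. if j = 0 then 1 else 2) d)
      (cop (bs d) :: (_, 'p mod_ring) salg)"
    unfolding cop_def
  proof (rule homog_ghom)
    show "homog (\<lambda>x. rdeg (snd x)) 1 (Dtau i :: (_, 'p mod_ring) salg)" for i
      unfolding Dtau_def by (intro homog_add homog_sum homog_ten(2) homog_taug homog_u)
    show "homog (\<lambda>x. rdeg (snd x)) (if j = 0 then 1 else 2) (Dpol j :: (_, 'p mod_ring) salg)" for j
      by (auto simp: Dpol_def Dxi_def intro!: homog_sum homog_ten(2) homog_xig homog_u)
  qed (rule add)
  moreover have "homog (\<lambda>x. rdeg (fst x) - ldeg ?p (snd x)) (wt (\<lambda>i. 0) (\<lambda>j. 0) d)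
      (cop (bs d) :: (_, 'p mod_ring) salg)"
    unfolding cop_def
  proof (rule homog_ghom)
    show "homog (\<lambda>x. rdeg (fst x) - ldeg ?p (snd x)) 0 (Dtau i :: (_, 'p mod_ring) salg)" for i
      unfolding Dtau_def
      by (intro homog_add homog_sum homog_ten(3)[OF homog_xig_power(2) homog_taug(1)]
          homog_ten(3)[OF homog_taug(2) homog_u(1)])
    show "homog (\<lambda>x. rdeg (fst x) - ldeg ?p (snd x)) 0 (Dpol j :: (_, 'p mod_ring) salg)" for j
      by (auto simp: Dpol_def Dxi_def intro!: homog_sum homog_ten(3)[OF homog_xig_power(2) homog_xig(1)]
          homog_ten(3)[OF homog_u(2) homog_u(1)])
  qed (rule add)
  ultimately show ?thesis unfolding homog_def wt_zero ldeg_def[symmetric] rdeg_def[symmetric]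
    by fastforce
qed

section \<open>The convolution algebra of functionals\<close>

definition conv :: "(mono \<Rightarrow> 'p::prime_card mod_ring) \<Rightarrow> (mono \<Rightarrow> 'p mod_ring) \<Rightarrow> mono \<Rightarrow> 'p mod_ring" where
  "conv \<phi> \<psi> d = evl (\<lambda>(b, c). \<phi> b * \<psi> c) (cop (bs d))"

lemma evl_slinear: "slinear f \<Longrightarrow> evl \<phi> (f a) = evl (\<lambda>x. evl \<phi> (f (bs x))) a"
proof (induction a rule: salg_induct)
  case (mon x c)
  show ?case by (subst slinearD(4)[OF mon]) (simp add: evl_sc)
next
  case (add a b)
  then show ?case by (simp add: slinearD(1) evl_add)
qed

lemma evl_add_fun: "evl (\<lambda>x. \<phi> x + \<psi> x) a = evl \<phi> a + evl \<psi> a"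
  by (simp add: evl_superset[OF finite_supp order_refl] distrib_left sum.distrib)

lemma evl_cmult_fun: "evl (\<lambda>x. c * \<phi> x) a = c * evl \<phi> a"
  by (simp add: evl_superset[OF finite_supp order_refl] sum_distrib_left mult_ac)

lemma conv_add_left: "conv (\<lambda>x. \<phi> x + \<phi>' x) \<psi> d = conv \<phi> \<psi> d + conv \<phi>' \<psi> d"
  unfolding conv_def evl_add_fun[symmetric] by (simp add: case_prod_unfold distrib_right)

lemma conv_add_right: "conv \<phi> (\<lambda>x. \<psi> x + \<psi>' x) d = conv \<phi> \<psi> d + conv \<phi> \<psi>' d"
  unfolding conv_def evl_add_fun[symmetric] by (simp add: case_prod_unfold distrib_left)

lemma conv_cmult_left: "conv (\<lambda>x. r * \<phi> x) \<psi> d = r * conv \<phi> \<psi> d"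
  unfolding conv_def evl_cmult_fun[symmetric] by (simp add: case_prod_unfold mult.assoc)

lemma conv_cmult_right: "conv \<phi> (\<lambda>x. r * \<psi> x) d = r * conv \<phi> \<psi> d"
  unfolding conv_def evl_cmult_fun[symmetric] by (simp add: case_prod_unfold mult.left_commute)

lemma conv_nonzero:
  assumes "conv \<phi> \<psi> d \<noteq> (0 :: 'p::prime_card mod_ring)"
  obtains b c where "ldeg CARD('p) b = ldeg CARD('p) d" "rdeg c = rdeg d" "rdeg b = ldeg CARD('p) c"
    "\<phi> b \<noteq> 0" "\<psi> c \<noteq> 0"
proof -
  have "\<exists>(b, c)\<in>supp (cop (bs d) :: (_, 'p mod_ring) salg). \<phi> b * \<psi> c \<noteq> 0"
    using assms unfolding conv_def evl_superset[OF finite_supp order_refl]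
    by (elim sum.not_neutral_contains_not_neutral) force
  then obtain b c where "(b, c) \<in> supp (cop (bs d) :: (_, 'p mod_ring) salg)" "\<phi> b * \<psi> c \<noteq> 0" by auto
  then show thesis using supp_cop[of d, where 'p = 'p] by (intro that[of b c]) auto
qed

lemma conv_cong:
  assumes "\<And>b c. ldeg CARD('p) b = ldeg CARD('p) d \<Longrightarrow> rdeg c = rdeg d \<Longrightarrow> rdeg b = ldeg CARD('p) c \<Longrightarrow>
    \<phi> b * \<psi> c = \<phi>' b * \<psi>' c"
  shows "conv \<phi> \<psi> d = (conv \<phi>' \<psi>' d :: 'p::prime_card mod_ring)"
  unfolding conv_def by (rule evl_cong) (use supp_cop[of d, where 'p = 'p] assms in auto)

section \<open>Contraction of a tensor factor by functionals and characters\<close>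

definition contrL :: "('b::sbasis \<Rightarrow> 'k::field) \<Rightarrow> ('b \<times> 'c::sbasis, 'k) salg \<Rightarrow> ('c, 'k) salg" where
  "contrL \<phi> = slin (\<lambda>(b, c). sc (\<phi> b) (bs c))"

definition contrR :: "('c::sbasis \<Rightarrow> 'k::field) \<Rightarrow> ('b::sbasis \<times> 'c, 'k) salg \<Rightarrow> ('b, 'k) salg" where
  "contrR \<psi> = slin (\<lambda>(b, c). sc (\<psi> c) (bs b))"

lemma slinear_contr [simp]: "slinear (contrL \<phi>)" "slinear (contrR \<phi>)"
  by (simp_all add: contrL_def contrR_def)

lemma contr_mon [simp]:
  "contrL \<phi> (mon (b, c) r) = sc (r * \<phi> b) (bs c)" "contrR \<psi> (mon (b, c) r) = sc (r * \<psi> c) (bs b)"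
  by (simp_all add: contrL_def contrR_def)

lemma mon_add: "mon x (c + d) = (mon x c + mon x d :: ('b::sbasis, 'k::field) salg)"
  by (rule salg_eqI) (simp add: coef_mon)

lemma contrL_ten: "contrL \<phi> (ten a b) = sc (evl \<phi> a) b"
proof (induction a rule: salg_induct)
  case (mon x r)
  show ?case by (induction b rule: salg_induct) (simp_all add: ten_simps slinearD(1)[OF slinear_contr(1)] mult_ac)
qed (simp add: ten_simps slinearD(1)[OF slinear_contr(1)] evl_add sc_add_left)

lemma contrR_ten: "contrR \<phi> (ten a b) = sc (evl \<phi> b) a"
proof (induction a rule: salg_induct)
  case (mon x r)
  show ?case
    by (induction b rule: salg_induct)
      (simp_all add: ten_simps slinearD(1)[OF slinear_contr(2)] evl_add mon_add algebra_simps)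
qed (simp add: ten_simps slinearD(1)[OF slinear_contr(2)])

lemma evl_contrL: "evl (\<lambda>(b, c). \<phi> b * \<psi> c) a = evl \<psi> (contrL \<phi> a)"
  by (subst evl_slinear[OF slinear_contr(1)]) (rule evl_cong, auto simp: evl_sc)

lemma evl_contrR: "evl (\<lambda>(b, c). \<phi> b * \<psi> c) a = evl \<phi> (contrR \<psi> a)"
  by (subst evl_slinear[OF slinear_contr(2)]) (rule evl_cong, auto simp: evl_sc mult.commute)

text \<open>An algebra homomorphism to the ground field. Vanishing on odd monomials removes the
  Koszul sign when a tensor factor is contracted.\<close>

definition character :: "('b::sbasis \<Rightarrow> 'k::field) \<Rightarrow> bool" where
  "character \<chi> \<longleftrightarrow> \<chi> bone = 1 \<and> (\<forall>x y. \<chi> x * \<chi> y = of_int (bsg x y) * \<chi> (bpl x y))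
    \<and> (\<forall>x. \<chi> x \<noteq> 0 \<longrightarrow> even (bpar x))"

lemma character_sign: "character \<chi> \<Longrightarrow> (- 1) ^ (n * bpar x) * \<chi> x = \<chi> x"
  by (cases "\<chi> x = 0") (auto simp: character_def)

lemma alghom_contrL:
  assumes "character (\<chi> :: 'b::sbasis \<Rightarrow> 'k::field)"
  shows "alghom (contrL \<chi> :: ('b \<times> 'c::sbasis, 'k) salg \<Rightarrow> _)"
proof (rule alghomI)
  show "contrL \<chi> (bs bone) = 1" using assms by (simp add: bone_prod_def one_salg_eq character_def)
  fix x y :: "'b \<times> 'c"
  obtain b c b' c' where [simp]: "x = (b, c)" "y = (b', c')" by (cases x; cases y)
  have c: "\<chi> b * \<chi> b' = of_int (bsg b b') * \<chi> (bpl b b')" using assms by (auto simp: character_def)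
  have "of_int (bsg x y) * \<chi> (bpl b b')
      = (- 1) ^ (bpar c * bpar b') * (of_int (bsg b b') * \<chi> (bpl b b')) * of_int (bsg c c')"
    by (simp add: bsg_prod_def mult_ac)
  also have "\<dots> = \<chi> b * \<chi> b' * of_int (bsg c c')"
    using character_sign[OF assms, of "bpar c" b'] unfolding c[symmetric] by (auto simp: mult_ac)
  finally show "contrL \<chi> (bs x) * contrL \<chi> (bs y) = sc (of_int (bsg x y)) (contrL \<chi> (bs (bpl x y)))"
    by (simp add: mon_mult bpl_prod_def)
qed simp

lemma alghom_contrR:
  assumes "character (\<chi> :: 'c::sbasis \<Rightarrow> 'k::field)"
  shows "alghom (contrR \<chi> :: ('b::sbasis \<times> 'c, 'k) salg \<Rightarrow> _)"
proof (rule alghomI)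
  show "contrR \<chi> (bs bone) = 1" using assms by (simp add: bone_prod_def one_salg_eq character_def)
  fix x y :: "'b \<times> 'c"
  obtain b c b' c' where [simp]: "x = (b, c)" "y = (b', c')" by (cases x; cases y)
  have c: "\<chi> c * \<chi> c' = of_int (bsg c c') * \<chi> (bpl c c')" using assms by (auto simp: character_def)
  have "of_int (bsg x y) * \<chi> (bpl c c')
      = (- 1) ^ (bpar b' * bpar c) * (of_int (bsg c c') * \<chi> (bpl c c')) * of_int (bsg b b')"
    by (simp add: bsg_prod_def mult_ac)
  also have "\<dots> = \<chi> c * \<chi> c' * of_int (bsg b b')"
    using character_sign[OF assms, of "bpar b'" c] unfolding c[symmetric] by (auto simp: mult_ac)
  finally show "contrR \<chi> (bs x) * contrR \<chi> (bs y) = sc (of_int (bsg x y)) (contrR \<chi> (bs (bpl x y)))"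
    by (simp add: mon_mult bpl_prod_def)
qed simp

text \<open>The algebra homomorphism to the ground field that sends the variables in \<open>J\<close> to \<open>1\<close> and all other
  generators to \<open>0\<close>.\<close>

definition ch :: "nat set \<Rightarrow> mono \<Rightarrow> 'k::field" where
  "ch J x = (if fst x = {||} \<and> Poly_Mapping.keys (snd x) \<subseteq> J then 1 else 0)"

lemma keys_add_nat: "Poly_Mapping.keys (e + f) = Poly_Mapping.keys e \<union> Poly_Mapping.keys f"
  for e f :: "'i \<Rightarrow>\<^sub>0 nat"
  by (auto simp: in_keys_iff lookup_add)

lemma character_ch: "character (ch J :: mono \<Rightarrow> 'k::field)"
  unfolding character_def
proof (intro conjI allI impI)
  show "ch J bone = (1 :: 'k)" by (simp add: ch_def bone_mono)
  show "ch J x * ch J y = of_int (bsg x y) * (ch J (bpl x y) :: 'k)" for x y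
    by (cases x; cases y) (auto simp: ch_def bpl_mono bsg_mono keys_add_nat inversions_def)
  show "even (bpar x)" if "ch J x \<noteq> (0 :: 'k)" for x
    using that by (cases x) (auto simp: ch_def bpar_mono split: if_splits)
qed

lemma evl_character:
  assumes "character \<chi>"
  shows "evl \<chi> (a * b) = evl \<chi> a * evl \<chi> b" "evl \<chi> 1 = 1" "evl \<chi> (a ^ n) = evl \<chi> a ^ n"
proof -
  show m: "evl \<chi> (a * b) = evl \<chi> a * evl \<chi> b" for a b
  proof (induction a rule: salg_induct)
    case (mon x r)
    show ?case
    proof (induction b rule: salg_induct)
      case (mon y s)
      have "\<chi> x * \<chi> y = of_int (bsg x y) * \<chi> (bpl x y)" using assms by (simp add: character_def)
      then show ?case by (simp add: mon_mult mult_ac)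
    qed (simp add: distrib_left evl_add)
  qed (simp add: distrib_right evl_add)
  show o: "evl \<chi> 1 = 1" using assms by (simp add: one_salg_eq character_def)
  show "evl \<chi> (a ^ n) = evl \<chi> a ^ n" by (induction n) (auto simp: m o)
qed

lemma evl_ch_gens:
  "evl (ch J) (taug i) = 0" "evl (ch J) (pgen j) = (if j \<in> J then 1 else 0)"
  "evl (ch J) (xig j) = (if j \<in> J then 1 else 0)"
  by (auto simp: taug_def pgen_def xig_def ch_def evl_character[OF character_ch])

lemma evl_ch_xig_power: "n > 0 \<Longrightarrow> evl (ch J) (xig j ^ n) = (if j \<in> J then 1 else 0)"
  by (simp add: evl_character(3)[OF character_ch] evl_ch_gens)

lemma counit_mono_eq: "counit_mono = ch {0}"
  by (auto simp: fun_eq_iff ch_def)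

context odd_prime
begin

lemma card_power_pos: "CARD('p) ^ s > 0"
  by (simp add: prime_gt_0_nat prime_card)

lemma contrL_Dtau: "contrL (ch J) (Dtau i :: (_, 'p mod_ring) salg)
    = (\<Sum>s\<le>i. if i - s \<in> J then taug s else 0)"
  unfolding Dtau_def
  by (simp add: slinearD[OF slinear_contr(1)] contrL_ten evl_ch_gens evl_ch_xig_power card_power_pos
      if_distrib[of "\<lambda>c. sc c _"] cong: if_cong)

lemma contrL_Dxi: "contrL (ch J) (Dxi j :: (_, 'p mod_ring) salg)
    = (\<Sum>s\<le>j. if j - s \<in> J then xig s else 0)"
  unfolding Dxi_def
  by (simp add: slinearD[OF slinear_contr(1)] contrL_ten evl_ch_gens evl_ch_xig_power card_power_pos
      if_distrib[of "\<lambda>c. sc c _"] cong: if_cong)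

text \<open>Contraction by a character is an algebra homomorphism, so the counit law can be checked
  on the generators.\<close>

lemma contrL_counit_cop: "contrL (ch {0}) (cop a) = (a :: (mono, 'p mod_ring) salg)"
proof (rule alghom_eqI[of "\<lambda>a. contrL (ch {0}) (cop a)" "\<lambda>a. a"])
  show "alghom (\<lambda>a :: (mono, 'p mod_ring) salg. contrL (ch {0}) (cop a))"
    by (rule alghom_comp[OF alghom_contrL[OF character_ch] alghom_cop])
  have e: "(\<Sum>s\<le>i. if i - s \<in> {0} then f s else 0) = f i" for i and f :: "nat \<Rightarrow> (mono, 'p mod_ring) salg"
    by (subst sum.cong[OF refl, where h = "\<lambda>s. if s = i then f s else 0"]) auto
  show "contrL (ch {0}) (cop (taug i)) = (taug i :: (mono, 'p mod_ring) salg)" for i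
    by (simp only: cop_taug contrL_Dtau e)
  show "contrL (ch {0}) (cop (pgen j)) = (pgen j :: (mono, 'p mod_ring) salg)" for j
  proof (cases "j = 0")
    case True
    then show ?thesis by (simp add: cop_def Dpol_def contrL_ten evl_ch_gens)
  next
    case False
    then have "cop (pgen j) = (Dxi j :: (_, 'p mod_ring) salg)" by (simp add: cop_def Dpol_def)
    then show ?thesis using False by (simp only: contrL_Dxi e) (simp add: xig_def)
  qed
qed simp

lemma contrR_counit_cop: "contrR (ch {0}) (cop a) = (a :: (mono, 'p mod_ring) salg)"
proof (rule alghom_eqI[of "\<lambda>a. contrR (ch {0}) (cop a)" "\<lambda>a. a"])
  show "alghom (\<lambda>a :: (mono, 'p mod_ring) salg. contrR (ch {0}) (cop a))"
    by (rule alghom_comp[OF alghom_contrR[OF character_ch] alghom_cop])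
  show "contrR (ch {0}) (cop (taug i)) = (taug i :: (mono, 'p mod_ring) salg)" for i
    by (simp add: cop_taug Dtau_def slinearD(1,5)[OF slinear_contr(2)] contrR_ten evl_ch_gens)
  show "contrR (ch {0}) (cop (pgen j)) = (pgen j :: (mono, 'p mod_ring) salg)" for j
  proof (cases "j = 0")
    case True
    then show ?thesis by (simp add: cop_def Dpol_def contrR_ten evl_ch_gens)
  next
    case False
    have "contrR (ch {0}) (Dxi j) = (\<Sum>s\<le>j. if s = 0 then xig j else (0 :: (mono, 'p mod_ring) salg))"
      unfolding Dxi_def slinearD(5)[OF slinear_contr(2)] contrR_ten
      by (rule sum.cong) (auto simp: evl_ch_gens)
    moreover have "cop (pgen j) = (Dxi j :: (_, 'p mod_ring) salg)" using False by (simp add: cop_def Dpol_def)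
    ultimately show ?thesis using False by (simp add: xig_def)
  qed
qed simp

lemma conv_counit_left: "conv (ch {0}) \<phi> = (\<phi> :: mono \<Rightarrow> 'p mod_ring)"
  by (rule ext) (simp add: conv_def evl_contrL contrL_counit_cop)

lemma conv_counit_right: "conv \<phi> (ch {0}) = (\<phi> :: mono \<Rightarrow> 'p mod_ring)"
  by (rule ext) (simp add: conv_def evl_contrR contrR_counit_cop)

lemma evl_cop_left:
  "evl (\<lambda>(x, y, z). \<phi> x * (\<psi> y * \<chi> z)) (cop_left a) = evl (\<lambda>(x, z). conv \<phi> \<psi> x * \<chi> z) a"
proof -
  have "evl (\<lambda>(x, y, z). \<phi> x * (\<psi> y * \<chi> z)) (cop_left (bs (b, c))) = conv \<phi> \<psi> b * \<chi> c" for b c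
  proof -
    have "evl (\<lambda>(x, y, z). \<phi> x * (\<psi> y * \<chi> z)) (asc t)
        = evl (\<lambda>(xy, z). (\<lambda>(x, y). \<phi> x * \<psi> y) xy * \<chi> z) t" for t
      by (subst evl_slinear[OF slinear_asc]) (rule evl_cong, auto simp: asc_def mult.assoc)
    moreover have "cop_left (bs (b, c)) = asc (ten (cop (bs b)) (bs c))"
      using cop_left_ten[of "bs b" "bs c"] by simp
    ultimately show ?thesis by (simp only: evl_ten) (simp add: conv_def)
  qed
  then show ?thesis
    by (subst evl_slinear[OF alghomD(1)[OF alghom_cop_left]]) (rule evl_cong, auto)
qed

lemma evl_cop_right:
  "evl (\<lambda>(x, y, z). \<phi> x * (\<psi> y * \<chi> z)) (cop_right a) = evl (\<lambda>(x, z). \<phi> x * conv \<psi> \<chi> z) a"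
proof -
  have "evl (\<lambda>(x, y, z). \<phi> x * (\<psi> y * \<chi> z)) (cop_right (bs (b, c))) = \<phi> b * conv \<psi> \<chi> c" for b c
  proof -
    have "evl (\<lambda>(x, y, z). \<phi> x * (\<psi> y * \<chi> z)) (ten (bs b) (cop (bs c)))
        = evl \<phi> (bs b) * evl (\<lambda>(y, z). \<psi> y * \<chi> z) (cop (bs c))"
      unfolding evl_ten[symmetric] by (simp add: case_prod_unfold)
    moreover have "cop_right (bs (b, c)) = ten (bs b) (cop (bs c))"
      using cop_right_ten[of "bs b" "bs c"] by simp
    ultimately show ?thesis by (simp add: conv_def)
  qed
  then show ?thesis
    by (subst evl_slinear[OF alghomD(1)[OF alghom_cop_right]]) (rule evl_cong, auto)
qed

text \<open>Both sides evaluate the same functional on the threefold tensor product, at the two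
  iterated coproducts.\<close>

lemma conv_assoc: "conv (conv \<phi> \<psi>) \<chi> = conv \<phi> (conv \<psi> (\<chi> :: mono \<Rightarrow> 'p mod_ring))"
proof
  fix d
  have "conv (conv \<phi> \<psi>) \<chi> d = evl (\<lambda>(x, y, z). \<phi> x * (\<psi> y * \<chi> z)) (cop_left (cop (bs d)))"
    by (simp add: conv_def evl_cop_left)
  also have "\<dots> = conv \<phi> (conv \<psi> \<chi>) d"
    unfolding coassociative evl_cop_right by (simp add: conv_def)
  finally show "conv (conv \<phi> \<psi>) \<chi> d = conv \<phi> (conv \<psi> \<chi>) d" .
qed

end

section \<open>The functionals of the generators, multiplication by \<open>u\<close>, and the shift
  of indices\<close>

definition phiP :: "nat \<Rightarrow> mono \<Rightarrow> 'k::field" where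
  "phiP i x = (if fst x = {||} \<and> Poly_Mapping.keys (snd x) \<subseteq> {0, 1} \<and> Poly_Mapping.lookup (snd x) 1 = i
    then 1 else 0)"

definition phiB :: "mono \<Rightarrow> 'k::field" where
  "phiB x = (if fst x = {|0|} \<and> Poly_Mapping.keys (snd x) \<subseteq> {0} then 1 else 0)"

definition umon :: mono where "umon = ({||}, Poly_Mapping.single 0 1)"

definition addu :: "mono \<Rightarrow> mono" where "addu x = (fst x, snd x + Poly_Mapping.single 0 1)"

lemma umon_simps: "bpl umon x = addu x" "bsg umon x = 1" "bpar umon = 0"
  by (cases x; simp add: umon_def addu_def bpl_mono bsg_mono bpar_mono inversions_def add.commute)+

lemma bs_umon: "pgen 0 = bs umon"
  by (simp add: pgen_def umon_def)

lemma bs_addu: "bs (addu x) = pgen 0 * bs x"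
  by (simp add: bs_umon mon_mult umon_simps)

lemma rdeg_addu: "rdeg (addu x) = rdeg x + 1"
  and ldeg_addu: "ldeg p (addu x) = ldeg p x + 1"
proof -
  have "wt \<alpha> \<beta> (addu x) = wt \<alpha> \<beta> x + \<beta> 0" for \<alpha> \<beta>
  proof -
    have "wt \<alpha> \<beta> (bpl umon x) = wt \<alpha> \<beta> umon + wt \<alpha> \<beta> x"
      using additive_wt[of \<alpha> \<beta>] umon_simps(2)[of x] unfolding additive_degree_def by (metis zero_neq_one)
    then show ?thesis unfolding umon_simps(1) by (simp add: wt_def umon_def)
  qed
  then show "rdeg (addu x) = rdeg x + 1" "ldeg p (addu x) = ldeg p x + 1"
    by (simp_all add: rdeg_def ldeg_def)
qed

lemma evl_u_mult:
  "evl (\<lambda>(b, c). \<phi> b * \<psi> c) (ten (pgen 0) (pgen 0) * a) = evl (\<lambda>(b, c). \<phi> (addu b) * \<psi> (addu c)) a"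
proof (induction a rule: salg_induct)
  case (mon x r)
  show ?case
    by (cases x) (simp add: bs_umon mon_mult bpl_prod_def[of "(umon, _)"] bsg_prod_def[of "(umon, _)"] umon_simps)
qed (simp add: distrib_left evl_add)

lemma phi_addu [simp]: "phiP i (addu x) = phiP i x" "phiB (addu x) = phiB x" "ch {0} (addu x) = ch {0} x"
  by (auto simp: phiP_def phiB_def ch_def addu_def keys_add_nat lookup_add lookup_single)

lemma lookup_pred_addu: "Poly_Mapping.lookup e 0 \<noteq> 0 \<Longrightarrow> \<exists>x. (S, e) = addu x"
  by (rule exI[of _ "(S, e - Poly_Mapping.single 0 1)"])
    (auto simp: addu_def poly_mapping_eq_iff fun_eq_iff lookup_add lookup_minus lookup_single when_def)

text \<open>The exponents after raising every index by one, where \<open>u\<^sup>2\<close> counts as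
  \<open>\<xi>\<^sub>0\<close> and an odd power of \<open>u\<close> is rounded down.\<close>

definition she :: "(nat \<Rightarrow>\<^sub>0 nat) \<Rightarrow> (nat \<Rightarrow>\<^sub>0 nat)" where
  "she f = Abs_poly_mapping (\<lambda>j. case j of 0 \<Rightarrow> 0
    | Suc k \<Rightarrow> if k = 0 then Poly_Mapping.lookup f 0 div 2 else Poly_Mapping.lookup f k)"

lemma lookup_she: "Poly_Mapping.lookup (she f) j = (case j of 0 \<Rightarrow> 0
    | Suc k \<Rightarrow> if k = 0 then Poly_Mapping.lookup f 0 div 2 else Poly_Mapping.lookup f k)"
proof -
  have "finite {j. (case j of 0 \<Rightarrow> 0
    | Suc k \<Rightarrow> if k = 0 then Poly_Mapping.lookup f 0 div 2 else Poly_Mapping.lookup f k) \<noteq> 0}"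
  proof (rule finite_subset)
    show "{j. (case j of 0 \<Rightarrow> 0
      | Suc k \<Rightarrow> if k = 0 then Poly_Mapping.lookup f 0 div 2 else Poly_Mapping.lookup f k) \<noteq> 0}
        \<subseteq> Suc ` insert 0 (Poly_Mapping.keys f)"
    proof
      fix j assume "j \<in> {j. (case j of 0 \<Rightarrow> 0
        | Suc k \<Rightarrow> if k = 0 then Poly_Mapping.lookup f 0 div 2 else Poly_Mapping.lookup f k) \<noteq> 0}"
      then show "j \<in> Suc ` insert 0 (Poly_Mapping.keys f)"
        by (cases j) (auto simp: in_keys_iff split: if_splits)
    qed
  qed simp
  then show ?thesis by (simp add: she_def)
qed

lemma keys_she: "Poly_Mapping.keys (she f) \<subseteq> Suc ` insert 0 (Poly_Mapping.keys f)"
proof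
  fix j assume "j \<in> Poly_Mapping.keys (she f)"
  then show "j \<in> Suc ` insert 0 (Poly_Mapping.keys f)"
    by (cases j) (auto simp: in_keys_iff lookup_she split: if_splits)
qed

text \<open>A right inverse of the adjoint map \<open>desc\<close> on monomials in which the
  exponent of \<open>u\<close> is even.\<close>

definition shift :: "mono \<Rightarrow> mono" where "shift c = (Suc |`| fst c, she (snd c))"

text \<open>\<open>up c\<close> is the monomial without \<open>u\<close> that pairs with the operation of top degree
  (\<open>P\<^sup>k\<close> on classes of degree \<open>2k\<close>, \<open>\<beta> P\<^sup>k\<close> on classes of degree \<open>2k + 1\<close>) applied to \<open>c\<close>.\<close>

definition up :: "mono \<Rightarrow> mono" where
  "up c = ((if odd (Poly_Mapping.lookup (snd c) 0) then finsert 0 (fst (shift c)) else fst (shift c)), snd (shift c))"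

text \<open>A monomial divisible by \<open>u\<close> comes from a smaller right degree, and one
  without \<open>u\<close> from lowering its indices. This dichotomy drives the induction on the
  right degree.\<close>

lemma addu_or_up: "(\<exists>c. b = addu c) \<or> (\<exists>c. b = up c)"
proof -
  obtain S e where b: "b = (S, e)" by (cases b)
  show ?thesis
  proof (cases "Poly_Mapping.lookup e 0 = 0")
    case False
    then show ?thesis using lookup_pred_addu b by blast
  next
    case True
    let ?o = "if 0 |\<in>| S then 1 else 0 :: nat"
    \<comment> \<open>The factors \<open>\<xi>\<^sub>1\<^sup>a\<close> and
      \<open>\<tau>\<^sub>0\<close> come from \<open>u\<close> with exponent \<open>2 * a\<close>,
      increased by 1 if \<open>\<tau>\<^sub>0\<close> is present; all other indices drop by
      one.\<close>
    define g where "g = (\<lambda>j. if j = 0 then 2 * Poly_Mapping.lookup e 1 + ?o else Poly_Mapping.lookup e (Suc j))"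
    define f where "f = Abs_poly_mapping g"
    have "{j. g j \<noteq> 0} \<subseteq> insert 0 ((\<lambda>j. j - 1) ` Poly_Mapping.keys e)"
    proof
      fix j assume "j \<in> {j. g j \<noteq> 0}"
      then have "j = 0 \<or> Suc j \<in> Poly_Mapping.keys e" by (auto simp: g_def in_keys_iff split: if_splits)
      then show "j \<in> insert 0 ((\<lambda>j. j - 1) ` Poly_Mapping.keys e)" by (auto intro: image_eqI[of j _ "Suc j"])
    qed
    then have "finite {j. g j \<noteq> 0}" by (rule finite_subset) simp
    then have f: "Poly_Mapping.lookup f = g" by (simp add: f_def)
    have S: "Suc |`| ((\<lambda>i. i - 1) |`| (S |-| {|0|})) = S |-| {|0|}"
    proof -
      have "(\<lambda>i. Suc (i - 1)) ` (fset S - {0}) = (\<lambda>i. i) ` (fset S - {0})"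
        by (rule image_cong) auto
      then have "fset (Suc |`| ((\<lambda>i. i - 1) |`| (S |-| {|0|}))) = fset (S |-| {|0|})"
        by (simp only: fimage.rep_eq minus_fset.rep_eq image_image) simp
      then show ?thesis by (simp only: fset_inject)
    qed
    have "up ((\<lambda>i. i - 1) |`| (S |-| {|0|}), f) = b"
      unfolding up_def shift_def fst_conv snd_conv S b f
      by (auto simp: g_def poly_mapping_eq_iff fun_eq_iff lookup_she f True split: nat.splits)
    then show ?thesis by metis
  qed
qed

lemma wt_she:
  "(\<Sum>j\<in>Poly_Mapping.keys (she f). \<beta> j * int (Poly_Mapping.lookup (she f) j))
    = \<beta> 1 * int (Poly_Mapping.lookup f 0 div 2)
      + (\<Sum>j\<in>Poly_Mapping.keys f - {0}. \<beta> (Suc j) * int (Poly_Mapping.lookup f j))"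
proof -
  have "(\<Sum>j\<in>Poly_Mapping.keys (she f). \<beta> j * int (Poly_Mapping.lookup (she f) j))
      = (\<Sum>j\<in>Suc ` insert 0 (Poly_Mapping.keys f). \<beta> j * int (Poly_Mapping.lookup (she f) j))"
  proof (rule sum.mono_neutral_left)
    show "\<forall>j\<in>Suc ` insert 0 (Poly_Mapping.keys f) - Poly_Mapping.keys (she f).
        \<beta> j * int (Poly_Mapping.lookup (she f) j) = 0"
      by (simp add: in_keys_iff)
  qed (simp, rule keys_she)
  also have "\<dots> = (\<Sum>j\<in>insert 0 (Poly_Mapping.keys f). \<beta> (Suc j) * int (Poly_Mapping.lookup (she f) (Suc j)))"
    by (subst sum.reindex) auto
  also have "insert 0 (Poly_Mapping.keys f) = insert 0 (Poly_Mapping.keys f - {0})" by auto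
  also have "(\<Sum>j\<in>insert 0 (Poly_Mapping.keys f - {0}). \<beta> (Suc j) * int (Poly_Mapping.lookup (she f) (Suc j)))
      = \<beta> 1 * int (Poly_Mapping.lookup f 0 div 2)
        + (\<Sum>j\<in>Poly_Mapping.keys f - {0}. \<beta> (Suc j) * int (Poly_Mapping.lookup (she f) (Suc j)))"
    by (subst sum.insert) (auto simp: lookup_she)
  also have "(\<Sum>j\<in>Poly_Mapping.keys f - {0}. \<beta> (Suc j) * int (Poly_Mapping.lookup (she f) (Suc j)))
      = (\<Sum>j\<in>Poly_Mapping.keys f - {0}. \<beta> (Suc j) * int (Poly_Mapping.lookup f j))"
    by (rule sum.cong) (auto simp: lookup_she)
  finally show ?thesis .
qed

lemma wt_split: "wt \<alpha> \<beta> c = (\<Sum>i\<in>fset (fst c). \<alpha> i) + \<beta> 0 * int (Poly_Mapping.lookup (snd c) 0)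
    + (\<Sum>j\<in>Poly_Mapping.keys (snd c) - {0}. \<beta> j * int (Poly_Mapping.lookup (snd c) j))"
proof -
  have "wt \<alpha> \<beta> (fst c, snd c) = (\<Sum>i\<in>fset (fst c). \<alpha> i)
      + (\<Sum>j\<in>insert 0 (Poly_Mapping.keys (snd c) - {0}). \<beta> j * int (Poly_Mapping.lookup (snd c) j))"
    by (rule wt_superset) auto
  also have "(\<Sum>j\<in>insert 0 (Poly_Mapping.keys (snd c) - {0}). \<beta> j * int (Poly_Mapping.lookup (snd c) j))
      = \<beta> 0 * int (Poly_Mapping.lookup (snd c) 0)
        + (\<Sum>j\<in>Poly_Mapping.keys (snd c) - {0}. \<beta> j * int (Poly_Mapping.lookup (snd c) j))"
    by (subst sum.insert) auto
  finally show ?thesis by (simp add: add.assoc)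
qed

lemma wt_shift: "wt \<alpha> \<beta> (shift c) = (\<Sum>i\<in>fset (fst c). \<alpha> (Suc i))
    + \<beta> 1 * int (Poly_Mapping.lookup (snd c) 0 div 2)
    + (\<Sum>j\<in>Poly_Mapping.keys (snd c) - {0}. \<beta> (Suc j) * int (Poly_Mapping.lookup (snd c) j))"
  unfolding wt_def shift_def fst_conv snd_conv wt_she
  by (simp add: sum.reindex)

lemma wt_up: "wt \<alpha> \<beta> (up c) = wt \<alpha> \<beta> (shift c) + (if odd (Poly_Mapping.lookup (snd c) 0) then \<alpha> 0 else 0)"
  by (auto simp: wt_def up_def shift_def)

text \<open>\<open>u\<^sup>2\<close> and \<open>\<xi>\<^sub>1\<close> both have right degree 2, and
  a left-over \<open>u\<close> is traded for \<open>\<tau>\<^sub>0\<close>, both of right degree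
  1.\<close>

lemma rdeg_up: "rdeg (up c) = rdeg c"
proof -
  have "int (Poly_Mapping.lookup (snd c) 0) = 2 * int (Poly_Mapping.lookup (snd c) 0 div 2)
      + (if odd (Poly_Mapping.lookup (snd c) 0) then 1 else 0)" by presburger
  then show ?thesis
    unfolding rdeg_def wt_up wt_shift wt_split[of _ _ c] by (simp cong: sum.cong_simp)
qed

text \<open>Raising an index, including the passage from \<open>u\<^sup>2\<close> to
  \<open>\<xi>\<^sub>1\<close>, multiplies the left degree by p; a left-over \<open>u\<close> of
  left degree 1 becomes \<open>\<tau>\<^sub>0\<close> of left degree 2.\<close>

lemma ldeg_up:
  "ldeg p (up c) = int p * (ldeg p c - int (Poly_Mapping.lookup (snd c) 0 mod 2))
    + 2 * int (Poly_Mapping.lookup (snd c) 0 mod 2)"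
proof -
  have e: "int (Poly_Mapping.lookup (snd c) 0) = 2 * int (Poly_Mapping.lookup (snd c) 0 div 2)
      + (if odd (Poly_Mapping.lookup (snd c) 0) then 1 else 0)" by presburger
  have m: "Poly_Mapping.lookup (snd c) 0 mod 2 = (if odd (Poly_Mapping.lookup (snd c) 0) then 1 else 0)"
    by presburger
  have s: "(\<Sum>j\<in>Poly_Mapping.keys (snd c) - {0}. (if j = 0 then 1 else 2 * int p ^ j) * int (Poly_Mapping.lookup (snd c) j))
      = (\<Sum>j\<in>Poly_Mapping.keys (snd c) - {0}. 2 * int p ^ j * int (Poly_Mapping.lookup (snd c) j))"
    by (rule sum.cong) auto
  show ?thesis
    unfolding ldeg_def wt_up wt_shift wt_split[of _ _ c] s m e
    by (simp add: sum_distrib_left algebra_simps)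
qed

text \<open>\<open>u\<close> is the only generator of odd left degree. Hence the parity that
  separates the two kinds of top operation is the parity of the exponent of \<open>u\<close>, as in
  the definition of \<open>up\<close>.\<close>

lemma ldeg_mod_2: "ldeg p c mod 2 = int (Poly_Mapping.lookup (snd c) 0) mod 2"
proof -
  have s: "(\<Sum>j\<in>Poly_Mapping.keys (snd c) - {0}. (if j = 0 then 1 else 2 * int p ^ j) * int (Poly_Mapping.lookup (snd c) j))
      = 2 * (\<Sum>j\<in>Poly_Mapping.keys (snd c) - {0}. int p ^ j * int (Poly_Mapping.lookup (snd c) j))"
    unfolding sum_distrib_left by (rule sum.cong) auto
  show ?thesis unfolding ldeg_def wt_split s by (simp flip: sum_distrib_left)
qed

lemma rdeg_nonneg: "rdeg c \<ge> 0"
  by (auto simp: rdeg_def wt_def intro!: add_nonneg_nonneg sum_nonneg)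

lemma rdeg_le_ldeg:
  assumes "p > 0" shows "rdeg c \<le> ldeg p c"
proof -
  have "int p ^ i \<ge> 1" for i using assms by simp
  then have "2 * int p ^ i \<ge> 2" for i using mult_left_mono[of 1 "int p ^ i" 2] by simp
  moreover from this have "2 * int p ^ i \<ge> 1" for i using order_trans[of 1 2 "2 * int p ^ i"] by simp
  ultimately show ?thesis unfolding rdeg_def ldeg_def wt_def
    by (intro add_mono sum_mono mult_right_mono) auto
qed

lemma rdeg_eq_0: "rdeg c = 0 \<Longrightarrow> c = ({||}, 0)"
proof -
  assume r: "rdeg c = 0"
  have nn: "(\<Sum>j\<in>Poly_Mapping.keys (snd c). (if j = 0 then 1 else 2) * int (Poly_Mapping.lookup (snd c) j)) \<ge> 0"
    by (auto intro!: sum_nonneg)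
  have t: "int (card (fset (fst c))) + (\<Sum>j\<in>Poly_Mapping.keys (snd c).
      (if j = 0 then 1 else 2) * int (Poly_Mapping.lookup (snd c) j)) = 0"
    using r by (simp add: rdeg_def wt_def)
  then have "card (fset (fst c)) = 0" using nn by linarith
  then have "fst c = {||}" by (simp add: bot_fset.rep_eq[symmetric] fset_inject del: bot_fset.rep_eq)
  moreover have "(\<Sum>j\<in>Poly_Mapping.keys (snd c). (if j = 0 then 1 else 2) * int (Poly_Mapping.lookup (snd c) j)) = 0"
    using t nn by linarith
  then have "\<forall>j\<in>Poly_Mapping.keys (snd c). (if j = 0 then 1 else 2) * int (Poly_Mapping.lookup (snd c) j) = 0"
    by (subst (asm) sum_nonneg_eq_0_iff) auto
  then have "Poly_Mapping.lookup (snd c) j = 0" if "j \<in> Poly_Mapping.keys (snd c)" for j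
    using that by (cases "j = 0") force+
  ultimately have "fst c = {||}" "Poly_Mapping.keys (snd c) = {}"
    by (simp, use \<open>\<And>j. j \<in> Poly_Mapping.keys (snd c) \<Longrightarrow> _\<close> in \<open>fastforce simp: in_keys_iff\<close>)
  then show ?thesis by (cases c) auto
qed

lemma rdeg_even_part: "Poly_Mapping.keys e \<subseteq> {0, 1} \<Longrightarrow>
    rdeg ({||}, e) = int (Poly_Mapping.lookup e 0) + 2 * int (Poly_Mapping.lookup e 1)"
  unfolding rdeg_def by (subst wt_superset[of "{0, 1}"]) auto

section \<open>Convolution with the Bockstein and with operations of top degree\<close>

context odd_prime
begin

lemma cop_addu: "cop (bs (addu b)) = ten (pgen 0) (pgen 0) * (cop (bs b) :: (_, 'p mod_ring) salg)"
  unfolding bs_addu alghomD(2)[OF alghom_cop] by (simp add: cop_def Dpol_def)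

lemma conv_addu: "conv \<phi> \<psi> (addu b) = conv (\<lambda>x. \<phi> (addu x)) (\<lambda>x. \<psi> (addu x) :: 'p mod_ring) b"
  by (simp add: conv_def cop_addu evl_u_mult)

text \<open>Among the generators only \<open>\<tau>\<^sub>0\<close> has a coproduct with
  \<open>\<tau>\<^sub>0\<close> in the left factor; a weight counts these occurrences.\<close>

lemma supp_cop_no_tau0:
  assumes "0 |\<notin>| S"
  shows "supp (cop (bs (S, e)) :: (_, 'p mod_ring) salg) \<subseteq> {x. 0 |\<notin>| fst (fst x)}"
proof -
  let ?w = "wt (\<lambda>i. if i = 0 then 1 else 0) (\<lambda>j. 0)"
  have x: "homog ?w 0 (xig j)" for j
    using homog_power[OF additive_wt homog_gens(2), of _ "\<lambda>j. 0" 0 2] homog_gens(2)[of _ "\<lambda>j. 0" j]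
    by (auto simp: xig_def)
  have xp: "homog ?w 0 (xig j ^ n)" for j n
    using homog_power[OF additive_wt x[of j], of n] by simp
  \<comment> \<open>The value at \<open>\<tau>\<^sub>0\<close>, which does not divide the monomial,
    is replaced by 0, so that all generators have weight 0 on the left.\<close>
  define f where "f i = (if i = 0 then 0 else Dtau i :: (_, 'p mod_ring) salg)" for i
  have "oprod Dtau (fset S) = oprod f (fset S)"
    unfolding oprod_def using assms by (intro arg_cong[of _ _ prod_list] map_cong) (auto simp: f_def)
  then have c: "cop (bs (S, e)) = ghom f Dpol (bs (S, e))" by (simp add: cop_def ghom_bs)
  have "homog (\<lambda>x. ?w (fst x)) (wt (\<lambda>i. 0) (\<lambda>j. 0) (S, e)) (cop (bs (S, e)) :: (_, 'p mod_ring) salg)"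
    unfolding c
  proof (rule homog_ghom)
    show "additive_degree (\<lambda>x. ?w (fst x))" by (rule additive_prod(1)[OF additive_wt additive_wt])
    show "homog (\<lambda>x. ?w (fst x)) 0 (Dpol j :: (_, 'p mod_ring) salg)" for j
      using homog_gens(2)[of _ "\<lambda>j. 0" 0]
      by (auto simp: Dpol_def Dxi_def intro!: homog_sum homog_ten(1) xp)
    show "homog (\<lambda>x. ?w (fst x)) 0 (f i)" for i
    proof (cases "i = 0")
      case False
      then have "homog ?w 0 (taug i :: (_, 'p mod_ring) salg)"
        using homog_gens(1)[of "\<lambda>i. if i = 0 then 1 else 0" _ i] by simp
      then show ?thesis using False unfolding f_def Dtau_def
        by (auto intro!: homog_add homog_sum homog_ten(1) xp)
    qed (simp add: f_def homog_def)
  qed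
  then show ?thesis unfolding homog_def wt_zero
    by (auto simp: wt_def sum.delta split: if_splits)
qed

lemma evl_cong_zero: "(\<And>x. x \<in> supp a \<Longrightarrow> \<phi> x = 0) \<Longrightarrow> evl \<phi> a = 0"
  by (auto simp: evl_superset[OF finite_supp order_refl] intro!: sum.neutral)

lemma conv_phiB_no_tau0:
  assumes "0 |\<notin>| S"
  shows "conv phiB \<psi> (S, e) = (0 :: 'p mod_ring)"
  unfolding conv_def using supp_cop_no_tau0[OF assms, of e]
  by (intro evl_cong_zero) (auto simp: phiB_def)

lemma inversions_zero: "inversions {0 :: nat} S = 0"
proof -
  have "{(i, j). i \<in> {0 :: nat} \<and> j \<in> S \<and> j < i} = {}" by auto
  then show ?thesis unfolding inversions_def by (simp only: card.empty)
qed

lemma contrL_phiB_tau_u: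
  "contrL phiB (ten (taug 0) (pgen 0) * a) = pgen 0 * contrL (ch {0}) (a :: (mono \<times> mono, 'p mod_ring) salg)"
proof (induction a rule: salg_induct)
  case (mon x r)
  obtain S e c where x: "x = ((S, e), c)" by (cases x) auto
  have "of_int (bsg ({|0|}, 0) (S, e)) * phiB (bpl ({|0|}, 0) (S, e)) = (ch {0} (S, e) :: 'p mod_ring)"
    by (cases "0 |\<in>| S") (auto simp: bsg_mono bpl_mono phiB_def ch_def inversions_zero)
  then show ?case
    by (simp add: x taug_def bs_umon mon_mult bpl_prod_def[of "(_, umon)"] bsg_prod_def[of "(_, umon)"]
        umon_simps mult.assoc)
qed (simp_all add: distrib_left slinearD(1)[OF slinear_contr(1)])

lemma contrL_phiB_xi_tau:
  fixes a :: "(mono \<times> mono, 'p mod_ring) salg"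
  assumes "supp a \<subseteq> {x. 0 |\<notin>| fst (fst x)}"
  shows "contrL phiB (ten (xig 0) (taug 0) * a) = 0"
  using assms
proof (induction a rule: supp_induct)
  case (mon x r)
  obtain S e c where x: "x = ((S, e), c)" by (cases x) auto
  have z: "phiB (bpl ({||}, f) (S, e)) = (0 :: 'p mod_ring)" for f
    using mon x by (auto simp: bpl_mono phiB_def)
  have "xig 0 = (bs ({||}, Poly_Mapping.single 0 2) :: (mono, 'p mod_ring) salg)"
    by (simp add: xig_def pgen_power)
  then show ?case
    by (simp add: x taug_def mon_mult bpl_prod_def[of "(({||}, _), _)"] z)
qed (simp_all add: distrib_left slinearD[OF slinear_contr(1)])

text \<open>In \<open>\<Delta> \<tau>\<^sub>0 = u\<^sup>2 \<otimes> \<tau>\<^sub>0 + \<tau>\<^sub>0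
  \<otimes> u\<close> only the last term has \<open>\<tau>\<^sub>0\<close> on the left. Contraction
  thus replaces \<open>\<tau>\<^sub>0\<close> by \<open>u\<close>, and on the remaining factors it
  is the counit law.\<close>

lemma conv_phiB:
  "conv phiB \<psi> (S, e) = (if 0 |\<in>| S then \<psi> (addu (S |-| {|0|}, e)) else 0 :: 'p mod_ring)"
proof (cases "0 |\<in>| S")
  case True
  let ?b = "(S |-| {|0|}, e)"
  have "finsert 0 S = S" using True by auto
  then have "bs (S, e) = taug 0 * (bs ?b :: (_, 'p mod_ring) salg)"
    by (simp add: taug_def mon_mult bpl_mono bsg_mono inversions_zero)
  then have "cop (bs (S, e)) = Dtau 0 * (cop (bs ?b) :: (_, 'p mod_ring) salg)"
    using alghomD(2)[OF alghom_cop] cop_taug by metis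
  also have "Dtau 0 = ten (xig 0) (taug 0) + (ten (taug 0) (pgen 0) :: (_, 'p mod_ring) salg)"
    by (simp add: Dtau_def)
  finally have "contrL phiB (cop (bs (S, e))) = pgen 0 * (bs ?b :: (_, 'p mod_ring) salg)"
    using contrL_phiB_xi_tau[OF supp_cop_no_tau0[of "S |-| {|0|}" e]]
    by (simp add: distrib_right slinearD(1)[OF slinear_contr(1)] contrL_phiB_tau_u contrL_counit_cop)
  then show ?thesis using True by (simp add: conv_def evl_contrL bs_addu[symmetric])
qed (simp add: conv_phiB_no_tau0)

text \<open>The adjoint of left convolution by the sum over \<open>i\<close> of the functionals dual to \<open>\<xi>\<^sub>1\<^sup>i\<close>.\<close>

definition desc :: "(mono, 'p mod_ring) salg \<Rightarrow> (mono, 'p mod_ring) salg" where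
  "desc a = contrL (ch {Suc 0}) (cop a)"

lemma alghom_desc: "alghom desc"
  unfolding desc_def by (rule alghom_comp[OF alghom_contrL[OF character_ch] alghom_cop])

lemma sum_diff_one:
  "(\<Sum>s\<le>i. if i - s \<in> {Suc 0} then f s else 0) = (if i = 0 then 0 else f (i - 1))"
  for f :: "nat \<Rightarrow> (mono, 'p mod_ring) salg"
proof (cases i)
  case (Suc k)
  then show ?thesis
    by (subst sum.cong[OF refl, where h = "\<lambda>s. if s = k then f s else 0"]) (auto simp: sum.delta)
qed simp

text \<open>Only the term of the coproduct with a power of \<open>\<xi>\<^sub>1\<close> on the left
  survives, the one with \<open>s = i - 1\<close>.\<close>

lemma desc_gens:
  "desc (taug i) = (if i = 0 then 0 else taug (i - 1))"
  "desc (pgen j) = (if j = 0 then 0 else xig (j - 1))"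
proof -
  show "desc (taug i) = (if i = 0 then 0 else taug (i - 1))"
    unfolding desc_def cop_taug contrL_Dtau by (rule sum_diff_one)
  show "desc (pgen j) = (if j = 0 then 0 else xig (j - 1))"
  proof (cases "j = 0")
    case True
    then show ?thesis by (simp add: desc_def cop_def Dpol_def contrL_ten evl_ch_gens)
  next
    case False
    then have "cop (pgen j) = (Dxi j :: (_, 'p mod_ring) salg)" by (simp add: cop_def Dpol_def)
    then show ?thesis unfolding desc_def using sum_diff_one[of j xig] by (simp only: contrL_Dxi)
  qed
qed

lemma desc_addu: "desc (bs (addu b)) = 0"
  unfolding bs_addu alghomD(2)[OF alghom_desc] by (simp add: desc_gens)

lemma oprod_Suc: "finite T \<Longrightarrow> oprod f (Suc ` T) = oprod (\<lambda>i. f (Suc i)) T"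
proof -
  assume T: "finite T"
  have "sorted_list_of_set (set (map Suc (sorted_list_of_set T))) = map Suc (sorted_list_of_set T)"
    by (rule sorted_list_of_set.idem_if_sorted_distinct)
      (simp_all add: sorted_map distinct_map)
  then show ?thesis using T by (simp add: oprod_def o_def)
qed

lemma desc_shift:
  assumes "even (Poly_Mapping.lookup f 0)"
  shows "desc (bs (shift (T, f))) = bs (T, f)"
proof -
  obtain N where N: "Poly_Mapping.keys f \<subseteq> {..<N}" using keys_bounded by blast
  have N': "Poly_Mapping.keys (she f) \<subseteq> {..<Suc (Suc N)}"
    using N keys_she[of f] by fastforce
  have N2: "Poly_Mapping.keys f \<subseteq> {..<Suc N}" using N by auto
  have "desc (bs (shift (T, f))) = oprod (\<lambda>i. desc (taug i)) (fset (Suc |`| T)) * eprod (\<lambda>j. desc (pgen j)) (she f)"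
    unfolding shift_def fst_conv snd_conv by (rule alghom_bs[OF alghom_desc])
  also have "oprod (\<lambda>i. desc (taug i)) (fset (Suc |`| T)) = oprod taug (fset T)"
    by (simp add: oprod_Suc desc_gens)
  also have "eprod (\<lambda>j. desc (pgen j)) (she f) = eprod pgen f"
  proof -
    have e: "xig j ^ Poly_Mapping.lookup (she f) (Suc j) = (pgen j :: (mono, 'p mod_ring) salg) ^ Poly_Mapping.lookup f j" for j
      using assms by (auto simp: lookup_she xig_def simp flip: power_mult)
    show ?thesis
    proof -
      have "[0..<Suc (Suc N)] = 0 # map Suc [0..<Suc N]"
        by (simp add: upt_conv_Cons map_Suc_upt del: upt_Suc)
      moreover have "Poly_Mapping.lookup (she f) 0 = 0" by (simp add: lookup_she)
      ultimately show ?thesis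
        unfolding eprod_upt[OF N'] eprod_upt[OF N2] by (simp add: o_def desc_gens e del: upt_Suc)
    qed
  qed
  finally show ?thesis by (simp add: bs_mono_eq)
qed

lemma conv_ch1_shift: "even (Poly_Mapping.lookup f 0) \<Longrightarrow> conv (ch {Suc 0}) \<psi> (shift (T, f)) = (\<psi> (T, f) :: 'p mod_ring)"
  using desc_shift by (simp add: conv_def evl_contrL desc_def)

lemma conv_ch1_addu: "conv (ch {Suc 0}) \<psi> (addu b) = (0 :: 'p mod_ring)"
  using desc_addu by (simp add: conv_def evl_contrL desc_def)

text \<open>Matching of degrees in the coproduct leaves only left factors of right degree
  \<open>2 * s\<close>. For a monomial in \<open>u\<close> and \<open>\<xi>\<^sub>1\<close> of that
  degree, containing \<open>\<xi>\<^sub>1\<close> to the power \<open>s\<close> and not containing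
  \<open>u\<close> are the same, so \<open>P\<^sup>s\<close> acts like a character, whose adjoint is
  computed on generators.\<close>

lemma conv_phiP_ch1:
  assumes "\<And>c. rdeg c = rdeg d \<Longrightarrow> \<psi> c \<noteq> 0 \<Longrightarrow> ldeg CARD('p) c = 2 * int s"
  shows "conv (phiP s) \<psi> d = (conv (ch {Suc 0}) \<psi> d :: 'p mod_ring)"
proof (rule conv_cong)
  fix b c
  assume r: "rdeg c = rdeg d" and l: "rdeg b = ldeg CARD('p) c"
  show "phiP s b * \<psi> c = ch {Suc 0} b * \<psi> c"
  proof (cases "\<psi> c = 0")
    case False
    then have b: "rdeg b = 2 * int s" using assms r l by simp
    obtain S e where [simp]: "b = (S, e)" by (cases b)
    have "phiP s b = (ch {Suc 0} b :: 'p mod_ring)"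
    proof (cases "S = {||} \<and> Poly_Mapping.keys e \<subseteq> {0, 1}")
      case True
      have "Poly_Mapping.keys e \<subseteq> {1} \<longleftrightarrow> Poly_Mapping.lookup e 0 = 0"
        using True by (auto simp: in_keys_iff)
      moreover have "2 * int s = int (Poly_Mapping.lookup e 0) + 2 * int (Poly_Mapping.lookup e 1)"
        using rdeg_even_part True b by simp
      ultimately show ?thesis using True
        by (auto simp: phiP_def ch_def in_keys_iff)
    qed (auto simp: phiP_def ch_def)
    then show ?thesis by simp
  qed simp
qed

lemma top_even_up:
  assumes "\<And>c. rdeg c = rdeg d \<Longrightarrow> \<psi> c \<noteq> 0 \<Longrightarrow> ldeg CARD('p) c = 2 * int s"
    and "even (Poly_Mapping.lookup (snd d) 0)"
  shows "conv (phiP s) \<psi> (up d) = (\<psi> d :: 'p mod_ring)"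
proof -
  have "up d = shift d" using assms(2) by (simp add: up_def shift_def)
  then show ?thesis
    using assms conv_ch1_shift[of "snd d" \<psi> "fst d"] rdeg_up[of d] by (subst conv_phiP_ch1) (auto simp: rdeg_up)
qed

lemma top_even_addu:
  assumes "\<And>c. rdeg c = rdeg (addu d) \<Longrightarrow> \<psi> c \<noteq> 0 \<Longrightarrow> ldeg CARD('p) c = 2 * int s"
  shows "conv (phiP s) \<psi> (addu d) = (0 :: 'p mod_ring)"
  using assms by (subst conv_phiP_ch1) (auto simp: conv_ch1_addu)

text \<open>The Bockstein turns the \<open>\<tau>\<^sub>0\<close> of \<open>up d\<close> into a
  \<open>u\<close>; passing this \<open>u\<close> on to \<open>\<psi>\<close> lowers the degrees by
  one and leads back to the even case.\<close>

lemma top_odd_up: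
  assumes "\<And>c. rdeg c = rdeg d \<Longrightarrow> \<psi> c \<noteq> 0 \<Longrightarrow> ldeg CARD('p) c = 2 * int s + 1"
    and "odd (Poly_Mapping.lookup (snd d) 0)"
  shows "conv phiB (conv (phiP s) \<psi>) (up d) = (\<psi> d :: 'p mod_ring)"
proof -
  obtain T f where d: "d = (T, f)" by (cases d)
  \<comment> \<open>One \<open>u\<close> is split off, so that the remaining exponent is even and
    the shift can be inverted.\<close>
  define f' where "f' = f - Poly_Mapping.single 0 1"
  have f: "Poly_Mapping.lookup f 0 = Suc (Poly_Mapping.lookup f' 0)" "j \<noteq> 0 \<Longrightarrow> Poly_Mapping.lookup f j = Poly_Mapping.lookup f' j" for j
    using assms(2) by (auto simp: d f'_def lookup_minus lookup_single elim: oddE)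
  have ev: "even (Poly_Mapping.lookup f' 0)" using assms(2) f by (simp add: d)
  have s: "shift (T, f) = shift (T, f')"
    using ev by (auto simp: shift_def poly_mapping_eq_iff fun_eq_iff lookup_she f split: nat.splits)
  have a: "addu (T, f') = (T, f)"
    by (auto simp: addu_def poly_mapping_eq_iff fun_eq_iff lookup_add lookup_single when_def f)
  have u: "up d = (finsert 0 (fst (shift (T, f'))), snd (shift (T, f')))"
    using assms(2) by (simp add: up_def d s)
  have n: "fst (shift (T, f')) |-| {|0|} = fst (shift (T, f'))" by (auto simp: shift_def)
  have "conv phiB (conv (phiP s) \<psi>) (up d) = conv (phiP s) \<psi> (addu (shift (T, f')))"
    unfolding u conv_phiB using n by simp
  also have "\<dots> = conv (phiP s) (\<lambda>x. \<psi> (addu x)) (shift (T, f'))"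
    by (simp add: conv_addu)
  also have "\<dots> = conv (ch {Suc 0}) (\<lambda>x. \<psi> (addu x)) (shift (T, f'))"
  proof (rule conv_phiP_ch1)
    fix c assume "rdeg c = rdeg (shift (T, f'))" "\<psi> (addu c) \<noteq> 0"
    moreover have "rdeg (shift (T, f')) = rdeg (T, f')"
      using rdeg_up[of "(T, f')"] ev by (simp add: up_def shift_def)
    ultimately show "ldeg CARD('p) c = 2 * int s"
      using assms(1)[of "addu c"] rdeg_addu[of "(T, f')"] by (simp add: rdeg_addu ldeg_addu d a)
  qed
  also have "\<dots> = \<psi> d" by (simp add: conv_ch1_shift[OF ev] a d)
  finally show ?thesis .
qed

lemma top_odd_addu:
  assumes "\<And>c. rdeg c = rdeg (addu d) \<Longrightarrow> \<psi> c \<noteq> 0 \<Longrightarrow> ldeg CARD('p) c = 2 * int s + 1"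
  shows "conv phiB (conv (phiP s) \<psi>) (addu d) = (0 :: 'p mod_ring)"
proof -
  obtain S e where d: "d = (S, e)" by (cases d)
  show ?thesis
  proof (cases "0 |\<in>| S")
    case True
    let ?x = "addu (S |-| {|0|}, e)"
    have "rdeg (S, e) = rdeg (S |-| {|0|}, e) + 1"
    proof -
      have "1 \<le> card (fset S)" using True by (metis One_nat_def Suc_leI card_gt_0_iff empty_iff finite_fset)
      then show ?thesis using True by (simp add: rdeg_def wt_def of_nat_diff)
    qed
    then have r: "rdeg (addu d) = rdeg (addu ?x)" by (simp add: d rdeg_addu)
    have "conv phiB (conv (phiP s) \<psi>) (addu d) = conv (phiP s) (\<lambda>x. \<psi> (addu x)) ?x"
    proof -
      have "addu d = (S, e + Poly_Mapping.single 0 1)" by (simp add: d addu_def)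
      moreover have "(S |-| {|0|}, e + Poly_Mapping.single 0 1) = ?x" by (simp add: addu_def)
      ultimately have "conv phiB (conv (phiP s) \<psi>) (addu d) = conv (phiP s) \<psi> (addu ?x)"
        using True by (simp only: conv_phiB if_True)
      then show ?thesis unfolding conv_addu by simp
    qed
    also have "\<dots> = conv (ch {Suc 0}) (\<lambda>x. \<psi> (addu x)) ?x"
      proof (rule conv_phiP_ch1)
      fix c assume "rdeg c = rdeg ?x" "\<psi> (addu c) \<noteq> 0"
      then show "ldeg CARD('p) c = 2 * int s"
        using assms[of "addu c"] r by (simp add: rdeg_addu ldeg_addu)
    qed
    finally show ?thesis by (simp add: conv_ch1_addu)
  qed (simp add: d addu_def conv_phiB)
qed

end

section \<open>The Adem relations\<close>

subsection \<open>A binomial identity modulo \<open>p\<close>\<close>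

lemma fps_nth_one_plus_X_power: "fps_nth ((1 + fps_X) ^ m) j = (of_nat (m choose j) :: 'k::field)"
proof (induction m arbitrary: j)
  case 0
  show ?case by (cases j) auto
next
  case (Suc m)
  then show ?case by (cases j) (auto simp: fps_mult_fps_X_plus_1_nth)
qed

lemma inverse_one_plus_X: "inverse (1 + fps_X) * (1 + fps_X) = (1 :: 'k::field fps)"
  by (rule inverse_mult_eq_1) simp

text \<open>The total exponent of \<open>1 + fps_X\<close> is \<open>k - n - 1\<close>, so this is
  upper negation of a binomial coefficient.\<close>

lemma fps_nth_negative_binomial:
  "fps_nth ((1 + fps_X) ^ k * inverse (1 + fps_X) ^ Suc n) k = (- 1) ^ k * (of_nat (n choose k) :: 'k::field)"
proof (induction n arbitrary: k)
  case 0
  show ?case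
  proof (cases k)
    case (Suc m)
    have "(1 + fps_X) ^ Suc m * inverse (1 + fps_X) = (1 + fps_X :: 'k fps) ^ m"
      using inverse_one_plus_X[where 'k = 'k] by (simp add: mult_ac)
    then show ?thesis using Suc by (simp add: fps_nth_one_plus_X_power binomial_eq_0 del: power_Suc)
  qed simp
next
  case (Suc n)
  show ?case
  proof (cases k)
    case 0
    then show ?thesis by (simp add: fps_nth_power_0)
  next
    case (Suc m)
    let ?A = "1 + fps_X :: 'k fps"
    let ?Q = "?A ^ m * inverse ?A ^ Suc n"
    have q: "?A ^ Suc m * inverse ?A ^ Suc (Suc n) = ?Q"
    proof -
      have "?A ^ Suc m * inverse ?A ^ Suc (Suc n) = (inverse ?A * ?A) * ?Q" by (simp add: mult_ac)
      then show ?thesis by (simp only: inverse_one_plus_X mult_1_left)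
    qed
    have e: "?A ^ Suc m * inverse ?A ^ Suc n = ?A * ?Q" by (simp add: mult_ac)
    have "fps_nth ?Q (Suc m) + fps_nth ?Q m = (- 1) ^ Suc m * of_nat (n choose Suc m)"
      using Suc.IH[of "Suc m"] unfolding e fps_mult_fps_X_plus_1_nth by simp
    moreover have "fps_nth ?Q m = (- 1) ^ m * of_nat (n choose m)" by (rule Suc.IH)
    ultimately have h: "fps_nth ?Q (Suc m) = (- 1) ^ Suc m * of_nat (n choose Suc m) - (- 1) ^ m * of_nat (n choose m)"
      by (simp add: eq_diff_eq)
    show ?thesis unfolding Suc q h by (simp add: algebra_simps)
  qed
qed

lemma choose_mult_self:
  assumes "l > 0"
  shows "(p * l) choose l = p * ((p * l - 1) choose (l - 1))"
proof (cases "p = 0")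
  case True
  then show ?thesis using assms by simp
next
  case False
  obtain l' where l: "l = Suc l'" using assms by (cases l) auto
  obtain n where n: "p * l = Suc n" using assms False by (cases "p * l") auto
  have "l * (p * l choose l) = p * l * (n choose l')"
    unfolding n using Suc_times_binomial_eq[of n l'] by (simp add: l n mult.commute)
  then have "l * (p * l choose l) = l * (p * (n choose l'))" by (simp add: mult_ac)
  then have "p * l choose l = p * (n choose l')" by (simp only: nat_mult_eq_cancel1[OF assms])
  then show ?thesis using n by (simp add: l)
qed

context odd_prime
begin

abbreviation "F_of \<equiv> of_nat :: nat \<Rightarrow> 'p mod_ring"

lemma one_plus_X_frobenius: "(1 + fps_X :: 'p mod_ring fps) ^ CARD('p) = 1 + fps_X ^ CARD('p)"
proof -
  have "(of_nat CARD('p) :: 'p mod_ring fps) = 0"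
    by (metis fps_of_nat fps_const_0_eq_0 of_nat_card_eq_0)
  then show ?thesis using commuting_frobenius[of "1 :: 'p mod_ring fps" fps_X "CARD('p)"] prime_card[where 'a = 'p] by simp
qed

text \<open>For positive \<open>m\<close> the coefficient vanishes unless \<open>m = p * l\<close>,
  and then it is \<open>(p * l) choose l\<close>, a multiple of p.\<close>

lemma fps_nth_diagonal:
  "fps_nth ((1 + fps_X ^ CARD('p)) ^ m) m = (if m = 0 then 1 else 0 :: 'p mod_ring)"
proof -
  let ?p = "CARD('p)"
  have "(1 + fps_X ^ ?p :: 'p mod_ring fps) ^ m = (\<Sum>l\<le>m. of_nat (m choose l) * fps_X ^ (?p * l))"
    using binomial_ring[of "fps_X ^ ?p" "1 :: 'p mod_ring fps" m] by (simp add: add.commute power_mult)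
  then have "fps_nth ((1 + fps_X ^ ?p :: 'p mod_ring fps) ^ m) m
      = (\<Sum>l\<le>m. F_of (m choose l) * (if m = ?p * l then 1 else 0))"
    by (simp add: fps_sum_nth fps_mult_of_nat_nth fps_X_power_nth)
  also have "\<dots> = (\<Sum>l\<le>m. if m = 0 then (if l = 0 then 1 else 0) else 0)"
  proof (rule sum.cong[OF refl])
    fix l assume "l \<in> {..m}"
    show "F_of (m choose l) * (if m = ?p * l then 1 else 0) = (if m = 0 then (if l = 0 then 1 else 0) else 0)"
    proof (cases "m = ?p * l \<and> m \<noteq> 0")
      case True
      then have "l > 0" by (cases "l = 0") auto
      then have "F_of (m choose l) = 0" using True choose_mult_self[OF \<open>l > 0\<close>, of ?p] by simp
      then show ?thesis using True \<open>l > 0\<close> by auto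
    qed (use card_ge_3 in auto)
  qed
  finally show ?thesis by simp
qed

lemma minus_one_power_cong_F: "even a = even b \<Longrightarrow> (- 1 :: 'p mod_ring) ^ a = (- 1) ^ b"
  by (cases "even a") auto

text \<open>With x for the variable, the Adem coefficient of index j is the coefficient of
  \<open>x\<^sup>a\<close> in \<open>V * (x\<^sup>p / (1 + x))\<^sup>j\<close>, where
  \<open>V\<close> is \<open>1 + x\<close> to the power \<open>a + b - p * b\<close>. By the
  binomial theorem the sum becomes \<open>1 + x\<close> to the power \<open>- p * b\<close> times
  the power with exponent \<open>a + b\<close> of \<open>x + (1 + x\<^sup>p)\<close>. Expanding the
  latter in powers of x, \<open>fps_nth_diagonal\<close> leaves only the term with
  \<open>x\<^sup>a\<close>.\<close>

lemma adem_binomial: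
  assumes "a < CARD('p) * b"
  shows "(\<Sum>j\<le>a div CARD('p). (- 1) ^ (a + j) * F_of (((CARD('p) - 1) * (b - j) - 1) choose (a - CARD('p) * j))
    * F_of ((a + b) choose j)) = F_of ((a + b) choose b)"
proof -
  let ?p = "CARD('p)" and ?N = "a + b"
  let ?A = "1 + fps_X :: 'p mod_ring fps" and ?X = "fps_X :: 'p mod_ring fps"
  let ?B = "1 + fps_X ^ CARD('p) :: 'p mod_ring fps"
  define I where "I = inverse ?A"
  have IA: "I * ?A = 1" unfolding I_def by (rule inverse_one_plus_X)
  have IAn: "I ^ n * ?A ^ n = 1" for n
    by (metis IA power_mult_distrib power_one)
  have p0: "?p > 0" by simp
  \<comment> \<open>The exponent \<open>a + b - p * b\<close> may be negative, hence the inverse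
    \<open>I\<close>.\<close>
  define V where "V = I ^ (?p * b) * ?A ^ ?N"
  have tm: "(- 1) ^ (a + j) * F_of (((?p - 1) * (b - j) - 1) choose (a - ?p * j))
      = fps_nth (V * (?X ^ ?p * I) ^ j) a" if j: "j \<le> a div ?p" for j
  proof -
    have pj: "?p * j \<le> a" using j p0 by (meson le_trans mult_le_mono2 times_div_less_eq_dividend)
    then have jb: "j < b" using assms by (metis le_less_trans mult_less_cancel1)
    define k where "k = a - ?p * j"
    define n where "n = (?p - 1) * (b - j) - 1"
    have n: "Suc n = (?p - 1) * (b - j)" using jb card_ge_3 by (simp add: n_def)
    have "(- 1 :: 'p mod_ring) ^ (a + j) = (- 1) ^ k"
      by (rule minus_one_power_cong_F) (use pj odd_card in \<open>simp add: k_def\<close>)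
    then have "(- 1) ^ (a + j) * F_of (n choose k) = fps_nth (?A ^ k * I ^ Suc n) k"
      using fps_nth_negative_binomial[of k n, where 'k = "'p mod_ring"] by (simp add: I_def)
    also have "\<dots> = fps_nth (?X ^ (?p * j) * (?A ^ k * I ^ Suc n)) a"
      using pj by (simp add: fps_X_power_mult_nth k_def)
    also have "?A ^ k * I ^ Suc n = V * I ^ j"
    proof -
      have e1: "?p * b + j = Suc n + (?N - k)"
      proof -
        obtain d where d: "b = j + d" using jb less_imp_add_positive by blast
        obtain q where q: "?p = Suc q" using p0 by (cases ?p) auto
        have "?N - k = b + ?p * j" using pj by (simp add: k_def)
        then show ?thesis unfolding n by (simp add: d q algebra_simps)
      qed
      have e2: "?N = k + (?N - k)" by (simp add: k_def)
      have "V * I ^ j = I ^ (?p * b + j) * ?A ^ ?N" by (simp add: V_def power_add mult_ac)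
      also have "\<dots> = I ^ Suc n * ?A ^ k * (I ^ (?N - k) * ?A ^ (?N - k))"
        by (subst e1, subst (2) e2) (simp only: power_add mult_ac)
      finally show ?thesis by (simp only: IAn) (simp add: mult_ac)
    qed
    also have "?X ^ (?p * j) * (V * I ^ j) = V * (?X ^ ?p * I) ^ j"
      by (subst power_mult) (simp only: power_mult_distrib mult_ac)
    finally show ?thesis unfolding n_def k_def .
  qed
  \<comment> \<open>Beyond \<open>a div p\<close> the power of x exceeds a, so the sum may be
    extended to all j up to \<open>a + b\<close> and the binomial theorem applies.\<close>
  have zero: "fps_nth (V * (?X ^ ?p * I) ^ j) a = 0" if "j > a div ?p" for j
  proof -
    have "a < ?p * j" using that p0 by (simp add: div_less_iff_less_mult mult.commute)
    have e: "V * (?X ^ ?p * I) ^ j = ?X ^ (?p * j) * (V * I ^ j)"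
      by (subst power_mult) (simp only: power_mult_distrib mult_ac)
    show ?thesis unfolding e using \<open>a < ?p * j\<close> by (simp add: fps_X_power_mult_nth)
  qed
  have "(\<Sum>j\<le>a div ?p. (- 1) ^ (a + j) * F_of (((?p - 1) * (b - j) - 1) choose (a - ?p * j)) * F_of (?N choose j))
      = (\<Sum>j\<le>a div ?p. fps_nth (of_nat (?N choose j) * (V * (?X ^ ?p * I) ^ j)) a)"
  proof (rule sum.cong[OF refl])
    fix j assume "j \<in> {..a div ?p}"
    then have "j \<le> a div ?p" by simp
    show "(- 1) ^ (a + j) * F_of (((?p - 1) * (b - j) - 1) choose (a - ?p * j)) * F_of (?N choose j)
        = fps_nth (of_nat (?N choose j) * (V * (?X ^ ?p * I) ^ j)) a"
      unfolding tm[OF \<open>j \<le> a div ?p\<close>] fps_mult_of_nat_nth by (rule mult.commute)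
  qed
  also have "\<dots> = (\<Sum>j\<le>?N. fps_nth (of_nat (?N choose j) * (V * (?X ^ ?p * I) ^ j)) a)"
    by (rule sum.mono_neutral_left)
      (auto simp: fps_mult_of_nat_nth zero not_le intro: le_trans[OF div_le_dividend])
  also have "\<dots> = fps_nth (V * (?X ^ ?p * I + 1) ^ ?N) a"
    unfolding binomial_ring by (simp add: fps_sum_nth sum_distrib_left mult_ac)
  also have "V * (?X ^ ?p * I + 1) ^ ?N = I ^ (?p * b) * (?X + ?B) ^ ?N"
  proof -
    have "?A * (?X ^ ?p * I + 1) = ?X ^ ?p * (I * ?A) + ?A" by (simp add: algebra_simps)
    also have "\<dots> = ?X + ?B" unfolding IA by simp
    finally have "?A ^ ?N * (?X ^ ?p * I + 1) ^ ?N = (?X + ?B) ^ ?N"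
      by (simp only: power_mult_distrib[symmetric])
    then show ?thesis unfolding V_def by (simp only: mult.assoc)
  qed
  also have "fps_nth (I ^ (?p * b) * (?X + ?B) ^ ?N) a
      = (\<Sum>i\<le>?N. F_of (?N choose i) * fps_nth (?X ^ i * (I ^ (?p * b) * ?B ^ (?N - i))) a)"
    unfolding binomial_ring sum_distrib_left fps_sum_nth
    by (rule sum.cong) (auto simp: fps_mult_of_nat_nth[symmetric] mult_ac)
  also have "\<dots> = (\<Sum>i\<le>?N. if i = a then F_of (?N choose a) else 0)"
  proof (rule sum.cong[OF refl])
    fix i
    show "F_of (?N choose i) * fps_nth (?X ^ i * (I ^ (?p * b) * ?B ^ (?N - i))) a
        = (if i = a then F_of (?N choose a) else 0)"
    proof (cases "i \<le> a")
      case True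
      \<comment> \<open>Since \<open>(1 + x)\<^sup>p = 1 + x\<^sup>p\<close>, the negative power
        cancels b of the factors.\<close>
      have "I ^ (?p * b) * ?B ^ (?N - i) = ?B ^ (a - i)"
      proof -
        have "?B ^ (?N - i) = ?A ^ (?p * b) * ?B ^ (a - i)"
        proof -
          have "?N - i = b + (a - i)" using True by simp
          then show ?thesis by (simp only: power_mult one_plus_X_frobenius power_add)
        qed
        then show ?thesis by (simp only: mult.assoc[symmetric] IAn) simp
      qed
      then show ?thesis using True by (simp add: fps_X_power_mult_nth fps_nth_diagonal)
    qed (simp add: fps_X_power_mult_nth)
  qed
  also have "\<dots> = F_of (?N choose a)" by (simp add: sum.delta)
  also have "?N choose a = ?N choose b" by (subst binomial_symmetric) auto
  finally show ?thesis .
qed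

text \<open>The coefficient of \<open>s\<^sup>a t\<^sup>b\<close> in \<open>(s + t)\<^sup>r (s\<^sup>p t)\<^sup>k\<close>, the image of \<open>\<Delta>(\<xi>\<^sub>1\<^sup>r \<xi>\<^sub>2\<^sup>k)\<close> under \<open>u \<mapsto> 1\<close>,
  \<open>\<xi>\<^sub>1 \<otimes> 1 \<mapsto> s\<close>, \<open>1 \<otimes> \<xi>\<^sub>1 \<mapsto> t\<close>.\<close>

definition adem_coeff :: "nat \<Rightarrow> nat \<Rightarrow> nat \<Rightarrow> nat \<Rightarrow> 'p mod_ring" where
  "adem_coeff r k a b = (if a + b = r + (CARD('p) + 1) * k \<and> k \<le> b then F_of (r choose (b - k)) else 0)"

text \<open>Subtracting \<open>(p * k, k, k)\<close> from \<open>(a, b, j)\<close> changes neither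
  the binomial coefficients of the relation nor, p being odd, the signs. This reduces to
  \<open>k = 0\<close>, which is \<open>adem_binomial\<close>; if \<open>a < p * k\<close>, both
  sides vanish.\<close>

lemma adem_coeff_sum:
  assumes "a < CARD('p) * b"
  shows "adem_coeff r k a b = (\<Sum>j\<le>a div CARD('p).
    (- 1) ^ (a + j) * F_of (((CARD('p) - 1) * (b - j) - 1) choose (a - CARD('p) * j)) * adem_coeff r k (a + b - j) j)"
proof -
  let ?p = "CARD('p)"
  have p0: "?p > 0" by simp
  have jn: "j \<le> a + b" if "j \<le> a div ?p" for j
    using that div_le_dividend[of a ?p] by linarith
  consider "a + b \<noteq> r + (?p + 1) * k" | "a + b = r + (?p + 1) * k" "a div ?p < k"
    | "a + b = r + (?p + 1) * k" "k \<le> a div ?p" by linarith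
  then show ?thesis
  proof cases
    case 1
    then show ?thesis using jn by (simp add: adem_coeff_def)
  next
    case 2
    then have "a < ?p * k" using p0 by (simp add: div_less_iff_less_mult mult.commute)
    then have "k \<le> b \<Longrightarrow> r < b - k" using 2(1) by auto
    then show ?thesis using 2 jn by (auto simp: adem_coeff_def binomial_eq_0 intro!: sum.neutral[symmetric])
  next
    case 3
    define a' where "a' = a - ?p * k"
    define b' where "b' = b - k"
    have pk: "?p * k \<le> a" using 3(2) p0 by (meson le_trans mult_le_mono2 times_div_less_eq_dividend)
    then have kb: "k < b" using assms by (metis le_less_trans mult_less_cancel1)
    have a: "a = a' + ?p * k" and b: "b = b' + k" using pk kb by (simp_all add: a'_def b'_def)
    have r: "r = a' + b'" using 3(1) a b by (simp add: algebra_simps)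
    have ab': "a' < ?p * b'" using assms by (simp add: a b algebra_simps)
    have q: "a div ?p = a' div ?p + k" using p0 by (simp add: a)
    have "(\<Sum>j\<le>a div ?p. (- 1) ^ (a + j) * F_of (((?p - 1) * (b - j) - 1) choose (a - ?p * j)) * adem_coeff r k (a + b - j) j)
        = (\<Sum>j\<in>{k..a' div ?p + k}. (- 1) ^ (a + j) * F_of (((?p - 1) * (b - j) - 1) choose (a - ?p * j)) * adem_coeff r k (a + b - j) j)"
      unfolding q by (rule sum.mono_neutral_right) (auto simp: adem_coeff_def)
    also have "\<dots> = (\<Sum>j\<le>a' div ?p. (- 1) ^ (a' + j) * F_of (((?p - 1) * (b' - j) - 1) choose (a' - ?p * j)) * F_of ((a' + b') choose j))"
    proof (rule sum.reindex_bij_witness[of _ "\<lambda>j. j + k" "\<lambda>j. j - k"])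
      fix j assume j: "j \<in> {k..a' div ?p + k}"
      then obtain i where i: "j = i + k" "i \<le> a' div ?p" by (metis add.commute add_le_cancel_right atLeastAtMost_iff le_Suc_ex)
      have s: "(- 1 :: 'p mod_ring) ^ (a' + i) = (- 1) ^ (a + (i + k))"
        by (rule minus_one_power_cong_F) (use odd_card in \<open>auto simp: a\<close>)
      have "adem_coeff r k (a + b - j) j = F_of ((a' + b') choose i)"
        using 3(1) jn[of j] i q by (simp add: adem_coeff_def r)
      moreover have "b - j = b' - i" "a - ?p * j = a' - ?p * i" using i by (simp_all add: a b algebra_simps)
      ultimately show "(- 1) ^ (a' + (j - k)) * F_of (((?p - 1) * (b' - (j - k)) - 1) choose (a' - ?p * (j - k))) * F_of ((a' + b') choose (j - k))
        = (- 1) ^ (a + j) * F_of (((?p - 1) * (b - j) - 1) choose (a - ?p * j)) * adem_coeff r k (a + b - j) j"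
        using i s by simp
    qed auto
    also have "\<dots> = F_of ((a' + b') choose b')" by (rule adem_binomial[OF ab'])
    also have "\<dots> = adem_coeff r k a b" using 3(1) kb by (simp add: adem_coeff_def r b)
    finally show ?thesis by simp
  qed
qed

text \<open>The signs of the second sum are opposite to those of the first, so Pascal's rule merges
  the two into the sum of \<open>adem_coeff_sum\<close>, provided that
  \<open>a < p * b\<close>.\<close>

lemma adem_coeff_sum_mixed:
  assumes a: "0 < a" "a \<le> CARD('p) * b"
  shows "adem_coeff r k a b =
    (\<Sum>j\<le>a div CARD('p). (- 1) ^ (a + j) * F_of (((CARD('p) - 1) * (b - j)) choose (a - CARD('p) * j))
      * adem_coeff r k (a + b - j) j)
    + (\<Sum>j\<le>(a - 1) div CARD('p). (- 1) ^ (a + j - 1) * F_of (((CARD('p) - 1) * (b - j) - 1) choose (a - CARD('p) * j - 1))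
      * adem_coeff r k (a + b - j) j)"
proof -
  let ?p = "CARD('p)"
  define x where "x j = adem_coeff r k (a + b - j) j" for j
  define M where "M j = (?p - 1) * (b - j)" for j
  define m where "m j = a - ?p * j" for j
  have p0: "?p > 0" by simp
  have pj: "?p * j \<le> a" if "j \<le> a div ?p" for j
    using that p0 by (meson le_trans mult_le_mono2 times_div_less_eq_dividend)
  have lt: "j \<le> (a - 1) div ?p \<longleftrightarrow> ?p * j < a" for j
    using p0 a(1) by (simp add: less_eq_div_iff_mult_less_eq mult.commute) linarith
  have "(\<Sum>j\<le>(a - 1) div ?p. (- 1) ^ (a + j - 1) * F_of ((M j - 1) choose (m j - 1)) * x j)
      = (\<Sum>j\<le>a div ?p. (if m j = 0 then 0 else - ((- 1) ^ (a + j) * F_of ((M j - 1) choose (m j - 1)))) * x j)"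
  proof (rule sum.mono_neutral_cong_left)
    show "{..(a - 1) div ?p} \<subseteq> {..a div ?p}"
      by (simp add: div_le_mono)
    show "\<forall>j\<in>{..a div ?p} - {..(a - 1) div ?p}. (if m j = 0 then 0 else - ((- 1) ^ (a + j) * F_of ((M j - 1) choose (m j - 1)))) * x j = 0"
      using lt by (auto simp: m_def)
    fix j assume "j \<in> {..(a - 1) div ?p}"
    then have "m j \<noteq> 0" using lt by (auto simp: m_def)
    moreover have "(- 1 :: 'p mod_ring) ^ (a + j) = - ((- 1) ^ (a + j - 1))"
      using a(1) by (cases "a + j") auto
    ultimately show "(- 1) ^ (a + j - 1) * F_of ((M j - 1) choose (m j - 1)) * x j
        = (if m j = 0 then 0 else - ((- 1) ^ (a + j) * F_of ((M j - 1) choose (m j - 1)))) * x j"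
      by simp
  qed simp
  then have "(\<Sum>j\<le>a div ?p. (- 1) ^ (a + j) * F_of (M j choose m j) * x j)
      + (\<Sum>j\<le>(a - 1) div ?p. (- 1) ^ (a + j - 1) * F_of ((M j - 1) choose (m j - 1)) * x j)
    = (\<Sum>j\<le>a div ?p. (- 1) ^ (a + j) * (F_of (M j choose m j) - (if m j = 0 then 0 else F_of ((M j - 1) choose (m j - 1)))) * x j)"
    by (auto simp: sum.distrib[symmetric] algebra_simps intro!: sum.cong)
  also have "\<dots> = x' a b" if "x' = adem_coeff r k" for x'
  proof (cases "a < ?p * b")
    case True
    have "F_of (M j choose m j) - (if m j = 0 then 0 else F_of ((M j - 1) choose (m j - 1))) = F_of ((M j - 1) choose m j)"
      if "j \<le> a div ?p" for j
    proof -
      have "j < b" using pj[OF that] True by (metis le_less_trans mult_less_cancel1)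
      then have "M j > 0" using card_ge_3 by (simp add: M_def)
      then obtain M' where "M j = Suc M'" by (cases "M j") auto
      then show ?thesis by (cases "m j") auto
    qed
    then show ?thesis
      unfolding that adem_coeff_sum[OF True] x_def by (intro sum.cong) (auto simp: M_def m_def)
  next
    case False
    \<comment> \<open>In the boundary case the lower index of each binomial coefficient exceeds the
      upper one unless \<open>j = b\<close>.\<close>
    then have ab: "a = ?p * b" using a by simp
    have z: "F_of (M j choose m j) - (if m j = 0 then 0 else F_of ((M j - 1) choose (m j - 1))) = (if j = b then 1 else 0)"
      if "j \<le> b" for j
    proof (cases "j = b")
      case False
      have m: "m j = ?p * (b - j)" by (simp add: m_def ab diff_mult_distrib2)
      have "M j < m j" "M j - 1 < m j - 1" using False that card_ge_3 unfolding M_def m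
      proof -
        obtain q where q: "?p = Suc q" "q > 0" using card_ge_3 by (cases ?p) auto
        have "q * (b - j) > 0" using q(2) False that by simp
        then show "(?p - 1) * (b - j) < ?p * (b - j)" "(?p - 1) * (b - j) - 1 < ?p * (b - j) - 1"
          using False that unfolding q(1) by (simp_all, linarith+)
      qed
      then show ?thesis using False by (simp add: binomial_eq_0)
    qed (simp add: M_def m_def ab)
    have "even (a + b)" using odd_card by (simp add: ab)
    have "a div ?p = b" by (simp add: ab)
    then have "(\<Sum>j\<le>a div ?p. (- 1) ^ (a + j) * (F_of (M j choose m j) - (if m j = 0 then 0 else F_of ((M j - 1) choose (m j - 1)))) * x j)
      = (\<Sum>j\<le>b. if j = b then (- 1) ^ (a + b) * x b else 0)"
      by (intro sum.cong) (auto simp: z)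
    also have "\<dots> = x b" using \<open>even (a + b)\<close> by (simp add: sum.delta)
    finally show ?thesis by (simp add: x_def that)
  qed
  finally show ?thesis by (simp add: x_def M_def m_def)
qed

end

subsection \<open>Products of two reduced powers\<close>

definition smon :: "nat fset \<Rightarrow> nat \<Rightarrow> nat \<Rightarrow> mono" where
  "smon S i j = (S, Poly_Mapping.single 1 i + Poly_Mapping.single 2 j)"

definition hgood :: "mono \<Rightarrow> mono \<Rightarrow> bool" where
  "hgood b c \<longleftrightarrow> fst b = {||} \<and> Poly_Mapping.keys (snd b) \<subseteq> {0, 1} \<and> fst c |\<subseteq>| {|0|} \<and> Poly_Mapping.keys (snd c) \<subseteq> {0, 1}"

text \<open>The image of \<open>b \<otimes> c\<close> in \<open>\<F>\<^sub>p[s, t] \<otimes> \<Lambda>(\<tau>\<^sub>0)\<close> under \<open>u \<mapsto> 1\<close>, \<open>\<xi>\<^sub>1 \<otimes> 1 \<mapsto> s\<close>, \<open>1 \<otimes> \<xi>\<^sub>1 \<mapsto> t\<close>,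
  \<open>1 \<otimes> \<tau>\<^sub>0 \<mapsto> \<tau>\<^sub>0\<close>, with all other generators going to \<open>0\<close>; the variables with index \<open>1\<close> and \<open>2\<close>
  play the roles of \<open>s\<close> and \<open>t\<close>.\<close>

definition hh :: "(mono \<times> mono, 'k::field) salg \<Rightarrow> (mono, 'k) salg" where
  "hh = slin (\<lambda>(b, c). if hgood b c
    then bs (smon (fst c) (Poly_Mapping.lookup (snd b) 1) (Poly_Mapping.lookup (snd c) 1)) else 0)"

lemma smon_mult: "mon (smon S i j) c * mon (smon T k l) d
    = mon (smon (S |\<union>| T) (i + k) (j + l)) (c * d * of_int (bsg (S, 0 :: nat \<Rightarrow>\<^sub>0 nat) (T, 0)))"
  by (simp add: smon_def mon_mult bpl_mono bsg_mono single_add add_ac)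

lemma smon_inject: "smon S i j = smon T k l \<longleftrightarrow> S = T \<and> i = k \<and> j = l"
proof
  assume a: "smon S i j = smon T k l"
  then have "S = T" and e: "Poly_Mapping.single 1 i + Poly_Mapping.single 2 j = (Poly_Mapping.single 1 k + Poly_Mapping.single 2 l :: nat \<Rightarrow>\<^sub>0 nat)"
    by (auto simp: smon_def)
  show "S = T \<and> i = k \<and> j = l"
    using \<open>S = T\<close> arg_cong[OF e, of "\<lambda>f. Poly_Mapping.lookup f 1"] arg_cong[OF e, of "\<lambda>f. Poly_Mapping.lookup f 2"]
    by (simp add: lookup_add lookup_single)
qed simp

lemma slinear_hh: "slinear hh" by (simp add: hh_def)

lemma hh_bs: "hh (bs (b, c)) = (if hgood b c
    then bs (smon (fst c) (Poly_Mapping.lookup (snd b) 1) (Poly_Mapping.lookup (snd c) 1)) else 0)"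
  by (simp add: hh_def)

lemma alghom_hh: "alghom (hh :: (mono \<times> mono, 'k::field) salg \<Rightarrow> _)"
proof (rule alghomI[OF slinear_hh])
  show "hh (bs bone) = (1 :: (mono, 'k) salg)"
    by (simp add: bone_prod_def[of, where 'a = mono and 'b = mono] hh_bs one_salg_eq bone_mono hgood_def smon_def)
  fix x y :: "mono \<times> mono"
  obtain S e T f S' e' T' f' where [simp]: "x = ((S, e), (T, f))" "y = ((S', e'), (T', f'))"
    by (metis surj_pair)
  have p: "bpl x y = ((S |\<union>| S', e + e'), (T |\<union>| T', f + f'))"
    by (simp add: bpl_prod_def[of "((S, e), _)"] bpl_mono)
  show "hh (bs x) * hh (bs y) = sc (of_int (bsg x y)) (hh (bs (bpl x y)) :: (mono, 'k) salg)"
  proof (cases "hgood (S, e) (T, f) \<and> hgood (S', e') (T', f')")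
    case True
    have "bsg x y = (- 1) ^ (bpar (T, f) * bpar (S', e')) * (bsg (S, e) (S', e') * bsg (T, f) (T', f'))"
      by (simp add: bsg_prod_def[of "((S, e), _)"])
    then have "bsg x y = bsg (T, 0 :: nat \<Rightarrow>\<^sub>0 nat) (T', 0)"
      using True by (simp only: hgood_def bsg_mono bpar_mono) (simp add: inversions_def)
    moreover have "hgood (S |\<union>| S', e + e') (T |\<union>| T', f + f')"
      using True by (auto simp: hgood_def keys_add_nat)
    ultimately show ?thesis using True unfolding p by (simp add: hh_bs smon_mult lookup_add)
  next
    case False
    then have "\<not> hgood (S |\<union>| S', e + e') (T |\<union>| T', f + f')"
      by (auto simp: hgood_def keys_add_nat)
    then show ?thesis using False unfolding p by (auto simp: hh_bs)
  qed
qed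

lemma xig_power_bs: "xig j ^ n = bs ({||}, if j = 0 then Poly_Mapping.single 0 (2 * n) else Poly_Mapping.single j n)"
proof (cases "j = 0")
  case True
  then have "xig j ^ n = pgen 0 ^ (2 * n)" by (simp add: xig_def power_mult)
  then show ?thesis using True by (simp add: pgen_power)
qed (simp add: xig_def pgen_power)

text \<open>Setting \<open>u\<close> to 1 sums over all powers of \<open>u\<close>, as the
  functionals do, so that their value is a single coefficient in the image.\<close>

lemma evl_hh:
  "evl (\<lambda>(b, c). phiP i b * phiP j c) x = coef (hh x) (smon {||} i j)"
  "evl (\<lambda>(b, c). phiP i b * (if fst c = {|0|} \<and> Poly_Mapping.keys (snd c) \<subseteq> {0, 1} \<and> Poly_Mapping.lookup (snd c) 1 = j then 1 else 0)) x
    = coef (hh x) (smon {|0|} i j)"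
  for x :: "(mono \<times> mono, 'k::field) salg"
proof -
  show "evl (\<lambda>(b, c). phiP i b * phiP j c) x = coef (hh x) (smon {||} i j)"
    unfolding evl_coef by (subst evl_slinear[OF slinear_hh], rule evl_cong)
      (auto simp: hh_bs phiP_def hgood_def smon_inject)
  show "evl (\<lambda>(b, c). phiP i b * (if fst c = {|0|} \<and> Poly_Mapping.keys (snd c) \<subseteq> {0, 1} \<and> Poly_Mapping.lookup (snd c) 1 = j then 1 else 0)) x
    = coef (hh x) (smon {|0|} i j)"
    unfolding evl_coef by (subst evl_slinear[OF slinear_hh], rule evl_cong)
      (auto simp: hh_bs phiP_def hgood_def smon_inject)
qed

context odd_prime
begin

abbreviation sgen :: "(mono, 'p mod_ring) salg" where "sgen \<equiv> bs (smon {||} 1 0)"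
abbreviation tgen :: "(mono, 'p mod_ring) salg" where "tgen \<equiv> bs (smon {||} 0 1)"

lemma smon_power: "bs (smon {||} i j) ^ n = (bs (smon {||} (n * i) (n * j)) :: (mono, 'p mod_ring) salg)"
proof (induction n)
  case 0
  show ?case by (simp add: one_salg_eq smon_def bone_mono)
next
  case (Suc n)
  then show ?case by (simp add: smon_mult bsg_mono inversions_def)
qed

lemma hh_ten_xi_xi: "hh (ten (xig k ^ n) (xig l ^ m) :: (_, 'p mod_ring) salg)
    = (if k \<le> 1 \<and> l \<le> 1 \<or> n = 0 \<and> l \<le> 1 \<or> k \<le> 1 \<and> m = 0 \<or> n = 0 \<and> m = 0
       then bs (smon {||} (if k = 1 then n else 0) (if l = 1 then m else 0)) else 0)"
  by (auto simp: xig_power_bs hh_bs hgood_def lookup_single when_def split: if_splits)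

lemma hh_ten_xi_tau: "n > 0 \<Longrightarrow> hh (ten (xig k ^ n) (taug i) :: (_, 'p mod_ring) salg)
    = (if k \<le> 1 \<and> i = 0 then bs (smon {|0|} (if k = 1 then n else 0) 0) else 0)"
  by (auto simp: xig_power_bs taug_def hh_bs hgood_def lookup_single when_def split: if_splits)

lemma hh_ten_tau: "hh (ten (taug i) (pgen 0) :: (_, 'p mod_ring) salg) = 0"
  by (simp add: taug_def pgen_def hh_bs hgood_def)

lemma hh_Dtau: "hh (Dtau i :: (_, 'p mod_ring) salg)
    = (if i = 0 then bs (smon {|0|} 0 0) else if i = 1 then bs (smon {|0|} 1 0) else 0)"
proof -
  have "hh (Dtau i :: (_, 'p mod_ring) salg) = (\<Sum>s\<le>i. if s = 0
      then (if i \<le> 1 then bs (smon {|0|} (if i = 1 then 1 else 0) 0) else 0) else 0)"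
    unfolding Dtau_def slinearD(1,5)[OF slinear_hh] hh_ten_tau
    by (simp only: add_0_right, intro sum.cong refl) (auto simp: hh_ten_xi_tau[OF card_power_pos])
  then show ?thesis by (simp add: sum.delta)
qed

lemma hh_Dpol: "hh (Dpol j :: (_, 'p mod_ring) salg)
    = (if j = 0 then 1 else if j = 1 then sgen + tgen
       else if j = 2 then bs (smon {||} CARD('p) 1) else 0)"
proof -
  have t: "hh (ten (xig (j - s) ^ (CARD('p) ^ s)) (xig s) :: (_, 'p mod_ring) salg)
      = (if j - s \<le> 1 \<and> s \<le> 1 then bs (smon {||} (if j - s = 1 then CARD('p) ^ s else 0) (if s = 1 then 1 else 0)) else 0)" for s
    using hh_ten_xi_xi[of "j - s" "CARD('p) ^ s" s 1] by auto
  have d: "hh (Dxi j :: (_, 'p mod_ring) salg) = (\<Sum>s\<le>j. if j - s \<le> 1 \<and> s \<le> 1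
      then bs (smon {||} (if j - s = 1 then CARD('p) ^ s else 0) (if s = 1 then 1 else 0)) else 0)"
    unfolding Dxi_def slinearD(5)[OF slinear_hh] t ..
  consider "j = 0" | "j = 1" | "j = 2" | "j > 2" by linarith
  then show ?thesis
  proof cases
    case 1
    then show ?thesis
      by (simp add: Dpol_def pgen_def hh_bs hgood_def smon_def one_salg_eq bone_mono lookup_single)
  next
    case 2
    then have "hh (Dpol j :: (_, 'p mod_ring) salg) = hh (Dxi j)" by (simp add: Dpol_def)
    then show ?thesis unfolding d using 2 by (simp add: atMost_Suc)
  next
    case 3
    have "{..2 :: nat} = {0, 1, 2}" by auto
    moreover have "hh (Dpol j :: (_, 'p mod_ring) salg) = hh (Dxi j)" using 3 by (simp add: Dpol_def)
    ultimately show ?thesis unfolding d using 3 by simp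
  next
    case 4
    then have "hh (Dxi j :: (_, 'p mod_ring) salg) = 0" unfolding d by (intro sum.neutral) auto
    then show ?thesis using 4 by (simp add: Dpol_def)
  qed
qed

lemma hh_cop: "hh (cop (bs (S, e)) :: (_, 'p mod_ring) salg)
    = oprod (\<lambda>i. hh (Dtau i)) (fset S) * eprod (\<lambda>j. hh (Dpol j)) e"
  unfolding cop_def ghom_bs by (simp add: alghomD(2)[OF alghom_hh] alghom_oprod[OF alghom_hh] alghom_eprod[OF alghom_hh])

lemma prod_list_zero: "(0 :: 'z::ring_1) \<in> set xs \<Longrightarrow> prod_list xs = 0"
  by (induction xs) auto

lemma hh_eprod:
  "eprod (\<lambda>j. hh (Dpol j :: (_, 'p mod_ring) salg)) e = (if Poly_Mapping.keys e \<subseteq> {0, 1, 2}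
    then (sgen + tgen) ^ Poly_Mapping.lookup e 1 * bs (smon {||} CARD('p) 1) ^ Poly_Mapping.lookup e 2 else 0)"
proof (cases "Poly_Mapping.keys e \<subseteq> {0, 1, 2}")
  case True
  then have "Poly_Mapping.keys e \<subseteq> {..<3}" by auto
  moreover have "[0..<3] = [0, 1, 2 :: nat]" by (simp add: upt_rec numeral_3_eq_3 numeral_2_eq_2)
  ultimately show ?thesis using True by (simp add: eprod_upt[of e 3] hh_Dpol)
next
  case False
  then obtain j where j: "j \<in> Poly_Mapping.keys e" "j \<notin> {0, 1, 2}" by blast
  then have "hh (Dpol j :: (_, 'p mod_ring) salg) ^ Poly_Mapping.lookup e j = 0"
    by (simp add: hh_Dpol in_keys_iff power_0_left)
  then have "0 \<in> set (map (\<lambda>j. hh (Dpol j :: (_, 'p mod_ring) salg) ^ Poly_Mapping.lookup e j)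
      (sorted_list_of_set (Poly_Mapping.keys e)))"
    using j by (force simp: image_iff)
  then show ?thesis using False unfolding eprod_def by (simp add: prod_list_zero del: set_map)
qed

lemma hh_oprod:
  "oprod (\<lambda>i. hh (Dtau i :: (_, 'p mod_ring) salg)) (fset S) = (if S = {||} then 1
    else if S = {|0|} then bs (smon {|0|} 0 0) else if S = {|1|} then bs (smon {|0|} 1 0) else 0)"
proof -
  consider "S = {||}" | "S = {|0|}" | "S = {|1|}" | "S = {|0, 1|}" | "\<exists>i. i |\<in>| S \<and> i \<ge> 2"
  proof -
    have "fset S \<in> Set.Pow {0, 1}" if "\<not> (\<exists>i. i |\<in>| S \<and> i \<ge> 2)"
    proof -
      have "i = 0 \<or> i = 1" if "i |\<in>| S" for i
        using \<open>\<not> (\<exists>i. i |\<in>| S \<and> i \<ge> 2)\<close> that less_2_cases[of i] by (metis One_nat_def linorder_not_less)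
      then show ?thesis by auto
    qed
    moreover have "Set.Pow {0 :: nat, 1} = {{}, {0}, {1}, {0, 1}}" by (simp add: Pow_insert) blast
    ultimately have "(\<exists>i. i |\<in>| S \<and> i \<ge> 2) \<or> fset S = fset {||} \<or> fset S = fset {|0|} \<or> fset S = fset {|1|}
        \<or> fset S = fset {|0, 1|}" by auto
    then show thesis using that unfolding fset_inject by blast
  qed
  then show ?thesis
  proof cases
    case 4
    have "oprod f {0, 1} = f 0 * f 1" for f :: "nat \<Rightarrow> (mono, 'p mod_ring) salg"
      using oprod_insert_min[of "{1 :: nat}" 0 f] oprod_insert_min[of "{}" 1 f] by simp
    then have "oprod (\<lambda>i. hh (Dtau i :: (_, 'p mod_ring) salg)) (fset S) = 0"
      using 4 by (simp add: hh_Dtau smon_mult bsg_mono)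
    moreover have "0 |\<in>| S" "1 |\<in>| S" using 4 by simp_all
    then have "S \<noteq> {||}" "S \<noteq> {|0|}" "S \<noteq> {|1|}" by auto
    ultimately show ?thesis by simp
  next
    case 5
    then obtain i where i: "i |\<in>| S" "i \<ge> 2" by auto
    then have "hh (Dtau i :: (_, 'p mod_ring) salg) = 0" by (simp add: hh_Dtau)
    then have "0 \<in> set (map (\<lambda>i. hh (Dtau i :: (_, 'p mod_ring) salg)) (sorted_list_of_set (fset S)))"
      using i by (force simp: image_iff)
    moreover have "S \<noteq> {||}" "S \<noteq> {|0|}" "S \<noteq> {|1|}" using i by auto
    ultimately show ?thesis unfolding oprod_def by (simp add: prod_list_zero del: set_map)
  qed (auto simp: oprod_def hh_Dtau)
qed

text \<open>The factor \<open>smon U q 0\<close> is the image of the exterior part of a monomial: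
  \<open>q = 1\<close> for \<open>\<tau>\<^sub>1\<close>, and \<open>q = 0\<close> for
  \<open>\<tau>\<^sub>0\<close> or no factor.\<close>

lemma coef_binomial_part:
  "coef (bs (smon U q 0) * ((sgen + tgen) ^ r * bs (smon {||} CARD('p) 1) ^ k)) (smon V a b)
    = (if U = V \<and> q \<le> a then adem_coeff r k (a - q) b else 0)"
proof -
  have c: "sgen * tgen = tgen * sgen" by (simp add: smon_mult bsg_mono inversions_def)
  have "bs (smon U q 0) * ((sgen + tgen) ^ r * bs (smon {||} CARD('p) 1) ^ k)
    = (\<Sum>i\<le>r. mon (smon U (q + (i + k * CARD('p))) (r - i + k)) (F_of (r choose i)))"
    unfolding commuting_binomial[OF c] sum_distrib_left sum_distrib_right smon_power
    by (rule sum.cong) (simp_all add: of_nat_mult_sc smon_mult bsg_mono inversions_def)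
  then have e: "coef (bs (smon U q 0) * ((sgen + tgen) ^ r * bs (smon {||} CARD('p) 1) ^ k)) (smon V a b)
    = (\<Sum>i\<le>r. if U = V \<and> q + (i + k * CARD('p)) = a \<and> r - i + k = b then F_of (r choose i) else 0)"
    by (simp add: coef_mon smon_inject)
  show ?thesis
  proof (cases "U = V \<and> q \<le> a \<and> a - q + b = r + (CARD('p) + 1) * k \<and> k \<le> b \<and> b - k \<le> r")
    case True
    have "(U = V \<and> q + (i + k * CARD('p)) = a \<and> r - i + k = b) \<longleftrightarrow> i = r - (b - k)" if "i \<le> r" for i
      using True that by (auto simp: algebra_simps)
    then have "(\<Sum>i\<le>r. if U = V \<and> q + (i + k * CARD('p)) = a \<and> r - i + k = b then F_of (r choose i) else 0)
      = (\<Sum>i\<le>r. if i = r - (b - k) then F_of (r choose (r - (b - k))) else 0)"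
      by (intro sum.cong) auto
    also have "\<dots> = F_of (r choose (r - (b - k)))" by (subst sum.delta) auto
    also have "r choose (r - (b - k)) = r choose (b - k)"
      using True binomial_symmetric[of "b - k" r] by simp
    finally show ?thesis using True unfolding e by (simp add: adem_coeff_def)
  next
    case False
    have "\<not> (U = V \<and> q + (i + k * CARD('p)) = a \<and> r - i + k = b)" if "i \<le> r" for i
      using False that by (auto simp: algebra_simps)
    then have "(\<Sum>i\<le>r. if U = V \<and> q + (i + k * CARD('p)) = a \<and> r - i + k = b then F_of (r choose i) else 0) = 0"
      by (intro sum.neutral) auto
    moreover have "(if U = V \<and> q \<le> a then adem_coeff r k (a - q) b else 0) = 0"
      using False by (auto simp: adem_coeff_def binomial_eq_0)
    ultimately show ?thesis unfolding e by simp
  qed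
qed

lemma conv_PP: "conv (phiP a) (phiP b) (S, e) = (if S = {||} \<and> Poly_Mapping.keys e \<subseteq> {0, 1, 2}
    then adem_coeff (Poly_Mapping.lookup e 1) (Poly_Mapping.lookup e 2) a b else 0)"
proof -
  have o: "(1 :: (mono, 'p mod_ring) salg) = bs (smon {||} 0 0)" by (simp add: smon_def one_salg_eq bone_mono)
  show ?thesis
    unfolding conv_def evl_hh hh_cop hh_eprod hh_oprod
    using coef_binomial_part[of "{||}" 0 _ _ "{||}" a b] coef_binomial_part[of "{|0|}" _ _ _ "{||}" a b]
    by (auto simp: o simp del: mult_1_left)
qed

definition phiBP :: "nat \<Rightarrow> mono \<Rightarrow> 'p mod_ring" where
  "phiBP j c = (if fst c = {|0|} \<and> Poly_Mapping.keys (snd c) \<subseteq> {0, 1} \<and> Poly_Mapping.lookup (snd c) 1 = j then 1 else 0)"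

lemma fminus_zero_eq: "0 |\<in>| S \<Longrightarrow> (S |-| {|0 :: nat|} = {||}) = (S = {|0|})"
  by (transfer, auto)

lemma conv_BP: "conv phiB (phiP j) = phiBP j"
proof
  fix c :: mono
  obtain S e where c: "c = (S, e)" by (cases c)
  show "conv phiB (phiP j) c = phiBP j c"
  proof (cases "0 |\<in>| S")
    case True
    show ?thesis
      unfolding c conv_phiB phi_addu
      by (simp only: phiBP_def phiP_def fst_conv snd_conv fminus_zero_eq[OF True] True if_True)
  next
    case False
    then have "S \<noteq> {|0|}" by blast
    then show ?thesis using False by (simp add: c conv_phiB phiBP_def)
  qed
qed

text \<open>\<open>\<tau>\<^sub>0\<close> goes to \<open>\<tau>\<^sub>0\<close> and
  \<open>\<tau>\<^sub>1\<close> to \<open>s * \<tau>\<^sub>0\<close>; the additional factor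
  \<open>s\<close> is responsible for \<open>a - 1\<close>.\<close>

lemma conv_PBP: "conv (phiP a) (conv phiB (phiP b)) (S, e) = (if Poly_Mapping.keys e \<subseteq> {0, 1, 2} then
    (if S = {|0|} then adem_coeff (Poly_Mapping.lookup e 1) (Poly_Mapping.lookup e 2) a b
     else if S = {|1|} \<and> a > 0 then adem_coeff (Poly_Mapping.lookup e 1) (Poly_Mapping.lookup e 2) (a - 1) b
     else 0) else 0)"
proof -
  have o: "(1 :: (mono, 'p mod_ring) salg) = bs (smon {||} 0 0)" by (simp add: smon_def one_salg_eq bone_mono)
  show ?thesis
    unfolding conv_BP conv_def phiBP_def evl_hh hh_cop hh_eprod hh_oprod
    using coef_binomial_part[of "{||}" 0 _ _ "{|0|}" a b] coef_binomial_part[of "{|0|}" 0 _ _ "{|0|}" a b]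
      coef_binomial_part[of "{|0|}" 1 _ _ "{|0|}" a b]
    by (auto simp: o simp del: mult_1_left)
qed

lemma conv_BPP: "conv phiB (conv (phiP a) (phiP b)) (S, e) = (if S = {|0|} \<and> Poly_Mapping.keys e \<subseteq> {0, 1, 2}
    then adem_coeff (Poly_Mapping.lookup e 1) (Poly_Mapping.lookup e 2) a b else 0)"
proof (cases "0 |\<in>| S")
  case True
  have "addu (S |-| {|0|}, e) = (S |-| {|0|}, e + Poly_Mapping.single 0 1)" by (simp add: addu_def)
  moreover have "(Poly_Mapping.keys (e + Poly_Mapping.single 0 1) \<subseteq> {0, 1, 2}) = (Poly_Mapping.keys e \<subseteq> {0, 1, 2})"
    by (simp add: keys_add_nat)
  moreover have "Poly_Mapping.lookup (e + Poly_Mapping.single 0 1) 1 = Poly_Mapping.lookup e 1"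
    "Poly_Mapping.lookup (e + Poly_Mapping.single 0 1) 2 = Poly_Mapping.lookup e 2"
    by (simp_all add: lookup_add lookup_single)
  ultimately show ?thesis
    by (simp only: conv_phiB True if_True conv_PP fminus_zero_eq[OF True])
next
  case False
  then have "S \<noteq> {|0|}" by blast
  then show ?thesis using False by (simp add: conv_phiB)
qed

lemma conv_BB: "conv phiB phiB d = (0 :: 'p mod_ring)"
proof -
  obtain S e where "d = (S, e)" by (cases d)
  moreover have "0 |\<notin>| S |-| {|0|}" by simp
  then have "S |-| {|0|} \<noteq> {|0|}" by (metis finsertI1)
  ultimately show ?thesis by (simp only: conv_phiB phi_addu) (simp only: phiB_def fst_conv, simp)
qed

lemma phiP_0: "phiP 0 = ch {0}"
  by (auto simp: fun_eq_iff phiP_def ch_def in_keys_iff subset_iff)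

end

section \<open>The pairing between the Steenrod algebra and the bialgebra\<close>

fun unword :: "'g word \<Rightarrow> 'g list" where "unword (Word l) = l"

lemma unword_plus: "unword (v + w) = unword v @ unword w"
  by (cases v; cases w) simp

lemma unword_zero: "unword 0 = []"
  by (simp add: zero_word_def)

fun gphi :: "st_gen \<Rightarrow> mono \<Rightarrow> 'p::prime_card mod_ring" where
  "gphi Beta = phiB" | "gphi (Pow i) = phiP i"

fun wphi :: "st_gen list \<Rightarrow> mono \<Rightarrow> 'p::prime_card mod_ring" where
  "wphi [] = ch {0}" | "wphi (g # w) = conv (gphi g) (wphi w)"

definition Phi :: "'p::prime_card st_free \<Rightarrow> mono \<Rightarrow> 'p mod_ring" where
  "Phi f d = (\<Sum>w\<in>Poly_Mapping.keys f. Poly_Mapping.lookup f w * wphi (unword w) d)"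

lemma Phi_superset:
  assumes "finite A" "Poly_Mapping.keys f \<subseteq> A"
  shows "Phi f d = (\<Sum>w\<in>A. Poly_Mapping.lookup f w * wphi (unword w) d)"
  unfolding Phi_def by (rule sum.mono_neutral_left) (use assms in \<open>auto simp: in_keys_iff\<close>)

lemma Phi_add: "Phi (f + g) = (\<lambda>d. Phi f d + Phi g d)"
proof
  fix d
  let ?A = "Poly_Mapping.keys f \<union> Poly_Mapping.keys g"
  have k: "Poly_Mapping.keys (f + g) \<subseteq> ?A" by (rule keys_add)
  show "Phi (f + g) d = Phi f d + Phi g d"
    by (simp add: Phi_superset[OF _ k] Phi_superset[of ?A f] Phi_superset[of ?A g] lookup_add distrib_right sum.distrib)
qed

lemma Phi_single: "Phi (Poly_Mapping.single w c) = (\<lambda>d. c * wphi (unword w) d)"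
  by (rule ext) (subst Phi_superset[of "{w}"], auto)

lemma Phi_zero: "Phi 0 = (\<lambda>d. 0)"
  by (simp add: Phi_def fun_eq_iff)

lemma Phi_uminus: "Phi (- f) = (\<lambda>d. - Phi f d)"
proof
  fix d
  have "Phi (f + - f) d = Phi f d + Phi (- f) d" unfolding Phi_add ..
  then show "Phi (- f) d = - Phi f d" by (simp add: Phi_zero eq_neg_iff_add_eq_0 add.commute)
qed

lemma Phi_diff: "Phi (f - g) = (\<lambda>d. Phi f d - Phi g d)"
  unfolding diff_conv_add_uminus[of f g] Phi_add Phi_uminus by simp

lemma Phi_sum: "Phi (sum f A) = (\<lambda>d. \<Sum>i\<in>A. Phi (f i) d)"
  by (induction A rule: infinite_finite_induct) (auto simp: Phi_zero Phi_add)

lemma Phi_one: "Phi 1 = ch {0}"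
  using Phi_single[of 0 1] by (simp add: unword_zero)

lemma scalar_commute:
  fixes c :: "'k::comm_ring_1" and f :: "'w::monoid_add \<Rightarrow>\<^sub>0 'k"
  shows "Poly_Mapping.single 0 c * f = f * Poly_Mapping.single 0 c"
  by (induction f rule: poly_mapping_single_induct) (auto simp: mult_single distrib_left distrib_right mult.commute)

lemma sign_scalar:
  "(- 1) ^ k * of_nat n = (Poly_Mapping.single 0 ((- 1) ^ k * of_nat n) :: 'w::monoid_add \<Rightarrow>\<^sub>0 'k::comm_ring_1)"
proof -
  have "(- 1) ^ k = (Poly_Mapping.single 0 ((- 1) ^ k) :: 'w \<Rightarrow>\<^sub>0 'k)"
    by (induction k) (simp_all add: mult_single single_uminus)
  moreover have "of_nat n = (Poly_Mapping.single 0 (of_nat n) :: 'w \<Rightarrow>\<^sub>0 'k)" by simp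
  ultimately show ?thesis by (metis add.left_neutral mult_single)
qed

section \<open>Homogeneous elements and the relations on a class of given degree\<close>

definition hdeg :: "nat \<Rightarrow> 'p::prime_card st_free \<Rightarrow> bool" where
  "hdeg k f \<longleftrightarrow> (\<forall>w\<in>Poly_Mapping.keys f. word_degree CARD('p) w = k)"

lemma word_degree_plus: "word_degree p (v + w) = word_degree p v + word_degree p w"
  by (cases v; cases w) simp

lemma hdeg_zero [simp]: "hdeg k 0"
  by (simp add: hdeg_def)

lemma hdeg_add: "hdeg k f \<Longrightarrow> hdeg k g \<Longrightarrow> hdeg k (f + g)"
  using keys_add[of f g] by (auto simp: hdeg_def)

lemma hdeg_uminus: "hdeg k f \<Longrightarrow> hdeg k (- f)"
  by (simp add: hdeg_def in_keys_iff)

lemma hdeg_diff: "hdeg k f \<Longrightarrow> hdeg k g \<Longrightarrow> hdeg k (f - g)"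
  using hdeg_add[OF _ hdeg_uminus, of k f g] by simp

lemma hdeg_sum: "(\<And>i. i \<in> A \<Longrightarrow> hdeg k (f i)) \<Longrightarrow> hdeg k (sum f A)"
  by (induction A rule: infinite_finite_induct) (auto intro: hdeg_add)

lemma hdeg_mult: "hdeg k f \<Longrightarrow> hdeg l g \<Longrightarrow> hdeg (k + l) (f * g)"
  using keys_mult[of f g] by (fastforce simp: hdeg_def word_degree_plus)

lemma hdeg_single: "word_degree CARD('p) w = k \<Longrightarrow> hdeg k (Poly_Mapping.single w c :: 'p::prime_card st_free)"
  by (simp add: hdeg_def)

lemma hdeg_scalar [simp]: "hdeg 0 (Poly_Mapping.single 0 c :: 'p::prime_card st_free)"
  by (rule hdeg_single) (simp add: zero_word_def)

lemma hdeg_one [simp]: "hdeg 0 1"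
  using hdeg_scalar[of 1] by simp

lemma hdeg_gens: "hdeg 1 sq_beta" "hdeg (2 * i * (CARD('p) - 1)) (sq_pow i :: 'p::prime_card st_free)"
  by (auto simp: sq_beta_def sq_pow_def intro!: hdeg_single)

lemma hdeg_induct [consumes 1, case_names zero single add]:
  assumes f: "hdeg k (f :: 'p::prime_card st_free)" and "P 0"
    and "\<And>w c. word_degree CARD('p) w = k \<Longrightarrow> P (Poly_Mapping.single w c)"
    and "\<And>f g. P f \<Longrightarrow> P g \<Longrightarrow> P (f + g)"
  shows "P f"
proof -
  have "P (\<Sum>w\<in>A. Poly_Mapping.single w (Poly_Mapping.lookup f w))" if "A \<subseteq> Poly_Mapping.keys f" "finite A" for A
    using that(2,1) by (induction A rule: finite_induct) (use f in \<open>auto intro: assms(2-4) simp: hdeg_def\<close>)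
  then show ?thesis by (subst poly_mapping_sum_singles) auto
qed

text \<open>Homogeneous relations that hold on every class of degree \<open>n\<close> of an unstable module.\<close>

inductive unst_rel :: "nat \<Rightarrow> nat \<Rightarrow> 'p::prime_card st_free \<Rightarrow> bool" for n where
  zero: "unst_rel n d 0"
| add: "unst_rel n d f \<Longrightarrow> unst_rel n d g \<Longrightarrow> unst_rel n d (f + g)"
| adem: "r \<in> adem_relators \<Longrightarrow> hdeg i v \<Longrightarrow> hdeg j r \<Longrightarrow> hdeg l w \<Longrightarrow> d = i + j + l \<Longrightarrow> unst_rel n d (v * r * w)"
| unstable: "hdeg i v \<Longrightarrow> hdeg l w \<Longrightarrow> e \<le> 1 \<Longrightarrow> e + 2 * q > n + l \<Longrightarrow>
    d = i + (e + 2 * q * (CARD('p) - 1)) + l \<Longrightarrow> unst_rel n d (v * (sq_beta ^ e * sq_pow q) * w :: 'p::prime_card st_free)"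

lemma unst_rel_left: "unst_rel n d f \<Longrightarrow> hdeg i h \<Longrightarrow> unst_rel n (i + d) (h * f)"
proof (induction rule: unst_rel.induct)
  case (adem r i' v j l w d)
  have "unst_rel n (i + d) (h * v * r * w)"
    by (rule unst_rel.adem[OF adem(1) hdeg_mult[OF adem.prems adem(2)] adem(3,4)]) (simp add: adem)
  then show ?case by (simp add: mult.assoc)
next
  case (unstable i' v l w e q d)
  have "unst_rel n (i + d) (h * v * (sq_beta ^ e * sq_pow q) * w)"
    by (rule unst_rel.unstable[OF hdeg_mult[OF unstable.prems unstable(1)] unstable(2-4)]) (simp add: unstable)
  then show ?case by (simp add: mult.assoc)
qed (auto intro: unst_rel.intros simp: distrib_left)

lemma unst_rel_scalar: "unst_rel n d f \<Longrightarrow> unst_rel n d (Poly_Mapping.single 0 c * f)"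
  using unst_rel_left[OF _ hdeg_scalar] by fastforce

lemma unst_rel_uminus: "unst_rel n d f \<Longrightarrow> unst_rel n d (- f)"
  using unst_rel_scalar[of n d f "- 1"] by (simp add: single_uminus)

lemma unst_rel_diff: "unst_rel n d f \<Longrightarrow> unst_rel n d g \<Longrightarrow> unst_rel n d (f - g)"
  using unst_rel.add[OF _ unst_rel_uminus, of n d f g] by simp

lemma unst_rel_unstable:
  "hdeg l w \<Longrightarrow> 2 * q > n + l \<Longrightarrow> d = 2 * q * (CARD('p) - 1) + l \<Longrightarrow> unst_rel n d (sq_pow q * w :: 'p::prime_card st_free)"
  "hdeg l w \<Longrightarrow> 2 * q + 1 > n + l \<Longrightarrow> d = 1 + 2 * q * (CARD('p) - 1) + l \<Longrightarrow>
    unst_rel n d (sq_beta * (sq_pow q * w) :: 'p::prime_card st_free)"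
  using unst_rel.unstable[OF hdeg_one, of l w 0 n q d] unst_rel.unstable[OF hdeg_one, of l w 1 n q d]
  by (auto simp: mult.assoc)

lemma unst_rel_pow0: "hdeg l w \<Longrightarrow> unst_rel n l ((sq_pow 0 - 1) * w :: 'p::prime_card st_free)"
proof -
  assume w: "hdeg l w"
  have "hdeg 0 (sq_pow 0 - 1 :: 'p st_free)"
    using hdeg_gens(2)[of 0, where 'p = 'p] by (intro hdeg_diff) auto
  then have "unst_rel n l (1 * (sq_pow 0 - 1) * w :: 'p st_free)"
    by (intro unst_rel.adem[OF _ hdeg_one _ w]) (auto simp: adem_relators_def Let_def)
  then show ?thesis by simp
qed

lemma unst_rel_beta2: "hdeg l w \<Longrightarrow> unst_rel n (2 + l) (sq_beta * (sq_beta * w) :: 'p::prime_card st_free)"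
proof -
  assume w: "hdeg l w"
  have "hdeg 2 (sq_beta * sq_beta :: 'p st_free)" using hdeg_mult[OF hdeg_gens(1) hdeg_gens(1), where 'a = 'p] by (simp add: numeral_2_eq_2)
  then have "unst_rel n (2 + l) (1 * (sq_beta * sq_beta) * w :: 'p st_free)"
    by (intro unst_rel.adem[OF _ hdeg_one _ w]) (auto simp: adem_relators_def Let_def)
  then show ?thesis by (simp add: mult.assoc)
qed

lemma wt_gphi:
  "phiP i b \<noteq> (0 :: 'k::field) \<Longrightarrow> ldeg p b = rdeg b + 2 * int i * (int p - 1) \<and> rdeg b \<ge> 2 * int i"
  "phiB b \<noteq> (0 :: 'k::field) \<Longrightarrow> ldeg p b = rdeg b + 1"
  "ch {0} b \<noteq> (0 :: 'k::field) \<Longrightarrow> ldeg p b = rdeg b"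
proof -
  assume "phiP i b \<noteq> (0 :: 'k)"
  then obtain e where b: "b = ({||}, e)" and k: "Poly_Mapping.keys e \<subseteq> {0, 1}" and i: "Poly_Mapping.lookup e 1 = i"
    by (cases b) (auto simp: phiP_def split: if_splits)
  have "ldeg p b = int (Poly_Mapping.lookup e 0) + 2 * int p * int i"
    unfolding b ldeg_def by (subst wt_superset[OF _ k]) (auto simp: i[symmetric])
  moreover have "rdeg b = int (Poly_Mapping.lookup e 0) + 2 * int i"
    using rdeg_even_part[OF k] by (simp only: b i)
  ultimately show "ldeg p b = rdeg b + 2 * int i * (int p - 1) \<and> rdeg b \<ge> 2 * int i"
    by (simp add: algebra_simps)
next
  assume "phiB b \<noteq> (0 :: 'k)"
  then obtain e where b: "b = ({|0|}, e)" and k: "Poly_Mapping.keys e \<subseteq> {0}"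
    by (cases b) (auto simp: phiB_def split: if_splits)
  show "ldeg p b = rdeg b + 1"
    unfolding b ldeg_def rdeg_def by (simp add: wt_superset[OF _ k])
next
  assume "ch {0} b \<noteq> (0 :: 'k)"
  then obtain e where b: "b = ({||}, e)" and k: "Poly_Mapping.keys e \<subseteq> {0}"
    by (cases b) (auto simp: ch_def split: if_splits)
  show "ldeg p b = rdeg b"
    unfolding b ldeg_def rdeg_def by (simp add: wt_superset[OF _ k])
qed

lemma wphi_degree:
  "wphi w b \<noteq> (0 :: 'p::prime_card mod_ring) \<Longrightarrow> ldeg CARD('p) b = rdeg b + int (word_degree CARD('p) (Word w))"
proof (induction w arbitrary: b)
  case Nil
  then show ?case using wt_gphi(3)[of b] by simp
next
  case (Cons g w)
  have p: "int (CARD('p) - 1) = int CARD('p) - 1" by (simp add: of_nat_diff Suc_leI)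
  from Cons.prems obtain b' c where bc: "ldeg CARD('p) b' = ldeg CARD('p) b" "rdeg c = rdeg b"
    "rdeg b' = ldeg CARD('p) c" "gphi g b' \<noteq> (0 :: 'p mod_ring)" "wphi w c \<noteq> (0 :: 'p mod_ring)"
    by (auto elim: conv_nonzero)
  have "ldeg CARD('p) b' = rdeg b' + int (gen_degree CARD('p) g)"
    using bc(4) wt_gphi(1)[of _ b' "CARD('p)"] wt_gphi(2)[of b' "CARD('p)"] by (cases g) (auto simp: p)
  then show ?case using Cons.IH[OF bc(5)] bc by simp
qed

lemma Phi_degree:
  assumes "hdeg k f" "Phi f b \<noteq> (0 :: 'p::prime_card mod_ring)"
  shows "ldeg CARD('p) b = rdeg b + int k"
proof -
  from assms(2) obtain w where "w \<in> Poly_Mapping.keys f" "Poly_Mapping.lookup f w * wphi (unword w) b \<noteq> 0"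
    unfolding Phi_def by (meson sum.not_neutral_contains_not_neutral)
  moreover obtain l where "w = Word l" by (cases w)
  ultimately show ?thesis using assms(1) wphi_degree[of l b, where 'p = 'p] by (auto simp: hdeg_def)
qed

context odd_prime
begin

lemma wphi_append: "wphi (v @ w) = (conv (wphi v) (wphi w) :: mono \<Rightarrow> 'p mod_ring)"
  by (induction v) (simp_all add: conv_counit_left conv_assoc)

lemma conv_zero: "conv (\<lambda>d. 0) \<psi> = (\<lambda>d. 0 :: 'p mod_ring)" "conv \<psi> (\<lambda>d. 0) = (\<lambda>d. 0 :: 'p mod_ring)"
  using conv_cmult_left[of 0 "\<lambda>d. 0" \<psi>] conv_cmult_right[of \<psi> 0 "\<lambda>d. 0"] by (auto simp: fun_eq_iff)

lemma Phi_mult: "Phi (f * g) = (conv (Phi f) (Phi g) :: mono \<Rightarrow> 'p mod_ring)"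
proof (induction f rule: poly_mapping_single_induct)
  case (single v c)
  show ?case
  proof (induction g rule: poly_mapping_single_induct)
    case (single w r)
    show ?case
      by (rule ext) (simp add: mult_single Phi_single unword_plus wphi_append conv_cmult_left conv_cmult_right)
  next
    case (add a b)
    then show ?case by (simp add: distrib_left Phi_add fun_eq_iff conv_add_right)
  qed
next
  case (add a b)
  then show ?case by (simp add: distrib_right Phi_add fun_eq_iff conv_add_left)
qed

lemma Phi_scalar_mult: "Phi (Poly_Mapping.single 0 c * f) = (\<lambda>d. c * Phi f d :: 'p mod_ring)"
  unfolding Phi_mult Phi_single unword_zero wphi.simps by (simp add: fun_eq_iff conv_cmult_left conv_counit_left)

lemma Phi_gens: "Phi sq_beta = (phiB :: mono \<Rightarrow> 'p mod_ring)" "Phi (sq_pow i) = (phiP i :: mono \<Rightarrow> 'p mod_ring)"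
  by (simp_all add: sq_beta_def sq_pow_def Phi_single conv_counit_right)

text \<open>The functionals do not see powers of \<open>u\<close>; this expresses that operations
  commute with suspension.\<close>

lemma Phi_addu: "Phi f (addu b) = (Phi f b :: 'p mod_ring)"
proof -
  have "wphi w (addu b) = (wphi w b :: 'p mod_ring)" for w b
  proof (induction w arbitrary: b)
    case (Cons g w)
    have "gphi g (addu x) = (gphi g x :: 'p mod_ring)" for x by (cases g) auto
    then show ?case by (simp add: conv_addu Cons)
  qed simp
  then show ?thesis by (simp add: Phi_def)
qed

lemma Phi_adem: "r \<in> adem_relators \<Longrightarrow> Phi r = (\<lambda>d. 0 :: 'p mod_ring)"
proof -
  assume "r \<in> adem_relators"
  then consider "r = sq_beta * sq_beta" | "r = sq_pow 0 - 1"
    | a b where "0 < a" "a < CARD('p) * b" "r = sq_pow a * sq_pow b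
      - (\<Sum>j\<le>a div CARD('p). (- 1) ^ (a + j) * of_nat (((CARD('p) - 1) * (b - j) - 1) choose (a - CARD('p) * j))
            * (sq_pow (a + b - j) * sq_pow j))"
    | a b where "0 < a" "a \<le> CARD('p) * b" "r = sq_pow a * sq_beta * sq_pow b
      - (\<Sum>j\<le>a div CARD('p). (- 1) ^ (a + j) * of_nat (((CARD('p) - 1) * (b - j)) choose (a - CARD('p) * j))
            * (sq_beta * sq_pow (a + b - j) * sq_pow j))
      - (\<Sum>j\<le>(a - 1) div CARD('p). (- 1) ^ (a + j - 1) * of_nat (((CARD('p) - 1) * (b - j) - 1) choose (a - CARD('p) * j - 1))
            * (sq_pow (a + b - j) * sq_beta * sq_pow j))"
    unfolding adem_relators_def Let_def by blast
  then show ?thesis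
  proof cases
    case 1
    then show ?thesis by (simp add: Phi_mult Phi_gens conv_BB fun_eq_iff)
  next
    case 2
    then show ?thesis by (simp add: Phi_diff Phi_gens Phi_one phiP_0)
  next
    case (3 a b)
    show ?thesis
    proof
      fix d :: mono
      obtain S e where d: "d = (S, e)" by (cases d)
      show "Phi r d = 0"
      proof (cases "S = {||} \<and> Poly_Mapping.keys e \<subseteq> {0, 1, 2}")
        case True
        then show ?thesis
          unfolding 3(3) d Phi_diff Phi_sum sign_scalar Phi_scalar_mult unfolding Phi_mult Phi_gens conv_PP
          using adem_coeff_sum[OF 3(2), of "Poly_Mapping.lookup e 1" "Poly_Mapping.lookup e 2"] by simp
      next
        case False
        then have z: "conv (phiP i) (phiP j) (S, e) = (0 :: 'p mod_ring)" for i j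
          by (simp only: conv_PP if_False)
        show ?thesis
          unfolding 3(3) d Phi_diff Phi_sum sign_scalar Phi_scalar_mult unfolding Phi_mult Phi_gens z by simp
      qed
    qed
  next
    case (4 a b)
    show ?thesis
    proof
      fix d :: mono
      obtain S e where d: "d = (S, e)" by (cases d)
      let ?x = "adem_coeff (Poly_Mapping.lookup e 1) (Poly_Mapping.lookup e 2)"
      have e: "Phi r d = conv (phiP a) (conv phiB (phiP b)) (S, e)
        - (\<Sum>j\<le>a div CARD('p). (- 1) ^ (a + j) * F_of (((CARD('p) - 1) * (b - j)) choose (a - CARD('p) * j))
            * conv phiB (conv (phiP (a + b - j)) (phiP j)) (S, e))
        - (\<Sum>j\<le>(a - 1) div CARD('p). (- 1) ^ (a + j - 1) * F_of (((CARD('p) - 1) * (b - j) - 1) choose (a - CARD('p) * j - 1))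
            * conv (phiP (a + b - j)) (conv phiB (phiP j)) (S, e))"
        unfolding 4(3) d Phi_diff Phi_sum sign_scalar Phi_scalar_mult unfolding Phi_mult Phi_gens conv_assoc ..
      consider "Poly_Mapping.keys e \<subseteq> {0, 1, 2} \<and> S = {|0|}" | "Poly_Mapping.keys e \<subseteq> {0, 1, 2} \<and> S = {|1|}"
        | "\<not> (Poly_Mapping.keys e \<subseteq> {0, 1, 2} \<and> (S = {|0|} \<or> S = {|1|}))" by blast
      then show "Phi r d = 0"
      proof cases
        case 1
        then show ?thesis
          unfolding e conv_PBP conv_BPP
          using adem_coeff_sum_mixed[OF 4(1,2), of "Poly_Mapping.lookup e 1" "Poly_Mapping.lookup e 2"] by simp
      next
        case 2
        \<comment> \<open>On monomials with \<open>\<tau>\<^sub>1\<close> the first sum of the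
          relation vanishes, and what remains is \<open>adem_coeff_sum\<close> with
          \<open>a - 1\<close> in place of \<open>a\<close>.\<close>
        have n: "{|1|} \<noteq> {|0 :: nat|}" by simp
        have le: "a - 1 < CARD('p) * b" using 4(1,2) by linarith
        have pos: "a + b - j > 0 \<and> a + b - j - 1 = a - 1 + b - j" if "j \<le> (a - 1) div CARD('p)" for j
          using that div_le_dividend[of "a - 1" "CARD('p)"] 4(1) by linarith
        have sg: "a - 1 + j = a + j - 1" "a - CARD('p) * j - 1 = a - 1 - CARD('p) * j" for j
          using 4(1) by auto
        have "Phi r d = ?x (a - 1) b - (\<Sum>j\<le>(a - 1) div CARD('p). (- 1) ^ (a + j - 1)
            * F_of (((CARD('p) - 1) * (b - j) - 1) choose (a - CARD('p) * j - 1)) * ?x (a + b - j - 1) j)"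
          unfolding e conv_PBP conv_BPP using 2 n 4(1) pos by (simp cong: sum.cong_simp)
        also have "\<dots> = 0"
          unfolding adem_coeff_sum[OF le] sg using pos by (simp cong: sum.cong_simp)
        finally show ?thesis .
      next
        case 3
        have "conv (phiP i) (conv phiB (phiP j)) (S, e) = (0 :: 'p mod_ring)"
          "conv phiB (conv (phiP i) (phiP j)) (S, e) = (0 :: 'p mod_ring)" for i j
          using 3 by (auto simp: conv_PBP conv_BPP)
        then show ?thesis unfolding e by simp
      qed
    qed
  qed
qed

text \<open>In the instability case the middle operation meets only monomials of right degree
  \<open>n + l\<close>, by the matching of degrees in the coproduct, whereas its functional vanishes
  in right degrees below \<open>e + 2 * q\<close>.\<close>

lemma unst_rel_sound:
  "unst_rel n d f \<Longrightarrow> rdeg b = int n \<Longrightarrow> Phi f b = (0 :: 'p mod_ring)"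
proof (induction rule: unst_rel.induct)
  case (adem r i v j l w d)
  then show ?case by (simp add: Phi_mult Phi_adem conv_zero)
next
  case (unstable i v l w e q d)
  let ?\<theta> = "sq_beta ^ e * sq_pow q :: 'p st_free"
  show ?case
  proof (rule ccontr)
    assume "Phi (v * ?\<theta> * w) b \<noteq> 0"
    then have "conv (Phi v) (conv (Phi ?\<theta>) (Phi w)) b \<noteq> 0" by (simp add: Phi_mult conv_assoc)
    then obtain c where c: "rdeg c = rdeg b" "conv (Phi ?\<theta>) (Phi w) c \<noteq> 0" by (rule conv_nonzero) blast
    from c(2) obtain x y where x: "rdeg y = rdeg c" "rdeg x = ldeg CARD('p) y" "Phi ?\<theta> x \<noteq> 0" "Phi w y \<noteq> 0"
      by (rule conv_nonzero) blast
    have "rdeg x = int n + int l" using Phi_degree[OF unstable(2) x(4)] x c unstable.prems by simp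
    moreover have "rdeg x \<ge> int e + 2 * int q"
    proof (cases "e = 0")
      case True
      then show ?thesis using x(3) wt_gphi(1)[of q x, where 'k = "'p mod_ring"] by (simp add: Phi_gens)
    next
      case False
      then have e: "e = 1" using unstable by simp
      have "conv phiB (phiP q) x \<noteq> (0 :: 'p mod_ring)" using x(3) by (simp add: e Phi_mult Phi_gens)
      then obtain f where f: "x = ({|0|}, f)" "Poly_Mapping.keys f \<subseteq> {0, 1}" "Poly_Mapping.lookup f 1 = q"
        by (cases x) (auto simp: conv_BP phiBP_def split: if_splits)
      have "rdeg x = 1 + (int (Poly_Mapping.lookup f 0) + 2 * int (Poly_Mapping.lookup f 1))"
        unfolding f(1) rdeg_def by (subst wt_superset[OF _ f(2)]) auto
      then show ?thesis using f(3) e by simp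
    qed
    ultimately show False using unstable by linarith
  qed
qed (simp_all add: Phi_zero Phi_add)

end

subsection \<open>The pairing is perfect on free unstable modules\<close>

text \<open>Up to relations that hold in degree \<open>n\<close>, the element \<open>f\<close> is an operation of top degree, which
  is \<open>P\<^sup>s\<close> on classes of degree \<open>2s\<close> and \<open>\<beta> P\<^sup>s\<close> on classes of degree \<open>2s + 1\<close>, applied to
  another element.\<close>

definition top_op :: "nat \<Rightarrow> nat \<Rightarrow> 'p::prime_card st_free \<Rightarrow> bool" where
  "top_op n d f \<longleftrightarrow> unst_rel n d f
    \<or> (\<exists>s k g r. n + k = 2 * s \<and> n + d = 2 * s * CARD('p) \<and> hdeg k g \<and> unst_rel n d r \<and> f = r + sq_pow s * g)
    \<or> (\<exists>s k g r. n + k = 2 * s + 1 \<and> n + d = 2 * s * CARD('p) + 2 \<and> hdeg k g \<and> unst_rel n d r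
        \<and> f = r + sq_beta * (sq_pow s * g))"

lemma top_op_rel: "unst_rel n d f \<Longrightarrow> top_op n d f"
  by (simp add: top_op_def)

lemma top_op_even:
  "n + k = 2 * s \<Longrightarrow> n + d = 2 * s * CARD('p) \<Longrightarrow> hdeg k g \<Longrightarrow> top_op n d (sq_pow s * g :: 'p::prime_card st_free)"
  unfolding top_op_def by (rule disjI2, rule disjI1) (metis add_0 unst_rel.zero)

lemma top_op_odd:
  "n + k = 2 * s + 1 \<Longrightarrow> n + d = 2 * s * CARD('p) + 2 \<Longrightarrow> hdeg k g \<Longrightarrow>
    top_op n d (sq_beta * (sq_pow s * g) :: 'p::prime_card st_free)"
  unfolding top_op_def by (rule disjI2, rule disjI2) (metis add_0 unst_rel.zero)

lemma top_op_cases [consumes 1, case_names rel even odd]: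
  assumes "top_op n d (f :: 'p::prime_card st_free)"
  obtains "unst_rel n d f"
  | s k g r where "n + k = 2 * s" "n + d = 2 * s * CARD('p)" "hdeg k g" "unst_rel n d r" "f = r + sq_pow s * g"
  | s k g r where "n + k = 2 * s + 1" "n + d = 2 * s * CARD('p) + 2" "hdeg k g" "unst_rel n d r"
      "f = r + sq_beta * (sq_pow s * g)"
  using assms unfolding top_op_def by blast

context odd_prime
begin

lemma card_Suc: obtains q where "CARD('p) = Suc q" "q \<ge> 2" "CARD('p) - 1 = q"
  using card_ge_3 by (cases "CARD('p)") auto

text \<open>Otherwise p would divide 1. Hence \<open>n\<close> and \<open>d\<close> decide which
  kind of top operation can occur.\<close>

lemma top_parity_clash: "2 * s * CARD('p) \<noteq> 2 * s' * CARD('p) + 2"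
proof
  assume "2 * s * CARD('p) = 2 * s' * CARD('p) + 2"
  then have "s * CARD('p) = s' * CARD('p) + 1" by simp
  then have "CARD('p) dvd s' * CARD('p) + 1" by (metis dvd_triv_right)
  then have "CARD('p) dvd 1" by (metis dvd_add_right_iff dvd_triv_right)
  then show False using card_ge_3 by simp
qed

text \<open>Two top operations can be combined under one leading operation because \<open>s\<close>
  and \<open>k\<close> are determined by \<open>n\<close> and \<open>d\<close>.\<close>

lemma top_op_add:
  assumes f: "top_op n d f" and g: "top_op n d (g :: 'p st_free)"
  shows "top_op n d (f + g)"
proof -
  have rel: "top_op n d (r + x)" if r: "unst_rel n d r" and x: "top_op n d x" for r x :: "'p st_free"
    using x
  proof (cases rule: top_op_cases)
    case rel
    then show ?thesis by (intro top_op_rel unst_rel.add r)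
  next
    case (even s k g r')
    then have "unst_rel n d (r + r')" "r + x = (r + r') + sq_pow s * g"
      by (auto intro: unst_rel.add r simp: add.assoc)
    then show ?thesis using even unfolding top_op_def by blast
  next
    case (odd s k g r')
    then have "unst_rel n d (r + r')" "r + x = (r + r') + sq_beta * (sq_pow s * g)"
      by (auto intro: unst_rel.add r simp: add.assoc)
    then show ?thesis using odd unfolding top_op_def by blast
  qed
  from f show ?thesis
  proof (cases rule: top_op_cases)
    case rel': rel
    then show ?thesis by (rule rel) (rule g)
  next
    case (even s k x r)
    note f' = even
    from g show ?thesis
    proof (cases rule: top_op_cases)
      case rel': rel
      then have "top_op n d (g + f)" by (rule rel) (rule f)
      then show ?thesis by (simp add: add.commute)
    next
      case (even s' k' x' r')
      have "s' = s" using f' even by simp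
      moreover from this have "k' = k" using f' even by simp
      ultimately have "f + g = (r + r') + sq_pow s * (x + x')" "hdeg k (x + x')"
        using f' even by (auto simp: distrib_left add_ac intro: hdeg_add)
      then show ?thesis using f' even unfolding top_op_def by (blast intro: unst_rel.add)
    next
      case (odd s' k' x' r')
      then show ?thesis using f' top_parity_clash[of s s'] by simp
    qed
  next
    case (odd s k x r)
    note f' = odd
    from g show ?thesis
    proof (cases rule: top_op_cases)
      case rel': rel
      then have "top_op n d (g + f)" by (rule rel) (rule f)
      then show ?thesis by (simp add: add.commute)
    next
      case (odd s' k' x' r')
      have "s' = s" using f' odd by simp
      moreover from this have "k' = k" using f' odd by simp
      ultimately have "f + g = (r + r') + sq_beta * (sq_pow s * (x + x'))" "hdeg k (x + x')"
        using f' odd by (auto simp: distrib_left add_ac intro: hdeg_add)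
      then show ?thesis using f' odd unfolding top_op_def by (blast intro: unst_rel.add)
    next
      case (even s' k' x' r')
      then show ?thesis using f' top_parity_clash[of s' s] by simp
    qed
  qed
qed

lemma top_op_sum: "(\<And>i. i \<in> A \<Longrightarrow> top_op n d (f i)) \<Longrightarrow> top_op n d (sum f A :: 'p st_free)"
  by (induction A rule: infinite_finite_induct) (auto intro: top_op_add top_op_rel unst_rel.zero)

lemma top_op_scalar:
  assumes "top_op n d f"
  shows "top_op n d (Poly_Mapping.single 0 c * f :: 'p st_free)"
proof -
  have c: "Poly_Mapping.single 0 c * (x * g) = x * (Poly_Mapping.single 0 c * g)" for x g :: "'p st_free"
    by (metis mult.assoc scalar_commute)
  have h: "hdeg k (Poly_Mapping.single 0 c * g)" if "hdeg k g" for k and g :: "'p st_free"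
    using hdeg_mult[OF hdeg_scalar that] by simp
  from assms show ?thesis
  proof (cases rule: top_op_cases)
    case rel
    then show ?thesis by (intro top_op_rel unst_rel_scalar)
  next
    case (even s k g r)
    show ?thesis unfolding even(5) distrib_left c
      by (intro top_op_add top_op_rel[OF unst_rel_scalar] top_op_even[OF even(1,2)] h even)
  next
    case (odd s k g r)
    show ?thesis unfolding odd(5) distrib_left c
      by (intro top_op_add top_op_rel[OF unst_rel_scalar] top_op_odd[OF odd(1,2)] h odd)
  qed
qed

lemma unst_rel_adem1:
  assumes "0 < a" "a < CARD('p) * b" "hdeg l w"
  shows "unst_rel n (2 * (a + b) * (CARD('p) - 1) + l) (sq_pow a * (sq_pow b * w)
    - (\<Sum>j\<le>a div CARD('p). Poly_Mapping.single 0 ((- 1) ^ (a + j) * of_nat (((CARD('p) - 1) * (b - j) - 1) choose (a - CARD('p) * j)))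
      * (sq_pow (a + b - j) * (sq_pow j * w))) :: 'p st_free)"
proof -
  let ?c = "\<lambda>j. Poly_Mapping.single 0 ((- 1) ^ (a + j) * of_nat (((CARD('p) - 1) * (b - j) - 1) choose (a - CARD('p) * j))) :: 'p st_free"
  let ?r = "sq_pow a * sq_pow b - (\<Sum>j\<le>a div CARD('p). ?c j * (sq_pow (a + b - j) * sq_pow j))"
  have le: "j \<le> a" if "j \<le> a div CARD('p)" for j using that div_le_dividend[of a "CARD('p)"] by linarith
  have deg: "hdeg (2 * (a + b) * (CARD('p) - 1)) (sq_pow x * sq_pow y :: 'p st_free)" if "x + y = a + b" for x y
    using hdeg_mult[OF hdeg_gens(2)[of x] hdeg_gens(2)[of y], where 'a = 'p] that
    by (metis distrib_right distrib_left)
  have "hdeg (2 * (a + b) * (CARD('p) - 1)) ?r"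
  proof (intro hdeg_diff hdeg_sum deg)
    fix j assume "j \<in> {..a div CARD('p)}"
    then have "a + b - j + j = a + b" using le[of j] by simp
    then show "hdeg (2 * (a + b) * (CARD('p) - 1)) (?c j * (sq_pow (a + b - j) * sq_pow j))"
      using hdeg_mult[OF hdeg_scalar deg] by simp
  qed simp
  moreover have "?r \<in> adem_relators"
    unfolding sign_scalar[symmetric] adem_relators_def Let_def using assms by blast
  ultimately have "unst_rel n (2 * (a + b) * (CARD('p) - 1) + l) (1 * ?r * w)"
    by (intro unst_rel.adem[OF _ hdeg_one _ assms(3)]) auto
  then show ?thesis by (simp only: mult_1_left left_diff_distrib sum_distrib_right mult.assoc)
qed

lemma unst_rel_adem2:
  assumes "0 < a" "a \<le> CARD('p) * b" "hdeg l w"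
  shows "unst_rel n (1 + 2 * (a + b) * (CARD('p) - 1) + l) (sq_pow a * (sq_beta * (sq_pow b * w))
    - (\<Sum>j\<le>a div CARD('p). Poly_Mapping.single 0 ((- 1) ^ (a + j) * of_nat (((CARD('p) - 1) * (b - j)) choose (a - CARD('p) * j)))
      * (sq_beta * (sq_pow (a + b - j) * (sq_pow j * w))))
    - (\<Sum>j\<le>(a - 1) div CARD('p). Poly_Mapping.single 0 ((- 1) ^ (a + j - 1) * of_nat (((CARD('p) - 1) * (b - j) - 1) choose (a - CARD('p) * j - 1)))
      * (sq_pow (a + b - j) * (sq_beta * (sq_pow j * w)))) :: 'p st_free)"
proof -
  let ?c = "\<lambda>j. Poly_Mapping.single 0 ((- 1) ^ (a + j) * of_nat (((CARD('p) - 1) * (b - j)) choose (a - CARD('p) * j))) :: 'p st_free"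
  let ?c' = "\<lambda>j. Poly_Mapping.single 0 ((- 1) ^ (a + j - 1) * of_nat (((CARD('p) - 1) * (b - j) - 1) choose (a - CARD('p) * j - 1))) :: 'p st_free"
  let ?r = "sq_pow a * sq_beta * sq_pow b - (\<Sum>j\<le>a div CARD('p). ?c j * (sq_beta * sq_pow (a + b - j) * sq_pow j))
    - (\<Sum>j\<le>(a - 1) div CARD('p). ?c' j * (sq_pow (a + b - j) * sq_beta * sq_pow j))"
  have le: "j \<le> a" if "j \<le> a div CARD('p)" for j using that div_le_dividend[of a "CARD('p)"] by linarith
  have le': "j \<le> a" if "j \<le> (a - 1) div CARD('p)" for j using that div_le_dividend[of "a - 1" "CARD('p)"] by linarith
  let ?d = "1 + 2 * (a + b) * (CARD('p) - 1)"
  have deg: "hdeg ?d (sq_pow x * sq_beta * sq_pow y :: 'p st_free)" "hdeg ?d (sq_beta * sq_pow x * sq_pow y :: 'p st_free)"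
    if "x + y = a + b" for x y
  proof -
    have e: "2 * x * (CARD('p) - 1) + 1 + 2 * y * (CARD('p) - 1) = ?d" "1 + 2 * x * (CARD('p) - 1) + 2 * y * (CARD('p) - 1) = ?d"
      unfolding that[symmetric] by (simp_all add: algebra_simps)
    show "hdeg ?d (sq_pow x * sq_beta * sq_pow y :: 'p st_free)" "hdeg ?d (sq_beta * sq_pow x * sq_pow y :: 'p st_free)"
      by (simp only: e(1)[symmetric], intro hdeg_mult hdeg_gens)
        (simp only: e(2)[symmetric], intro hdeg_mult hdeg_gens)
  qed
  have "hdeg ?d ?r"
  proof (intro hdeg_diff hdeg_sum deg)
    fix j assume "j \<in> {..a div CARD('p)}"
    then have "a + b - j + j = a + b" using le[of j] by simp
    then show "hdeg ?d (?c j * (sq_beta * sq_pow (a + b - j) * sq_pow j))"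
      using hdeg_mult[OF hdeg_scalar deg(2)] by simp
  next
    fix j assume "j \<in> {..(a - 1) div CARD('p)}"
    then have "a + b - j + j = a + b" using le'[of j] by simp
    then show "hdeg ?d (?c' j * (sq_pow (a + b - j) * sq_beta * sq_pow j))"
      using hdeg_mult[OF hdeg_scalar deg(1)] by simp
  qed simp
  moreover have "?r \<in> adem_relators"
    unfolding sign_scalar[symmetric] adem_relators_def Let_def using assms by blast
  ultimately have "unst_rel n (?d + l) (1 * ?r * w)"
    by (intro unst_rel.adem[OF _ hdeg_one _ assms(3)]) auto
  then show ?thesis by (simp only: mult_1_left left_diff_distrib sum_distrib_right mult.assoc)
qed

lemma hdeg_pow_mult: "hdeg k g \<Longrightarrow> hdeg (2 * s * (CARD('p) - 1) + k) (sq_pow s * g :: 'p st_free)"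
  by (rule hdeg_mult[OF hdeg_gens(2)])

lemma hdeg_beta_mult: "hdeg k g \<Longrightarrow> hdeg (1 + k) (sq_beta * g :: 'p st_free)"
  by (rule hdeg_mult[OF hdeg_gens(1)])

lemma top_op_pow0: "hdeg d f \<Longrightarrow> top_op n d f \<Longrightarrow> top_op n d (sq_pow 0 * f :: 'p st_free)"
  using top_op_add[OF top_op_rel[OF unst_rel_pow0]] by (fastforce simp: left_diff_distrib)

text \<open>In the Adem relations for a reduced power applied to an operation of top degree, instability
  kills all terms but those in which the leftmost operation is again of top degree.\<close>

lemma top_op_pow_even:
  assumes "n + k = 2 * s" "n + d = 2 * s * CARD('p)" "hdeg k (g :: 'p st_free)"
  shows "top_op n (2 * i * (CARD('p) - 1) + d) (sq_pow i * (sq_pow s * g))"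
proof -
  obtain q where q: "CARD('p) = Suc q" "q \<ge> 2" "CARD('p) - 1 = q" by (rule card_Suc)
  have d: "d = 2 * s * q + k" using assms(1,2) unfolding q by (simp add: algebra_simps)
  have hg: "hdeg d (sq_pow s * g)" using hdeg_pow_mult[OF assms(3), of s] by (simp add: d q)
  \<comment> \<open>\<open>sq_pow s * g\<close> takes a class of degree \<open>n\<close> to degree
    \<open>2 * s * p\<close>. There \<open>i = p * s\<close> is the top operation, larger
    \<open>i\<close> are unstable, and smaller ones fall under the Adem relation.\<close>
  consider "i = 0" | "0 < i" "i < CARD('p) * s" | "i = CARD('p) * s" | "i > CARD('p) * s" by linarith
  then show ?thesis
  proof cases
    case 1
    then show ?thesis using top_op_pow0[OF hg] top_op_even[OF assms] by simp
  next
    case 2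
    let ?c = "\<lambda>j. Poly_Mapping.single 0 ((- 1) ^ (i + j) * of_nat (((CARD('p) - 1) * (s - j) - 1) choose (i - CARD('p) * j))) :: 'p st_free"
    let ?S = "\<Sum>j\<le>i div CARD('p). ?c j * (sq_pow (i + s - j) * (sq_pow j * g))"
    have "top_op n (2 * i * (CARD('p) - 1) + d) (sq_pow i * (sq_pow s * g) - ?S)"
      using top_op_rel[OF unst_rel_adem1[OF 2 assms(3), of n]] unfolding d q(3) by (simp add: algebra_simps)
    moreover have "top_op n (2 * i * (CARD('p) - 1) + d) ?S"
    proof (intro top_op_sum top_op_scalar)
      fix j assume "j \<in> {..i div CARD('p)}"
      then have pj: "CARD('p) * j \<le> i" by (meson atMost_iff le_trans mult_le_mono2 times_div_less_eq_dividend)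
      then obtain m where i: "i = Suc q * j + m" unfolding q(1) using le_Suc_ex by blast
      have hj: "hdeg (2 * j * q + k) (sq_pow j * g)" using hdeg_pow_mult[OF assms(3), of j] by (simp add: q)
      \<comment> \<open>For \<open>i = p * j + m\<close> the outer power acts on degree
        \<open>2 * (s + q * j)\<close>, so it exceeds the top operation by \<open>m\<close>: it is
        of top degree for \<open>m = 0\<close> and unstable otherwise.\<close>
      have ij: "i + s - j = s + q * j + m" unfolding i by simp
      show "top_op n (2 * i * (CARD('p) - 1) + d) (sq_pow (i + s - j) * (sq_pow j * g))"
      proof (cases "m = 0")
        case True
        show ?thesis unfolding ij q(3)
          by (rule top_op_even[OF _ _ hj]) (use assms(1) in \<open>simp_all add: d q(1) i True algebra_simps\<close>)
      next
        case False
        show ?thesis unfolding ij q(3)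
          by (rule top_op_rel, rule unst_rel_unstable(1)[OF hj])
            (use assms(1) False in \<open>simp_all add: d q(1) i algebra_simps\<close>)
      qed
    qed
    ultimately have "top_op n (2 * i * (CARD('p) - 1) + d) (sq_pow i * (sq_pow s * g) - ?S + ?S)"
      by (intro top_op_add)
    then show ?thesis by simp
  next
    case 3
    show ?thesis
      by (rule top_op_even[OF _ _ hg]) (use assms(1) in \<open>simp_all add: 3 d q algebra_simps\<close>)
  next
    case 4
    then show ?thesis
      by (intro top_op_rel unst_rel_unstable(1)[OF hg]) (use assms(2) in \<open>simp_all add: algebra_simps\<close>)
  qed
qed

lemma top_op_pow_odd:
  assumes "n + k = 2 * s + 1" "n + d = 2 * s * CARD('p) + 2" "hdeg k (g :: 'p st_free)"
  shows "top_op n (2 * i * (CARD('p) - 1) + d) (sq_pow i * (sq_beta * (sq_pow s * g)))"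
proof -
  obtain q where q: "CARD('p) = Suc q" "q \<ge> 2" "CARD('p) - 1 = q" by (rule card_Suc)
  have d: "d = 1 + 2 * s * q + k" using assms(1,2) unfolding q by (simp add: algebra_simps)
  have hg: "hdeg d (sq_beta * (sq_pow s * g))"
    using hdeg_beta_mult[OF hdeg_pow_mult[OF assms(3), of s]] by (simp add: d q)
  \<comment> \<open>\<open>sq_beta * (sq_pow s * g)\<close> takes a class of degree \<open>n\<close>
    to degree \<open>2 * s * p + 2\<close>, so the top operation is now at
    \<open>i = p * s + 1\<close>, and the mixed Adem relation covers all smaller positive
    \<open>i\<close>.\<close>
  consider "i = 0" | "0 < i" "i \<le> CARD('p) * s" | "i = CARD('p) * s + 1" | "i > CARD('p) * s + 1" by linarith
  then show ?thesis
  proof cases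
    case 1
    then show ?thesis using top_op_pow0[OF hg] top_op_odd[OF assms] by simp
  next
    case 2
    let ?c = "\<lambda>j. Poly_Mapping.single 0 ((- 1) ^ (i + j) * of_nat (((CARD('p) - 1) * (s - j)) choose (i - CARD('p) * j))) :: 'p st_free"
    let ?c' = "\<lambda>j. Poly_Mapping.single 0 ((- 1) ^ (i + j - 1) * of_nat (((CARD('p) - 1) * (s - j) - 1) choose (i - CARD('p) * j - 1))) :: 'p st_free"
    let ?S = "\<Sum>j\<le>i div CARD('p). ?c j * (sq_beta * (sq_pow (i + s - j) * (sq_pow j * g)))"
    let ?S' = "\<Sum>j\<le>(i - 1) div CARD('p). ?c' j * (sq_pow (i + s - j) * (sq_beta * (sq_pow j * g)))"
    have "top_op n (2 * i * (CARD('p) - 1) + d) (sq_pow i * (sq_beta * (sq_pow s * g)) - ?S - ?S')"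
      using top_op_rel[OF unst_rel_adem2[OF 2 assms(3), of n]] unfolding d q(3) by (simp add: algebra_simps)
    moreover have "top_op n (2 * i * (CARD('p) - 1) + d) ?S"
    proof (intro top_op_sum top_op_scalar)
      fix j assume "j \<in> {..i div CARD('p)}"
      then have pj: "CARD('p) * j \<le> i" by (meson atMost_iff le_trans mult_le_mono2 times_div_less_eq_dividend)
      then obtain m where i: "i = Suc q * j + m" unfolding q(1) using le_Suc_ex by blast
      have hj: "hdeg (2 * j * q + k) (sq_pow j * g)" using hdeg_pow_mult[OF assms(3), of j] by (simp add: q)
      have ij: "i + s - j = s + q * j + m" unfolding i by simp
      show "top_op n (2 * i * (CARD('p) - 1) + d) (sq_beta * (sq_pow (i + s - j) * (sq_pow j * g)))"
      proof (cases "m = 0")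
        case True
        show ?thesis unfolding ij q(3)
          by (rule top_op_odd[OF _ _ hj]) (use assms(1) in \<open>simp_all add: d q(1) i True algebra_simps\<close>)
      next
        case False
        show ?thesis unfolding ij q(3)
          by (rule top_op_rel, rule unst_rel_unstable(2)[OF hj])
            (use assms(1) False in \<open>simp_all add: d q(1) i algebra_simps\<close>)
      qed
    qed
    moreover have "top_op n (2 * i * (CARD('p) - 1) + d) ?S'"
    proof (intro top_op_sum top_op_scalar)
      fix j assume "j \<in> {..(i - 1) div CARD('p)}"
      then have pj: "CARD('p) * j \<le> i - 1" by (meson atMost_iff le_trans mult_le_mono2 times_div_less_eq_dividend)
      then obtain m where "i - 1 = Suc q * j + m" unfolding q(1) using le_Suc_ex by blast
      then have i: "i = Suc q * j + m + 1" using 2(1) by simp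
      have hj: "hdeg (1 + (2 * j * q + k)) (sq_beta * (sq_pow j * g))"
        using hdeg_beta_mult[OF hdeg_pow_mult[OF assms(3), of j]] by (simp add: q)
      \<comment> \<open>The Bockstein raises the degree to \<open>2 * (s + q * j + 1)\<close> with
        the second-last power of index \<open>j\<close>, which matches the additional 1 in
        \<open>i = p * j + m + 1\<close>; the excess over the top operation is again
        \<open>m\<close>.\<close>
      have ij: "i + s - j = s + q * j + m + 1" unfolding i by simp
      show "top_op n (2 * i * (CARD('p) - 1) + d) (sq_pow (i + s - j) * (sq_beta * (sq_pow j * g)))"
      proof (cases "m = 0")
        case True
        show ?thesis unfolding ij q(3)
          by (rule top_op_even[OF _ _ hj]) (use assms(1) in \<open>simp_all add: d q(1) i True algebra_simps\<close>)
      next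
        case False
        show ?thesis unfolding ij q(3)
          by (rule top_op_rel, rule unst_rel_unstable(1)[OF hj])
            (use assms(1) False in \<open>simp_all add: d q(1) i algebra_simps\<close>)
      qed
    qed
    ultimately have "top_op n (2 * i * (CARD('p) - 1) + d)
        (sq_pow i * (sq_beta * (sq_pow s * g)) - ?S - ?S' + (?S + ?S'))"
      by (intro top_op_add)
    then show ?thesis by (simp add: algebra_simps)
  next
    case 3
    show ?thesis
      by (rule top_op_even[OF _ _ hg]) (use assms(1) in \<open>simp_all add: 3 d q algebra_simps\<close>)
  next
    case 4
    then show ?thesis
      by (intro top_op_rel unst_rel_unstable(1)[OF hg]) (use assms(2) in \<open>simp_all add: algebra_simps\<close>)
  qed
qed

lemma top_op_pow:
  assumes "top_op n d f"
  shows "top_op n (2 * i * (CARD('p) - 1) + d) (sq_pow i * f :: 'p st_free)"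
  using assms
proof (cases rule: top_op_cases)
  case rel
  then show ?thesis by (intro top_op_rel unst_rel_left hdeg_gens)
next
  case (even s k g r)
  show ?thesis unfolding even(5) distrib_left
    by (intro top_op_add top_op_rel unst_rel_left[OF even(4)] hdeg_gens top_op_pow_even[OF even(1-3)])
next
  case (odd s k g r)
  show ?thesis unfolding odd(5) distrib_left
    by (intro top_op_add top_op_rel unst_rel_left[OF odd(4)] hdeg_gens top_op_pow_odd[OF odd(1-3)])
qed

text \<open>After \<open>P\<^sup>s\<close> in top degree a Bockstein is unstable, and after
  \<open>\<beta> P\<^sup>s\<close> it is killed by \<open>\<beta>\<^sup>2 = 0\<close>; either way a
  relation results.\<close>

lemma top_op_beta:
  assumes "top_op n d f"
  shows "top_op n (1 + d) (sq_beta * f :: 'p st_free)"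
  using assms
proof (cases rule: top_op_cases)
  case rel
  then show ?thesis by (intro top_op_rel unst_rel_left hdeg_gens)
next
  case (even s k g r)
  have "unst_rel n (1 + d) (sq_beta * (sq_pow s * g))"
    by (rule unst_rel_unstable(2)[OF even(3)])
      (use even(1,2) card_ge_3 in \<open>auto simp: diff_mult_distrib2\<close>)
  then show ?thesis unfolding even(5) distrib_left
    by (intro top_op_rel unst_rel.add unst_rel_left[OF even(4)] hdeg_gens)
next
  case (odd s k g r)
  have "unst_rel n (2 + (2 * s * (CARD('p) - 1) + k)) (sq_beta * (sq_beta * (sq_pow s * g)))"
    by (rule unst_rel_beta2[OF hdeg_pow_mult[OF odd(3)]])
  moreover have "2 + (2 * s * (CARD('p) - 1) + k) = 1 + d"
  proof -
    obtain q where q: "CARD('p) = Suc q" "q \<ge> 2" "CARD('p) - 1 = q" by (rule card_Suc)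
    show ?thesis using odd(1,2) unfolding q by (simp add: algebra_simps)
  qed
  ultimately show ?thesis unfolding odd(5) distrib_left
    by (metis (no_types) top_op_rel unst_rel.add unst_rel_left[OF odd(4) hdeg_gens(1)])
qed

lemma single_word_Cons:
  "Poly_Mapping.single (Word (g # l)) c = (case g of Beta \<Rightarrow> sq_beta | Pow i \<Rightarrow> sq_pow i) * Poly_Mapping.single (Word l) (c :: 'p mod_ring)"
  by (cases g) (simp_all add: sq_beta_def sq_pow_def mult_single)

lemma single_word_snoc:
  "Poly_Mapping.single (Word (l @ [g])) c = Poly_Mapping.single (Word l) (c :: 'p mod_ring) * (case g of Beta \<Rightarrow> sq_beta | Pow i \<Rightarrow> sq_pow i)"
  by (cases g) (simp_all add: sq_beta_def sq_pow_def mult_single)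

lemma top_op_left: "top_op n d f \<Longrightarrow> hdeg i h \<Longrightarrow> top_op n (i + d) (h * f :: 'p st_free)"
proof -
  assume f: "top_op n d f"
  have word: "top_op n (word_degree CARD('p) (Word l) + d) (Poly_Mapping.single (Word l) c * f)" for l c
  proof (induction l)
    case Nil
    then show ?case using top_op_scalar[OF f, of c] by (simp add: zero_word_def)
  next
    case (Cons g l)
    then show ?case
      using top_op_beta[OF Cons] top_op_pow[OF Cons]
      by (cases g) (simp_all add: single_word_Cons mult.assoc add.assoc)
  qed
  assume "hdeg i h"
  then show ?thesis
  proof (induction h rule: hdeg_induct)
    case (single w c)
    then show ?case using word[of "unword w" c] by (cases w) auto
  qed (auto simp: distrib_right intro: top_op_rel unst_rel.zero top_op_add)
qed

text \<open>An instability relation in degree \<open>n' - 1\<close> that is lost in degree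
  \<open>n'\<close> has \<open>e + 2 * q = n' + l\<close>, so its middle operation is exactly of top
  degree. Closure under left multiplication absorbs what stands before it.\<close>

lemma unst_rel_desuspend:
  "unst_rel n d f \<Longrightarrow> n = n' - 1 \<Longrightarrow> n' > 0 \<Longrightarrow> top_op n' d (f :: 'p st_free)"
proof (induction rule: unst_rel.induct)
  case zero
  then show ?case by (intro top_op_rel unst_rel.zero)
next
  case (add d f g)
  then show ?case by (intro top_op_add) auto
next
  case (adem r i v j l w d)
  then show ?case by (intro top_op_rel unst_rel.adem)
next
  case (unstable i v l w e q d)
  show ?case
  proof (cases "e + 2 * q > n' + l")
    case True
    then show ?thesis using unstable by (intro top_op_rel unst_rel.unstable)
  next
    case False
    then have eq: "e + 2 * q = n' + l" using unstable by linarith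
    let ?d = "e + 2 * q * (CARD('p) - 1) + l"
    obtain m where m: "CARD('p) = Suc m" "m \<ge> 2" "CARD('p) - 1 = m" by (rule card_Suc)
    have deg: "n' + ?d = 2 * q * CARD('p) + 2 * e"
      using eq unfolding m by (simp add: algebra_simps)
    have "top_op n' ?d (sq_beta ^ e * sq_pow q * w)"
    proof (cases "e = 0")
      case True
      then show ?thesis
        using eq deg top_op_even[OF _ _ unstable(2), of n' q ?d] by simp
    next
      case False
      then have "e = 1" using unstable by simp
      then show ?thesis
        using eq deg top_op_odd[OF _ _ unstable(2), of n' q ?d] by (simp add: mult.assoc)
    qed
    then have "top_op n' (i + ?d) (v * (sq_beta ^ e * sq_pow q * w))" using unstable(1) by (rule top_op_left)
    then show ?thesis using unstable by (simp add: mult.assoc add.assoc)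
  qed
qed

text \<open>On a class of degree 0 the rightmost letter of a word acts by 0 or, if it is
  \<open>P\<^sup>0\<close>, as the identity; hence the induction from the right end.\<close>

lemma unst_rel_degree_zero:
  assumes "hdeg d (f :: 'p st_free)"
  shows "\<exists>c. unst_rel 0 d (f - Poly_Mapping.single 0 c) \<and> (d > 0 \<longrightarrow> c = 0)"
  using assms
proof (induction f rule: hdeg_induct)
  case zero
  then show ?case by (intro exI[of _ 0]) (simp add: unst_rel.zero)
next
  case (add f g)
  then obtain c c' where c: "unst_rel 0 d (f - Poly_Mapping.single 0 c)" "d > 0 \<longrightarrow> c = 0"
    "unst_rel 0 d (g - Poly_Mapping.single 0 c')" "d > 0 \<longrightarrow> c' = 0" by blast
  have "f + g - Poly_Mapping.single 0 (c + c') = (f - Poly_Mapping.single 0 c) + (g - Poly_Mapping.single 0 c')"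
    by (simp add: single_add)
  then show ?case using c by (metis add_0 unst_rel.add)
next
  case (single w c)
  obtain l where w: "w = Word l" by (cases w)
  have "\<exists>c'. unst_rel 0 (word_degree CARD('p) (Word l)) (Poly_Mapping.single (Word l) c - Poly_Mapping.single 0 c')
      \<and> (word_degree CARD('p) (Word l) > 0 \<longrightarrow> c' = 0)"
  proof (induction l rule: rev_induct)
    case Nil
    show ?case by (intro exI[of _ c]) (simp add: unst_rel.zero zero_word_def)
  next
    case (snoc g l)
    let ?v = "Poly_Mapping.single (Word l) c :: 'p st_free"
    have v: "hdeg (word_degree CARD('p) (Word l)) ?v" by (rule hdeg_single) simp
    show ?case
    proof (cases g)
      case Beta
      \<comment> \<open>Instability is phrased with \<open>\<beta> P\<^sup>0\<close>, so
        \<open>\<beta>\<close> is written as \<open>\<beta> P\<^sup>0\<close> minus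
        \<open>\<beta> (P\<^sup>0 - 1)\<close>.\<close>
      have "unst_rel 0 (word_degree CARD('p) (Word l) + 1) (?v * (sq_beta ^ 1 * sq_pow 0) * 1)"
        by (rule unst_rel.unstable[OF v hdeg_one]) auto
      moreover have "unst_rel 0 (word_degree CARD('p) (Word l) + 1) (?v * sq_beta * ((sq_pow 0 - 1) * 1))"
        using unst_rel_left[OF unst_rel_pow0[OF hdeg_one] hdeg_mult[OF v hdeg_gens(1)]] by simp
      ultimately have "unst_rel 0 (word_degree CARD('p) (Word l) + 1)
          (?v * (sq_beta ^ 1 * sq_pow 0) * 1 - ?v * sq_beta * ((sq_pow 0 - 1) * 1))"
        by (rule unst_rel_diff)
      moreover have "?v * (sq_beta ^ 1 * sq_pow 0) * 1 - ?v * sq_beta * ((sq_pow 0 - 1) * 1)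
          = Poly_Mapping.single (Word (l @ [g])) c - Poly_Mapping.single 0 0"
        using Beta by (simp add: single_word_snoc right_diff_distrib mult.assoc)
      moreover have "word_degree CARD('p) (Word (l @ [g])) = word_degree CARD('p) (Word l) + 1"
        using Beta by simp
      ultimately show ?thesis by metis
    next
      case (Pow q)
      show ?thesis
      proof (cases "q = 0")
        case True
        from snoc obtain c' where "unst_rel 0 (word_degree CARD('p) (Word l)) (?v - Poly_Mapping.single 0 c')
          \<and> (word_degree CARD('p) (Word l) > 0 \<longrightarrow> c' = 0)" by (rule exE)
        then have c': "unst_rel 0 (word_degree CARD('p) (Word l)) (?v - Poly_Mapping.single 0 c')"
          "word_degree CARD('p) (Word l) > 0 \<longrightarrow> c' = 0" by simp_all
        have "unst_rel 0 (word_degree CARD('p) (Word l)) (?v * ((sq_pow 0 - 1) * 1))"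
          using unst_rel_left[OF unst_rel_pow0[OF hdeg_one] v] by simp
        then have "unst_rel 0 (word_degree CARD('p) (Word l)) (?v * ((sq_pow 0 - 1) * 1) + (?v - Poly_Mapping.single 0 c'))"
          using c'(1) by (rule unst_rel.add)
        moreover have "?v * ((sq_pow 0 - 1) * 1) + (?v - Poly_Mapping.single 0 c')
            = Poly_Mapping.single (Word (l @ [g])) c - Poly_Mapping.single 0 c'"
          using Pow True by (simp add: single_word_snoc right_diff_distrib)
        moreover have "word_degree CARD('p) (Word (l @ [g])) = word_degree CARD('p) (Word l)"
          using Pow True by simp
        ultimately show ?thesis using c'(2) by metis
      next
        case False
        then have "unst_rel 0 (word_degree CARD('p) (Word l) + 2 * q * (CARD('p) - 1)) (?v * (sq_beta ^ 0 * sq_pow q) * 1)"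
          by (intro unst_rel.unstable[OF v hdeg_one]) auto
        moreover have "?v * (sq_beta ^ 0 * sq_pow q) * 1 = Poly_Mapping.single (Word (l @ [g])) c - Poly_Mapping.single 0 0"
          using Pow by (simp add: single_word_snoc)
        moreover have "word_degree CARD('p) (Word (l @ [g])) = word_degree CARD('p) (Word l) + 2 * q * (CARD('p) - 1)"
          using Pow by simp
        ultimately show ?thesis by metis
      qed
    qed
  qed
  then show ?case using single by (simp add: w)
qed

lemma even_lookup_ldeg: "even (Poly_Mapping.lookup (snd c) 0) \<longleftrightarrow> even (ldeg p c)"
  using ldeg_mod_2[of p c] by presburger

lemma ldeg_up_even:
  "ldeg CARD('p) c = 2 * int s \<Longrightarrow> ldeg CARD('p) (up c) = 2 * int s * int CARD('p)"
  using ldeg_up[of "CARD('p)" c] even_lookup_ldeg[of c "CARD('p)"]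
  by (simp add: even_iff_mod_2_eq_zero)

lemma ldeg_up_odd:
  "ldeg CARD('p) c = 2 * int s + 1 \<Longrightarrow> ldeg CARD('p) (up c) = 2 * int s * int CARD('p) + 2"
  using ldeg_up[of "CARD('p)" c] even_lookup_ldeg[of c "CARD('p)"]
  by (simp add: odd_iff_mod_2_eq_one)

lemma Phi_top_even:
  assumes "hdeg k g" "rdeg c + int k = 2 * int s"
  shows "ldeg CARD('p) c = 2 * int s \<Longrightarrow> Phi (sq_pow s * g) (up c) = (Phi g c :: 'p mod_ring)"
    and "c = addu b \<Longrightarrow> Phi (sq_pow s * g) c = (0 :: 'p mod_ring)"
proof -
  have d: "ldeg CARD('p) c' = 2 * int s" if "rdeg c' = rdeg c" "Phi g c' \<noteq> (0 :: 'p mod_ring)" for c'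
    using Phi_degree[OF assms(1) that(2)] that(1) assms(2) by simp
  show "Phi (sq_pow s * g) (up c) = Phi g c" if "ldeg CARD('p) c = 2 * int s"
    unfolding Phi_mult Phi_gens using d that even_lookup_ldeg[of c "CARD('p)"]
    by (intro top_even_up) auto
  show "Phi (sq_pow s * g) c = 0" if "c = addu b"
    unfolding Phi_mult Phi_gens that using d that by (intro top_even_addu) auto
qed

lemma Phi_top_odd:
  assumes "hdeg k g" "rdeg c + int k = 2 * int s + 1"
  shows "ldeg CARD('p) c = 2 * int s + 1 \<Longrightarrow> Phi (sq_beta * (sq_pow s * g)) (up c) = (Phi g c :: 'p mod_ring)"
    and "c = addu b \<Longrightarrow> Phi (sq_beta * (sq_pow s * g)) c = (0 :: 'p mod_ring)"
proof -
  have d: "ldeg CARD('p) c' = 2 * int s + 1" if "rdeg c' = rdeg c" "Phi g c' \<noteq> (0 :: 'p mod_ring)" for c'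
    using Phi_degree[OF assms(1) that(2)] that(1) assms(2) by simp
  show "Phi (sq_beta * (sq_pow s * g)) (up c) = Phi g c" if "ldeg CARD('p) c = 2 * int s + 1"
    unfolding Phi_mult Phi_gens using d that even_lookup_ldeg[of c "CARD('p)"]
    by (intro top_odd_up) auto
  show "Phi (sq_beta * (sq_pow s * g)) c = 0" if "c = addu b"
    unfolding Phi_mult Phi_gens that using d that by (intro top_odd_addu) auto
qed

text \<open>The strict inequality supports the inner induction on the degree. It fails for
  \<open>n = 0\<close>, where the identity \<open>P\<^sup>0\<close> is of top degree.\<close>

lemma top_degree_less:
  assumes "n > 0"
  shows "n + k = 2 * s \<Longrightarrow> n + d = 2 * s * CARD('p) \<Longrightarrow> k < d \<and> d = 2 * s * (CARD('p) - 1) + k"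
    and "n + k = 2 * s + 1 \<Longrightarrow> n + d = 2 * s * CARD('p) + 2 \<Longrightarrow> k < d \<and> d = 1 + (2 * s * (CARD('p) - 1) + k)"
proof -
  obtain q where q: "CARD('p) = Suc q" "q \<ge> 2" "CARD('p) - 1 = q" by (rule card_Suc)
  show "k < d \<and> d = 2 * s * (CARD('p) - 1) + k" if "n + k = 2 * s" "n + d = 2 * s * CARD('p)"
  proof -
    have d: "d = 2 * s * (CARD('p) - 1) + k" using that unfolding q by (simp add: algebra_simps)
    have "s > 0" using that assms by (cases "s = 0") auto
    then have "2 * s * (CARD('p) - 1) > 0" using q by simp
    then show ?thesis using d by linarith
  qed
  show "k < d \<and> d = 1 + (2 * s * (CARD('p) - 1) + k)" if "n + k = 2 * s + 1" "n + d = 2 * s * CARD('p) + 2"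
  proof -
    have "d = 1 + (2 * s * (CARD('p) - 1) + k)" using that unfolding q by (simp add: algebra_simps)
    then show ?thesis by linarith
  qed
qed

text \<open>Values on multiples of \<open>u\<close> show that \<open>f\<close> is a relation after
  desuspension, by the outer induction. Hence \<open>f\<close> is a top operation on some
  \<open>g\<close>, up to relations, and its value on \<open>up c\<close> is that of
  \<open>g\<close> on \<open>c\<close>, so the inner induction on the degree applies to
  \<open>g\<close>.\<close>

theorem Phi_injective:
  assumes "hdeg d (f :: 'p st_free)"
    and "\<And>b. rdeg b = int n \<Longrightarrow> ldeg CARD('p) b = int (n + d) \<Longrightarrow> Phi f b = 0"
  shows "unst_rel n d f"
  using assms
proof (induction n arbitrary: d f)
  case 0
  obtain c where c: "unst_rel 0 d (f - Poly_Mapping.single 0 c)" "d > 0 \<longrightarrow> c = 0"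
    using unst_rel_degree_zero[OF 0(1)] by blast
  have "c = 0"
  proof (cases "d = 0")
    case True
    let ?b = "({||}, 0) :: mono"
    have "rdeg ?b = int 0" "ldeg CARD('p) ?b = int (0 + d)" using True by (simp_all add: rdeg_def ldeg_def wt_def)
    then have "Phi f ?b = 0" "Phi (f - Poly_Mapping.single 0 c) ?b = 0"
      using 0(2) unst_rel_sound[OF c(1)] by blast+
    then show ?thesis by (simp add: Phi_diff Phi_single unword_zero ch_def)
  qed (use c in auto)
  then show ?case using c(1) by simp
next
  case (Suc n)
  from Suc.prems show ?case
  proof (induction d arbitrary: f rule: less_induct)
    case (less d)
    have "unst_rel n d f"
    proof (rule Suc.IH[OF less.prems(1)])
      fix b assume "rdeg b = int n" "ldeg CARD('p) b = int (n + d)"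
      then have "Phi f (addu b) = 0" by (intro less.prems(2)) (simp_all add: rdeg_addu ldeg_addu)
      then show "Phi f b = 0" by (simp add: Phi_addu)
    qed
    then have "top_op (Suc n) d f" by (rule unst_rel_desuspend) auto
    then show ?case
    proof (cases rule: top_op_cases)
      case (even s k g r)
      note deg = top_degree_less(1)[OF zero_less_Suc even(1,2)]
      have "unst_rel (Suc n) k g"
      proof (rule less.IH)
        show "k < d" "hdeg k g" using deg even by auto
        fix c assume c: "rdeg c = int (Suc n)" "ldeg CARD('p) c = int (Suc n + k)"
        have s: "ldeg CARD('p) c = 2 * int s" using c even(1) by simp
        have "ldeg CARD('p) (up c) = int (Suc n + d)"
          unfolding ldeg_up_even[OF s] even(2) by simp
        then have "Phi f (up c) = 0" using c by (intro less.prems(2)) (simp_all add: rdeg_up)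
        moreover have "Phi r (up c) = 0" using c by (intro unst_rel_sound[OF even(4)]) (simp add: rdeg_up)
        ultimately have "Phi (sq_pow s * g) (up c) = 0" by (simp add: even(5) Phi_add)
        then show "Phi g c = 0" using Phi_top_even(1)[OF even(3) _ s] c s by simp
      qed
      then have "unst_rel (Suc n) d (sq_pow s * g)" using unst_rel_left[OF _ hdeg_gens(2)[of s]] deg by metis
      then show ?thesis unfolding even(5) by (intro unst_rel.add even)
    next
      case (odd s k g r)
      note deg = top_degree_less(2)[OF zero_less_Suc odd(1,2)]
      have "unst_rel (Suc n) k g"
      proof (rule less.IH)
        show "k < d" "hdeg k g" using deg odd by auto
        fix c assume c: "rdeg c = int (Suc n)" "ldeg CARD('p) c = int (Suc n + k)"
        have s: "ldeg CARD('p) c = 2 * int s + 1" using c odd(1) by simp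
        have "ldeg CARD('p) (up c) = int (Suc n + d)"
          unfolding ldeg_up_odd[OF s] odd(2) by simp
        then have "Phi f (up c) = 0" using c by (intro less.prems(2)) (simp_all add: rdeg_up)
        moreover have "Phi r (up c) = 0" using c by (intro unst_rel_sound[OF odd(4)]) (simp add: rdeg_up)
        ultimately have "Phi (sq_beta * (sq_pow s * g)) (up c) = 0" by (simp add: odd(5) Phi_add)
        then show "Phi g c = 0" using Phi_top_odd(1)[OF odd(3) _ s] c s by simp
      qed
      then have "unst_rel (Suc n) d (sq_beta * (sq_pow s * g))"
        using unst_rel_left[OF unst_rel_left[OF _ hdeg_gens(2)[of s]] hdeg_gens(1)] deg by metis
      then show ?thesis unfolding odd(5) by (intro unst_rel.add odd)
    qed
  qed
qed

text \<open>An element provided by the outer induction matches the values on multiples of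
  \<open>u\<close>. A top operation then corrects the values on the monomials \<open>up c\<close>
  without disturbing the former, since it pairs to 0 with multiples of \<open>u\<close>.\<close>

theorem Phi_surjective:
  "\<exists>f :: 'p st_free. hdeg d f \<and> (\<forall>b. rdeg b = int n \<longrightarrow> ldeg CARD('p) b = int (n + d) \<longrightarrow> Phi f b = t b)"
proof (induction n arbitrary: d t)
  case 0
  show ?case
  proof (cases "d = 0")
    case True
    have "Phi (Poly_Mapping.single 0 (t ({||}, 0))) b = t b" if "rdeg b = 0" for b
      unfolding rdeg_eq_0[OF that] by (simp add: Phi_single unword_zero ch_def)
    then show ?thesis using True by (intro exI[of _ "Poly_Mapping.single 0 (t ({||}, 0))"]) simp
  next
    case False
    have "ldeg CARD('p) b \<noteq> int (0 + d)" if "rdeg b = int 0" for b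
      using rdeg_eq_0[of b] that False by (simp add: ldeg_def wt_def)
    then show ?thesis by (intro exI[of _ 0]) auto
  qed
next
  case (Suc n)
  show ?case
  proof (induction d arbitrary: t rule: less_induct)
    case (less d)
    obtain f where f: "hdeg d f" "\<And>b. rdeg b = int n \<Longrightarrow> ldeg CARD('p) b = int (n + d) \<Longrightarrow> Phi f b = t (addu b)"
      using Suc.IH[of d "\<lambda>b. t (addu b)"] by blast
    have fu: "Phi f (addu b) = t (addu b)" if "rdeg (addu b) = int (Suc n)" "ldeg CARD('p) (addu b) = int (Suc n + d)" for b
      using that f(2)[of b] by (simp add: Phi_addu rdeg_addu ldeg_addu)
    \<comment> \<open>The parity of the left degree of \<open>c\<close> decides which kind of top
      operation can reach \<open>up c\<close>.\<close>
    have up_deg: "(\<exists>s k. Suc n + k = 2 * s \<and> Suc n + d = 2 * s * CARD('p) \<and> ldeg CARD('p) c = 2 * int s)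
        \<or> (\<exists>s k. Suc n + k = 2 * s + 1 \<and> Suc n + d = 2 * s * CARD('p) + 2 \<and> ldeg CARD('p) c = 2 * int s + 1)"
      if r: "rdeg c = int (Suc n)" and l: "ldeg CARD('p) (up c) = int (Suc n + d)" for c
    proof -
      have ge: "int (Suc n) \<le> ldeg CARD('p) c" using rdeg_le_ldeg[of "CARD('p)" c] r by simp
      define m where "m = nat (ldeg CARD('p) c)"
      have m: "ldeg CARD('p) c = int m" using ge by (simp add: m_def)
      obtain k where k: "Suc n + k = m" using ge m le_Suc_ex by (metis of_nat_le_iff)
      show ?thesis
      proof (cases "even m")
        case True
        then obtain s where s: "m = 2 * s" by blast
        have "int (Suc n + d) = int (2 * s * CARD('p))"
          using ldeg_up_even[of c s] l m s by simp
        then have "Suc n + d = 2 * s * CARD('p)" by (simp only: of_nat_eq_iff)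
        then show ?thesis using m s k by auto
      next
        case False
        then obtain s where s: "m = 2 * s + 1" by (elim oddE)
        have "int (Suc n + d) = int (2 * s * CARD('p) + 2)"
          using ldeg_up_odd[of c s] l m s by simp
        then have "Suc n + d = 2 * s * CARD('p) + 2" by (simp only: of_nat_eq_iff)
        then show ?thesis using m s k by auto
      qed
    qed
    consider (even) s k where "Suc n + k = 2 * s" "Suc n + d = 2 * s * CARD('p)"
      | (odd) s k where "Suc n + k = 2 * s + 1" "Suc n + d = 2 * s * CARD('p) + 2"
      | (none) "\<And>c. rdeg c = int (Suc n) \<Longrightarrow> ldeg CARD('p) (up c) \<noteq> int (Suc n + d)"
      using up_deg by blast
    then show ?case
    proof cases
      case (even s k)
      note deg = top_degree_less(1)[OF zero_less_Suc even]
      obtain g where g: "hdeg k g" "\<And>c. rdeg c = int (Suc n) \<Longrightarrow> ldeg CARD('p) c = int (Suc n + k) \<Longrightarrow>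
          Phi g c = t (up c) - Phi f (up c)"
        using less.IH[of k "\<lambda>c. t (up c) - Phi f (up c)"] deg by blast
      have h: "hdeg d (f + sq_pow s * g)" using f(1) hdeg_pow_mult[OF g(1), of s] deg by (intro hdeg_add) auto
      have "Phi (f + sq_pow s * g) b = t b" if b: "rdeg b = int (Suc n)" "ldeg CARD('p) b = int (Suc n + d)" for b
      proof -
        consider c where "b = addu c" | c where "b = up c" using addu_or_up by blast
        then show ?thesis
        proof cases
          case 1
          have "Phi (sq_pow s * g) b = 0" using Phi_top_even(2)[OF g(1) _ 1, of s] b even by simp
          then show ?thesis using fu[of c] b by (simp add: 1 Phi_add)
        next
          case 2
          have r: "rdeg c = int (Suc n)" using b 2 by (simp add: rdeg_up)
          have l': "ldeg CARD('p) (up c) = int (Suc n + d)" using b 2 by simp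
          from up_deg[OF r l'] have l: "ldeg CARD('p) c = 2 * int s"
          proof (elim disjE exE conjE)
            fix s' assume "Suc n + d = 2 * s' * CARD('p)" "ldeg CARD('p) c = 2 * int s'"
            then show ?thesis using even by simp
          next
            fix s' assume "Suc n + d = 2 * s' * CARD('p) + 2"
            then show ?thesis using even top_parity_clash by metis
          qed
          have "Phi (sq_pow s * g) b = Phi g c"
            unfolding 2 by (rule Phi_top_even(1)[OF g(1) _ l]) (use r even in simp)
          also have "\<dots> = t b - Phi f b" unfolding 2 using r l even by (intro g(2)) simp_all
          finally show ?thesis by (simp add: Phi_add)
        qed
      qed
      then show ?thesis using h by blast
    next
      case (odd s k)
      note deg = top_degree_less(2)[OF zero_less_Suc odd]
      obtain g where g: "hdeg k g" "\<And>c. rdeg c = int (Suc n) \<Longrightarrow> ldeg CARD('p) c = int (Suc n + k) \<Longrightarrow>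
          Phi g c = t (up c) - Phi f (up c)"
        using less.IH[of k "\<lambda>c. t (up c) - Phi f (up c)"] deg by blast
      have h: "hdeg d (f + sq_beta * (sq_pow s * g))"
        using f(1) hdeg_beta_mult[OF hdeg_pow_mult[OF g(1), of s]] deg by (intro hdeg_add) auto
      have "Phi (f + sq_beta * (sq_pow s * g)) b = t b" if b: "rdeg b = int (Suc n)" "ldeg CARD('p) b = int (Suc n + d)" for b
      proof -
        consider c where "b = addu c" | c where "b = up c" using addu_or_up by blast
        then show ?thesis
        proof cases
          case 1
          have "Phi (sq_beta * (sq_pow s * g)) b = 0" using Phi_top_odd(2)[OF g(1) _ 1, of s] b odd by simp
          then show ?thesis using fu[of c] b by (simp add: 1 Phi_add)
        next
          case 2
          have r: "rdeg c = int (Suc n)" using b 2 by (simp add: rdeg_up)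
          have l': "ldeg CARD('p) (up c) = int (Suc n + d)" using b 2 by simp
          from up_deg[OF r l'] have l: "ldeg CARD('p) c = 2 * int s + 1"
          proof (elim disjE exE conjE)
            fix s' assume "Suc n + d = 2 * s' * CARD('p) + 2" "ldeg CARD('p) c = 2 * int s' + 1"
            then show ?thesis using odd by simp
          next
            fix s' assume "Suc n + d = 2 * s' * CARD('p)"
            then show ?thesis using odd top_parity_clash by metis
          qed
          have "Phi (sq_beta * (sq_pow s * g)) b = Phi g c"
            unfolding 2 by (rule Phi_top_odd(1)[OF g(1) _ l]) (use r odd in simp)
          also have "\<dots> = t b - Phi f b" unfolding 2 using r l odd by (intro g(2)) simp_all
          finally show ?thesis by (simp add: Phi_add)
        qed
      qed
      then show ?thesis using h by blast
    next
      case none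
      have "Phi f b = t b" if b: "rdeg b = int (Suc n)" "ldeg CARD('p) b = int (Suc n + d)" for b
        using addu_or_up[of b] fu none b by (metis rdeg_up)
      then show ?thesis using f(1) by blast
    qed
  qed
qed

end

section \<open>Modules over the prime field and the Steenrod algebra as a quotient\<close>

lemma ring_of_type_simps [simp]:
  "carrier (ring_of_type :: 'k::ring_1 ring) = UNIV"
  "x \<oplus>\<^bsub>ring_of_type\<^esub> y = x + (y :: 'k)" "x \<otimes>\<^bsub>ring_of_type\<^esub> y = x * (y :: 'k)"
  "\<zero>\<^bsub>ring_of_type\<^esub> = (0 :: 'k)" "\<one>\<^bsub>ring_of_type\<^esub> = (1 :: 'k)"
  by (simp_all add: ring_of_type_def)

lemma abelian_group_ring_of_type: "abelian_group (ring_of_type :: 'k::ring_1 ring)"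
  by (rule abelian_groupI) (auto simp: add_ac intro: exI[of _ "- _"] left_minus)

lemma ring_ring_of_type: "ring (ring_of_type :: 'k::ring_1 ring)"
  by (rule ringI[OF abelian_group_ring_of_type])
    (auto simp: distrib_left distrib_right mult.assoc intro!: monoidI)

lemma cring_ring_of_type: "cring (ring_of_type :: 'k::comm_ring_1 ring)"
  by (rule cringI[OF abelian_group_ring_of_type])
    (auto simp: algebra_simps intro!: comm_monoidI)

subsection \<open>Linear combinations\<close>

definition lc :: "('k::field, 'a) module \<Rightarrow> 'b set \<Rightarrow> ('b \<Rightarrow> 'k) \<Rightarrow> ('b \<Rightarrow> 'a) \<Rightarrow> 'a" where
  "lc V B f y = finsum V (\<lambda>b. f b \<odot>\<^bsub>V\<^esub> y b) B"

locale vspace = module "ring_of_type :: 'k::field ring" V for V :: "('k::field, 'a) module"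
begin

lemma vs_smult [simp]:
  "x \<in> carrier V \<Longrightarrow> (c * d) \<odot>\<^bsub>V\<^esub> x = c \<odot>\<^bsub>V\<^esub> (d \<odot>\<^bsub>V\<^esub> x)"
  "x \<in> carrier V \<Longrightarrow> 1 \<odot>\<^bsub>V\<^esub> x = x" "x \<in> carrier V \<Longrightarrow> 0 \<odot>\<^bsub>V\<^esub> x = \<zero>\<^bsub>V\<^esub>" "c \<odot>\<^bsub>V\<^esub> \<zero>\<^bsub>V\<^esub> = \<zero>\<^bsub>V\<^esub>"
  using smult_assoc1[of c d x] smult_one[of x] smult_l_null[of x] smult_r_null[of c] by simp_all

lemma vs_distr:
  "x \<in> carrier V \<Longrightarrow> (c + d) \<odot>\<^bsub>V\<^esub> x = (c \<odot>\<^bsub>V\<^esub> x) \<oplus>\<^bsub>V\<^esub> (d \<odot>\<^bsub>V\<^esub> x)"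
  "x \<in> carrier V \<Longrightarrow> y \<in> carrier V \<Longrightarrow> c \<odot>\<^bsub>V\<^esub> (x \<oplus>\<^bsub>V\<^esub> y) = (c \<odot>\<^bsub>V\<^esub> x) \<oplus>\<^bsub>V\<^esub> (c \<odot>\<^bsub>V\<^esub> y)"
  using smult_l_distr[of c d x] smult_r_distr[of c x y] by simp_all

lemma lc_empty [simp]: "lc V {} f y = \<zero>\<^bsub>V\<^esub>"
  by (simp add: lc_def)

lemma lc_insert:
  "finite B \<Longrightarrow> b \<notin> B \<Longrightarrow> (\<And>b'. b' \<in> insert b B \<Longrightarrow> y b' \<in> carrier V) \<Longrightarrow>
    lc V (insert b B) f y = (f b \<odot>\<^bsub>V\<^esub> y b) \<oplus>\<^bsub>V\<^esub> lc V B f y"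
  unfolding lc_def by (rule M.finsum_insert) auto

lemma lc_closed [simp]: "(\<And>b. b \<in> B \<Longrightarrow> y b \<in> carrier V) \<Longrightarrow> lc V B f y \<in> carrier V"
  unfolding lc_def by (rule M.finsum_closed) auto

lemma lc_cong:
  "(\<And>b. b \<in> B \<Longrightarrow> f b = g b) \<Longrightarrow> (\<And>b. b \<in> B \<Longrightarrow> y b = z b) \<Longrightarrow> (\<And>b. b \<in> B \<Longrightarrow> z b \<in> carrier V) \<Longrightarrow>
    lc V B f y = lc V B g z"
  unfolding lc_def by (rule M.finsum_cong') auto

lemma lc_vec_add:
  assumes "finite B" "\<And>b. b \<in> B \<Longrightarrow> y b \<in> carrier V" "\<And>b. b \<in> B \<Longrightarrow> z b \<in> carrier V"
  shows "lc V B f (\<lambda>b. y b \<oplus>\<^bsub>V\<^esub> z b) = lc V B f y \<oplus>\<^bsub>V\<^esub> lc V B f z"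
proof -
  have "lc V B f (\<lambda>b. y b \<oplus>\<^bsub>V\<^esub> z b) = finsum V (\<lambda>b. (f b \<odot>\<^bsub>V\<^esub> y b) \<oplus>\<^bsub>V\<^esub> (f b \<odot>\<^bsub>V\<^esub> z b)) B"
    unfolding lc_def by (rule M.finsum_cong') (use assms in \<open>auto simp: vs_distr\<close>)
  also have "\<dots> = lc V B f y \<oplus>\<^bsub>V\<^esub> lc V B f z"
    unfolding lc_def by (rule M.finsum_addf) (use assms in auto)
  finally show ?thesis .
qed

lemma lc_coeff_add:
  assumes "finite B" "\<And>b. b \<in> B \<Longrightarrow> y b \<in> carrier V"
  shows "lc V B (\<lambda>b. f b + g b) y = lc V B f y \<oplus>\<^bsub>V\<^esub> lc V B g y"
proof -
  have "lc V B (\<lambda>b. f b + g b) y = finsum V (\<lambda>b. (f b \<odot>\<^bsub>V\<^esub> y b) \<oplus>\<^bsub>V\<^esub> (g b \<odot>\<^bsub>V\<^esub> y b)) B"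
    unfolding lc_def by (rule M.finsum_cong') (use assms in \<open>auto simp: vs_distr\<close>)
  also have "\<dots> = lc V B f y \<oplus>\<^bsub>V\<^esub> lc V B g y"
    unfolding lc_def by (rule M.finsum_addf) (use assms in auto)
  finally show ?thesis .
qed

lemma lc_coeff_smult:
  assumes "finite B" "\<And>b. b \<in> B \<Longrightarrow> y b \<in> carrier V"
  shows "lc V B (\<lambda>b. c * f b) y = c \<odot>\<^bsub>V\<^esub> lc V B f y"
  using assms
proof (induction B rule: finite_induct)
  case (insert b B)
  have cl: "b' \<in> insert b B \<Longrightarrow> y b' \<in> carrier V" for b' using insert.prems .
  then have "lc V (insert b B) g y = (g b \<odot>\<^bsub>V\<^esub> y b) \<oplus>\<^bsub>V\<^esub> lc V B g y" for g
    by (intro lc_insert insert.hyps)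
  then show ?case using insert.IH cl by (simp add: vs_distr)
qed simp

lemma lc_coeff_zero: "(\<And>b. b \<in> B \<Longrightarrow> y b \<in> carrier V) \<Longrightarrow> (\<And>b. b \<in> B \<Longrightarrow> f b = 0) \<Longrightarrow> lc V B f y = \<zero>\<^bsub>V\<^esub>"
proof -
  assume "\<And>b. b \<in> B \<Longrightarrow> y b \<in> carrier V" "\<And>b. b \<in> B \<Longrightarrow> f b = 0"
  then have "lc V B f y = finsum V (\<lambda>b. \<zero>\<^bsub>V\<^esub>) B" unfolding lc_def by (intro M.finsum_cong') auto
  then show ?thesis by simp
qed

lemma lc_delta:
  assumes "finite B" "x \<in> B" "\<And>b. b \<in> B \<Longrightarrow> y b \<in> carrier V"
    and "f x = 1" "\<And>b. b \<in> B \<Longrightarrow> b \<noteq> x \<Longrightarrow> f b = 0"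
  shows "lc V B f y = y x"
proof -
  have "lc V (insert x (B - {x})) f y = (f x \<odot>\<^bsub>V\<^esub> y x) \<oplus>\<^bsub>V\<^esub> lc V (B - {x}) f y"
    using assms by (intro lc_insert) auto
  also have "lc V (B - {x}) f y = \<zero>\<^bsub>V\<^esub>" using assms by (intro lc_coeff_zero) auto
  finally show ?thesis using assms by (simp add: insert_absorb)
qed

lemma lc_lc:
  assumes "finite B" "finite C" "\<And>c. c \<in> C \<Longrightarrow> y c \<in> carrier V"
  shows "lc V B f (\<lambda>b. lc V C (g b) y) = lc V C (\<lambda>c. \<Sum>b\<in>B. f b * g b c) y"
  using assms(1)
proof (induction B rule: finite_induct)
  case empty
  show ?case using assms by (simp add: lc_coeff_zero)
next
  case (insert b B)
  have "lc V (insert b B) f (\<lambda>b. lc V C (g b) y) = (f b \<odot>\<^bsub>V\<^esub> lc V C (g b) y) \<oplus>\<^bsub>V\<^esub> lc V C (\<lambda>c. \<Sum>b\<in>B. f b * g b c) y"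
    using insert assms by (subst lc_insert) auto
  also have "\<dots> = lc V C (\<lambda>c. f b * g b c + (\<Sum>b\<in>B. f b * g b c)) y"
    using assms by (simp add: lc_coeff_add lc_coeff_smult)
  finally show ?case using insert by simp
qed

text \<open>\<open>contract\<close> sums over the support, which varies with \<open>y\<close>; over
  a fixed finite set linear combinations can be added and interchanged.\<close>

lemma contract_lc:
  assumes "finite B" "\<And>b. b \<notin> B \<Longrightarrow> y b = \<zero>\<^bsub>V\<^esub>" "\<And>b. y b \<in> carrier V"
  shows "contract V f y = lc V B f y"
  unfolding contract_def lc_def
  by (rule M.add.finprod_mono_neutral_cong_left) (use assms in auto)

end

lemma lc_linear_map:
  assumes "vspace V" "vspace W" "finite B" "\<And>b. b \<in> B \<Longrightarrow> y b \<in> carrier V"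
    and h: "\<And>x. x \<in> carrier V \<Longrightarrow> h x \<in> carrier W"
      "\<And>x x'. x \<in> carrier V \<Longrightarrow> x' \<in> carrier V \<Longrightarrow> h (x \<oplus>\<^bsub>V\<^esub> x') = h x \<oplus>\<^bsub>W\<^esub> h x'"
      "\<And>c x. x \<in> carrier V \<Longrightarrow> h (c \<odot>\<^bsub>V\<^esub> x) = c \<odot>\<^bsub>W\<^esub> h x"
  shows "h (lc V B f y) = lc W B f (\<lambda>b. h (y b))"
proof -
  interpret V: vspace V by fact
  interpret W: vspace W by fact
  have "h \<zero>\<^bsub>V\<^esub> = \<zero>\<^bsub>W\<^esub>" using h(3)[OF V.M.zero_closed, of 0] h(1)[OF V.M.zero_closed] by simp
  with assms(3,4) show ?thesis
  proof (induction B rule: finite_induct)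
    case (insert b B)
    have cl: "b' \<in> insert b B \<Longrightarrow> y b' \<in> carrier V" for b' using insert.prems(1) .
    then have cl': "b' \<in> insert b B \<Longrightarrow> h (y b') \<in> carrier W" for b' using h(1) by blast
    have "lc V (insert b B) f y = (f b \<odot>\<^bsub>V\<^esub> y b) \<oplus>\<^bsub>V\<^esub> lc V B f y"
      using cl by (intro V.lc_insert insert.hyps)
    moreover have "lc W (insert b B) f (\<lambda>b. h (y b)) = (f b \<odot>\<^bsub>W\<^esub> h (y b)) \<oplus>\<^bsub>W\<^esub> lc W B f (\<lambda>b. h (y b))"
      using cl' by (intro W.lc_insert insert.hyps)
    ultimately show ?case
      using insert.IH insert.prems(2) cl by (simp add: h)
  qed simp
qed

subsection \<open>The Steenrod algebra\<close>

lemma ideal_adem: "ideal adem_ideal (ring_of_type :: 'p::prime_card st_free ring)"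
  unfolding adem_ideal_def by (rule ring.genideal_ideal[OF ring_ring_of_type]) simp

lemma adem_subset: "adem_relators \<subseteq> (adem_ideal :: 'p::prime_card st_free set)"
  unfolding adem_ideal_def by (rule ring.genideal_self[OF ring_ring_of_type]) simp

lemma adem_minimal: "ideal I ring_of_type \<Longrightarrow> adem_relators \<subseteq> I \<Longrightarrow> adem_ideal \<subseteq> (I :: 'p::prime_card st_free set)"
  unfolding adem_ideal_def by (rule ring.genideal_minimal[OF ring_ring_of_type])

lemma adem_ideal_closed:
  "0 \<in> (adem_ideal :: 'p::prime_card st_free set)"
  "f \<in> adem_ideal \<Longrightarrow> g \<in> adem_ideal \<Longrightarrow> f + g \<in> (adem_ideal :: 'p::prime_card st_free set)"
  "f \<in> adem_ideal \<Longrightarrow> h * f \<in> (adem_ideal :: 'p::prime_card st_free set)"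
  "f \<in> adem_ideal \<Longrightarrow> f * h \<in> (adem_ideal :: 'p::prime_card st_free set)"
proof -
  interpret ideal "adem_ideal :: 'p st_free set" ring_of_type by (rule ideal_adem)
  show "0 \<in> (adem_ideal :: 'p st_free set)" using additive_subgroup.zero_closed[OF is_additive_subgroup] by simp
  show "f \<in> adem_ideal \<Longrightarrow> g \<in> adem_ideal \<Longrightarrow> f + g \<in> (adem_ideal :: 'p st_free set)" using additive_subgroup.a_closed[OF is_additive_subgroup, of f g] by simp
  show "f \<in> adem_ideal \<Longrightarrow> h * f \<in> (adem_ideal :: 'p st_free set)" using I_l_closed[of f h] by simp
  show "f \<in> adem_ideal \<Longrightarrow> f * h \<in> (adem_ideal :: 'p st_free set)" using I_r_closed[of f h] by simp
qed

lemma st_class_altdef: "st_class f = {i + f | i. i \<in> adem_ideal}"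
  unfolding st_class_def a_r_coset_def' by auto

lemma st_class_self: "f \<in> st_class f"
  unfolding st_class_altdef using adem_ideal_closed(1) by force

lemma st_class_eqI: "f - g \<in> adem_ideal \<Longrightarrow> st_class f = st_class g"
proof -
  have sub: "st_class f \<subseteq> st_class g" if "f - g \<in> adem_ideal" for f g :: "'a st_free"
  proof
    fix x assume "x \<in> st_class f"
    then obtain i where i: "i \<in> adem_ideal" "x = i + f" unfolding st_class_altdef by auto
    then have "x = (i + (f - g)) + g" by simp
    then show "x \<in> st_class g" unfolding st_class_altdef using adem_ideal_closed(2)[OF i(1) that] by blast
  qed
  assume d: "f - g \<in> adem_ideal"
  then have "- 1 * (f - g) \<in> adem_ideal" by (rule adem_ideal_closed(3))
  then show ?thesis using sub[OF d] sub[of g f] by auto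
qed

lemma st_class_memD: "g \<in> st_class f \<Longrightarrow> g - f \<in> adem_ideal"
  unfolding st_class_altdef by auto

lemma st_class_ops:
  "st_class f \<oplus>\<^bsub>steenrod\<^esub> st_class g = st_class (f + g)"
  "st_class f \<otimes>\<^bsub>steenrod\<^esub> st_class g = st_class (f * g :: 'p::prime_card st_free)"
proof -
  interpret ideal "adem_ideal :: 'p st_free set" ring_of_type by (rule ideal_adem)
  show "st_class f \<oplus>\<^bsub>steenrod\<^esub> st_class g = st_class (f + g)"
    using a_rcos_sum[of f g] by (simp add: steenrod_def FactRing_def st_class_def)
  show "st_class f \<otimes>\<^bsub>steenrod\<^esub> st_class g = st_class (f * g)"
    using rcoset_mult_add[of f g] by (simp add: steenrod_def FactRing_def st_class_def)
qed

lemma steenrod_component_iff: "a \<in> steenrod_component k \<longleftrightarrow> (\<exists>f. hdeg k f \<and> a = st_class f)"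
  unfolding steenrod_component_def hdeg_def by auto

lemma st_class_component: "hdeg k f \<Longrightarrow> st_class f \<in> steenrod_component k"
  unfolding steenrod_component_iff by blast

text \<open>The choice of a representative does not matter, because \<open>Phi\<close> vanishes on
  the Adem ideal; see \<open>pairing_class\<close>.\<close>

definition pairing :: "'p::prime_card st_free set \<Rightarrow> mono \<Rightarrow> 'p mod_ring" where
  "pairing a = Phi (SOME f. f \<in> a)"

context odd_prime
begin

lemma adem_ideal_kernel: "f \<in> adem_ideal \<Longrightarrow> Phi f = (\<lambda>d. 0 :: 'p mod_ring)"
proof -
  have "ideal {f. Phi f = (\<lambda>d. 0 :: 'p mod_ring)} ring_of_type"
  proof (rule idealI[OF ring_ring_of_type])
    show "subgroup {f. Phi f = (\<lambda>d. 0 :: 'p mod_ring)} (add_monoid ring_of_type)"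
    proof (rule group.subgroupI)
      show "group (add_monoid (ring_of_type :: 'p st_free ring))"
        by (rule abelian_group.a_group[OF abelian_group_ring_of_type])
      show "{f :: 'p st_free. Phi f = (\<lambda>d. 0)} \<noteq> {}" using Phi_zero by blast
      fix a :: "'p st_free" assume a: "a \<in> {f. Phi f = (\<lambda>d. 0)}"
      have "inv\<^bsub>add_monoid ring_of_type\<^esub> a = - a"
        by (rule group.inv_equality[OF abelian_group.a_group[OF abelian_group_ring_of_type]]) auto
      then show "inv\<^bsub>add_monoid ring_of_type\<^esub> a \<in> {f. Phi f = (\<lambda>d. 0)}" using a by (simp add: Phi_uminus)
    qed (auto simp: Phi_add)
  qed (auto simp: Phi_mult conv_zero)
  then have "adem_ideal \<subseteq> {f. Phi f = (\<lambda>d. 0 :: 'p mod_ring)}"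
    by (rule adem_minimal) (use Phi_adem in auto)
  then show "f \<in> adem_ideal \<Longrightarrow> Phi f = (\<lambda>d. 0 :: 'p mod_ring)" by blast
qed

lemma pairing_class: "pairing (st_class f) = (Phi f :: mono \<Rightarrow> 'p mod_ring)"
proof -
  have "(SOME g. g \<in> st_class f) \<in> st_class f" by (rule someI) (rule st_class_self)
  then have "Phi ((SOME g. g \<in> st_class f) - f) = (\<lambda>d. 0 :: 'p mod_ring)"
    by (intro adem_ideal_kernel st_class_memD)
  then show ?thesis by (simp add: pairing_def Phi_diff fun_eq_iff)
qed

subsection \<open>The components of the bialgebra\<close>

definition bidegree :: "nat \<Rightarrow> nat \<Rightarrow> mono set" where
  "bidegree m n = {b. ldeg CARD('p) b = int m \<and> rdeg b = int n}"

lemma bidegree_le: "b \<in> bidegree m n \<Longrightarrow> n \<le> m"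
  using rdeg_le_ldeg[of "CARD('p)" b] by (simp add: bidegree_def)

lemma le_card_power: "int i \<le> int CARD('p) ^ i"
proof -
  have "i \<le> CARD('p) ^ i" using card_ge_3 power_gt_expt[of "CARD('p)" i] by simp
  then show ?thesis by (metis of_nat_le_iff of_nat_power)
qed

text \<open>The left degree bounds every exponent and, since \<open>p\<^sup>i \<ge> i\<close>, every
  index.\<close>

lemma finite_bidegree: "finite (bidegree m n)"
proof (rule finite_subset)
  let ?T = "{e :: nat \<Rightarrow>\<^sub>0 nat. \<forall>x. (x \<in> {..m} \<longrightarrow> Poly_Mapping.lookup e x \<in> {..m}) \<and> (x \<notin> {..m} \<longrightarrow> Poly_Mapping.lookup e x = 0)}"
  show "bidegree m n \<subseteq> (fset -` Set.Pow {..m}) \<times> ?T"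
  proof
    fix b assume "b \<in> bidegree m n"
    then have l: "ldeg CARD('p) b = int m" by (simp add: bidegree_def)
    obtain S e where b: "b = (S, e)" by (cases b)
    let ?A = "\<Sum>i\<in>fset S. 2 * int CARD('p) ^ i"
    let ?g = "\<lambda>j. (if j = 0 then 1 else 2 * int CARD('p) ^ j) * int (Poly_Mapping.lookup e j)"
    have nn: "0 \<le> ?A" "0 \<le> (\<Sum>j\<in>Poly_Mapping.keys e. ?g j)" by (auto intro!: sum_nonneg)
    have s: "?A + (\<Sum>j\<in>Poly_Mapping.keys e. ?g j) = int m" using l by (simp add: b ldeg_def wt_def)
    have "i \<le> m" if "i |\<in>| S" for i
    proof -
      have "2 * int CARD('p) ^ i \<le> ?A" using that by (intro member_le_sum) auto
      then show ?thesis using le_card_power[of i] s nn by linarith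
    qed
    moreover have "j \<le> m \<and> Poly_Mapping.lookup e j \<le> m" if "j \<in> Poly_Mapping.keys e" for j
    proof -
      have g: "?g j \<le> int m" using member_le_sum[of j "Poly_Mapping.keys e" ?g] that s nn by force
      have k: "int (Poly_Mapping.lookup e j) \<ge> 1" using that by (auto simp: in_keys_iff Suc_le_eq)
      have c: "(if j = 0 then 1 else 2 * int CARD('p) ^ j) \<ge> max 1 (int j)"
      proof (cases "j = 0")
        case False
        have "1 \<le> int CARD('p) ^ j" using card_ge_3 by (intro one_le_power) simp
        then show ?thesis unfolding if_not_P[OF False] using le_card_power[of j] by linarith
      qed simp
      have "?g j \<ge> max 1 (int j) * int (Poly_Mapping.lookup e j)"
        by (rule mult_right_mono[OF c]) simp
      moreover have "max 1 (int j) * int (Poly_Mapping.lookup e j) \<ge> 1 * int (Poly_Mapping.lookup e j)"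
        by (rule mult_right_mono) auto
      moreover have "max 1 (int j) * int (Poly_Mapping.lookup e j) \<ge> max 1 (int j) * 1"
        using k by (intro mult_left_mono) auto
      ultimately show ?thesis using g by linarith
    qed
    ultimately show "b \<in> (fset -` Set.Pow {..m}) \<times> ?T"
      using b by (auto simp: in_keys_iff) (metis linorder_not_le zero_le gr0I)
  qed
  let ?G = "{g :: nat \<Rightarrow> nat. \<forall>x. (x \<in> {..m} \<longrightarrow> g x \<in> {..m}) \<and> (x \<notin> {..m} \<longrightarrow> g x = 0)}"
  have "finite ?G"
    by (rule finite_set_of_finite_funs) (rule finite_atMost)+
  moreover have "inj (Poly_Mapping.lookup :: (nat \<Rightarrow>\<^sub>0 nat) \<Rightarrow> _)"
    by (simp add: inj_def)
  ultimately have "finite (Poly_Mapping.lookup -` ?G :: (nat \<Rightarrow>\<^sub>0 nat) set)"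
    by (rule finite_vimageI)
  also have "Poly_Mapping.lookup -` ?G = ?T"
    unfolding vimage_def mem_Collect_eq ..
  finally have "finite ?T" .
  moreover have "finite (fset -` Set.Pow {..m})"
    by (rule finite_vimageI[OF _ injI]) (simp, rule iffD1[OF fset_inject])
  ultimately show "finite ((fset -` Set.Pow {..m}) \<times> ?T)" by (intro finite_cartesian_product)
qed

lemma lookup_lin_ext:
  "Poly_Mapping.lookup (lin_ext f a) x = (\<Sum>b\<in>Poly_Mapping.keys a. Poly_Mapping.lookup a b * Poly_Mapping.lookup (f b) x)"
  by (simp add: lin_ext_def lookup_sum)

lemma quot_mono_degree:
  "Poly_Mapping.lookup (quot_mono b) k = (if ldeg CARD('p) b = int k then ch {0} b else 0 :: 'p mod_ring)"
  "Poly_Mapping.lookup (quot_mono b) k = (if rdeg b = int k then ch {0} b else 0 :: 'p mod_ring)"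
proof -
  obtain S e where b: "b = (S, e)" by (cases b)
  have "ldeg CARD('p) b = int (Poly_Mapping.lookup e 0) \<and> rdeg b = int (Poly_Mapping.lookup e 0)"
    if "S = {||}" "Poly_Mapping.keys e \<subseteq> {0}"
    unfolding b ldeg_def rdeg_def using that by (simp add: wt_superset[OF _ that(2)])
  then show "Poly_Mapping.lookup (quot_mono b) k = (if ldeg CARD('p) b = int k then ch {0} b else 0 :: 'p mod_ring)"
    "Poly_Mapping.lookup (quot_mono b) k = (if rdeg b = int k then ch {0} b else 0 :: 'p mod_ring)"
    by (auto simp: b ch_def lookup_single when_def)
qed

lemma evl_delta: "(\<Sum>x\<in>Poly_Mapping.keys (delta_mono b :: _ \<Rightarrow>\<^sub>0 'p mod_ring). Poly_Mapping.lookup (delta_mono b) x * \<phi> x) = evl \<phi> (cop (bs b) :: (_, 'p mod_ring) salg)"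
  unfolding Abs_delta_mono[symmetric] by (simp add: evl.abs_eq)

text \<open>On the support of the coproduct the first factor has the left degree of the whole
  monomial, so the quotient map is the counit times a fixed power of \<open>u\<close>, and the
  counit law applies.\<close>

lemma lookup_left_coact:
  "Poly_Mapping.lookup (left_coact a) (k, y) = (if ldeg CARD('p) y = int k then Poly_Mapping.lookup a y else 0 :: 'p mod_ring)"
proof (induction a rule: poly_mapping_single_induct)
  case (single b c)
  have "Poly_Mapping.lookup (left_coact (Poly_Mapping.single b c)) (k, y)
      = c * evl (\<lambda>(x, z). Poly_Mapping.lookup (quot_mono x) k * (if z = y then 1 else 0)) (cop (bs b) :: (_, 'p mod_ring) salg)"
    by (simp add: left_coact_def delta_def lin_ext_scale lookup_lin_ext case_prod_unfold lookup_single when_def evl_delta)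
  also have "evl (\<lambda>(x, z). Poly_Mapping.lookup (quot_mono x) k * (if z = y then 1 else 0)) (cop (bs b) :: (_, 'p mod_ring) salg)
      = evl (\<lambda>x. (if ldeg CARD('p) b = int k then 1 else 0) * (\<lambda>(x, z). ch {0} x * (if z = y then 1 else 0)) x) (cop (bs b))"
    using supp_cop[of b, where 'p = 'p] by (intro evl_cong) (auto simp: quot_mono_degree(1))
  also have "\<dots> = (if ldeg CARD('p) b = int k then 1 else 0) * conv (ch {0}) (\<lambda>z. if z = y then 1 else 0) b"
    unfolding evl_cmult_fun conv_def ..
  finally show ?case by (simp add: conv_counit_left lookup_single when_def)
next
  case (add a b)
  then show ?case by (simp add: left_coact_def delta_def lin_ext_add lookup_add)
qed

lemma lookup_right_coact:
  "Poly_Mapping.lookup (right_coact a) (y, k) = (if rdeg y = int k then Poly_Mapping.lookup a y else 0 :: 'p mod_ring)"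
proof (induction a rule: poly_mapping_single_induct)
  case (single b c)
  have "Poly_Mapping.lookup (right_coact (Poly_Mapping.single b c)) (y, k)
      = c * evl (\<lambda>(z, x). (if z = y then 1 else 0) * Poly_Mapping.lookup (quot_mono x) k) (cop (bs b) :: (_, 'p mod_ring) salg)"
    by (simp add: right_coact_def delta_def lin_ext_scale lookup_lin_ext case_prod_unfold lookup_single when_def evl_delta)
  also have "evl (\<lambda>(z, x). (if z = y then 1 else 0) * Poly_Mapping.lookup (quot_mono x) k) (cop (bs b) :: (_, 'p mod_ring) salg)
      = evl (\<lambda>x. (if rdeg b = int k then 1 else 0) * (\<lambda>(z, x). (if z = y then 1 else 0) * ch {0} x) x) (cop (bs b))"
    using supp_cop[of b, where 'p = 'p] by (intro evl_cong) (auto simp: quot_mono_degree(2))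
  also have "\<dots> = (if rdeg b = int k then 1 else 0) * conv (\<lambda>z. if z = y then 1 else 0) (ch {0}) b"
    unfolding evl_cmult_fun conv_def ..
  finally show ?case by (simp add: conv_counit_right lookup_single when_def)
next
  case (add a b)
  then show ?case by (simp add: right_coact_def delta_def lin_ext_add lookup_add)
qed

lemma dst_component_iff:
  "a \<in> dst_component m n \<longleftrightarrow> Poly_Mapping.keys (a :: 'p dst) \<subseteq> bidegree m n"
proof -
  have "left_coact a = tens (Poly_Mapping.single m 1) a \<longleftrightarrow> (\<forall>y\<in>Poly_Mapping.keys a. ldeg CARD('p) y = int m)"
  proof
    assume l: "left_coact a = tens (Poly_Mapping.single m 1) a"
    show "\<forall>y\<in>Poly_Mapping.keys a. ldeg CARD('p) y = int m"
    proof
      fix y assume "y \<in> Poly_Mapping.keys a"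
      then show "ldeg CARD('p) y = int m"
        using lookup_left_coact[of a m y] unfolding l by (auto simp: in_keys_iff split: if_splits)
    qed
  next
    assume "\<forall>y\<in>Poly_Mapping.keys a. ldeg CARD('p) y = int m"
    then have y: "Poly_Mapping.lookup a y \<noteq> 0 \<Longrightarrow> ldeg CARD('p) y = int m" for y by (simp add: in_keys_iff)
    show "left_coact a = tens (Poly_Mapping.single m 1) a"
    proof (rule poly_mapping_eqI)
      fix x :: "nat \<times> mono"
      obtain k z where "x = (k, z)" by (cases x)
      then show "Poly_Mapping.lookup (left_coact a) x = Poly_Mapping.lookup (tens (Poly_Mapping.single m 1) a) x"
        using y[of z] by (cases "Poly_Mapping.lookup a z = 0") (auto simp: lookup_left_coact lookup_single when_def)
    qed
  qed
  moreover have "right_coact a = tens a (Poly_Mapping.single n 1) \<longleftrightarrow> (\<forall>y\<in>Poly_Mapping.keys a. rdeg y = int n)"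
  proof
    assume l: "right_coact a = tens a (Poly_Mapping.single n 1)"
    show "\<forall>y\<in>Poly_Mapping.keys a. rdeg y = int n"
    proof
      fix y assume "y \<in> Poly_Mapping.keys a"
      then show "rdeg y = int n"
        using lookup_right_coact[of a y n] unfolding l by (auto simp: in_keys_iff split: if_splits)
    qed
  next
    assume "\<forall>y\<in>Poly_Mapping.keys a. rdeg y = int n"
    then have y: "Poly_Mapping.lookup a y \<noteq> 0 \<Longrightarrow> rdeg y = int n" for y by (simp add: in_keys_iff)
    show "right_coact a = tens a (Poly_Mapping.single n 1)"
    proof (rule poly_mapping_eqI)
      fix x :: "mono \<times> nat"
      obtain z k where "x = (z, k)" by (cases x)
      then show "Poly_Mapping.lookup (right_coact a) x = Poly_Mapping.lookup (tens a (Poly_Mapping.single n 1)) x"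
        using y[of z] by (cases "Poly_Mapping.lookup a z = 0") (auto simp: lookup_right_coact lookup_single when_def)
    qed
  qed
  ultimately show ?thesis unfolding dst_component_def bidegree_def by auto
qed

text \<open>A bidegree contains finitely many monomials, so every function supported there is a
  finite sum of elementary tensors.\<close>

lemma tensor_space_iff:
  assumes "vspace V"
  shows "y \<in> tensor_space V (dst_component m n :: 'p dst set) \<longleftrightarrow>
    (\<forall>b. y b \<in> carrier V) \<and> (\<forall>b. b \<notin> bidegree m n \<longrightarrow> y b = \<zero>\<^bsub>V\<^esub>)"
proof
  interpret vspace V by fact
  assume "y \<in> tensor_space V (dst_component m n :: 'p dst set)"
  then show "(\<forall>b. y b \<in> carrier V) \<and> (\<forall>b. b \<notin> bidegree m n \<longrightarrow> y b = \<zero>\<^bsub>V\<^esub>)"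
  proof (induction rule: tensor_space.induct)
    case (add x a y)
    have "Poly_Mapping.lookup a b = 0" if "b \<notin> bidegree m n" for b
      using add(2) that unfolding dst_component_iff by (auto simp: in_keys_iff)
    then show ?case using add by auto
  qed auto
next
  interpret vspace V by fact
  assume y: "(\<forall>b. y b \<in> carrier V) \<and> (\<forall>b. b \<notin> bidegree m n \<longrightarrow> y b = \<zero>\<^bsub>V\<^esub>)"
  have "y \<in> tensor_space V (dst_component m n :: 'p dst set)"
    if "finite B" "B \<subseteq> bidegree m n" "\<forall>b. y b \<in> carrier V" "\<forall>b. b \<notin> B \<longrightarrow> y b = \<zero>\<^bsub>V\<^esub>" for B y
    using that
  proof (induction B arbitrary: y rule: finite_induct)
    case empty
    then have "y = (\<lambda>b. \<zero>\<^bsub>V\<^esub>)" by auto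
    then show ?case by (simp add: tensor_space.zero)
  next
    case (insert c B)
    define y' where "y' b = (if b = c then \<zero>\<^bsub>V\<^esub> else y b)" for b
    have "y' \<in> tensor_space V (dst_component m n :: 'p dst set)"
      by (rule insert.IH) (use insert.prems in \<open>auto simp: y'_def\<close>)
    moreover have "Poly_Mapping.single c 1 \<in> (dst_component m n :: 'p dst set)"
      unfolding dst_component_iff using insert.prems by simp
    moreover have yc: "y c \<in> carrier V" using insert.prems(2) by blast
    ultimately have "(\<lambda>b. (Poly_Mapping.lookup (Poly_Mapping.single c 1) b \<odot>\<^bsub>V\<^esub> y c) \<oplus>\<^bsub>V\<^esub> y' b)
        \<in> tensor_space V (dst_component m n :: 'p dst set)"
      by (intro tensor_space.add)
    moreover have "(\<lambda>b. (Poly_Mapping.lookup (Poly_Mapping.single c 1) b \<odot>\<^bsub>V\<^esub> y c) \<oplus>\<^bsub>V\<^esub> y' b) = y"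
      using insert.prems yc by (auto simp: fun_eq_iff y'_def lookup_single when_def)
    ultimately show ?case by simp
  qed
  then show "y \<in> tensor_space V (dst_component m n :: 'p dst set)"
    using y finite_bidegree by blast
qed

end

section \<open>From unstable modules to comodules\<close>

lemma vspace_component: "graded_space M \<Longrightarrow> vspace (M n)"
  by (simp add: graded_space_def vspace_def)

lemma hdeg_unstable:
  "e \<le> 1 \<Longrightarrow> hdeg (e + 2 * q * (CARD('p) - 1)) (sq_beta ^ e * sq_pow q :: 'p::prime_card st_free)"
  by (rule hdeg_mult[OF _ hdeg_gens(2)]) (cases e, auto simp: hdeg_gens(1)[unfolded One_nat_def])

context
  fixes M :: "('p::prime_card, 'a) st_module"
  assumes M: "is_st_module M"
begin

lemma vspace_stcomp: "vspace (stcomp M n)"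
  using M by (auto simp: is_st_module_def intro: vspace_component)

lemma act_closed:
  assumes "hdeg k f" "x \<in> carrier (stcomp M n)"
  shows "act M k n (st_class f) x \<in> carrier (stcomp M (n + int k))"
  using M assms by (simp add: is_st_module_def st_class_component)

lemma act_add:
  assumes "hdeg k f" "hdeg k g" "x \<in> carrier (stcomp M n)"
  shows "act M k n (st_class (f + g)) x = act M k n (st_class f) x \<oplus>\<^bsub>stcomp M (n + int k)\<^esub> act M k n (st_class g) x"
proof -
  have "act M k n (st_class f \<oplus>\<^bsub>steenrod\<^esub> st_class g) x = act M k n (st_class f) x \<oplus>\<^bsub>stcomp M (n + int k)\<^esub> act M k n (st_class g) x"
    using M assms unfolding is_st_module_def by (blast intro: st_class_component)
  then show ?thesis by (simp add: st_class_ops)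
qed

lemma act_add_right:
  assumes "hdeg k f" "x \<in> carrier (stcomp M n)" "y \<in> carrier (stcomp M n)"
  shows "act M k n (st_class f) (x \<oplus>\<^bsub>stcomp M n\<^esub> y) = act M k n (st_class f) x \<oplus>\<^bsub>stcomp M (n + int k)\<^esub> act M k n (st_class f) y"
  using M assms unfolding is_st_module_def by (blast intro: st_class_component)

lemma act_mult:
  assumes "hdeg k f" "hdeg l g" "x \<in> carrier (stcomp M n)"
  shows "act M (k + l) n (st_class (f * g)) x = act M k (n + int l) (st_class f) (act M l n (st_class g) x)"
proof -
  have "act M (k + l) n (st_class f \<otimes>\<^bsub>steenrod\<^esub> st_class g) x = act M k (n + int l) (st_class f) (act M l n (st_class g) x)"
    using M assms unfolding is_st_module_def by (blast intro: st_class_component)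
  then show ?thesis by (simp add: st_class_ops)
qed

lemma act_scalar: "x \<in> carrier (stcomp M n) \<Longrightarrow> act M 0 n (st_class (Poly_Mapping.single 0 c)) x = c \<odot>\<^bsub>stcomp M n\<^esub> x"
  using M unfolding is_st_module_def by blast

lemma act_one: "x \<in> carrier (stcomp M n) \<Longrightarrow> act M 0 n (st_class 1) x = x"
  using act_scalar[of x n 1] module.smult_one[OF vspace.axioms[OF vspace_stcomp], of x n] by simp

lemma act_smult:
  assumes "hdeg k f" "x \<in> carrier (stcomp M n)"
  shows "act M k n (st_class (Poly_Mapping.single 0 c * f)) x = c \<odot>\<^bsub>stcomp M (n + int k)\<^esub> act M k n (st_class f) x"
  using act_mult[OF hdeg_scalar assms] act_scalar[OF act_closed[OF assms]] by simp

lemma act_smult_right: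
  assumes "hdeg k f" "x \<in> carrier (stcomp M n)"
  shows "act M k n (st_class f) (c \<odot>\<^bsub>stcomp M n\<^esub> x) = c \<odot>\<^bsub>stcomp M (n + int k)\<^esub> act M k n (st_class f) x"
  using act_mult[OF assms(1) hdeg_scalar assms(2), of c] act_smult[OF assms, of c] act_scalar[OF assms(2), of c]
  by (simp add: scalar_commute)

lemma act_zero: "x \<in> carrier (stcomp M n) \<Longrightarrow> act M k n (st_class 0) x = \<zero>\<^bsub>stcomp M (n + int k)\<^esub>"
  using act_smult[OF hdeg_zero, of x n k 0] vspace.vs_smult(3)[OF vspace_stcomp act_closed[OF hdeg_zero], of x n k] by simp

lemma act_zero_right: "hdeg k f \<Longrightarrow> act M k n (st_class f) \<zero>\<^bsub>stcomp M n\<^esub> = \<zero>\<^bsub>stcomp M (n + int k)\<^esub>"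
proof -
  interpret V: vspace "stcomp M n" by (rule vspace_stcomp)
  interpret W: vspace "stcomp M (n + int k)" by (rule vspace_stcomp)
  assume f: "hdeg k f"
  then show ?thesis
    using act_smult_right[OF f V.M.zero_closed, of 0] act_closed[OF f V.M.zero_closed] by simp
qed

lemma act_sum:
  assumes "finite B" "\<And>b. b \<in> B \<Longrightarrow> hdeg k (h b)" "x \<in> carrier (stcomp M n)"
  shows "act M k n (st_class (\<Sum>b\<in>B. Poly_Mapping.single 0 (c b) * h b)) x
    = lc (stcomp M (n + int k)) B c (\<lambda>b. act M k n (st_class (h b)) x)"
  using assms(1,2)
proof (induction B rule: finite_induct)
  case empty
  interpret W: vspace "stcomp M (n + int k)" by (rule vspace_stcomp)
  show ?case using assms by (simp add: act_zero)
next
  case (insert b B)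
  interpret W: vspace "stcomp M (n + int k)" by (rule vspace_stcomp)
  have h: "b' \<in> insert b B \<Longrightarrow> hdeg k (h b')" for b' using insert.prems .
  then have sh: "hdeg k (Poly_Mapping.single 0 (c b') * h b')" if "b' \<in> insert b B" for b'
    using hdeg_mult[OF hdeg_scalar h[OF that]] by simp
  have "act M k n (st_class (\<Sum>b\<in>insert b B. Poly_Mapping.single 0 (c b) * h b)) x
      = act M k n (st_class (Poly_Mapping.single 0 (c b) * h b + (\<Sum>b\<in>B. Poly_Mapping.single 0 (c b) * h b))) x"
    using insert.hyps by simp
  also have "\<dots> = act M k n (st_class (Poly_Mapping.single 0 (c b) * h b)) x
      \<oplus>\<^bsub>stcomp M (n + int k)\<^esub> act M k n (st_class (\<Sum>b\<in>B. Poly_Mapping.single 0 (c b) * h b)) x"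
    using sh by (intro act_add hdeg_sum assms) auto
  also have "\<dots> = (c b \<odot>\<^bsub>stcomp M (n + int k)\<^esub> act M k n (st_class (h b)) x)
      \<oplus>\<^bsub>stcomp M (n + int k)\<^esub> lc (stcomp M (n + int k)) B c (\<lambda>b. act M k n (st_class (h b)) x)"
    using insert.IH h assms(3) by (simp add: act_smult)
  also have "\<dots> = lc (stcomp M (n + int k)) (insert b B) c (\<lambda>b. act M k n (st_class (h b)) x)"
    using insert.hyps h assms(3) by (intro W.lc_insert[symmetric] act_closed) auto
  finally show ?case .
qed

lemma act_unstable:
  assumes "is_unstable M" "e \<le> 1" "int e + 2 * int q > n" "x \<in> carrier (stcomp M n)"
  shows "act M (e + 2 * q * (CARD('p) - 1)) n (st_class (sq_beta ^ e * sq_pow q)) x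
    = \<zero>\<^bsub>stcomp M (n + int (e + 2 * q * (CARD('p) - 1)))\<^esub>"
proof -
  have "e \<in> {0, 1}" using assms(2) by auto
  then show ?thesis using assms unfolding is_unstable_def Let_def by blast
qed

text \<open>Homogeneity is carried along in the induction because additivity of the action is
  available only within one degree.\<close>

lemma act_unst_rel:
  assumes "unst_rel n d f" "is_unstable M" "x \<in> carrier (stcomp M (int n))"
  shows "hdeg d f \<and> act M d (int n) (st_class f) x = \<zero>\<^bsub>stcomp M (int n + int d)\<^esub>"
  using assms(1)
proof (induction rule: unst_rel.induct)
  case (zero d)
  show ?case using assms by (simp add: act_zero)
next
  case (add d f g)
  interpret W: vspace "stcomp M (int n + int d)" by (rule vspace_stcomp)
  show ?case using add assms by (simp add: act_add hdeg_add)
next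
  case (adem r i v j l w d)
  have "r \<in> adem_ideal" using adem(1) adem_subset by blast
  then have "v * r * w - 0 \<in> adem_ideal" by (simp add: adem_ideal_closed)
  then have "st_class (v * r * w) = st_class 0" by (rule st_class_eqI)
  then show ?case using adem assms by (simp add: act_zero hdeg_mult)
next
  case (unstable i v l w e q d)
  let ?s = "sq_beta ^ e * sq_pow q :: 'p st_free" and ?j = "e + 2 * q * (CARD('p) - 1)"
  have s: "hdeg ?j ?s" using unstable by (intro hdeg_unstable)
  define y where "y = act M l (int n) (st_class w) x"
  have y: "y \<in> carrier (stcomp M (int n + int l))" unfolding y_def using unstable assms by (intro act_closed)
  have "act M d (int n) (st_class (v * ?s * w)) x = act M (i + ?j) (int n + int l) (st_class (v * ?s)) y"
    unfolding y_def unstable(5) by (intro act_mult hdeg_mult s unstable assms)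
  also have "\<dots> = act M i (int n + int l + int ?j) (st_class v) (act M ?j (int n + int l) (st_class ?s) y)"
    by (intro act_mult s unstable y)
  also have "act M ?j (int n + int l) (st_class ?s) y = \<zero>\<^bsub>stcomp M (int n + int l + int ?j)\<^esub>"
    using unstable by (intro act_unstable assms y) auto
  also have "act M i (int n + int l + int ?j) (st_class v) \<zero>\<^bsub>stcomp M (int n + int l + int ?j)\<^esub> = \<zero>\<^bsub>stcomp M (int n + int l + int ?j + int i)\<^esub>"
    by (rule act_zero_right) (rule unstable)
  also have "int n + int l + int ?j + int i = int n + int d" using unstable by simp
  finally show ?case using unstable s hdeg_mult[OF hdeg_mult[OF unstable(1) s] unstable(2)] by simp
qed

text \<open>\<open>P\<^sup>0\<close> is the identity by an Adem relator and kills negative degrees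
  by instability.\<close>

lemma negative_component:
  assumes "is_unstable M" "n < 0" "x \<in> carrier (stcomp M n)"
  shows "x = \<zero>\<^bsub>stcomp M n\<^esub>"
proof -
  have "sq_pow 0 - 1 \<in> (adem_ideal :: 'p st_free set)"
    using adem_subset by (auto simp: adem_relators_def Let_def)
  then have "st_class (sq_pow 0) = (st_class 1 :: 'p st_free set)" by (rule st_class_eqI)
  then show ?thesis using act_unstable[OF assms(1), of 0 n 0 x] assms act_one[OF assms(3)] by simp
qed

end

context odd_prime
begin

text \<open>It exists by \<open>Phi_surjective\<close>. Its values on one bidegree determine it only
  up to relations on classes of degree \<open>n\<close>, which act by 0 on unstable modules.\<close>

definition dual :: "nat \<Rightarrow> nat \<Rightarrow> mono \<Rightarrow> 'p st_free" where
  "dual m n b = (SOME f. hdeg (m - n) f \<and> (\<forall>b'\<in>bidegree m n. Phi f b' = (if b' = b then 1 else 0)))"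

lemma dual:
  assumes "n \<le> m"
  shows "hdeg (m - n) (dual m n b)" "b' \<in> bidegree m n \<Longrightarrow> Phi (dual m n b) b' = (if b' = b then 1 else 0)"
proof -
  obtain f :: "'p st_free" where "hdeg (m - n) f"
    "\<forall>b'. rdeg b' = int n \<longrightarrow> ldeg CARD('p) b' = int (n + (m - n)) \<longrightarrow> Phi f b' = (if b' = b then 1 else 0)"
    using Phi_surjective[of "m - n" n "\<lambda>b'. if b' = b then 1 else 0"] by blast
  then have "\<exists>f :: 'p st_free. hdeg (m - n) f \<and> (\<forall>b'\<in>bidegree m n. Phi f b' = (if b' = b then 1 else 0))"
    using assms by (auto simp: bidegree_def)
  from someI_ex[OF this]
  show "hdeg (m - n) (dual m n b)" "b' \<in> bidegree m n \<Longrightarrow> Phi (dual m n b) b' = (if b' = b then 1 else 0)"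
    unfolding dual_def by blast+
qed

text \<open>The difference of \<open>f\<close> and its expansion in the dual elements pairs to 0
  with every monomial of the bidegree, so by \<open>Phi_injective\<close> it is a relation on
  classes of degree \<open>n\<close>.\<close>

lemma act_expand:
  assumes M: "is_st_module (M :: ('p, 'a) st_module)" "is_unstable M" and le: "n \<le> m" and f: "hdeg (m - n) f"
    and x: "x \<in> carrier (stcomp M (int n))"
  shows "act M (m - n) (int n) (st_class f) x
    = lc (stcomp M (int m)) (bidegree m n) (Phi f) (\<lambda>b. act M (m - n) (int n) (st_class (dual m n b)) x)"
proof -
  interpret W: vspace "stcomp M (int m)" by (rule vspace_stcomp[OF M(1)])
  have m: "int n + int (m - n) = int m" using le by simp
  define s where "s = (\<Sum>b\<in>bidegree m n. Poly_Mapping.single 0 (Phi f b) * dual m n b)"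
  have s: "hdeg (m - n) s" unfolding s_def
    using hdeg_mult[OF hdeg_scalar dual(1)[OF le]] by (intro hdeg_sum) simp
  have "Phi s b = Phi f b" if "b \<in> bidegree m n" for b
    unfolding s_def using that finite_bidegree
    by (simp add: Phi_sum Phi_scalar_mult dual[OF le] if_distrib[of "\<lambda>t. _ * t"] sum.delta cong: if_cong)
  then have "unst_rel n (m - n) (f - s)"
    using le by (intro Phi_injective hdeg_diff f s) (auto simp: Phi_diff bidegree_def)
  then have "act M (m - n) (int n) (st_class (f - s)) x = \<zero>\<^bsub>stcomp M (int m)\<^esub>"
    using act_unst_rel[OF M(1) _ M(2) x] m by simp
  moreover have "act M (m - n) (int n) (st_class ((f - s) + s)) x
      = act M (m - n) (int n) (st_class (f - s)) x \<oplus>\<^bsub>stcomp M (int m)\<^esub> act M (m - n) (int n) (st_class s) x"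
    using act_add[OF M(1) hdeg_diff[OF f s] s x] m by simp
  moreover have "act M (m - n) (int n) (st_class s) x
      = lc (stcomp M (int m)) (bidegree m n) (Phi f) (\<lambda>b. act M (m - n) (int n) (st_class (dual m n b)) x)"
    unfolding s_def using act_sum[OF M(1) finite_bidegree dual(1)[OF le] x] m by simp
  moreover have "act M (m - n) (int n) (st_class s) x \<in> carrier (stcomp M (int m))"
    using act_closed[OF M(1) s x] m by simp
  ultimately show ?thesis by simp
qed

definition comodule_of :: "('p, 'a) st_module \<Rightarrow> ('p, 'a) comodule" where
  "comodule_of M = \<lparr>cocomp = \<lambda>n. stcomp M (int n),
    coact = \<lambda>n x m b. if b \<in> bidegree m n then act M (m - n) (int n) (st_class (dual m n b)) x
      else \<zero>\<^bsub>stcomp M (int m)\<^esub>\<rparr>"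

lemma comodule_of_simps [simp]:
  "cocomp (comodule_of M) n = stcomp M (int n)"
  "coact (comodule_of M) n x m b = (if b \<in> bidegree m n then act M (m - n) (int n) (st_class (dual m n b)) x
      else \<zero>\<^bsub>stcomp M (int m)\<^esub>)"
  by (simp_all add: comodule_of_def)

lemma bidegree_dual: "b \<in> bidegree m n \<Longrightarrow> hdeg (m - n) (dual m n b' :: 'p st_free) \<and> int n + int (m - n) = int m"
  using bidegree_le[of b m n] dual(1)[of n m b'] by simp

lemma counit_bidegree: "b \<in> bidegree m n \<Longrightarrow> m \<noteq> n \<Longrightarrow> ch {0} b = (0 :: 'p mod_ring)"
  using quot_mono_degree[of b m] by (auto simp: bidegree_def split: if_splits)

text \<open>Homogeneity of \<open>g\<close> and \<open>h\<close> cuts the coproduct down to two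
  finite bidegrees, so that convolution is expressed by structure constants.\<close>

lemma conv_dual:
  assumes "hdeg (l - m) g" "hdeg (m - n) h" "m \<le> l" "n \<le> m" "d \<in> bidegree l n"
  shows "conv (Phi g) (Phi h) d
    = (\<Sum>b\<in>bidegree l m. Phi g b * (\<Sum>c\<in>bidegree m n. Phi h c * Poly_Mapping.lookup (delta_mono d) (b, c) :: 'p mod_ring))"
proof -
  let ?t = "cop (bs d) :: (_, 'p mod_ring) salg"
  let ?B = "bidegree l m \<times> bidegree m n"
  have z: "Phi g b * Phi h c = 0" if "(b, c) \<in> supp ?t" "(b, c) \<notin> ?B" for b c
  proof (rule ccontr)
    assume nz: "Phi g b * Phi h c \<noteq> 0"
    then have "ldeg CARD('p) b = rdeg b + int (l - m)" "ldeg CARD('p) c = rdeg c + int (m - n)"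
      using Phi_degree[OF assms(1), of b] Phi_degree[OF assms(2), of c] by auto
    moreover have "ldeg CARD('p) b = ldeg CARD('p) d" "rdeg c = rdeg d" "rdeg b = ldeg CARD('p) c"
      using supp_cop[of d, where 'p = 'p] that by auto
    ultimately show False using that assms by (auto simp: bidegree_def)
  qed
  have "conv (Phi g) (Phi h) d = (\<Sum>x\<in>supp ?t. coef ?t x * (case x of (b, c) \<Rightarrow> Phi g b * Phi h c))"
    unfolding conv_def by (rule evl_superset) auto
  also have "\<dots> = (\<Sum>x\<in>?B. coef ?t x * (case x of (b, c) \<Rightarrow> Phi g b * Phi h c))"
  proof (rule sum.mono_neutral_cong)
    fix x assume "x \<in> supp ?t - ?B"
    moreover obtain b c where "x = (b, c)" by (cases x)
    ultimately show "coef ?t x * (case x of (b, c) \<Rightarrow> Phi g b * Phi h c) = 0" using z[of b c] by auto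
  qed (simp_all add: finite_bidegree supp_iff)
  also have "\<dots> = (\<Sum>b\<in>bidegree l m. \<Sum>c\<in>bidegree m n. coef ?t (b, c) * (Phi g b * Phi h c))"
    by (simp add: sum.cartesian_product case_prod_unfold)
  finally show ?thesis by (simp add: coef_cop sum_distrib_left mult_ac)
qed

lemma delta_mono_degree:
  "Poly_Mapping.lookup (delta_mono d :: _ \<Rightarrow>\<^sub>0 'p mod_ring) (b, c) \<noteq> 0 \<Longrightarrow>
    ldeg CARD('p) b = ldeg CARD('p) d \<and> rdeg c = rdeg d \<and> rdeg b = ldeg CARD('p) c"
  using supp_cop[of d, where 'p = 'p] by (auto simp: supp_iff coef_cop)

lemma finsum_singleton_support:
  assumes "vspace V" "y m \<in> carrier V" "\<And>m'. m' \<noteq> m \<Longrightarrow> y m' = \<zero>\<^bsub>V\<^esub>"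
  shows "finsum V y {m. y m \<noteq> \<zero>\<^bsub>V\<^esub>} = y m"
proof -
  interpret vspace V by fact
  have "finsum V y {m. y m \<noteq> \<zero>\<^bsub>V\<^esub>} = finsum V y {m}"
    by (rule M.add.finprod_mono_neutral_cong_left) (use assms in auto)
  also have "\<dots> = y m" using assms by simp
  finally show ?thesis .
qed

context
  fixes M :: "('p, 'a) st_module"
  assumes M: "is_st_module M" "is_unstable M"
begin

lemma coact_comodule_of_closed:
  "x \<in> carrier (stcomp M (int n)) \<Longrightarrow> coact (comodule_of M) n x m b \<in> carrier (stcomp M (int m))"
proof -
  interpret W: vspace "stcomp M (int m)" by (rule vspace_stcomp[OF M(1)])
  show "x \<in> carrier (stcomp M (int n)) \<Longrightarrow> coact (comodule_of M) n x m b \<in> carrier (stcomp M (int m))"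
    using act_closed[OF M(1), of "m - n" "dual m n b" x "int n"] bidegree_dual[of b m n b] by auto
qed

lemma contract_comodule_of:
  assumes "x \<in> carrier (stcomp M (int n))"
  shows "contract (stcomp M (int m)) f (coact (comodule_of M) n x m)
    = lc (stcomp M (int m)) (bidegree m n) f (coact (comodule_of M) n x m)"
  by (intro vspace.contract_lc vspace_stcomp M finite_bidegree coact_comodule_of_closed assms) simp

text \<open>Counitality and coassociativity reduce to it, with \<open>f = 1\<close> and with
  \<open>f\<close> a product of two dual elements.\<close>

lemma contract_comodule_of_act:
  assumes x: "x \<in> carrier (stcomp M (int n))" and "n \<le> m" "hdeg (m - n) f"
    and "\<And>b. b \<in> bidegree m n \<Longrightarrow> g b = Phi f b"
  shows "contract (stcomp M (int m)) g (coact (comodule_of M) n x m) = act M (m - n) (int n) (st_class f) x"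
proof -
  interpret W: vspace "stcomp M (int m)" by (rule vspace_stcomp[OF M(1)])
  have "act M (m - n) (int n) (st_class (dual m n b)) x \<in> carrier (stcomp M (int m))" if "b \<in> bidegree m n" for b
    using coact_comodule_of_closed[OF x, of m b] that by simp
  then show ?thesis
    unfolding contract_comodule_of[OF x] act_expand[OF M assms(2,3) x]
    using assms(4) by (intro W.lc_cong) simp_all
qed

lemma is_comodule_comodule_of: "is_comodule (comodule_of M)"
proof -
  let ?C = "comodule_of M" and ?V = "\<lambda>n. stcomp M (int n)"
  have vs: "vspace (?V n)" for n by (rule vspace_stcomp[OF M(1)])
  have gs: "graded_space ?V"
    using vs by (simp add: graded_space_def vspace_def)
  have add: "coact ?C n (x \<oplus>\<^bsub>?V n\<^esub> y) m b = coact ?C n x m b \<oplus>\<^bsub>?V m\<^esub> coact ?C n y m b"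
    if "x \<in> carrier (?V n)" "y \<in> carrier (?V n)" for n m b x y
  proof -
    interpret W: vspace "?V m" by (rule vs)
    show ?thesis using bidegree_dual[of b m n b] act_add_right[OF M(1) _ that, of "m - n" "dual m n b"] by auto
  qed
  have smult: "coact ?C n (c \<odot>\<^bsub>?V n\<^esub> x) m b = c \<odot>\<^bsub>?V m\<^esub> coact ?C n x m b"
    if "x \<in> carrier (?V n)" for n m b c x
  proof -
    interpret W: vspace "?V m" by (rule vs)
    show ?thesis using bidegree_dual[of b m n b] act_smult_right[OF M(1) _ that, of "m - n" "dual m n b" c] by auto
  qed
  have tensor: "coact ?C n x m \<in> tensor_space (?V m) (dst_component m n)" if "x \<in> carrier (?V n)" for n m x
    unfolding tensor_space_iff[OF vs] using coact_comodule_of_closed[OF that] by simp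
  have zero: "contract (?V m) g (coact ?C n x m) = \<zero>\<^bsub>?V m\<^esub>"
    if "x \<in> carrier (?V n)" "\<And>b. b \<in> bidegree m n \<Longrightarrow> g b = 0" for n m x g
    unfolding contract_comodule_of[OF that(1)]
    by (intro vspace.lc_coeff_zero vs coact_comodule_of_closed that)
  have unit: "contract (?V n) g (coact ?C n x n) = x"
    if "x \<in> carrier (?V n)" "\<And>b. b \<in> bidegree n n \<Longrightarrow> g b = ch {0} b" for n x g
    using contract_comodule_of_act[OF that(1), of n 1 g] that act_one[OF M(1) that(1)] by (simp add: Phi_one)
  have quot: "contract (?V m) (\<lambda>b. Poly_Mapping.lookup (quot_mono b) k) (coact ?C n x m) = (if m = n \<and> k = n then x else \<zero>\<^bsub>?V m\<^esub>)"
    if x: "x \<in> carrier (?V n)" for n m k x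
  proof (cases "m = n \<and> k = n")
    case True
    then show ?thesis using unit[OF x] by (auto simp: quot_mono_degree(1) bidegree_def)
  next
    case False
    have "Poly_Mapping.lookup (quot_mono b) k = (0 :: 'p mod_ring)" if "b \<in> bidegree m n" for b
      using False that quot_mono_degree[of b k] by (auto simp: bidegree_def split: if_splits)
    then show ?thesis using False zero[OF x] by auto
  qed
  have counit: "contract (?V m) counit_mono (coact ?C n x m) = (if m = n then x else \<zero>\<^bsub>?V m\<^esub>)"
    if x: "x \<in> carrier (?V n)" for n m x
    using unit[OF x] zero[OF x] counit_bidegree[of _ m n] by (auto simp: counit_mono_eq)
  have coassoc: "finsum (?V l) (\<lambda>m. coact ?C m (coact ?C n x m c) l b) {m. coact ?C m (coact ?C n x m c) l b \<noteq> \<zero>\<^bsub>?V l\<^esub>}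
      = contract (?V l) (\<lambda>d. Poly_Mapping.lookup (delta_mono d) (b, c)) (coact ?C n x l)"
    if x: "x \<in> carrier (?V n)" for n l b c x
  proof -
    interpret W: vspace "?V l" by (rule vs)
    have z: "coact ?C m (coact ?C n x m c) l b = \<zero>\<^bsub>?V l\<^esub>" if "\<not> (c \<in> bidegree m n \<and> b \<in> bidegree l m)" for m
    proof (cases "b \<in> bidegree l m")
      case True
      then show ?thesis
        using that bidegree_dual[of b l m b] act_zero_right[OF M(1), of "l - m" "dual l m b" "int m"] by simp
    qed simp
    show ?thesis
    proof (cases "\<exists>m. c \<in> bidegree m n \<and> b \<in> bidegree l m")
      case True
      then obtain m where m: "c \<in> bidegree m n" "b \<in> bidegree l m" by blast
      have le: "n \<le> m" "m \<le> l" using m bidegree_le by blast+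
      have deg: "(l - m) + (m - n) = l - n" "int n + int (m - n) = int m" using le by simp_all
      have "m' = m" if "c \<in> bidegree m' n" for m' using that m by (simp add: bidegree_def)
      then have "finsum (?V l) (\<lambda>m. coact ?C m (coact ?C n x m c) l b) {m. coact ?C m (coact ?C n x m c) l b \<noteq> \<zero>\<^bsub>?V l\<^esub>}
          = coact ?C m (coact ?C n x m c) l b"
        using z by (intro finsum_singleton_support vs coact_comodule_of_closed x) blast
      also have "\<dots> = act M (l - m) (int m) (st_class (dual l m b)) (act M (m - n) (int n) (st_class (dual m n c)) x)"
        using m by simp
      also have "\<dots> = act M (l - n) (int n) (st_class (dual l m b * dual m n c)) x"
        using act_mult[OF M(1) dual(1)[OF le(2)] dual(1)[OF le(1)] x, of b c] by (simp only: deg)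
      also have "\<dots> = contract (?V l) (\<lambda>d. Poly_Mapping.lookup (delta_mono d) (b, c)) (coact ?C n x l)"
      proof (rule contract_comodule_of_act[symmetric, OF x])
        show "n \<le> l" using le by simp
        show "hdeg (l - n) (dual l m b * dual m n c)"
          using hdeg_mult[OF dual(1)[OF le(2)] dual(1)[OF le(1)], of b c] by (simp only: deg)
        fix d assume d: "d \<in> bidegree l n"
        \<comment> \<open>Convolution of the functionals of two dual elements picks out one
          structure constant of the coproduct.\<close>
        show "Poly_Mapping.lookup (delta_mono d) (b, c) = Phi (dual l m b * dual m n c) d"
          unfolding Phi_mult conv_dual[OF dual(1)[OF le(2)] dual(1)[OF le(1)] le(2,1) d]
          using m finite_bidegree
          by (simp add: dual le if_distrib[of "\<lambda>t. t * _"] sum.delta cong: if_cong)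
      qed
      finally show ?thesis .
    next
      case False
      have "Poly_Mapping.lookup (delta_mono d) (b, c) = (0 :: 'p mod_ring)" if d: "d \<in> bidegree l n" for d
      proof (rule ccontr)
        assume "Poly_Mapping.lookup (delta_mono d) (b, c) \<noteq> (0 :: 'p mod_ring)"
        from delta_mono_degree[OF this] have "c \<in> bidegree (nat (rdeg b)) n \<and> b \<in> bidegree l (nat (rdeg b))"
          using d rdeg_nonneg[of b] by (auto simp: bidegree_def)
        then show False using False by blast
      qed
      then have "contract (?V l) (\<lambda>d. Poly_Mapping.lookup (delta_mono d) (b, c)) (coact ?C n x l) = \<zero>\<^bsub>?V l\<^esub>"
        by (rule zero[OF x])
      moreover have "{m. coact ?C m (coact ?C n x m c) l b \<noteq> \<zero>\<^bsub>?V l\<^esub>} = {}" using z False by blast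
      ultimately show ?thesis by simp
    qed
  qed
  show ?thesis
    unfolding is_comodule_def comodule_of_simps(1)
    by (intro conjI gs allI ballI add smult tensor quot counit coassoc)
qed

end

end

section \<open>From comodules to unstable modules\<close>

text \<open>The zero module for negative degrees. The type of the elements is arbitrary, so
  \<open>undefined\<close> serves as the only element.\<close>

definition trivial_module :: "('k, 'a) module" where
  "trivial_module = \<lparr>carrier = {undefined}, monoid.mult = (\<lambda>x y. undefined), one = undefined,
    zero = undefined, add = (\<lambda>x y. undefined), module.smult = (\<lambda>c x. undefined)\<rparr>"

lemma trivial_module_simps [simp]:
  "carrier trivial_module = {undefined}" "\<zero>\<^bsub>trivial_module\<^esub> = undefined"
  "x \<oplus>\<^bsub>trivial_module\<^esub> y = undefined" "c \<odot>\<^bsub>trivial_module\<^esub> x = undefined"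
  by (simp_all add: trivial_module_def)

lemma module_trivial_module: "module (ring_of_type :: 'k::field ring) trivial_module"
  by (rule moduleI[OF cring_ring_of_type]) (auto intro: abelian_groupI)

context odd_prime
begin

text \<open>An operation can lead from a negative to a nonnegative degree, hence the case
  distinction in the zero that it produces.\<close>

definition module_of :: "('p, 'a) comodule \<Rightarrow> ('p, 'a) st_module" where
  "module_of N = \<lparr>stcomp = \<lambda>n. if 0 \<le> n then cocomp N (nat n) else trivial_module,
    act = \<lambda>k n a x. if 0 \<le> n
      then contract (cocomp N (nat n + k)) (pairing a) (coact N (nat n) x (nat n + k))
      else \<zero>\<^bsub>if 0 \<le> n + int k then cocomp N (nat (n + int k)) else trivial_module\<^esub>\<rparr>"

lemma module_of_simps:
  "stcomp (module_of N) n = (if 0 \<le> n then cocomp N (nat n) else trivial_module)"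
  "0 \<le> n \<Longrightarrow> act (module_of N) k n a x = contract (cocomp N (nat n + k)) (pairing a) (coact N (nat n) x (nat n + k))"
  "n < 0 \<Longrightarrow> act (module_of N) k n a x = \<zero>\<^bsub>stcomp (module_of N) (n + int k)\<^esub>"
  by (simp_all add: module_of_def)

lemma module_of_nonneg [simp]:
  "stcomp (module_of N) (int n) = cocomp N n"
  "act (module_of N) k (int n) a x = contract (cocomp N (n + k)) (pairing a) (coact N n x (n + k))"
  by (simp_all add: module_of_def)

context
  fixes N :: "('p, 'a) comodule"
  assumes N: "is_comodule N"
begin

lemma vspace_cocomp: "vspace (cocomp N n)"
  using N by (auto simp: is_comodule_def intro: vspace_component)

lemma coact_add:
  "x \<in> carrier (cocomp N n) \<Longrightarrow> y \<in> carrier (cocomp N n) \<Longrightarrow>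
    coact N n (x \<oplus>\<^bsub>cocomp N n\<^esub> y) m b = coact N n x m b \<oplus>\<^bsub>cocomp N m\<^esub> coact N n y m b"
  using N by (simp add: is_comodule_def del: split_paired_All)

lemma coact_smult:
  "x \<in> carrier (cocomp N n) \<Longrightarrow> coact N n (c \<odot>\<^bsub>cocomp N n\<^esub> x) m b = c \<odot>\<^bsub>cocomp N m\<^esub> coact N n x m b"
  using N by (simp add: is_comodule_def del: split_paired_All)

lemma coact_tensor: "x \<in> carrier (cocomp N n) \<Longrightarrow> coact N n x m \<in> tensor_space (cocomp N m) (dst_component m n)"
  using N by (simp add: is_comodule_def)

lemma coact_closed: "x \<in> carrier (cocomp N n) \<Longrightarrow> coact N n x m b \<in> carrier (cocomp N m)"
  using coact_tensor unfolding tensor_space_iff[OF vspace_cocomp] by blast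

lemma coact_support: "x \<in> carrier (cocomp N n) \<Longrightarrow> b \<notin> bidegree m n \<Longrightarrow> coact N n x m b = \<zero>\<^bsub>cocomp N m\<^esub>"
  using coact_tensor unfolding tensor_space_iff[OF vspace_cocomp] by blast

lemma coact_counit:
  "x \<in> carrier (cocomp N n) \<Longrightarrow> contract (cocomp N m) (ch {0}) (coact N n x m) = (if m = n then x else \<zero>\<^bsub>cocomp N m\<^esub>)"
  using N unfolding counit_mono_eq[symmetric] by (simp add: is_comodule_def)

lemma coact_coassoc:
  "x \<in> carrier (cocomp N n) \<Longrightarrow> finsum (cocomp N l) (\<lambda>m. coact N m (coact N n x m c) l b)
      {m. coact N m (coact N n x m c) l b \<noteq> \<zero>\<^bsub>cocomp N l\<^esub>}
    = contract (cocomp N l) (\<lambda>d. Poly_Mapping.lookup (delta_mono d) (b, c)) (coact N n x l)"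
  using N unfolding is_comodule_def by blast

lemma coact_zero: "coact N n \<zero>\<^bsub>cocomp N n\<^esub> m b = \<zero>\<^bsub>cocomp N m\<^esub>"
proof -
  interpret V: vspace "cocomp N n" by (rule vspace_cocomp)
  interpret W: vspace "cocomp N m" by (rule vspace_cocomp)
  show ?thesis using coact_smult[OF V.M.zero_closed, of 0 m b] coact_closed[OF V.M.zero_closed, of m b] by simp
qed

lemma contract_coact:
  "x \<in> carrier (cocomp N n) \<Longrightarrow> contract (cocomp N m) f (coact N n x m) = lc (cocomp N m) (bidegree m n) f (coact N n x m)"
  by (intro vspace.contract_lc vspace_cocomp finite_bidegree coact_closed coact_support)

lemma contract_coact_closed:
  "x \<in> carrier (cocomp N n) \<Longrightarrow> contract (cocomp N m) f (coact N n x m) \<in> carrier (cocomp N m)"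
  unfolding contract_coact by (intro vspace.lc_closed vspace_cocomp coact_closed)

lemma contract_coact_add:
  assumes "x \<in> carrier (cocomp N n)" "y \<in> carrier (cocomp N n)"
  shows "contract (cocomp N m) f (coact N n (x \<oplus>\<^bsub>cocomp N n\<^esub> y) m)
    = contract (cocomp N m) f (coact N n x m) \<oplus>\<^bsub>cocomp N m\<^esub> contract (cocomp N m) f (coact N n y m)"
proof -
  interpret V: vspace "cocomp N n" by (rule vspace_cocomp)
  have eq: "coact N n (x \<oplus>\<^bsub>cocomp N n\<^esub> y) m = (\<lambda>b. coact N n x m b \<oplus>\<^bsub>cocomp N m\<^esub> coact N n y m b)"
    using assms by (simp add: coact_add fun_eq_iff)
  have xy: "x \<oplus>\<^bsub>cocomp N n\<^esub> y \<in> carrier (cocomp N n)" using assms by simp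
  show ?thesis
    unfolding contract_coact[OF xy] contract_coact[OF assms(1)] contract_coact[OF assms(2)]
    unfolding eq
    by (rule vspace.lc_vec_add[OF vspace_cocomp finite_bidegree coact_closed[OF assms(1)] coact_closed[OF assms(2)]])
qed

lemma contract_coact_zero: "contract (cocomp N m) f (coact N n \<zero>\<^bsub>cocomp N n\<^esub> m) = \<zero>\<^bsub>cocomp N m\<^esub>"
proof -
  interpret W: vspace "cocomp N m" by (rule vspace_cocomp)
  show ?thesis by (simp add: contract_def coact_zero)
qed

lemma coact_coact:
  assumes x: "x \<in> carrier (cocomp N n)" and c: "c \<in> bidegree m n"
  shows "coact N m (coact N n x m c) l b
    = lc (cocomp N l) (bidegree l n) (\<lambda>d. Poly_Mapping.lookup (delta_mono d) (b, c)) (coact N n x l)"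
proof -
  have "coact N m' (coact N n x m' c) l b = \<zero>\<^bsub>cocomp N l\<^esub>" if "m' \<noteq> m" for m'
    using coact_support[OF x, of c m'] c that coact_zero by (simp add: bidegree_def)
  then have "coact N m (coact N n x m c) l b = finsum (cocomp N l) (\<lambda>m. coact N m (coact N n x m c) l b)
      {m. coact N m (coact N n x m c) l b \<noteq> \<zero>\<^bsub>cocomp N l\<^esub>}"
    by (intro finsum_singleton_support[symmetric] vspace_cocomp coact_closed x)
  then show ?thesis unfolding coact_coassoc[OF x] contract_coact[OF x] .
qed

text \<open>Associativity of the action: coassociativity replaces the iterated coaction by structure
  constants of the coproduct, which \<open>conv_dual\<close> assembles into a convolution.\<close>

lemma contract_contract:
  assumes x: "x \<in> carrier (cocomp N n)" and g: "hdeg (l - m) g" "hdeg (m - n) h" and le: "m \<le> l" "n \<le> m"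
  shows "contract (cocomp N l) (Phi g) (coact N m (contract (cocomp N m) (Phi h) (coact N n x m)) l)
    = contract (cocomp N l) (conv (Phi g) (Phi h)) (coact N n x l)"
proof -
  interpret W: vspace "cocomp N l" by (rule vspace_cocomp)
  let ?K = "\<lambda>b c d. Poly_Mapping.lookup (delta_mono d) (b, c)"
  have "coact N m (contract (cocomp N m) (Phi h) (coact N n x m)) l b
      = lc (cocomp N l) (bidegree l n) (\<lambda>d. \<Sum>c\<in>bidegree m n. Phi h c * ?K b c d) (coact N n x l)" for b
  proof -
    have "coact N m (contract (cocomp N m) (Phi h) (coact N n x m)) l b
        = lc (cocomp N l) (bidegree m n) (Phi h) (\<lambda>c. coact N m (coact N n x m c) l b)"
      unfolding contract_coact[OF x]
      by (rule lc_linear_map[OF vspace_cocomp vspace_cocomp finite_bidegree])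
        (simp_all add: coact_closed x coact_add coact_smult)
    also have "\<dots> = lc (cocomp N l) (bidegree m n) (Phi h) (\<lambda>c. lc (cocomp N l) (bidegree l n) (?K b c) (coact N n x l))"
      by (rule W.lc_cong) (simp_all add: coact_coact x coact_closed)
    also have "\<dots> = lc (cocomp N l) (bidegree l n) (\<lambda>d. \<Sum>c\<in>bidegree m n. Phi h c * ?K b c d) (coact N n x l)"
      by (rule W.lc_lc) (simp_all add: finite_bidegree coact_closed x)
    finally show ?thesis .
  qed
  then have "contract (cocomp N l) (Phi g) (coact N m (contract (cocomp N m) (Phi h) (coact N n x m)) l)
      = lc (cocomp N l) (bidegree l m) (Phi g) (\<lambda>b. lc (cocomp N l) (bidegree l n)
          (\<lambda>d. \<Sum>c\<in>bidegree m n. Phi h c * ?K b c d) (coact N n x l))"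
    unfolding contract_coact[OF contract_coact_closed[OF x]] by (intro W.lc_cong) (simp_all add: coact_closed x)
  also have "\<dots> = lc (cocomp N l) (bidegree l n)
      (\<lambda>d. \<Sum>b\<in>bidegree l m. Phi g b * (\<Sum>c\<in>bidegree m n. Phi h c * ?K b c d)) (coact N n x l)"
    by (rule W.lc_lc) (simp_all add: finite_bidegree coact_closed x)
  also have "\<dots> = contract (cocomp N l) (conv (Phi g) (Phi h)) (coact N n x l)"
    unfolding contract_coact[OF x] by (rule W.lc_cong) (simp_all add: conv_dual[OF g le] coact_closed x)
  finally show ?thesis .
qed

lemma is_st_module_module_of: "is_st_module (module_of N)"
proof -
  let ?M = "module_of N"
  have vs: "vspace (stcomp ?M n)" for n
    using vspace_cocomp module_trivial_module[where 'k = "'p mod_ring" and 'a = 'a] by (simp add: module_of_simps(1) vspace_def)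
  have gs: "graded_space (stcomp ?M)"
    using vs by (simp add: graded_space_def vspace_def)
  have closed: "act ?M k n a x \<in> carrier (stcomp ?M (n + int k))" if "x \<in> carrier (stcomp ?M n)" for k n a x
  proof (cases "0 \<le> n")
    case True
    then obtain m where n: "n = int m" using nonneg_int_cases by blast
    show ?thesis using that contract_coact_closed[of x m] unfolding n of_nat_add[symmetric] by (simp del: of_nat_add)
  next
    case False
    interpret W: vspace "stcomp ?M (n + int k)" by (rule vs)
    show ?thesis using False by (simp add: module_of_simps(3))
  qed
  have add_right: "act ?M k n a (x \<oplus>\<^bsub>stcomp ?M n\<^esub> y) = act ?M k n a x \<oplus>\<^bsub>stcomp ?M (n + int k)\<^esub> act ?M k n a y"
    if "x \<in> carrier (stcomp ?M n)" "y \<in> carrier (stcomp ?M n)" for k n a x y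
  proof (cases "0 \<le> n")
    case True
    then obtain m where n: "n = int m" using nonneg_int_cases by blast
    show ?thesis using that contract_coact_add[of x m y] unfolding n of_nat_add[symmetric] by (simp del: of_nat_add)
  next
    case False
    interpret W: vspace "stcomp ?M (n + int k)" by (rule vs)
    show ?thesis using False by (simp add: module_of_simps(3))
  qed
  have add_left: "act ?M k n (a \<oplus>\<^bsub>steenrod\<^esub> b) x = act ?M k n a x \<oplus>\<^bsub>stcomp ?M (n + int k)\<^esub> act ?M k n b x"
    if a: "a \<in> steenrod_component k" "b \<in> steenrod_component k" and x: "x \<in> carrier (stcomp ?M n)" for k n a b x
  proof (cases "0 \<le> n")
    case True
    then obtain m where n: "n = int m" using nonneg_int_cases by blast
    interpret W: vspace "cocomp N (m + k)" by (rule vspace_cocomp)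
    obtain f g where f: "a = st_class f" "b = st_class g" using a by (auto simp: steenrod_component_iff)
    show ?thesis
      using x unfolding n of_nat_add[symmetric] f st_class_ops
      by (simp add: pairing_class contract_coact Phi_add W.lc_coeff_add finite_bidegree coact_closed del: of_nat_add)
  next
    case False
    interpret W: vspace "stcomp ?M (n + int k)" by (rule vs)
    show ?thesis using False by (simp add: module_of_simps(3))
  qed
  have act_zero: "act ?M k n a \<zero>\<^bsub>stcomp ?M n\<^esub> = \<zero>\<^bsub>stcomp ?M (n + int k)\<^esub>" for k n a
  proof (cases "0 \<le> n")
    case True
    then obtain m where n: "n = int m" using nonneg_int_cases by blast
    show ?thesis unfolding n of_nat_add[symmetric] by (simp add: contract_coact_zero del: of_nat_add)
  qed (simp add: module_of_simps(3))
  have mult: "act ?M (k + l) n (a \<otimes>\<^bsub>steenrod\<^esub> b) x = act ?M k (n + int l) a (act ?M l n b x)"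
    if a: "a \<in> steenrod_component k" "b \<in> steenrod_component l" and x: "x \<in> carrier (stcomp ?M n)" for k l n a b x
  proof (cases "0 \<le> n")
    case True
    then obtain m where n: "n = int m" using nonneg_int_cases by blast
    obtain f g where f: "a = st_class f" "b = st_class g" "hdeg k f" "hdeg l g" using a by (auto simp: steenrod_component_iff)
    have "contract (cocomp N (m + l + k)) (Phi f) (coact N (m + l) (contract (cocomp N (m + l)) (Phi g) (coact N m x (m + l))) (m + l + k))
        = contract (cocomp N (m + l + k)) (conv (Phi f) (Phi g)) (coact N m x (m + l + k))"
      by (rule contract_contract) (use x f in \<open>simp_all add: n\<close>)
    then show ?thesis
      unfolding n of_nat_add[symmetric] f(1,2) st_class_ops by (simp add: pairing_class Phi_mult ac_simps del: of_nat_add)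
  next
    case False
    then show ?thesis using act_zero[of k "n + int l" a] by (simp add: module_of_simps(3) ac_simps)
  qed
  have scalar: "act ?M 0 n (st_class (Poly_Mapping.single 0 c)) x = c \<odot>\<^bsub>stcomp ?M n\<^esub> x"
    if x: "x \<in> carrier (stcomp ?M n)" for n c x
  proof (cases "0 \<le> n")
    case True
    then obtain m where n: "n = int m" using nonneg_int_cases by blast
    interpret W: vspace "cocomp N m" by (rule vspace_cocomp)
    have x: "x \<in> carrier (cocomp N m)" using x by (simp add: n)
    have "Phi (Poly_Mapping.single 0 c) = (\<lambda>d. c * ch {0} d :: 'p mod_ring)"
      using Phi_scalar_mult[of c 1] by (simp add: Phi_one)
    then have "act ?M 0 n (st_class (Poly_Mapping.single 0 c)) x = c \<odot>\<^bsub>cocomp N m\<^esub> contract (cocomp N m) (ch {0}) (coact N m x m)"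
      using x by (simp add: n pairing_class contract_coact W.lc_coeff_smult finite_bidegree coact_closed)
    then show ?thesis using x by (simp add: n coact_counit)
  qed (simp add: module_of_simps)
  show ?thesis
    unfolding is_st_module_def
    by (intro conjI gs allI ballI closed add_right add_left mult scalar)
qed

text \<open>By \<open>unst_rel_sound\<close> with \<open>v = w = 1\<close> the functional of an
  unstable operation vanishes on the whole bidegree over which the coaction is contracted.\<close>

lemma is_unstable_module_of: "is_unstable (module_of N)"
  unfolding is_unstable_def Let_def
proof (intro allI impI ballI, elim conjE)
  fix e i n x
  let ?d = "e + 2 * i * (CARD('p) - 1)"
  assume e: "e \<in> {0, 1 :: nat}" "n < int e + 2 * int i" and x: "x \<in> carrier (stcomp (module_of N) n)"
  show "act (module_of N) ?d n (st_class (sq_beta ^ e * sq_pow i)) x = \<zero>\<^bsub>stcomp (module_of N) (n + int ?d)\<^esub>"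
  proof (cases "0 \<le> n")
    case True
    then obtain m where n: "n = int m" using nonneg_int_cases by blast
    interpret W: vspace "cocomp N (m + ?d)" by (rule vspace_cocomp)
    have "unst_rel m ?d (1 * (sq_beta ^ e * sq_pow i) * 1 :: 'p st_free)"
      using e by (intro unst_rel.unstable[OF hdeg_one hdeg_one]) (auto simp: n)
    then have "Phi (sq_beta ^ e * sq_pow i) b = (0 :: 'p mod_ring)" if "b \<in> bidegree (m + ?d) m" for b
      using unst_rel_sound[of m ?d _ b] that by (simp add: bidegree_def)
    moreover have x: "x \<in> carrier (cocomp N m)" using x by (simp add: n)
    ultimately show ?thesis
      unfolding n of_nat_add[symmetric] module_of_nonneg pairing_class contract_coact[OF x]
      by (intro W.lc_coeff_zero coact_closed)
  qed (simp add: module_of_simps(3))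
qed

end

end

section \<open>The equivalence\<close>

lemma graded_mapsD:
  assumes "f \<in> graded_maps M N"
  shows "x \<in> carrier (M n) \<Longrightarrow> f n x \<in> carrier (N n)" "x \<notin> carrier (M n) \<Longrightarrow> f n x = undefined"
    "x \<in> carrier (M n) \<Longrightarrow> y \<in> carrier (M n) \<Longrightarrow> f n (x \<oplus>\<^bsub>M n\<^esub> y) = f n x \<oplus>\<^bsub>N n\<^esub> f n y"
    "x \<in> carrier (M n) \<Longrightarrow> f n (c \<odot>\<^bsub>M n\<^esub> x) = c \<odot>\<^bsub>N n\<^esub> f n x"
  using assms unfolding graded_maps_def by (auto intro: PiE_arb)

lemma graded_mapsI:
  assumes "\<And>n x. x \<in> carrier (M n) \<Longrightarrow> f n x \<in> carrier (N n)" "\<And>n x. x \<notin> carrier (M n) \<Longrightarrow> f n x = undefined"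
    "\<And>n x y. x \<in> carrier (M n) \<Longrightarrow> y \<in> carrier (M n) \<Longrightarrow> f n (x \<oplus>\<^bsub>M n\<^esub> y) = f n x \<oplus>\<^bsub>N n\<^esub> f n y"
    "\<And>n c x. x \<in> carrier (M n) \<Longrightarrow> f n (c \<odot>\<^bsub>M n\<^esub> x) = c \<odot>\<^bsub>N n\<^esub> f n x"
  shows "f \<in> graded_maps M N"
  using assms unfolding graded_maps_def by auto

lemma graded_space_closed:
  assumes "graded_space M"
  shows "x \<in> carrier (M n) \<Longrightarrow> y \<in> carrier (M n) \<Longrightarrow> x \<oplus>\<^bsub>M n\<^esub> y \<in> carrier (M n)"
    "x \<in> carrier (M n) \<Longrightarrow> c \<odot>\<^bsub>M n\<^esub> x \<in> carrier (M n)"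
proof -
  interpret vspace "M n" by (rule vspace_component[OF assms])
  show "x \<in> carrier (M n) \<Longrightarrow> y \<in> carrier (M n) \<Longrightarrow> x \<oplus>\<^bsub>M n\<^esub> y \<in> carrier (M n)"
    "x \<in> carrier (M n) \<Longrightarrow> c \<odot>\<^bsub>M n\<^esub> x \<in> carrier (M n)" by simp_all
qed

lemma graded_id_apply: "graded_id M n x = (if x \<in> carrier (M n) then x else undefined)"
  by (simp add: graded_id_def)

lemma graded_comp_apply: "graded_comp M g f n x = (if x \<in> carrier (M n) then g n (f n x) else undefined)"
  by (simp add: graded_comp_def compose_def)

lemma graded_id_maps: "graded_space M \<Longrightarrow> graded_id M \<in> graded_maps M M"
  by (rule graded_mapsI) (simp_all add: graded_id_apply graded_space_closed)

lemma graded_comp_maps: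
  "graded_space M \<Longrightarrow> f \<in> graded_maps M N \<Longrightarrow> g \<in> graded_maps N L \<Longrightarrow> graded_comp M g f \<in> graded_maps M L"
  by (rule graded_mapsI) (simp_all add: graded_comp_apply graded_space_closed graded_mapsD)

lemma graded_comp_id:
  "f \<in> graded_maps M N \<Longrightarrow> graded_comp M f (graded_id M) = f"
  "f \<in> graded_maps M N \<Longrightarrow> graded_comp M (graded_id N) f = f"
  by (auto simp: fun_eq_iff graded_comp_apply graded_id_apply graded_mapsD)

lemma graded_comp_assoc:
  "f \<in> graded_maps M N \<Longrightarrow> graded_comp M (graded_comp N h g) f = graded_comp M h (graded_comp M g f)"
  by (auto simp: fun_eq_iff graded_comp_apply graded_mapsD)

definition graded_inverse ::
  "('i \<Rightarrow> ('k, 'a) module) \<Rightarrow> ('i \<Rightarrow> ('k, 'a) module) \<Rightarrow> ('i \<Rightarrow> 'a \<Rightarrow> 'a) \<Rightarrow> 'i \<Rightarrow> 'a \<Rightarrow> 'a" where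
  "graded_inverse M N f = (\<lambda>n. \<lambda>y\<in>carrier (N n). inv_into (carrier (M n)) (f n) y)"

lemma graded_inverse:
  assumes bij: "\<And>n. bij_betw (f n) (carrier (M n)) (carrier (N n))" and f: "f \<in> graded_maps M N" and M: "graded_space M"
  shows "x \<in> carrier (M n) \<Longrightarrow> graded_inverse M N f n (f n x) = x"
    "graded_inverse M N f \<in> graded_maps N M"
    "graded_comp M (graded_inverse M N f) f = graded_id M" "graded_comp N f (graded_inverse M N f) = graded_id N"
proof -
  let ?g = "graded_inverse M N f"
  show l: "?g n (f n x) = x" if "x \<in> carrier (M n)" for n x
    using that graded_mapsD(1)[OF f that] bij_betw_imp_inj_on[OF bij] by (simp add: graded_inverse_def)
  have ex: "\<exists>x\<in>carrier (M n). y = f n x" if "y \<in> carrier (N n)" for n y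
    using that bij_betw_imp_surj_on[OF bij[of n]] by blast
  show "?g \<in> graded_maps N M"
  proof (rule graded_mapsI)
    fix n y assume "y \<in> carrier (N n)"
    then obtain x where x: "x \<in> carrier (M n)" "y = f n x" using ex by blast
    then show "?g n y \<in> carrier (M n)" using l by simp
    show "?g n (c \<odot>\<^bsub>N n\<^esub> y) = c \<odot>\<^bsub>M n\<^esub> ?g n y" for c
      using x l[OF graded_space_closed(2)[OF M x(1)], of c] l by (simp add: graded_mapsD(4)[OF f])
    fix y' assume "y' \<in> carrier (N n)"
    then obtain x' where x': "x' \<in> carrier (M n)" "y' = f n x'" using ex by blast
    show "?g n (y \<oplus>\<^bsub>N n\<^esub> y') = ?g n y \<oplus>\<^bsub>M n\<^esub> ?g n y'"
      using x x' l[OF graded_space_closed(1)[OF M x(1) x'(1)]] l by (simp add: graded_mapsD(3)[OF f])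
  qed (simp add: graded_inverse_def)
  show "graded_comp M ?g f = graded_id M"
    by (auto simp: fun_eq_iff graded_comp_apply graded_id_apply l)
  have "f n (?g n y) = y" if "y \<in> carrier (N n)" for n y
    using ex[OF that] l by auto
  then show "graded_comp N f ?g = graded_id N"
    by (auto simp: fun_eq_iff graded_comp_apply graded_id_apply)
qed

lemma st_module_mapsD:
  assumes "f \<in> st_module_maps M N"
  shows "f \<in> graded_maps (stcomp M) (stcomp N)"
    "a \<in> steenrod_component k \<Longrightarrow> x \<in> carrier (stcomp M n) \<Longrightarrow> f (n + int k) (act M k n a x) = act N k n a (f n x)"
  using assms unfolding st_module_maps_def by auto

lemma st_module_mapsI:
  assumes "f \<in> graded_maps (stcomp M) (stcomp N)"
    "\<And>a k n x. a \<in> steenrod_component k \<Longrightarrow> x \<in> carrier (stcomp M n) \<Longrightarrow> f (n + int k) (act M k n a x) = act N k n a (f n x)"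
  shows "f \<in> st_module_maps M N"
  using assms unfolding st_module_maps_def by auto

lemma st_module_closed:
  "is_st_module M \<Longrightarrow> a \<in> steenrod_component k \<Longrightarrow> x \<in> carrier (stcomp M n) \<Longrightarrow> act M k n a x \<in> carrier (stcomp M (n + int k))"
  using act_closed[of M k _ x n] by (auto simp: steenrod_component_iff)

lemma st_module_graded: "is_st_module M \<Longrightarrow> graded_space (stcomp M)"
  by (simp add: is_st_module_def)

lemma st_module_id: "is_st_module M \<Longrightarrow> graded_id (stcomp M) \<in> st_module_maps M M"
  by (rule st_module_mapsI) (simp_all add: graded_id_maps graded_id_apply st_module_graded st_module_closed)

lemma st_module_comp:
  assumes "is_st_module M" "f \<in> st_module_maps M N" "g \<in> st_module_maps N L"
  shows "graded_comp (stcomp M) g f \<in> st_module_maps M L"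
  by (rule st_module_mapsI)
    (use assms in \<open>simp_all add: graded_comp_maps[OF _ st_module_mapsD(1) st_module_mapsD(1)] st_module_graded
      graded_comp_apply st_module_closed st_module_mapsD(2) graded_mapsD(1)[OF st_module_mapsD(1)]\<close>)

lemma is_category_unstable_modules: "is_category (unstable_modules :: (('p::prime_card, 'a) st_module, _) cat)"
  unfolding is_category_def unstable_modules_def
  by (auto intro: st_module_id st_module_comp graded_comp_id graded_comp_assoc dest: st_module_mapsD(1))

lemma is_iso_unstable_modules:
  assumes "is_st_module (M :: ('p::prime_card, 'a) st_module)" "is_st_module N" "f \<in> st_module_maps M N"
    and bij: "\<And>n. bij_betw (f n) (carrier (stcomp M n)) (carrier (stcomp N n))"
  shows "is_iso unstable_modules M N f"
proof -
  let ?g = "graded_inverse (stcomp M) (stcomp N) f"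
  note g = graded_inverse[OF bij st_module_mapsD(1)[OF assms(3)] st_module_graded[OF assms(1)]]
  have "?g \<in> st_module_maps N M"
  proof (rule st_module_mapsI[OF g(2)])
    fix a :: "'p st_free set" and k n y assume a: "a \<in> steenrod_component k" and "y \<in> carrier (stcomp N n)"
    then obtain x where x: "x \<in> carrier (stcomp M n)" "y = f n x"
      using bij_betw_imp_surj_on[OF bij[of n]] by blast
    then show "?g (n + int k) (act N k n a y) = act M k n a (?g n y)"
      using a st_module_mapsD(2)[OF assms(3) a x(1), symmetric] g(1)[OF st_module_closed[OF assms(1) a x(1)]] g(1)[OF x(1)]
      by simp
  qed
  then show ?thesis
    using assms(3) g(3,4) unfolding is_iso_def unstable_modules_def by auto
qed

lemma comodule_mapsD:
  assumes "f \<in> comodule_maps M N"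
  shows "f \<in> graded_maps (cocomp M) (cocomp N)"
    "x \<in> carrier (cocomp M n) \<Longrightarrow> coact N n (f n x) m b = f m (coact M n x m b)"
  using assms unfolding comodule_maps_def by (auto simp del: split_paired_All)

lemma comodule_mapsI:
  assumes "f \<in> graded_maps (cocomp M) (cocomp N)"
    "\<And>n x m b. x \<in> carrier (cocomp M n) \<Longrightarrow> coact N n (f n x) m b = f m (coact M n x m b)"
  shows "f \<in> comodule_maps M N"
  using assms unfolding comodule_maps_def by auto

lemma comodule_graded: "is_comodule M \<Longrightarrow> graded_space (cocomp M)"
  by (simp add: is_comodule_def)

context odd_prime
begin

lemma comodule_id: "is_comodule (M :: ('p, 'a) comodule) \<Longrightarrow> graded_id (cocomp M) \<in> comodule_maps M M"
  by (rule comodule_mapsI) (simp_all add: graded_id_maps graded_id_apply comodule_graded coact_closed)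

lemma comodule_comp:
  assumes "is_comodule (M :: ('p, 'a) comodule)" "f \<in> comodule_maps M N" "g \<in> comodule_maps N L"
  shows "graded_comp (cocomp M) g f \<in> comodule_maps M L"
  by (rule comodule_mapsI)
    (use assms in \<open>simp_all add: graded_comp_maps[OF _ comodule_mapsD(1) comodule_mapsD(1)] comodule_graded
      graded_comp_apply coact_closed comodule_mapsD(2) graded_mapsD(1)[OF comodule_mapsD(1)]\<close>)

lemma is_category_graded_comodules: "is_category (graded_comodules :: (('p, 'a) comodule, _) cat)"
  unfolding is_category_def graded_comodules_def
  by (auto intro: comodule_id comodule_comp graded_comp_id graded_comp_assoc dest: comodule_mapsD(1))

section \<open>The functors on morphisms and the natural isomorphisms\<close>

definition comodule_map_of :: "(int \<Rightarrow> 'a \<Rightarrow> 'a) \<Rightarrow> nat \<Rightarrow> 'a \<Rightarrow> 'a" where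
  "comodule_map_of f = (\<lambda>n. f (int n))"

definition module_map_of :: "(nat \<Rightarrow> 'a \<Rightarrow> 'a) \<Rightarrow> int \<Rightarrow> 'a \<Rightarrow> 'a" where
  "module_map_of f = (\<lambda>n. if 0 \<le> n then f (nat n) else (\<lambda>x\<in>{undefined}. undefined))"

lemma module_map_of_nonneg [simp]: "module_map_of f (int n) = f n"
  by (simp add: module_map_of_def)

lemma is_functor_comodule_of:
  "is_functor unstable_modules graded_comodules comodule_of (\<lambda>X Y :: ('p, 'a) st_module. comodule_map_of)"
proof -
  have "comodule_map_of f \<in> comodule_maps (comodule_of M) (comodule_of N)"
    if M: "is_st_module M" "is_unstable M" and N: "is_st_module N" and f: "f \<in> st_module_maps M N"
    for M N :: "('p, 'a) st_module" and f
  proof (rule comodule_mapsI)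
    note f' = st_module_mapsD(1)[OF f]
    show "comodule_map_of f \<in> graded_maps (cocomp (comodule_of M)) (cocomp (comodule_of N))"
      by (rule graded_mapsI) (simp_all add: comodule_map_of_def graded_mapsD[OF f'])
    fix n x m b assume x: "x \<in> carrier (cocomp (comodule_of M) n)"
    have "f (int m) \<zero>\<^bsub>stcomp M (int m)\<^esub> = \<zero>\<^bsub>stcomp N (int m)\<^esub>"
    proof -
      interpret V: vspace "stcomp M (int m)" by (rule vspace_stcomp[OF M(1)])
      interpret W: vspace "stcomp N (int m)" by (rule vspace_stcomp[OF N])
      show ?thesis
        using graded_mapsD(4)[OF f' V.M.zero_closed, of 0] graded_mapsD(1)[OF f' V.M.zero_closed] by simp
    qed
    moreover have "f (int m) (act M (m - n) (int n) (st_class (dual m n b)) x)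
        = act N (m - n) (int n) (st_class (dual m n b)) (f (int n) x)" if "b \<in> bidegree m n"
      using st_module_mapsD(2)[OF f st_class_component, of "m - n" "dual m n b" x "int n"] x bidegree_dual[OF that, of b] by simp
    ultimately show "coact (comodule_of N) n (comodule_map_of f n x) m b = comodule_map_of f m (coact (comodule_of M) n x m b)"
      by (simp add: comodule_map_of_def)
  qed
  moreover have "comodule_map_of (graded_id (stcomp M)) = graded_id (cocomp (comodule_of M))" for M :: "('p, 'a) st_module"
    by (simp add: fun_eq_iff comodule_map_of_def graded_id_apply)
  moreover have "comodule_map_of (graded_comp (stcomp M) g f)
      = graded_comp (cocomp (comodule_of M)) (comodule_map_of g) (comodule_map_of f)" for M :: "('p, 'a) st_module" and f g
    by (simp add: fun_eq_iff comodule_map_of_def graded_comp_apply)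
  ultimately show ?thesis
    unfolding is_functor_def unstable_modules_def graded_comodules_def by (simp add: is_comodule_comodule_of)
qed

lemma is_functor_module_of:
  "is_functor graded_comodules unstable_modules module_of (\<lambda>X Y :: ('p, 'a) comodule. module_map_of)"
proof -
  have "module_map_of f \<in> st_module_maps (module_of M) (module_of N)"
    if M: "is_comodule M" and N: "is_comodule N" and f: "f \<in> comodule_maps M N"
    for M N :: "('p, 'a) comodule" and f
  proof (rule st_module_mapsI)
    note f' = comodule_mapsD(1)[OF f]
    show maps: "module_map_of f \<in> graded_maps (stcomp (module_of M)) (stcomp (module_of N))"
      by (rule graded_mapsI) (auto simp: module_map_of_def module_of_simps graded_mapsD[OF f'])
    fix a :: "'p st_free set" and k n x assume a: "a \<in> steenrod_component k" and x: "x \<in> carrier (stcomp (module_of M) n)"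
    show "module_map_of f (n + int k) (act (module_of M) k n a x) = act (module_of N) k n a (module_map_of f n x)"
    proof (cases "0 \<le> n")
      case True
      then obtain m where n: "n = int m" using nonneg_int_cases by blast
      have x: "x \<in> carrier (cocomp M m)" using x by (simp add: n)
      have fx: "f m x \<in> carrier (cocomp N m)" by (rule graded_mapsD(1)[OF f' x])
      have "f (m + k) (lc (cocomp M (m + k)) (bidegree (m + k) m) (pairing a) (coact M m x (m + k)))
          = lc (cocomp N (m + k)) (bidegree (m + k) m) (pairing a) (\<lambda>b. f (m + k) (coact M m x (m + k) b))"
        by (rule lc_linear_map[OF vspace_cocomp[OF M] vspace_cocomp[OF N] finite_bidegree])
          (simp_all add: coact_closed[OF M] x graded_mapsD[OF f'])
      then show ?thesis
        unfolding n of_nat_add[symmetric] module_of_nonneg module_map_of_nonneg contract_coact[OF M x] contract_coact[OF N fx]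
        by (simp add: comodule_mapsD(2)[OF f x, symmetric])
    next
      case False
      interpret V: vspace "stcomp (module_of M) (n + int k)" by (rule vspace_stcomp[OF is_st_module_module_of[OF M]])
      interpret W: vspace "stcomp (module_of N) (n + int k)" by (rule vspace_stcomp[OF is_st_module_module_of[OF N]])
      show ?thesis
        using False graded_mapsD(4)[OF maps V.M.zero_closed, of 0] graded_mapsD(1)[OF maps V.M.zero_closed]
        by (simp add: module_of_simps(3))
    qed
  qed
  moreover have "module_map_of (graded_id (cocomp M)) = graded_id (stcomp (module_of M))" for M :: "('p, 'a) comodule"
    by (auto simp: fun_eq_iff module_map_of_def graded_id_apply module_of_simps)
  moreover have "module_map_of (graded_comp (cocomp M) g f)
      = graded_comp (stcomp (module_of M)) (module_map_of g) (module_map_of f)" for M :: "('p, 'a) comodule" and f g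
    by (auto simp: fun_eq_iff module_map_of_def graded_comp_apply module_of_simps)
  ultimately show ?thesis
    unfolding is_functor_def unstable_modules_def graded_comodules_def
    by (simp add: is_st_module_module_of is_unstable_module_of)
qed

text \<open>Negative components of an unstable module are zero but need not equal
  \<open>trivial_module\<close>, so the unit is not the identity there: it sends their zero to
  \<open>undefined\<close>.\<close>

definition unit_map :: "('p, 'a) st_module \<Rightarrow> int \<Rightarrow> 'a \<Rightarrow> 'a" where
  "unit_map M n = (\<lambda>x\<in>carrier (stcomp M n). if 0 \<le> n then x else undefined)"

lemma unit_map_iso:
  assumes M: "is_st_module (M :: ('p, 'a) st_module)" "is_unstable M"
  shows "is_iso unstable_modules M (module_of (comodule_of M)) (unit_map M)"
proof (rule is_iso_unstable_modules)
  let ?N = "module_of (comodule_of M)"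
  have C: "is_comodule (comodule_of M)" by (rule is_comodule_comodule_of[OF M])
  show "is_st_module M" by fact
  show N: "is_st_module ?N" by (rule is_st_module_module_of[OF C])
  have comp: "stcomp ?N n = (if 0 \<le> n then stcomp M n else trivial_module)" for n
    by (simp add: module_of_simps(1))
  have zero: "unit_map M n \<zero>\<^bsub>stcomp M n\<^esub> = \<zero>\<^bsub>stcomp ?N n\<^esub>" for n
  proof -
    interpret V: vspace "stcomp M n" by (rule vspace_stcomp[OF M(1)])
    show ?thesis by (simp add: unit_map_def comp)
  qed
  show "bij_betw (unit_map M n) (carrier (stcomp M n)) (carrier (stcomp ?N n))" for n
  proof (cases "0 \<le> n")
    case True
    then show ?thesis by (auto simp: bij_betw_def inj_on_def unit_map_def comp)
  next
    case False
    interpret V: vspace "stcomp M n" by (rule vspace_stcomp[OF M(1)])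
    have "carrier (stcomp M n) = {\<zero>\<^bsub>stcomp M n\<^esub>}"
      using negative_component[OF M, of n] False by auto
    then show ?thesis using False by (simp add: bij_betw_def unit_map_def comp)
  qed
  show "unit_map M \<in> st_module_maps M ?N"
  proof (rule st_module_mapsI)
    show "unit_map M \<in> graded_maps (stcomp M) (stcomp ?N)"
      by (rule graded_mapsI)
        (auto simp: unit_map_def comp graded_space_closed[OF st_module_graded[OF M(1)]])
    fix a :: "'p st_free set" and k n x assume a: "a \<in> steenrod_component k" and x: "x \<in> carrier (stcomp M n)"
    obtain f where f: "a = st_class f" "hdeg k f" using a by (auto simp: steenrod_component_iff)
    show "unit_map M (n + int k) (act M k n a x) = act ?N k n a (unit_map M n x)"
    proof (cases "0 \<le> n")
      case True
      then obtain m where n: "n = int m" using nonneg_int_cases by blast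
      have "contract (stcomp M (int (m + k))) (Phi f) (coact (comodule_of M) m x (m + k)) = act M k (int m) (st_class f) x"
        using contract_comodule_of_act[OF M, of x m "m + k" f "Phi f"] x f n by simp
      moreover have "act M k (int m) (st_class f) x \<in> carrier (stcomp M (int (m + k)))"
        using act_closed[OF M(1) f(2), of x n] x n by simp
      ultimately show ?thesis
        using x unfolding n of_nat_add[symmetric] module_of_nonneg f(1) pairing_class comodule_of_simps(1)
        by (simp add: unit_map_def del: of_nat_add)
    next
      case False
      then have "x = \<zero>\<^bsub>stcomp M n\<^esub>" using negative_component[OF M _ x] by simp
      then have "act M k n a x = \<zero>\<^bsub>stcomp M (n + int k)\<^esub>" using act_zero_right[OF M(1) f(2)] f by simp
      then show ?thesis using False zero by (simp add: module_of_simps(3))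
    qed
  qed
qed

text \<open>The two coactions agree on the carriers but may differ outside, so the identity map is
  an isomorphism although the two comodules need not be equal.\<close>

lemma counit_iso:
  assumes N: "is_comodule (N :: ('p, 'a) comodule)"
  shows "is_iso graded_comodules (comodule_of (module_of N)) N (graded_id (cocomp N))"
proof -
  let ?M = "comodule_of (module_of N)"
  have comp: "cocomp ?M = cocomp N" by (simp add: fun_eq_iff)
  have coact: "coact ?M n x m b = coact N n x m b" if x: "x \<in> carrier (cocomp N n)" for n x m b
  proof (cases "b \<in> bidegree m n")
    case True
    interpret W: vspace "cocomp N m" by (rule vspace_cocomp[OF N])
    have le: "n \<le> m" by (rule bidegree_le[OF True])
    \<comment> \<open>Pairing with the dual element of \<open>b\<close> extracts the coefficient of
      \<open>b\<close>.\<close>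
    have "coact ?M n x m b = contract (cocomp N m) (Phi (dual m n b)) (coact N n x m)"
      using True le by (simp add: pairing_class)
    also have "\<dots> = coact N n x m b"
      unfolding contract_coact[OF N x]
      by (rule W.lc_delta) (simp_all add: finite_bidegree True coact_closed[OF N x] dual[OF le])
    finally show ?thesis .
  qed (simp add: coact_support[OF N x])
  note id = graded_id_maps[OF comodule_graded[OF N]]
  have "graded_id (cocomp N) \<in> comodule_maps ?M N" "graded_id (cocomp N) \<in> comodule_maps N ?M"
    by (rule comodule_mapsI; simp add: comp id coact graded_id_apply coact_closed[OF N] del: comodule_of_simps)+
  then show ?thesis
    unfolding is_iso_def graded_comodules_def using graded_comp_id(1)[OF id] by (auto simp: comp)
qed

lemma equivalent_unstable_modules_comodules:
  "equivalent_categories (unstable_modules :: (('p, 'a) st_module, int \<Rightarrow> 'a \<Rightarrow> 'a) cat)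
    (graded_comodules :: (('p, 'a) comodule, nat \<Rightarrow> 'a \<Rightarrow> 'a) cat)"
  unfolding equivalent_categories_def
proof (intro conjI exI)
  show "is_functor unstable_modules graded_comodules comodule_of (\<lambda>X Y :: ('p, 'a) st_module. comodule_map_of)"
    by (rule is_functor_comodule_of)
  show "is_functor graded_comodules unstable_modules module_of (\<lambda>X Y :: ('p, 'a) comodule. module_map_of)"
    by (rule is_functor_module_of)
  have "graded_comp (stcomp M) (unit_map N) f = graded_comp (stcomp M) (module_map_of (comodule_map_of f)) (unit_map M)"
    if f: "f \<in> st_module_maps M N" for M N :: "('p, 'a) st_module" and f
    using graded_mapsD(1)[OF st_module_mapsD(1)[OF f]]
    by (auto simp: fun_eq_iff graded_comp_apply unit_map_def module_map_of_def comodule_map_of_def)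
  then show "is_natural_iso unstable_modules unstable_modules (\<lambda>X :: ('p, 'a) st_module. X) (\<lambda>X Y f. f)
      (\<lambda>X. module_of (comodule_of X)) (\<lambda>X Y f. module_map_of (comodule_map_of f)) unit_map"
    unfolding is_natural_iso_def using unit_map_iso by (auto simp: unstable_modules_def)
  have "graded_comp (cocomp (comodule_of (module_of M))) (graded_id (cocomp N)) (comodule_map_of (module_map_of f))
      = graded_comp (cocomp (comodule_of (module_of M))) f (graded_id (cocomp M))"
    if f: "f \<in> comodule_maps M N" for M N :: "('p, 'a) comodule" and f
    using graded_mapsD(1)[OF comodule_mapsD(1)[OF f]]
    by (auto simp: fun_eq_iff graded_comp_apply graded_id_apply comodule_map_of_def)
  then show "is_natural_iso graded_comodules graded_comodules (\<lambda>X :: ('p, 'a) comodule. comodule_of (module_of X))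
      (\<lambda>X Y f. comodule_map_of (module_map_of f)) (\<lambda>X. X) (\<lambda>X Y f. f) (\<lambda>X. graded_id (cocomp X))"
    unfolding is_natural_iso_def using counit_iso by (auto simp: graded_comodules_def)
qed (rule is_category_unstable_modules is_category_graded_comodules)+

end

theorem theorem1:
  assumes "odd CARD('p::prime_card)"
  shows "equivalent_categories
    (unstable_modules :: (('p, 'a) st_module, int \<Rightarrow> 'a \<Rightarrow> 'a) cat)
    (graded_comodules :: (('p, 'a) comodule, nat \<Rightarrow> 'a \<Rightarrow> 'a) cat)"
proof -
  interpret odd_prime "TYPE('p)" by standard (rule assms)
  show ?thesis by (rule equivalent_unstable_modules_comodules)
qed

end
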